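(* Let $$V(x,t)=V_1(g(t)x,t)+\frac1{(2\pi)^{3/2}}\sum_{j=1}^\infty f_j(t)e^{ig_j(t)x\cdot a_j},\qquad x\in\mathbb{R}^3,\ t\ge0,$$ be a real-valued potential, where $a_j\in\mathbb{R}^3$, $g$ and $g_j$ ($j\ge1$) are real-valued functions on $[0,\infty)$, and $$h(t):=\int_{\mathbb{R}^3}|\hat V_1(\xi,t)|\,d^3\xi+\sum_{j=1}^\infty|f_j(t)|\in L^1_t[0,\infty).$$ Then for all $1\le p\le\infty$, $$\lim_{t\to\infty}\|U(0,t)e^{-itH_0}-\Omega\|_{L^p\to L^p}=0$$ and $$\|\Omega\|_{L^p\to L^p}\le\exp\left(\frac{\|h(t)\|_{L^1_t(0,\infty)}}{(2\pi)^{3/2}}\right).$$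
   Context: $H_0=-\Delta_x$ on $L^2(\mathbb{R}^3)$, $H(t)=H_0+V(x,t)$, and $U(t,s)$ is the propagator of $i\partial_t\psi=H(t)\psi$, so $\psi(t)=U(t,s)\psi(s)$. $L^p=L^p(\mathbb{R}^3)$. $\Omega=\Omega_+=s\text{-}\lim_{t\to\infty}U(0,t)e^{-itH_0}$ on $L^p\cap L^2$, extended by continuity. $\hat V_1(\xi,t)=(2\pi)^{-3/2}\int e^{-i\xi\cdot x}V_1(x,t)\,d^3x$ is the Fourier transform in $x$.
   Formalization: V_1(·,t) is taken to be its continuous representative (which exists when its Fourier transform is integrable); otherwise, where g(t)=0, V would depend on an arbitrary point value V_1(0,t) not controlled by h, and the claim can fail. *)

theory Defs
  imports "HOL-Analysis.Analysis" "HOL-Probability.Essential_Supremum"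
begin

type_synonym wavefun = "real^3 \<Rightarrow> complex"

section \<open>Lebesgue spaces and operators on them\<close>

text \<open>
  Elements of \<open>L\<^sup>p(\<real>\<^sup>3)\<close> are represented by Borel functions (every a.e.-class contains one), and
  operators by maps on such representatives.  The norm is \<open>\<infinity>\<close> outside \<open>L\<^sup>p\<close>, also for
  non-measurable functions.
\<close>

definition Lp_norm :: "ennreal \<Rightarrow> wavefun \<Rightarrow> ennreal" where
  "Lp_norm p f =
    (if f \<notin> borel_measurable borel then \<infinity>
     else if p = \<infinity> then esssup lborel (\<lambda>x. ennreal (cmod (f x)))
     else let I = (\<integral>\<^sup>+x. ennreal (cmod (f x) powr enn2real p) \<partial>lborel)
          in if I = \<infinity> then \<infinity> else ennreal (enn2real I powr (1 / enn2real p)))"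

definition Lp_space :: "ennreal \<Rightarrow> wavefun set" where
  "Lp_space p = {f. Lp_norm p f < \<infinity>}"

abbreviation ae_equal :: "wavefun \<Rightarrow> wavefun \<Rightarrow> bool" where
  "ae_equal f g \<equiv> (AE x in lborel. f x = g x)"

definition inner_L2 :: "wavefun \<Rightarrow> wavefun \<Rightarrow> complex" where
  "inner_L2 \<phi> \<psi> = (LINT x|lborel. cnj (\<phi> x) * \<psi> x)"

definition Lp_opnorm :: "ennreal \<Rightarrow> (wavefun \<Rightarrow> wavefun) \<Rightarrow> ennreal" where
  "Lp_opnorm p T = (SUP f\<in>{f. Lp_norm p f \<le> 1}. Lp_norm p (T f))"

text \<open>
  Convergence used for extending operators by continuity: norm convergence for \<open>p < \<infinity>\<close>.  As
  \<open>L\<^sup>\<infinity> \<inter> L\<^sup>2\<close> is not norm dense in \<open>L\<^sup>\<infinity>\<close>, for \<open>p = \<infinity>\<close> it is weak-* convergence against \<open>L\<^sup>1\<close>;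
  the boundedness clause is no restriction, by the uniform boundedness principle.
\<close>

definition Lp_converges :: "ennreal \<Rightarrow> (nat \<Rightarrow> wavefun) \<Rightarrow> wavefun \<Rightarrow> bool" where
  "Lp_converges p F f \<longleftrightarrow>
    (if p = \<infinity> then
       (\<exists>C<\<infinity>. \<forall>n. Lp_norm \<infinity> (F n) \<le> C) \<and>
       (\<forall>\<phi>\<in>Lp_space 1. (\<lambda>n. LINT x|lborel. F n x * \<phi> x) \<longlonglongrightarrow> (LINT x|lborel. f x * \<phi> x))
     else (\<lambda>n. Lp_norm p (\<lambda>x. F n x - f x)) \<longlonglongrightarrow> 0)"

text \<open>
  Extension by continuity to \<open>L\<^sup>p\<close> of an operator \<open>T\<close> given on a dense set \<open>D\<close>; the value is
  determined up to a.e. equality.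
\<close>

definition cont_extension ::
    "ennreal \<Rightarrow> wavefun set \<Rightarrow> (wavefun \<Rightarrow> wavefun) \<Rightarrow> wavefun \<Rightarrow> wavefun" where
  "cont_extension p D T f =
    (SOME g. g \<in> Lp_space p \<and>
       (\<forall>F. range F \<subseteq> D \<and> Lp_converges p F f \<longrightarrow> Lp_converges p (\<lambda>n. T (F n)) g))"

section \<open>Schwartz functions and the Fourier transform\<close>

definition partial_deriv :: "3 \<Rightarrow> wavefun \<Rightarrow> wavefun" where
  "partial_deriv i \<phi> x = frechet_derivative \<phi> (at x) (axis i 1)"

definition laplacian :: "wavefun \<Rightarrow> wavefun" where
  "laplacian \<phi> x = (\<Sum>i\<in>UNIV. partial_deriv i (partial_deriv i \<phi>) x)"

definition schwartz :: "wavefun set" where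
  "schwartz = {\<phi>. \<forall>is :: 3 list. let \<psi> = foldr partial_deriv is \<phi> in
      (\<forall>x. \<psi> differentiable (at x)) \<and>
      (\<forall>k::nat. bounded (range (\<lambda>x. norm x ^ k *\<^sub>R \<psi> x)))}"

definition fourier :: "wavefun \<Rightarrow> wavefun" where
  "fourier f \<xi> = (2 * pi) powr (- 3 / 2) *\<^sub>R (LINT x|lborel. exp (- \<i> * of_real (\<xi> \<bullet> x)) * f x)"

definition inv_fourier :: "wavefun \<Rightarrow> wavefun" where
  "inv_fourier f x = (2 * pi) powr (- 3 / 2) *\<^sub>R (LINT \<xi>|lborel. exp (\<i> * of_real (\<xi> \<bullet> x)) * f \<xi>)"

text \<open>
  The function \<open>W\<close> is the Fourier transform of \<open>f\<close> in the sense of tempered distributions, with the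
  normalisation of \<^const>\<open>fourier\<close>.  For integrable \<open>f\<close> this holds for \<open>W = fourier f\<close>; the
  distributional form also covers non-integrable \<open>f\<close> whose Fourier transform is a function.
\<close>

definition is_fourier_transform :: "wavefun \<Rightarrow> wavefun \<Rightarrow> bool" where
  "is_fourier_transform f W \<longleftrightarrow>
    (\<forall>\<phi>\<in>schwartz.
       integrable lborel (\<lambda>x. f x * fourier \<phi> x) \<and>
       integrable lborel (\<lambda>\<xi>. W \<xi> * \<phi> \<xi>) \<and>
       (LINT \<xi>|lborel. W \<xi> * \<phi> \<xi>) = (LINT x|lborel. f x * fourier \<phi> x))"

section \<open>Schroedinger evolutions\<close>

text \<open>
  The group \<open>e\<^sup>-\<^sup>i\<^sup>t\<^sup>H\<close> of the free Hamiltonian \<open>H = -\<Delta>\<close>: the Fourier multiplier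
  \<open>exp (- i t |\<xi>|\<^sup>2)\<close> on Schwartz functions, extended by continuity to \<open>L\<^sup>2\<close>.
\<close>

definition free_evolution :: "real \<Rightarrow> wavefun \<Rightarrow> wavefun" where
  "free_evolution t =
    cont_extension 2 schwartz
      (\<lambda>\<phi>. inv_fourier (\<lambda>\<xi>. exp (- \<i> * of_real (t * (norm \<xi>)\<^sup>2)) * fourier \<phi> \<xi>))"

text \<open>
  \<open>U\<close> is the unitary propagator on \<open>L\<^sup>2\<close> of \<open>i \<partial>\<^sub>t \<psi> = (- \<Delta> + V(x,t)) \<psi>\<close> for times \<open>\<ge> 0\<close>.
  As \<open>V\<close> is only integrable in time, the equation holds for a.e. time; it is stated weakly
  in space, against Schwartz functions, and integrated in time.
\<close>

definition is_propagator ::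
    "(real^3 \<Rightarrow> real \<Rightarrow> real) \<Rightarrow> (real \<Rightarrow> real \<Rightarrow> wavefun \<Rightarrow> wavefun) \<Rightarrow> bool" where
  "is_propagator V U \<longleftrightarrow>
    (\<forall>t\<ge>0. \<forall>s\<ge>0. \<forall>f\<in>Lp_space 2. Lp_norm 2 (U t s f) = Lp_norm 2 f) \<and>
    (\<forall>t\<ge>0. \<forall>s\<ge>0. \<forall>f\<in>Lp_space 2. \<forall>g\<in>Lp_space 2. \<forall>c.
       ae_equal (U t s (\<lambda>x. c * f x + g x)) (\<lambda>x. c * U t s f x + U t s g x)) \<and>
    (\<forall>t\<ge>0. \<forall>f\<in>Lp_space 2. ae_equal (U t t f) f) \<and>
    (\<forall>t\<ge>0. \<forall>r\<ge>0. \<forall>s\<ge>0. \<forall>f\<in>Lp_space 2. ae_equal (U t r (U r s f)) (U t s f)) \<and>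
    (\<forall>t\<ge>0. \<forall>s\<ge>0. \<forall>f\<in>Lp_space 2.
       ((\<lambda>\<tau>. Lp_norm 2 (\<lambda>x. U \<tau> s f x - U t s f x)) \<longlongrightarrow> 0) (at t within {0..})) \<and>
    (\<forall>s\<ge>0. \<forall>f\<in>Lp_space 2. \<forall>\<phi>\<in>schwartz. \<forall>t\<^sub>1\<ge>0. \<forall>t\<^sub>2\<ge>t\<^sub>1.
       let \<psi> = (\<lambda>\<tau>. U \<tau> s f);
           H\<psi> = (\<lambda>\<tau>. inner_L2 (\<lambda>x. - laplacian \<phi> x) (\<psi> \<tau>)
                    + inner_L2 \<phi> (\<lambda>x. of_real (V x \<tau>) * \<psi> \<tau> x))
       in set_integrable lebesgue {t\<^sub>1..t\<^sub>2} H\<psi> \<and>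
          \<i> * (inner_L2 \<phi> (\<psi> t\<^sub>2) - inner_L2 \<phi> (\<psi> t\<^sub>1)) = (LINT \<tau>:{t\<^sub>1..t\<^sub>2}|lebesgue. H\<psi> \<tau>))"

definition wave_approx ::
    "(real \<Rightarrow> real \<Rightarrow> wavefun \<Rightarrow> wavefun) \<Rightarrow> real \<Rightarrow> wavefun \<Rightarrow> wavefun" where
  "wave_approx U t f = U 0 t (free_evolution t f)"

definition wave_operator :: "(real \<Rightarrow> real \<Rightarrow> wavefun \<Rightarrow> wavefun) \<Rightarrow> wavefun \<Rightarrow> wavefun" where
  "wave_operator U f =
    (SOME g. g \<in> Lp_space 2 \<and> ((\<lambda>t. Lp_norm 2 (\<lambda>x. wave_approx U t f x - g x)) \<longlongrightarrow> 0) at_top)"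

abbreviation on_Lp :: "ennreal \<Rightarrow> (wavefun \<Rightarrow> wavefun) \<Rightarrow> wavefun \<Rightarrow> wavefun" where
  "on_Lp p T \<equiv> cont_extension p (Lp_space p \<inter> Lp_space 2) T"

end

(*
  Conjugating the plane wave e^(i b x) with the free evolution e^(i t H_0) gives a translation
  composed with phases, an isometry of every L^p.  Hence <e^(-i t H_0) phi, U(t,0) u> satisfies a
  Duhamel formula whose integrand is a superposition, of total mass (2 pi)^(-3/2) h(t), of the same
  quantities with phi replaced by isometric images of phi.  Gronwall's inequality over a class of
  phi stable under these isometries bounds it by exp of the integrated mass times its value at
  t = 0, and integrating once more over [s,t] bounds its increments; by duality these are L^p bounds
  for U(0,t) e^(-i t H_0) and for its differences.  The bounds pass to the limit Omega and to the
  extensions from the intersection of L^p and L^2; for p = infinity the extension is the dual of the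
  transpose on L^1.
*)

theory Submission
  imports Defs "HOL-Probability.Probability"
begin

section \<open>Lebesgue norms\<close>

text \<open>The propagator is known only through an equation tested against fixed Schwartz functions
  and integrated in time, with a potential merely integrable in time. The wanted test function e^(-i
  t H_0) phi moves with t, and nothing can be differentiated at a given time. So the formula is
  proved for Gaussians phi, whose evolutions remain explicit Schwartz functions, by freezing the
  test function on short intervals and controlling the errors; it extends to L^2 because its
  validity defines a closed subspace. The supremum in Gronwall's argument runs over a ball of L^p
  intersected with a ball of L^2: the first gives the constant, the second makes the supremum finite
  beforehand. Norms in L^p are reached by pairing with bounded functions of bounded support, which
  lie in every L^p. Hence L^2 limits suffice to carry bounds to Omega, and all exponents are treated
  alike, except where an extension must be shown to exist. The factor (2 pi)^(-3/2) before h is that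
  of the inverse Fourier transform of V_1 and, by the form of V, of the series.\<close>

definition pint :: "real \<Rightarrow> wavefun \<Rightarrow> ennreal" where
  "pint q f = (\<integral>\<^sup>+x. ennreal (cmod (f x) powr q) \<partial>lborel)"

lemma exponent_cases:
  assumes "1 \<le> (p::ennreal)"
  obtains "p = \<infinity>" | q where "1 \<le> q" "p = ennreal q"
proof (cases p)
  case (real r)
  with assms that(2)[of r] show thesis
    by (metis ennreal_1 ennreal_le_iff)
qed (use that in auto)

lemma Lp_norm_measurable: "Lp_norm p f < \<infinity> \<Longrightarrow> f \<in> borel_measurable borel"
  unfolding Lp_norm_def by (auto split: if_splits)

text \<open>Trades the root in \<open>Lp_norm\<close> for a power on the right, so that estimates
  for finite exponents become estimates of the integral \<open>pint\<close>.\<close>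

lemma Lp_norm_le_iff:
  assumes "1 \<le> q" "0 \<le> C" and [measurable]: "f \<in> borel_measurable borel"
  shows "Lp_norm (ennreal q) f \<le> ennreal C \<longleftrightarrow> pint q f \<le> ennreal (C powr q)"
proof (cases "pint q f")
  case (real I)
  have "Lp_norm (ennreal q) f = ennreal (I powr (1/q))"
    using real assms unfolding Lp_norm_def pint_def by (auto simp: Let_def)
  moreover have "I powr (1/q) \<le> C \<longleftrightarrow> I \<le> C powr q"
  proof
    assume "I powr (1/q) \<le> C"
    then have "(I powr (1/q)) powr q \<le> C powr q"
      using assms by (intro powr_mono2) auto
    then show "I \<le> C powr q" using assms real by (simp add: powr_powr)
  next
    assume "I \<le> C powr q"
    then have "I powr (1/q) \<le> (C powr q) powr (1/q)"
      using assms real by (intro powr_mono2) auto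
    then show "I powr (1/q) \<le> C" using assms real by (simp add: powr_powr)
  qed
  ultimately show ?thesis using real assms by simp
next
  case top
  then show ?thesis
    using assms unfolding Lp_norm_def pint_def by (auto simp: Let_def top_unique)
qed

lemma Lp_norm_inf_le_iff:
  assumes [measurable]: "f \<in> borel_measurable borel" and "0 \<le> C"
  shows "Lp_norm \<infinity> f \<le> ennreal C \<longleftrightarrow> (AE x in lborel. cmod (f x) \<le> C)"
proof
  assume *: "Lp_norm \<infinity> f \<le> ennreal C"
  have "AE x in lborel. ennreal (cmod (f x)) \<le> esssup lborel (\<lambda>x. ennreal (cmod (f x)))"
    by (rule esssup_AE)
  then show "AE x in lborel. cmod (f x) \<le> C"
  proof (rule AE_mp, intro AE_I2 impI)
    fix x assume "ennreal (cmod (f x)) \<le> esssup lborel (\<lambda>x. ennreal (cmod (f x)))"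
    also have "\<dots> \<le> ennreal C" using * by (simp add: Lp_norm_def)
    finally show "cmod (f x) \<le> C" using \<open>0 \<le> C\<close> by simp
  qed
next
  assume "AE x in lborel. cmod (f x) \<le> C"
  then show "Lp_norm \<infinity> f \<le> ennreal C"
    unfolding Lp_norm_def by (auto intro!: esssup_I elim!: AE_mp intro: AE_I2 ennreal_leI)
qed

lemma Lp_norm_finiteE:
  assumes "Lp_norm p f < \<infinity>"
  obtains C where "0 \<le> C" "Lp_norm p f = ennreal C"
  using assms by (cases "Lp_norm p f") auto

lemma Lp_norm_mono_AE:
  assumes p: "1 \<le> p" and [measurable]: "f \<in> borel_measurable borel" "g \<in> borel_measurable borel"
    and le: "AE x in lborel. cmod (f x) \<le> cmod (g x)"
  shows "Lp_norm p f \<le> Lp_norm p g"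
proof (cases "Lp_norm p g < \<infinity>")
  case True
  then obtain C where C: "0 \<le> C" "Lp_norm p g = ennreal C" by (rule Lp_norm_finiteE)
  from p show ?thesis
  proof (cases rule: exponent_cases)
    case 1
    have "AE x in lborel. cmod (g x) \<le> C" using C 1 Lp_norm_inf_le_iff[of g C] by simp
    then have "AE x in lborel. cmod (f x) \<le> C" using le by eventually_elim auto
    then show ?thesis using C 1 Lp_norm_inf_le_iff[of f C] by simp
  next
    case (2 q)
    have "pint q f \<le> pint q g"
      unfolding pint_def using le 2
      by (intro nn_integral_mono_AE) (auto elim!: eventually_mono intro!: ennreal_leI powr_mono2)
    also have "\<dots> \<le> ennreal (C powr q)" using C 2 Lp_norm_le_iff[of q C g] by simp
    finally show ?thesis using C 2 Lp_norm_le_iff[of q C f] by simp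
  qed
next
  case False
  then show ?thesis by (metis infinity_ennreal_def less_top top_greatest)
qed

lemma Lp_norm_cong_AE:
  assumes "1 \<le> p" "f \<in> borel_measurable borel" "g \<in> borel_measurable borel"
    "AE x in lborel. cmod (f x) = cmod (g x)"
  shows "Lp_norm p f = Lp_norm p g"
  using assms by (intro antisym Lp_norm_mono_AE) (auto elim!: AE_mp)

text \<open>Bounding the sum by twice the maximum gives the crude factor 2^q, valid for every q >=
  0.\<close>

lemma powr_add_le:
  assumes "0 \<le> (a::real)" "0 \<le> b" "0 \<le> q"
  shows "(a + b) powr q \<le> 2 powr q * (a powr q + b powr q)"
proof -
  have "(a + b) powr q \<le> (2 * max a b) powr q"
    using assms by (intro powr_mono2) auto
  also have "\<dots> = 2 powr q * (max a b) powr q"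
    using assms by (simp add: powr_mult)
  also have "\<dots> \<le> 2 powr q * (a powr q + b powr q)"
    by (intro mult_left_mono) (auto simp: max_def)
  finally show ?thesis .
qed

text \<open>This quasi-triangle inequality serves for membership in L^p and for convergence to 0,
  where the factor 2^q is harmless; the sharp constants of the theorem come from duality.\<close>

lemma pint_add_le:
  assumes "0 \<le> q" and [measurable]: "f \<in> borel_measurable borel" "g \<in> borel_measurable borel"
  shows "pint q (\<lambda>x. f x + g x) \<le> ennreal (2 powr q) * (pint q f + pint q g)"
proof -
  have "pint q (\<lambda>x. f x + g x)
      \<le> (\<integral>\<^sup>+x. ennreal (2 powr q) * (ennreal (cmod (f x) powr q) + ennreal (cmod (g x) powr q)) \<partial>lborel)"
    unfolding pint_def
  proof (intro nn_integral_mono)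
    fix x
    have "cmod (f x + g x) powr q \<le> (cmod (f x) + cmod (g x)) powr q"
      using assms by (intro powr_mono2) (auto simp: norm_triangle_ineq)
    also have "\<dots> \<le> 2 powr q * (cmod (f x) powr q + cmod (g x) powr q)"
      using assms by (intro powr_add_le) auto
    finally show "ennreal (cmod (f x + g x) powr q)
        \<le> ennreal (2 powr q) * (ennreal (cmod (f x) powr q) + ennreal (cmod (g x) powr q))"
      by (metis ennreal_leI ennreal_mult' ennreal_plus powr_ge_zero)
  qed
  also have "\<dots> = ennreal (2 powr q) * (pint q f + pint q g)"
    unfolding pint_def by (subst nn_integral_cmult) (auto simp: nn_integral_add)
  finally show ?thesis .
qed

lemma Lp_space_diff:
  assumes p: "1 \<le> p" and f: "f \<in> Lp_space p" and g: "g \<in> Lp_space p"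
  shows "(\<lambda>x. f x - g x) \<in> Lp_space p"
proof -
  have [measurable]: "f \<in> borel_measurable borel" "g \<in> borel_measurable borel"
    using f g by (auto simp: Lp_space_def intro: Lp_norm_measurable)
  obtain C where C: "0 \<le> C" "Lp_norm p f = ennreal C"
    using f unfolding Lp_space_def by (metis Lp_norm_finiteE mem_Collect_eq)
  obtain D where D: "0 \<le> D" "Lp_norm p g = ennreal D"
    using g unfolding Lp_space_def by (metis Lp_norm_finiteE mem_Collect_eq)
  from p show ?thesis
  proof (cases rule: exponent_cases)
    case 1
    have "AE x in lborel. cmod (f x) \<le> C" using C 1 Lp_norm_inf_le_iff[of f C] by simp
    moreover have "AE x in lborel. cmod (g x) \<le> D" using D 1 Lp_norm_inf_le_iff[of g D] by simp
    ultimately have "AE x in lborel. cmod (f x - g x) \<le> C + D"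
      by eventually_elim (smt (verit) norm_triangle_ineq4)
    then have "Lp_norm p (\<lambda>x. f x - g x) \<le> ennreal (C + D)"
      using C D 1 Lp_norm_inf_le_iff[of "\<lambda>x. f x - g x" "C + D"] by simp
    then show ?thesis by (simp add: Lp_space_def le_less_trans)
  next
    case (2 q)
    have "pint q (\<lambda>x. f x + - g x) \<le> ennreal (2 powr q) * (pint q f + pint q (\<lambda>x. - g x))"
      using 2 by (intro pint_add_le) auto
    also have "pint q (\<lambda>x. - g x) = pint q g" by (simp add: pint_def)
    also have "ennreal (2 powr q) * (pint q f + pint q g)
        \<le> ennreal (2 powr q) * (ennreal (C powr q) + ennreal (D powr q))"
      using 2 C D Lp_norm_le_iff[of q C f] Lp_norm_le_iff[of q D g]
      by (intro mult_left_mono add_mono) auto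
    also have "\<dots> < \<infinity>" by (simp add: ennreal_mult_less_top)
    finally show ?thesis
      using 2 by (auto simp: Lp_space_def Lp_norm_def pint_def Let_def)
  qed
qed

text \<open>Riesz-Fischer by a rapidly converging subsequence, for all q > 0 at once: the weights
  2^(k q) on the increments turn summability of their integrals into geometric decay almost
  everywhere.\<close>

lemma pint_complete:
  assumes q: "0 < q" and F[measurable]: "\<And>n. F n \<in> borel_measurable borel"
    and Cauchy: "\<And>e. 0 < e \<Longrightarrow> \<exists>N::nat. \<forall>m\<ge>N. \<forall>n\<ge>N. pint q (\<lambda>x. F m x - F n x) \<le> ennreal e"
  shows "\<exists>g\<in>borel_measurable borel. \<forall>e>0. \<exists>N. \<forall>n\<ge>N. pint q (\<lambda>x. F n x - g x)
    \<le> ennreal e"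
proof -
  \<comment> \<open>Chosen so that 2^(k q) * e k = (1/2)^k: the weighted series has finite integral,
    and where its sum is C the k-th increment is at most C^(1/q) * 2^(-k).\<close>
  define e where "e k = (1/2)^k * 2 powr (- (real k * q))" for k :: nat
  have e: "0 < e k" for k by (simp add: e_def)
  obtain N where N: "\<And>k m n. m \<ge> N k \<Longrightarrow> n \<ge> N k
    \<Longrightarrow> pint q (\<lambda>x. F m x - F n x) \<le> ennreal (e k)"
    using Cauchy[OF e] by metis
  \<comment> \<open>The maximum puts \<open>r k\<close> above all thresholds \<open>N j\<close> with
    j <= k; adding k makes it tend to infinity, which the Fatou step below uses.\<close>
  define r where "r k = Max (N ` {..k}) + k" for k
  have rN: "N j \<le> r k" if "j \<le> k" for j k
    unfolding r_def using that by (intro trans_le_add1 Max_ge) auto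
  define d where "d k x = F (r (Suc k)) x - F (r k) x" for k x
  have dm[measurable]: "d k \<in> borel_measurable borel" for k unfolding d_def by measurable
  have "(\<integral>\<^sup>+x. (\<Sum>k. ennreal (2 powr (real k * q)) * ennreal (cmod (d k x) powr q)) \<partial>lborel)
      = (\<Sum>k. ennreal (2 powr (real k * q)) * pint q (d k))"
    unfolding pint_def by (subst nn_integral_suminf) (auto simp: nn_integral_cmult)
  also have "\<dots> \<le> (\<Sum>k. ennreal ((1/2)^k))"
  proof (intro suminf_le allI)
    fix k
    have "pint q (d k) \<le> ennreal (e k)"
      unfolding d_def by (intro N) (auto intro: rN)
    then have "ennreal (2 powr (real k * q)) * pint q (d k)
        \<le> ennreal (2 powr (real k * q)) * ennreal (e k)" by (intro mult_left_mono) auto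
    also have "\<dots> = ennreal ((1/2)^k)"
      by (simp add: e_def powr_minus field_simps flip: ennreal_mult)
    finally show "ennreal (2 powr (real k * q)) * pint q (d k) \<le> ennreal ((1/2)^k)" .
  qed auto
  also have "\<dots> < \<infinity>"
    by (subst suminf_ennreal2) (auto simp: summable_geometric)
  finally have fin: "(\<integral>\<^sup>+x. (\<Sum>k. ennreal (2 powr (real k * q)) * ennreal (cmod (d k x) powr q)) \<partial>lborel) \<noteq> \<infinity>"
    by simp
  have conv: "AE x in lborel. convergent (\<lambda>k. F (r k) x)"
  proof -
    have "AE x in lborel. (\<Sum>k. ennreal (2 powr (real k * q)) * ennreal (cmod (d k x) powr q)) \<noteq> \<infinity>"
      by (rule nn_integral_PInf_AE[OF _ fin]) measurable
    then show ?thesis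
    proof (rule eventually_mono)
      fix x
      assume *: "(\<Sum>k. ennreal (2 powr (real k * q)) * ennreal (cmod (d k x) powr q)) \<noteq> \<infinity>"
      define C where "C = enn2real (\<Sum>k. ennreal (2 powr (real k * q)) * ennreal (cmod (d k x) powr q))"
      have b: "cmod (d k x) \<le> C powr (1/q) * (1/2)^k" for k
      proof -
        have "ennreal (2 powr (real k * q) * cmod (d k x) powr q)
            \<le> (\<Sum>k. ennreal (2 powr (real k * q)) * ennreal (cmod (d k x) powr q))"
          using sum_le_suminf[of "\<lambda>k. ennreal (2 powr (real k * q)) * ennreal (cmod (d k x) powr q)" "{k}"]
          by (simp add: ennreal_mult)
        also have "\<dots> = ennreal C"
          unfolding C_def using * by (simp add: less_top)
        finally have "2 powr (real k * q) * cmod (d k x) powr q \<le> C"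
          by (simp add: C_def)
        then have "(2 powr real k * cmod (d k x)) powr q \<le> C"
          by (simp add: powr_mult powr_powr)
        then have "((2 powr real k * cmod (d k x)) powr q) powr (1/q) \<le> C powr (1/q)"
          using q by (intro powr_mono2) auto
        then have "2 powr real k * cmod (d k x) \<le> C powr (1/q)"
          using q by (simp add: powr_powr)
        then show ?thesis by (simp add: powr_realpow field_simps)
      qed
      have "summable (\<lambda>k. d k x)"
        by (rule summable_comparison_test[where g="\<lambda>k. C powr (1/q) * (1/2)^k"])
           (auto intro!: exI[of _ 0] b summable_mult summable_geometric)
      then have "convergent (\<lambda>n. \<Sum>k<n. d k x)"
        by (simp add: summable_iff_convergent)
      moreover have "(\<Sum>k<n. d k x) = F (r n) x - F (r 0) x" for n
        unfolding d_def by (rule sum_lessThan_telescope)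
      ultimately have "convergent (\<lambda>n. F (r n) x - F (r 0) x)" by simp
      then show "convergent (\<lambda>k. F (r k) x)"
        by (simp add: convergent_diff_const_right_iff)
    qed
  qed
  \<comment> \<open>Where the subsequence diverges \<open>lim\<close> has an unspecified value; this
    concerns a null set only, and \<open>g\<close> is Borel all the same.\<close>
  define g where "g x = lim (\<lambda>k. F (r k) x)" for x
  have gm[measurable]: "g \<in> borel_measurable borel"
    unfolding g_def by measurable
  show ?thesis
  proof (intro bexI[OF _ gm] allI impI)
    fix \<epsilon> :: real assume "0 < \<epsilon>"
    then obtain M where M: "\<forall>m\<ge>M. \<forall>n\<ge>M. pint q (\<lambda>x. F m x - F n x) \<le> ennreal \<epsilon>"
      using Cauchy by blast
    show "\<exists>N. \<forall>n\<ge>N. pint q (\<lambda>x. F n x - g x) \<le> ennreal \<epsilon>"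
    proof (intro exI[of _ M] allI impI)
      fix n assume n: "M \<le> n"

      have ev: "\<forall>\<^sub>F k in sequentially. pint q (\<lambda>x. F n x - F (r k) x) \<le> ennreal \<epsilon>"
        using M n unfolding eventually_sequentially r_def by (intro exI[of _ M]) auto
      \<comment> \<open>Fatou along the subsequence carries the Cauchy estimate of the whole
        sequence to the limit.\<close>
      have "pint q (\<lambda>x. F n x - g x)
          = (\<integral>\<^sup>+x. liminf (\<lambda>k. ennreal (cmod (F n x - F (r k) x) powr q)) \<partial>lborel)"
        unfolding pint_def
      proof (rule nn_integral_cong_AE, use conv in eventually_elim)
        case (elim x)
        then have "(\<lambda>k. F (r k) x) \<longlonglongrightarrow> g x" unfolding g_def
          by (simp add: convergent_LIMSEQ_iff)
        then have "(\<lambda>k. ennreal (cmod (F n x - F (r k) x) powr q))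
          \<longlonglongrightarrow> ennreal (cmod (F n x - g x) powr q)"
          using q by (intro tendsto_intros) auto
        then show ?case by (metis lim_imp_Liminf trivial_limit_sequentially)
      qed
      also have "\<dots> \<le> liminf (\<lambda>k. pint q (\<lambda>x. F n x - F (r k) x))"
        unfolding pint_def by (intro nn_integral_liminf) measurable
      also have "\<dots> \<le> ennreal \<epsilon>"
        by (rule order_trans[OF Liminf_le_Limsup Limsup_bounded[OF ev]]) simp
      finally show "pint q (\<lambda>x. F n x - g x) \<le> ennreal \<epsilon>" .
    qed
  qed
qed

lemma ennreal_tendsto_0_iff:
  fixes f :: "'a \<Rightarrow> ennreal"
  shows "(f \<longlongrightarrow> 0) F \<longleftrightarrow> (\<forall>e>0. \<forall>\<^sub>F x in F. f x \<le> ennreal e)"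
proof
  assume *: "(f \<longlongrightarrow> 0) F"
  show "\<forall>e>0. \<forall>\<^sub>F x in F. f x \<le> ennreal e"
  proof (intro allI impI)
    fix e :: real assume "e > 0"
    then have "\<forall>\<^sub>F x in F. f x < ennreal e" using order_tendstoD(2)[OF *, of "ennreal e"] by simp
    then show "\<forall>\<^sub>F x in F. f x \<le> ennreal e" by eventually_elim simp
  qed
next
  assume *: "\<forall>e>0. \<forall>\<^sub>F x in F. f x \<le> ennreal e"
  show "(f \<longlongrightarrow> 0) F"
  proof (rule order_tendstoI)
    fix a :: ennreal assume "0 < a"
    then obtain e where "0 < e" "e < a" using dense by blast
    then obtain r where r: "e = ennreal r" "0 < r" by (cases e) auto
    with * have "\<forall>\<^sub>F x in F. f x \<le> e" by simp
    then show "\<forall>\<^sub>F x in F. f x < a" using \<open>e < a\<close> by (auto elim: eventually_mono)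
  qed simp
qed

lemma Lp_norm_tendsto_0_iff:
  assumes q: "1 \<le> q" and [measurable]: "\<And>n. G n \<in> borel_measurable borel"
  shows "((\<lambda>n. Lp_norm (ennreal q) (G n)) \<longlongrightarrow> 0) F
    \<longleftrightarrow> (\<forall>e>0. \<forall>\<^sub>F n in F. pint q (G n) \<le> ennreal e)"
  unfolding ennreal_tendsto_0_iff
proof (intro iffI allI impI)
  fix e :: real assume *: "\<forall>e>0. \<forall>\<^sub>F x in F. Lp_norm (ennreal q) (G x) \<le> ennreal e" "0 < e"
  then have "\<forall>\<^sub>F x in F. Lp_norm (ennreal q) (G x) \<le> ennreal (e powr (1/q))" by simp
  then show "\<forall>\<^sub>F n in F. pint q (G n) \<le> ennreal e"
    by (rule eventually_mono) (use q \<open>0 < e\<close> in \<open>simp add: Lp_norm_le_iff powr_powr\<close>)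
next
  fix e :: real assume *: "\<forall>e>0. \<forall>\<^sub>F x in F. pint q (G x) \<le> ennreal e" "0 < e"
  then have "\<forall>\<^sub>F x in F. pint q (G x) \<le> ennreal (e powr q)" by simp
  then show "\<forall>\<^sub>F n in F. Lp_norm (ennreal q) (G n) \<le> ennreal e"
    by (rule eventually_mono) (use q \<open>0 < e\<close> in \<open>simp add: Lp_norm_le_iff\<close>)
qed

section \<open>Test functions and truncations\<close>

definition tests :: "wavefun set" where
  "tests = {u \<in> borel_measurable borel. \<exists>K R. 0
    \<le> K \<and> (\<forall>x. cmod (u x) \<le> K * indicator (cball 0 R) x)}"

text \<open>
  \<open>dual_bound p u s\<close> says that \<open>\<parallel>u\<parallel> \<le> s\<close> in the norm dual to \<open>L\<^sup>p\<close>; this form spares the conjugate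
  exponent and its degenerate values.
\<close>

definition dual_bound :: "ennreal \<Rightarrow> wavefun \<Rightarrow> real \<Rightarrow> bool" where
  "dual_bound p u s \<longleftrightarrow>
    (\<forall>\<phi>\<in>borel_measurable borel. \<forall>r\<ge>0. Lp_norm p \<phi> \<le> ennreal r \<longrightarrow>
       cmod (LINT x|lborel. \<phi> x * u x) \<le> r * s)"

lemma cball_measurable[measurable]: "cball (0::real^3) R \<in> sets borel"
  by simp

lemma borel_measurable_cnj[measurable (raw)]:
  assumes [measurable]: "f \<in> borel_measurable M"
  shows "(\<lambda>x. cnj (f x)) \<in> borel_measurable M"
proof -
  have "cnj \<in> borel_measurable borel" by (intro borel_measurable_continuous_onI continuous_intros)
  then show ?thesis by (rule measurable_compose[OF assms])
qed

lemma borel_measurable_complex_sgn[measurable (raw)]: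
  assumes [measurable]: "(f :: 'a \<Rightarrow> complex) \<in> borel_measurable M"
  shows "(\<lambda>x. sgn (f x)) \<in> borel_measurable M"
  unfolding sgn_div_norm by measurable

lemma norm_integral_le:
  fixes f :: "'a \<Rightarrow> 'b::{banach, second_countable_topology}"
  assumes "integrable M f" "integrable M g" "AE x in M. norm (f x) \<le> g x"
  shows "norm (integral\<^sup>L M f) \<le> (LINT x|M. g x)"
  using integral_norm_bound[of M f] integral_mono_AE[OF integrable_norm[OF assms(1)] assms(2,3)]
  by linarith

lemma testsE:
  assumes "u \<in> tests"
  obtains K R where "u \<in> borel_measurable borel" "0 \<le> K" "\<And>x. cmod (u x) \<le> K * indicator (cball 0 R) x"
  using assms unfolding tests_def by blast

lemma tests_measurable: "u \<in> tests \<Longrightarrow> u \<in> borel_measurable borel"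
  by (simp add: tests_def)

text \<open>For p = infinity this is the volume of the ball. For finite q the pointwise bound t <= r
  + r^(1-q) t^q does the work of Hoelder's inequality; its second term accounts for the summand 1,
  and its negative power of r for the hypothesis 0 < r.\<close>

lemma nn_integral_ball_le:
  assumes p: "1 \<le> p" and [measurable]: "\<phi> \<in> borel_measurable borel"
    and r: "0 < r" "Lp_norm p \<phi> \<le> ennreal r"
  shows "(\<integral>\<^sup>+x. ennreal (cmod (\<phi> x) * indicator (cball 0 R) x) \<partial>lborel)
    \<le> ennreal (r * (measure lborel (cball (0::real^3) R) + 1))"
  using p
proof (cases rule: exponent_cases)
  case 1
  then have "AE x in lborel. cmod (\<phi> x) \<le> r" using r Lp_norm_inf_le_iff[of \<phi> r] by simp
  then have "(\<integral>\<^sup>+x. ennreal (cmod (\<phi> x) * indicator (cball 0 R) x) \<partial>lborel)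
    \<le> (\<integral>\<^sup>+x. ennreal r * indicator (cball 0 R) (x::real^3) \<partial>lborel)"
    by (intro nn_integral_mono_AE) (auto elim!: eventually_mono simp: indicator_def ennreal_leI)
  also have "\<dots> = ennreal r * emeasure lborel (cball (0::real^3) R)"
    by (rule nn_integral_cmult_indicator) simp
  also have "\<dots> = ennreal (r * measure lborel (cball (0::real^3) R))"
    using r emeasure_eq_ennreal_measure[of lborel "cball (0::real^3) R"] emeasure_lborel_cball_finite[of "0::real^3" R, THEN less_imp_neq]
    by (simp add: ennreal_mult')
  also have "\<dots> \<le> ennreal (r * (measure lborel (cball (0::real^3) R) + 1))"
    using r by (intro ennreal_leI mult_left_mono) auto
  finally show ?thesis .
next
  case (2 q)
  have I: "pint q \<phi> \<le> ennreal (r powr q)" using r 2 Lp_norm_le_iff[of q r \<phi>] by simp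
  have le: "t \<le> r + r powr (1 - q) * t powr q" if "0 \<le> t" for t
  proof (cases "t \<le> r")
    case False
    then have "1 \<le> (t / r) powr (q - 1)"
      using r 2 by (intro ge_one_powr_ge_zero) auto
    then have "t * 1 \<le> t * (t / r) powr (q - 1)" using that by (intro mult_left_mono)
    also have "\<dots> = r powr (1 - q) * t powr q"
      using False r by (simp add: powr_divide powr_diff field_simps)
    finally show ?thesis using r by simp
  qed (use r in \<open>auto simp: add_increasing2\<close>)
  have "(\<integral>\<^sup>+x. ennreal (cmod (\<phi> x) * indicator (cball 0 R) x) \<partial>lborel)
    \<le> (\<integral>\<^sup>+x. ennreal r * indicator (cball 0 R) (x::real^3) + ennreal (r powr (1 - q)) * ennreal (cmod (\<phi> x) powr q) \<partial>lborel)"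
    using le r by (intro nn_integral_mono)
      (auto simp: indicator_def ennreal_leI simp flip: ennreal_mult ennreal_plus)
  also have "\<dots> = ennreal r * emeasure lborel (cball (0::real^3) R) + ennreal (r powr (1 - q)) * pint q \<phi>"
    unfolding pint_def by (subst nn_integral_add) (auto simp: nn_integral_cmult nn_integral_cmult_indicator)
  also have "\<dots> \<le> ennreal r * emeasure lborel (cball (0::real^3) R) + ennreal (r powr (1 - q)) * ennreal (r powr q)"
    by (intro add_mono mult_left_mono I) auto
  also have "\<dots> = ennreal (r * (measure lborel (cball (0::real^3) R) + 1))"
    using r emeasure_eq_ennreal_measure[of lborel "cball (0::real^3) R"] emeasure_lborel_cball_finite[of "0::real^3" R, THEN less_imp_neq]
    by (simp add: powr_diff ring_distribs flip: ennreal_mult)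
  finally show ?thesis .
qed

lemma integrable_mult_tests:
  assumes p: "1 \<le> p" and \<phi>: "\<phi> \<in> Lp_space p" and u: "u \<in> tests"
  shows "integrable lborel (\<lambda>x. \<phi> x * u x)"
proof -
  have [measurable]: "\<phi> \<in> borel_measurable borel" "u \<in> borel_measurable borel"
    using assms by (auto simp: Lp_space_def tests_measurable intro: Lp_norm_measurable)
  obtain C where C: "0 \<le> C" "Lp_norm p \<phi> = ennreal C"
    using \<phi> unfolding Lp_space_def by (metis Lp_norm_finiteE mem_Collect_eq)
  obtain K R where K: "0 \<le> K" "\<And>x. cmod (u x) \<le> K * indicator (cball 0 R) x"
    using u by (rule testsE) blast
  have "(\<integral>\<^sup>+x. ennreal (cmod (\<phi> x * u x)) \<partial>lborel)
      \<le> (\<integral>\<^sup>+x. ennreal K * ennreal (cmod (\<phi> x) * indicator (cball 0 R) x) \<partial>lborel)"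
  proof (intro nn_integral_mono)
    fix x
    have "cmod (\<phi> x) * cmod (u x) \<le> cmod (\<phi> x) * (K * indicator (cball 0 R) x)"
      by (intro mult_left_mono K) auto
    then show "ennreal (cmod (\<phi> x * u x)) \<le> ennreal K * ennreal (cmod (\<phi> x) * indicator (cball 0 R) x)"
      using K(1) by (simp add: norm_mult ennreal_leI mult.left_commute flip: ennreal_mult)
  qed
  also have "\<dots> = ennreal K * (\<integral>\<^sup>+x. ennreal (cmod (\<phi> x) * indicator (cball 0 R) x) \<partial>lborel)"
    by (rule nn_integral_cmult) measurable
  also have "\<dots> \<le> ennreal K * ennreal ((C + 1) * (measure lborel (cball (0::real^3) R) + 1))"
    using p C by (intro mult_left_mono nn_integral_ball_le) (auto intro: ennreal_leI)
  also have "\<dots> < \<infinity>" by (simp add: ennreal_mult_less_top)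
  finally show ?thesis by (intro integrableI_bounded) auto
qed

lemma dual_bound_tests:
  assumes p: "1 \<le> p" and u: "u \<in> tests"
  obtains s where "0 \<le> s" "dual_bound p u s"
proof -
  have [measurable]: "u \<in> borel_measurable borel" using u by (rule tests_measurable)
  obtain K R where K: "0 \<le> K" "\<And>x. cmod (u x) \<le> K * indicator (cball 0 R) x"
    using u by (rule testsE) blast
  define c where "c = measure lborel (cball (0::real^3) R) + 1"
  have c: "c > 0" by (simp add: c_def add_nonneg_pos)
  have "cmod (LINT x|lborel. \<phi> x * u x) \<le> r * (K * c)"
    if [measurable]: "\<phi> \<in> borel_measurable borel" and r: "0 \<le> r" "Lp_norm p \<phi> \<le> ennreal r" for \<phi> r
  proof -
    \<comment> \<open>The bound r may be 0, while the ball estimate wants a positive one; hence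
      every r' > r, followed by the limit r' -> r.\<close>
    have *: "cmod (LINT x|lborel. \<phi> x * u x) \<le> K * (r' * c)" if "r < r'" for r'
    proof -
      have "ennreal (cmod (LINT x|lborel. \<phi> x * u x))
        \<le> (\<integral>\<^sup>+x. ennreal (cmod (\<phi> x * u x)) \<partial>lborel)"
        by (intro integral_norm_bound_ennreal integrable_mult_tests[OF p _ u])
           (use r in \<open>auto simp: Lp_space_def intro: le_less_trans\<close>)
      also have "\<dots> \<le> (\<integral>\<^sup>+x. ennreal K * ennreal (cmod (\<phi> x) * indicator (cball 0 R) x) \<partial>lborel)"
      proof (intro nn_integral_mono)
        fix x
        have "cmod (\<phi> x) * cmod (u x) \<le> cmod (\<phi> x) * (K * indicator (cball 0 R) x)"
          by (intro mult_left_mono K) auto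
        then show "ennreal (cmod (\<phi> x * u x)) \<le> ennreal K * ennreal (cmod (\<phi> x) * indicator (cball 0 R) x)"
          using K(1) by (simp add: norm_mult ennreal_leI mult.left_commute flip: ennreal_mult)
      qed
      also have "\<dots> = ennreal K * (\<integral>\<^sup>+x. ennreal (cmod (\<phi> x) * indicator (cball 0 R) x) \<partial>lborel)"
        by (rule nn_integral_cmult) measurable
      also have "\<dots> \<le> ennreal K * ennreal (r' * c)"
        unfolding c_def using p r that
        by (intro mult_left_mono nn_integral_ball_le) (auto intro: order_trans ennreal_leI)
      also have "\<dots> = ennreal (K * (r' * c))" using K by (simp add: ennreal_mult')
      finally show ?thesis using K r c that by simp
    qed
    show ?thesis
    proof (rule tendsto_lowerbound)
      show "((\<lambda>r'. K * (r' * c)) \<longlongrightarrow> r * (K * c)) (at_right r)"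
        by (rule tendsto_eq_intros refl | simp)+
      show "\<forall>\<^sub>F r' in at_right r. cmod (LINT x|lborel. \<phi> x * u x) \<le> K * (r' * c)"
        using * by (auto simp: eventually_at_right_less eventually_at_filter intro!: always_eventually)
    qed simp
  qed
  then show thesis
    using that[of "K * c"] K c unfolding dual_bound_def by auto
qed

lemma tests_bounded_support:
  assumes [measurable]: "f \<in> borel_measurable borel"
    and "\<And>x. cmod (f x) \<le> K" "\<And>x. f x \<noteq> 0 \<Longrightarrow> norm x \<le> R"
  shows "f \<in> tests"
proof -
  have "0 \<le> K" using assms(2)[of 0] norm_ge_zero order_trans by blast
  moreover have "cmod (f x) \<le> K * indicator (cball 0 R) x" for x
    using assms(2,3)[of x] \<open>0 \<le> K\<close> by (cases "f x = 0") (auto simp: indicator_def)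
  ultimately show ?thesis using assms(1) unfolding tests_def by blast
qed

text \<open>Cutting off in space and in size makes a test function of every Borel function, and at
  each point the truncations are eventually equal to the function. The extensions to L^p are
  evaluated along this sequence.\<close>

definition trunc :: "nat \<Rightarrow> wavefun \<Rightarrow> wavefun" where
  "trunc n f x = (if norm x \<le> real n \<and> cmod (f x) \<le> real n then f x else 0)"

lemma trunc_measurable[measurable]:
  assumes [measurable]: "f \<in> borel_measurable borel"
  shows "trunc n f \<in> borel_measurable borel"
  unfolding trunc_def[abs_def] by measurable

lemma trunc_tests: "f \<in> borel_measurable borel \<Longrightarrow> trunc n f \<in> tests"
  by (rule tests_bounded_support[where K="real n" and R="real n"]) (auto simp: trunc_def split: if_splits)

lemma cmod_trunc_le: "cmod (trunc n f x) \<le> cmod (f x)"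
  by (simp add: trunc_def)

lemma trunc_eventually: "\<forall>\<^sub>F n in sequentially. trunc n f x = f x"
proof -
  obtain N where N: "max (norm x) (cmod (f x)) \<le> real N" using real_arch_simple by blast
  show ?thesis unfolding eventually_sequentially
    by (rule exI[of _ N]) (use N in \<open>auto simp: trunc_def\<close>)
qed

lemma trunc_tendsto: "(\<lambda>n. trunc n f x) \<longlonglongrightarrow> f x"
  by (rule tendsto_eventually[OF trunc_eventually])

text \<open>The reason for testing with bounded functions of bounded support: one class lies in
  every L^p, and unlike smooth functions it contains the truncated extremal functions of the duality
  argument, which involve indicators and \<open>sgn\<close>.\<close>

lemma tests_Lp:
  assumes p: "1 \<le> p" and u: "u \<in> tests" shows "u \<in> Lp_space p"
proof -
  obtain K R where K: "u \<in> borel_measurable borel" "0 \<le> K" "\<And>x. cmod (u x) \<le> K * indicator (cball 0 R) x"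
    using u by (rule testsE) blast
  note K(1)[measurable]
  from p show ?thesis
  proof (cases rule: exponent_cases)
    case 1
    have "cmod (u x) \<le> K" for x
      using K(2) K(3)[of x] by (cases "x \<in> cball 0 R") (auto simp del: mem_cball)
    then show ?thesis using 1 K Lp_norm_inf_le_iff[of u K] by (auto simp: Lp_space_def le_less_trans)
  next
    case (2 q)
    have "pint q u \<le> (\<integral>\<^sup>+x. ennreal (K powr q) * indicator (cball 0 R) (x::real^3) \<partial>lborel)"
      unfolding pint_def
    proof (intro nn_integral_mono)
      fix x show "ennreal (cmod (u x) powr q) \<le> ennreal (K powr q) * indicator (cball 0 R) x"
        using K(2) K(3)[of x] 2 by (auto simp: indicator_def intro!: ennreal_leI powr_mono2 split: if_splits)
    qed
    also have "\<dots> = ennreal (K powr q) * emeasure lborel (cball (0::real^3) R)"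
      by (rule nn_integral_cmult_indicator) simp
    also have "\<dots> < \<infinity>"
      using emeasure_lborel_cball_finite[of "0::real^3" R] by (simp add: ennreal_mult_less_top)
    finally show ?thesis
      using 2 K by (auto simp: Lp_space_def Lp_norm_def pint_def Let_def)
  qed
qed

lemma integrable_tests: "u \<in> tests \<Longrightarrow> integrable lborel u"
  using tests_Lp[of 1 u]
  by (intro integrableI_bounded)
     (auto simp: tests_measurable Lp_space_def Lp_norm_def Let_def less_top split: if_splits)

text \<open>One sequence serves both notions of convergence, norm and weak-*: the truncations and
  their errors are dominated by |f|, so dominated convergence applies to either.\<close>

lemma trunc_converges:
  assumes p: "1 \<le> p" and f: "f \<in> Lp_space p"
  shows "Lp_converges p (\<lambda>n. trunc n f) f"
proof -
  have fm[measurable]: "f \<in> borel_measurable borel"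
    using f by (auto simp: Lp_space_def intro: Lp_norm_measurable)
  from p show ?thesis
  proof (cases rule: exponent_cases)
    case 1
    obtain C where C: "0 \<le> C" "Lp_norm p f = ennreal C"
      using f unfolding Lp_space_def by (metis Lp_norm_finiteE mem_Collect_eq)
    have fC: "AE x in lborel. cmod (f x) \<le> C" using 1 C Lp_norm_inf_le_iff[of f C] by simp
    have "Lp_norm \<infinity> (trunc n f) \<le> ennreal C" for n
      using C 1 Lp_norm_mono_AE[OF p, of "trunc n f" f] by (simp add: cmod_trunc_le)
    moreover have "(\<lambda>n. LINT x|lborel. trunc n f x * \<phi> x)
      \<longlonglongrightarrow> (LINT x|lborel. f x * \<phi> x)"
      if \<phi>: "\<phi> \<in> Lp_space 1" for \<phi>
    proof -
      have [measurable]: "\<phi> \<in> borel_measurable borel"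
        using \<phi> by (auto simp: Lp_space_def intro: Lp_norm_measurable)
      have "integrable lborel \<phi>"
        using \<phi> by (intro integrableI_bounded) (auto simp: Lp_space_def Lp_norm_def Let_def less_top split: if_splits)
      then have "integrable lborel (\<lambda>x. C * cmod (\<phi> x))" by simp
      then show ?thesis
      proof (rule integral_dominated_convergence[rotated 2])
        show "AE x in lborel. (\<lambda>n. trunc n f x * \<phi> x) \<longlonglongrightarrow> f x * \<phi> x"
          by (intro AE_I2 tendsto_mult trunc_tendsto tendsto_const)
        show "AE x in lborel. cmod (trunc n f x * \<phi> x) \<le> C * cmod (\<phi> x)" for n
          using fC
          by eventually_elim (auto simp: norm_mult intro!: mult_right_mono order_trans[OF cmod_trunc_le])
      qed measurable
    qed
    ultimately show ?thesis unfolding Lp_converges_def 1 by (auto intro!: exI[of _ "ennreal C"])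
  next
    case (2 q)
    have fin: "pint q f < \<infinity>"
      using f 2 by (auto simp: Lp_space_def Lp_norm_def pint_def Let_def less_top split: if_splits)
    have "(\<lambda>n. \<integral>\<^sup>+x. ennreal (cmod (trunc n f x - f x) powr q) \<partial>lborel)
      \<longlonglongrightarrow> (\<integral>\<^sup>+x. 0 \<partial>(lborel::(real^3) measure))"
    proof (rule nn_integral_dominated_convergence[where w="\<lambda>x. ennreal (cmod (f x) powr q)"])
      show "AE x in lborel. ennreal (cmod (trunc n f x - f x) powr q) \<le> ennreal (cmod (f x) powr q)" for n
        by (auto simp: trunc_def)
      show "(\<integral>\<^sup>+ x. ennreal (cmod (f x) powr q) \<partial>lborel) < \<infinity>" using fin
        by (simp add: pint_def)
      show "AE x in lborel. (\<lambda>n. ennreal (cmod (trunc n f x - f x) powr q)) \<longlonglongrightarrow> 0"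
        by (intro AE_I2 tendsto_eventually eventually_mono[OF trunc_eventually]) auto
    qed measurable
    then have "(\<lambda>n. pint q (\<lambda>x. trunc n f x - f x)) \<longlonglongrightarrow> 0" by (simp add: pint_def)
    then have "(\<lambda>n. Lp_norm (ennreal q) (\<lambda>x. trunc n f x - f x)) \<longlonglongrightarrow> 0"
      using 2 by (subst Lp_norm_tendsto_0_iff) (auto simp: ennreal_tendsto_0_iff)
    then show ?thesis using 2 by (simp add: Lp_converges_def)
  qed
qed

text \<open>What the two notions of convergence have in common. Later limits go through pairings
  with test functions, where the exponent makes no difference.\<close>

lemma Lp_converges_tests:
  assumes p: "1 \<le> p" and F: "\<And>n. F n \<in> Lp_space p" and f: "f \<in> Lp_space p"
    and conv: "Lp_converges p F f" and u: "u \<in> tests"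
  shows "(\<lambda>n. LINT x|lborel. F n x * u x) \<longlonglongrightarrow> (LINT x|lborel. f x * u x)"
  using p
proof (cases rule: exponent_cases)
  case 1
  then show ?thesis using conv tests_Lp[OF _ u, of 1] by (auto simp: Lp_converges_def)
next
  case (2 q)
  obtain s where s: "0 \<le> s" "dual_bound p u s" using dual_bound_tests[OF p u] .
  have mm: "F n \<in> borel_measurable borel" "f \<in> borel_measurable borel" for n
    using f F[of n] by (auto simp: Lp_space_def intro: Lp_norm_measurable)
  have lim: "(\<lambda>n. Lp_norm p (\<lambda>x. F n x - f x)) \<longlonglongrightarrow> 0" using conv 2
    by (simp add: Lp_converges_def)
  show ?thesis
  proof (rule LIMSEQ_I)
    fix e :: real assume "0 < e"
    define e' where "e' = e / (s + 1)"
    have e': "0 < e'" using \<open>0 < e\<close> s by (simp add: e'_def)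
    have es: "e' * s < e"
    proof -
      have "e' * s = e * (s / (s + 1))" by (simp add: e'_def)
      also have "\<dots> < e * 1" using \<open>0 < e\<close> s by (intro mult_strict_left_mono) auto
      finally show ?thesis by simp
    qed
    obtain N where N: "\<And>n. n \<ge> N \<Longrightarrow> Lp_norm p (\<lambda>x. F n x - f x) \<le> ennreal e'"
      using lim e' unfolding ennreal_tendsto_0_iff eventually_sequentially by blast
    show "\<exists>N. \<forall>n\<ge>N. norm ((LINT x|lborel. F n x * u x) - (LINT x|lborel. f x * u x)) < e"
    proof (intro exI[of _ N] allI impI)
      fix n assume n: "N \<le> n"
      have "(LINT x|lborel. F n x * u x) - (LINT x|lborel. f x * u x) = (LINT x|lborel. (F n x - f x) * u x)"
        using integrable_mult_tests[OF p F u] integrable_mult_tests[OF p f u]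
        by (subst Bochner_Integration.integral_diff[symmetric]) (auto simp: left_diff_distrib)
      moreover have "cmod (LINT x|lborel. (F n x - f x) * u x) \<le> e' * s"
        using s(2) N[OF n] e' mm unfolding dual_bound_def by auto
      ultimately show "norm ((LINT x|lborel. F n x * u x) - (LINT x|lborel. f x * u x)) < e"
        using es by simp
    qed
  qed
qed

section \<open>The L^p norm as a supremum of pairings with test functions\<close>

lemma powr_Young:
  assumes "0 \<le> x" "0 < y" "1 \<le> (q::real)"
  shows "x * y powr (q - 1) \<le> x powr q / q + (1 - 1 / q) * y powr q"
\<comment> \<open>The conjugate exponent q / (q - 1) is undefined at q = 1, where the claim is an
  equality.\<close>
proof (cases "q = 1")
  case False
  then have q: "q > 1" using assms by simp
  have "x * y powr (q - 1) \<le> x powr q / q + (y powr (q - 1)) powr (q / (q - 1)) / (q / (q - 1))"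
    using assms q by (intro Youngs_inequality) (auto simp: field_simps)
  also have "(y powr (q - 1)) powr (q / (q - 1)) = y powr q" using q by (simp add: powr_powr)
  finally show ?thesis using q by (simp add: field_simps)
qed (use assms in auto)

text \<open>The converse of Hoelder's inequality. Membership of \<open>g\<close> in L^p is part of
  the conclusion, so the extremal function for \<open>g\<close> is cut off to bounded sets on which
  |g| is bounded, and the cut-off is removed at the end.\<close>

lemma Lp_norm_le_by_duality:
  assumes p: "1 \<le> p" and gm[measurable]: "g \<in> borel_measurable borel" and C: "0 \<le> C"
    and bound: "\<And>u s. u \<in> tests \<Longrightarrow> 0 \<le> s \<Longrightarrow> dual_bound p u s
      \<Longrightarrow> cmod (LINT x|lborel. g x * u x) \<le> C * s"
  shows "Lp_norm p g \<le> ennreal C"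
  using p
proof (cases rule: exponent_cases)
  case 1
  have "AE x in lborel. \<not> (C + 1 / Suc n < cmod (g x) \<and> norm x \<le> real m \<and> cmod (g x) \<le> real m)"
    for n m
  proof -
    \<comment> \<open>A bounded piece of the set where |g| exceeds C by a fixed margin. Pairing with
      the sign of \<open>g\<close> on E gives (C + 1/(n+1)) |E| <= C |E|, so E is null.\<close>
    define E where "E = {x. C + 1 / Suc n < cmod (g x) \<and> norm x \<le> real m \<and> cmod (g x) \<le> real m}"
    have [measurable]: "E \<in> sets borel" unfolding E_def by measurable
    have Esub: "E \<subseteq> cball 0 (real m)" by (auto simp: E_def)
    have Efin: "emeasure lborel E < \<infinity>"
      using emeasure_mono[OF Esub, of lborel] emeasure_lborel_cball_finite[of "0::real^3" "real m"]
      by (auto simp: le_less_trans)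
    define u where "u x = indicator E x * cnj (sgn (g x))" for x
    have um[measurable]: "u \<in> borel_measurable borel" unfolding u_def by measurable
    have ub: "cmod (u x) \<le> indicator E x" for x by (simp add: u_def norm_mult norm_sgn indicator_def)
    have ut: "u \<in> tests"
    proof (rule tests_bounded_support[OF um, where K=1 and R="real m"])
      show "cmod (u x) \<le> 1" for x using ub[of x] by (cases "x \<in> E") auto
      show "u x \<noteq> 0 \<Longrightarrow> norm x \<le> real m" for x using Esub
        by (auto simp: u_def indicator_def split: if_splits)
    qed
    have iE: "integrable lborel (indicator E :: _ \<Rightarrow> real)"
      using Efin by (intro integrable_real_indicator) auto
    have gu: "g x * u x = complex_of_real (indicator E x * cmod (g x))" for x
      by (simp add: u_def indicator_def sgn_div_norm complex_norm_square[symmetric] scaleR_conv_of_real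
          power2_eq_square field_simps)
    \<comment> \<open>|u| is at most the indicator of E, so its pairing with a function bounded by r
      is at most r |E|.\<close>
    have db: "dual_bound p u (measure lborel E)"
      unfolding dual_bound_def
    proof (intro ballI allI impI)
      fix \<phi> :: wavefun and r :: real assume [measurable]: "\<phi> \<in> borel_measurable borel"
        and r: "0 \<le> r" "Lp_norm p \<phi> \<le> ennreal r"
      have AEr: "AE x in lborel. cmod (\<phi> x) \<le> r" using r 1 Lp_norm_inf_le_iff[of \<phi> r] by simp
      have "cmod (LINT x|lborel. \<phi> x * u x) \<le> (LINT x|lborel. r * indicator E x)"
      proof (rule norm_integral_le)
        show "integrable lborel (\<lambda>x. \<phi> x * u x)"
          by (rule integrable_mult_tests[OF p _ ut]) (use r in \<open>auto simp: Lp_space_def intro: le_less_trans\<close>)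
      next
        show "integrable lborel (\<lambda>x. r * indicator E x :: real)" using iE by simp
      next
        show "AE x in lborel. cmod (\<phi> x * u x) \<le> r * indicator E x"
          using AEr by eventually_elim (auto simp: norm_mult intro!: mult_mono ub r)
      qed
      then show "cmod (LINT x|lborel. \<phi> x * u x) \<le> r * measure lborel E" by simp
    qed
    have b: "cmod (LINT x|lborel. g x * u x) \<le> C * measure lborel E"
      by (rule bound[OF ut _ db]) simp
    have "(\<lambda>x. of_real (indicator E x * cmod (g x))) \<in> tests"
      by (rule tests_bounded_support[where R="real m" and K="real m"])
         (auto simp: E_def indicator_def split: if_splits)
    from integrable_norm[OF integrable_tests[OF this]]
    have "integrable lborel (\<lambda>x. indicator E x * cmod (g x))" by (simp add: norm_mult)
    then have "(LINT x|lborel. (C + 1 / Suc n) * indicator E x) \<le> (LINT x|lborel. indicator E x * cmod (g x))"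
      by (intro integral_mono integrable_mult_right iE) (auto simp: E_def indicator_def)
    also have "\<dots> \<le> cmod (LINT x|lborel. g x * u x)"
      unfolding gu integral_complex_of_real norm_of_real by (rule abs_ge_self)
    finally have "(C + 1 / Suc n) * measure lborel E \<le> C * measure lborel E" using b by simp
    then have "measure lborel E = 0"
      by (smt (verit) divide_pos_pos measure_nonneg mult_less_cancel_right of_nat_0_less_iff zero_less_Suc)
    then have "emeasure lborel E = 0" using Efin by (auto simp: measure_def enn2real_eq_0_iff)
    then have "AE x in lborel. x \<notin> E" by (intro AE_not_in) auto
    then show ?thesis by (simp add: E_def)
  qed
  then have "AE x in lborel. \<forall>n m. \<not> (C + 1 / Suc n < cmod (g x) \<and> norm x \<le> real m \<and> cmod (g x)
    \<le> real m)"
    unfolding AE_all_countable by blast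
  then have "AE x in lborel. cmod (g x) \<le> C"
  proof eventually_elim
    case (elim x)
    obtain m where "max (norm x) (cmod (g x)) \<le> real m" using real_arch_simple by blast
    then have *: "cmod (g x) \<le> C + 1 / Suc n" for n using elim by (metis max.boundedE not_le)
    show ?case
    proof (rule ccontr)
      assume "\<not> cmod (g x) \<le> C"
      then obtain n where "1 / real (Suc n) < cmod (g x) - C" using reals_Archimedean[of "cmod (g x) - C"]
        by (auto simp: inverse_eq_divide)
      with *[of n] show False by simp
    qed
  qed
  then show ?thesis using 1 C Lp_norm_inf_le_iff[of g C] by simp
next
  case (2 q)
  \<comment> \<open>The lower bound on |g| excludes its zeros, where Young's inequality below would
    lack a positive argument; the discarded zeros contribute nothing to the integral of
    |g|^q.\<close>
  define E where "E n = {x. norm x \<le> real n \<and> cmod (g x) \<le> real n \<and> 1 / Suc n \<le> cmod (g x)}" for n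
  have [measurable]: "E n \<in> sets borel" for n unfolding E_def by measurable
  have gpos: "0 < cmod (g x)" if "x \<in> E n" for x n
    using that by (auto simp: E_def intro: less_le_trans[of 0 "1 / Suc n"])
  have step: "(\<integral>\<^sup>+x. ennreal (cmod (g x) powr q) * indicator (E n) x \<partial>lborel)
    \<le> ennreal (C powr q)" for n
  proof -
    \<comment> \<open>The extremal function: on E n one has g u = |g|^q and, for q > 1,
      |u|^(q/(q-1)) = |g|^q. This is why its dual norm is bounded by I^((q-1)/q) below.\<close>
    define u where "u x = indicator (E n) x * complex_of_real (cmod (g x) powr (q - 1)) * cnj (sgn (g x))" for x
    have um[measurable]: "u \<in> borel_measurable borel" unfolding u_def by measurable
    have cu: "cmod (u x) = indicator (E n) x * cmod (g x) powr (q - 1)" for x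
      using gpos[of x n] by (auto simp: u_def norm_mult norm_sgn indicator_def)
    have ut: "u \<in> tests"
    proof (rule tests_bounded_support[OF um, where R="real n"])
      show "cmod (u x) \<le> real n powr (q - 1)" for x
        unfolding cu using 2 by (auto simp: indicator_def E_def intro!: powr_mono2)
      show "u x \<noteq> 0 \<Longrightarrow> norm x \<le> real n" for x
        by (auto simp: u_def E_def indicator_def split: if_splits)
    qed
    have gu: "g x * u x = complex_of_real (indicator (E n) x * cmod (g x) powr q)" for x
    proof (cases "x \<in> E n")
      case True
      then have "g x \<noteq> 0" using gpos by fastforce
      then have "g x * cnj (sgn (g x)) = complex_of_real (cmod (g x))"
        by (simp add: sgn_div_norm scaleR_conv_of_real field_simps)
           (metis complex_norm_square power2_eq_square of_real_power)
      moreover have "g x * u x = (g x * cnj (sgn (g x))) * complex_of_real (cmod (g x) powr (q - 1))"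
        using True by (simp add: u_def)
      ultimately have "g x * u x = complex_of_real (cmod (g x) * cmod (g x) powr (q - 1))"
        by (simp only: of_real_mult)
      moreover have "cmod (g x) * cmod (g x) powr (q - 1) = cmod (g x) powr q"
        using \<open>g x \<noteq> 0\<close> by (simp add: powr_diff)
      ultimately show ?thesis using True by simp
    qed (simp add: u_def)
    define G where "G x = (indicator (E n) x :: real) * cmod (g x) powr q" for x
    have Gm[measurable]: "G \<in> borel_measurable borel" unfolding G_def by measurable
    have iG: "integrable lborel G"
    proof -
      have "(\<lambda>x. of_real (G x)) \<in> tests"
        by (rule tests_bounded_support[where R="real n" and K="real n powr q"])
           (use 2 in \<open>auto simp: G_def indicator_def E_def intro!: powr_mono2 split: if_splits\<close>)
      from integrable_norm[OF integrable_tests[OF this]] show ?thesis by (simp add: G_def[abs_def] norm_mult)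
    qed
    define I where "I = (LINT x|lborel. G x)"
    have I0: "0 \<le> I" unfolding I_def G_def by simp
    have nnI: "(\<integral>\<^sup>+x. ennreal (cmod (g x) powr q) * indicator (E n) x \<partial>lborel) = ennreal I"
    proof -
      have "(\<integral>\<^sup>+x. ennreal (cmod (g x) powr q) * indicator (E n) x \<partial>lborel)
        = (\<integral>\<^sup>+x. ennreal (G x) \<partial>lborel)"
        by (intro nn_integral_cong) (auto simp: G_def indicator_def)
      then show ?thesis
        unfolding I_def using iG by (subst (asm) nn_integral_eq_integral) (auto simp: G_def)
    qed
    show ?thesis
    proof (cases "I = 0")
      case False
      then have Ip: "0 < I" using I0 by simp
      have db: "dual_bound p u (I powr ((q - 1) / q))"
        unfolding dual_bound_def
      proof (intro ballI allI impI)
        fix \<phi> :: wavefun and r :: real assume [measurable]: "\<phi> \<in> borel_measurable borel"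
          and r0: "0 \<le> r" "Lp_norm p \<phi> \<le> ennreal r"
        have iu: "integrable lborel (\<lambda>x. \<phi> x * u x)"
          by (rule integrable_mult_tests[OF p _ ut]) (use r0 in \<open>auto simp: Lp_space_def intro: le_less_trans\<close>)
        have *: "cmod (LINT x|lborel. \<phi> x * u x) \<le> r * I powr ((q - 1) / q)"
          if r: "0 < r" "Lp_norm p \<phi> \<le> ennreal r" for r
        proof -
          have P: "pint q \<phi> \<le> ennreal (r powr q)" using r 2 Lp_norm_le_iff[of q r \<phi>] by simp
          define \<Phi> where "\<Phi> x = cmod (\<phi> x) powr q" for x
          have [measurable]: "\<Phi> \<in> borel_measurable borel" unfolding \<Phi>_def by measurable
          have i\<Phi>: "integrable lborel \<Phi>"
            using P by (intro integrableI_bounded) (auto simp: \<Phi>_def pint_def intro: le_less_trans)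
          have "ennreal (LINT x|lborel. \<Phi> x) = pint q \<phi>"
            unfolding pint_def \<Phi>_def[symmetric] using i\<Phi> by (subst nn_integral_eq_integral) (auto simp: \<Phi>_def)
          with P have "ennreal (LINT x|lborel. \<Phi> x) \<le> ennreal (r powr q)" by simp
          then have \<Phi>r: "(LINT x|lborel. \<Phi> x) \<le> r powr q" by (subst (asm) ennreal_le_iff) auto
          define c where "c = r * I powr ((q - 1) / q)"
          have c: "0 < c" using r Ip by (simp add: c_def)
          have "cmod (LINT x|lborel. \<phi> x * u x)
            \<le> (LINT x|lborel. c * (\<Phi> x / (q * r powr q) + (1 - 1/q) * (G x / I)))"
          proof (rule norm_integral_le[OF iu])
            show "integrable lborel (\<lambda>x. c * (\<Phi> x / (q * r powr q) + (1 - 1/q) * (G x / I)))"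
              using i\<Phi> iG by simp
            show "AE x in lborel. cmod (\<phi> x * u x) \<le> c * (\<Phi> x / (q * r powr q) + (1 - 1/q) * (G x / I))"
            proof (rule AE_I2)
              fix x
              show "cmod (\<phi> x * u x) \<le> c * (\<Phi> x / (q * r powr q) + (1 - 1/q) * (G x / I))"
              proof (cases "x \<in> E n")
                case True
                \<comment> \<open>With these normalisations the integrals of X^q and, over E n, of
                  Y^q are at most 1, and the weights 1/q and 1 - 1/q of Young's inequality sum to
                  1.\<close>
                define X where "X = cmod (\<phi> x) / r"
                define Y where "Y = cmod (g x) / I powr (1/q)"
                have Y: "0 < Y" using gpos[OF True] Ip by (simp add: Y_def)
                have "cmod (\<phi> x * u x) = cmod (\<phi> x) * cmod (g x) powr (q - 1)"
                  using True by (simp add: norm_mult cu)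
                also have "\<dots> = c * (X * Y powr (q - 1))"
                  using r Ip by (simp add: c_def X_def Y_def powr_divide powr_powr field_simps)
                also have "\<dots> \<le> c * (X powr q / q + (1 - 1/q) * Y powr q)"
                  using c Y 2 r by (intro mult_left_mono powr_Young) (auto simp: X_def)
                also have "X powr q / q = \<Phi> x / (q * r powr q)"
                  using r by (simp add: X_def \<Phi>_def powr_divide field_simps)
                also have "Y powr q = G x / I"
                  using True Ip 2 by (simp add: Y_def G_def powr_divide powr_powr)
                finally show ?thesis .
              next
                case False
                then have "u x = 0" by (simp add: u_def)
                moreover have "0 \<le> \<Phi> x" "0 \<le> G x" by (auto simp: \<Phi>_def G_def)
                ultimately show ?thesis using c Ip r 2 by auto
              qed
            qed
          qed
          also have "\<dots> = c * ((LINT x|lborel. \<Phi> x) / (q * r powr q) + (1 - 1/q))"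
            using i\<Phi> iG Ip by (simp add: I_def)
          also have "\<dots> \<le> c * (r powr q / (q * r powr q) + (1 - 1/q))"
            using c \<Phi>r 2 r by (intro mult_left_mono add_right_mono divide_right_mono) auto
          also have "\<dots> = c" using r 2 by (simp add: field_simps)
          finally show ?thesis by (simp add: c_def)
        qed
        \<comment> \<open>The estimate above divides by its bound and so asks for a positive one;
          letting it decrease to r covers r = 0.\<close>
        show "cmod (LINT x|lborel. \<phi> x * u x) \<le> r * I powr ((q - 1) / q)"
        proof (rule tendsto_lowerbound)
          show "((\<lambda>r'. r' * I powr ((q - 1) / q)) \<longlongrightarrow> r * I powr ((q - 1) / q)) (at_right r)"
            by (rule tendsto_eq_intros refl | simp)+
          show "\<forall>\<^sub>F r' in at_right r. cmod (LINT x|lborel. \<phi> x * u x) \<le> r' * I powr ((q - 1) / q)"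
          proof -
            have "cmod (LINT x|lborel. \<phi> x * u x) \<le> r' * I powr ((q - 1) / q)" if "r < r'" for r'
              by (rule *) (use that r0 ennreal_leI[of r r'] in \<open>auto intro: order_trans\<close>)
            then show ?thesis by (auto simp: eventually_at_filter intro!: always_eventually)
          qed
        qed simp
      qed
      have "cmod (LINT x|lborel. g x * u x) \<le> C * I powr ((q - 1) / q)"
        by (rule bound[OF ut _ db]) simp
      then have "I \<le> C * I powr ((q - 1) / q)"
        using I0 unfolding gu G_def[symmetric] integral_complex_of_real norm_of_real by (simp add: I_def)
      then have "I powr (1/q) * I powr ((q - 1) / q) \<le> C * I powr ((q - 1) / q)"
        using Ip 2 by (simp flip: powr_add add: field_simps)
      then have "I powr (1/q) \<le> C" using Ip by simp
      then have "(I powr (1/q)) powr q \<le> C powr q" using 2 by (intro powr_mono2) auto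
      then have "I \<le> C powr q" using Ip 2 by (simp add: powr_powr)
      then show ?thesis unfolding nnI by (rule ennreal_leI)
    qed (simp add: nnI)
  qed
  \<comment> \<open>The sets E n exhaust the points where g is non-zero, so Fatou removes the
    cut-off.\<close>
  have "pint q g \<le> (\<integral>\<^sup>+x. liminf (\<lambda>n. ennreal (cmod (g x) powr q) * indicator (E n) x) \<partial>lborel)"
    unfolding pint_def
  proof (intro nn_integral_mono)
    fix x
    have "\<forall>\<^sub>F n in sequentially. ennreal (cmod (g x) powr q) * indicator (E n) x = ennreal (cmod (g x) powr q)"
    proof (cases "g x = 0")
      case False
      obtain N1 where N1: "max (norm x) (cmod (g x)) \<le> real N1" using real_arch_simple by blast
      obtain N2 where N2: "1 / real (Suc N2) < cmod (g x)"
        using reals_Archimedean[of "cmod (g x)"] False by (auto simp: inverse_eq_divide)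
      show ?thesis unfolding eventually_sequentially
      proof (intro exI[of _ "max N1 N2"] allI impI)
        fix n assume n: "max N1 N2 \<le> n"
        have "1 / real (Suc n) \<le> 1 / real (Suc N2)" using n by (intro divide_left_mono) auto
        then have "x \<in> E n" using N1 N2 n by (auto simp: E_def)
        then show "ennreal (cmod (g x) powr q) * indicator (E n) x = ennreal (cmod (g x) powr q)" by simp
      qed
    qed simp
    then have "(\<lambda>n. ennreal (cmod (g x) powr q) * indicator (E n) x)
      \<longlonglongrightarrow> ennreal (cmod (g x) powr q)"
      by (rule tendsto_eventually)
    then show "ennreal (cmod (g x) powr q) \<le> liminf (\<lambda>n. ennreal (cmod (g x) powr q) * indicator (E n) x)"
      by (simp add: lim_imp_Liminf)
  qed
  also have "\<dots> \<le> liminf (\<lambda>n. \<integral>\<^sup>+x. ennreal (cmod (g x) powr q) * indicator (E n) x \<partial>lborel)"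
    by (intro nn_integral_liminf) measurable
  also have "\<dots> \<le> ennreal (C powr q)"
    by (rule order_trans[OF Liminf_le_Limsup Limsup_bounded]) (auto simp: step)
  finally show ?thesis using 2 C Lp_norm_le_iff[of q C g] by simp
qed

section \<open>The Hilbert space structure of L2\<close>

text \<open>A real-valued L^2 norm, in agreement with \<open>Lp_norm 2\<close> on
  \<open>Lp_space 2\<close>. Where the square is not integrable the integral defaults to 0 and the
  value means nothing.\<close>

definition nrm :: "wavefun \<Rightarrow> real" where
  "nrm f = sqrt (LINT x|lborel. (cmod (f x))\<^sup>2)"

lemma Lp_space_measurable: "f \<in> Lp_space p \<Longrightarrow> f \<in> borel_measurable borel"
  by (auto simp: Lp_space_def intro: Lp_norm_measurable)

lemma L2_iff:
  "f \<in> Lp_space 2 \<longleftrightarrow> f \<in> borel_measurable borel \<and> integrable lborel (\<lambda>x. (cmod (f x))\<^sup>2)"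
proof (cases "f \<in> borel_measurable borel")
  case True
  note [measurable] = True
  have "integrable lborel (\<lambda>x. (cmod (f x))\<^sup>2)
    \<longleftrightarrow> (\<integral>\<^sup>+x. ennreal ((cmod (f x))\<^sup>2) \<partial>lborel) < \<infinity>"
    by (subst integrable_iff_bounded) auto
  moreover have "f \<in> Lp_space 2
    \<longleftrightarrow> (\<integral>\<^sup>+x. ennreal ((cmod (f x))\<^sup>2) \<partial>lborel) < \<infinity>"
    using True by (auto simp: Lp_space_def Lp_norm_def Let_def less_top)
  ultimately show ?thesis using True by simp
qed (auto dest: Lp_space_measurable)

lemma nrm_nonneg[simp]: "0 \<le> nrm f"
  by (simp add: nrm_def)

lemma nrm_sq: "(nrm f)\<^sup>2 = (LINT x|lborel. (cmod (f x))\<^sup>2)"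
  by (simp add: nrm_def)

lemma Lp_norm_2:
  assumes "f \<in> Lp_space 2" shows "Lp_norm 2 f = ennreal (nrm f)"
proof -
  have *: "f \<in> borel_measurable borel" "integrable lborel (\<lambda>x. (cmod (f x))\<^sup>2)"
    using assms by (auto simp: L2_iff)
  have "(\<integral>\<^sup>+x. ennreal ((cmod (f x))\<^sup>2) \<partial>lborel)
    = ennreal (LINT x|lborel. (cmod (f x))\<^sup>2)"
    using * by (intro nn_integral_eq_integral) auto
  then show ?thesis
    using * by (simp add: Lp_norm_def nrm_def Let_def powr_half_sqrt)
qed

lemma L2_cong_AE:
  assumes "f \<in> Lp_space 2" "g \<in> borel_measurable borel" "AE x in lborel. cmod (g x) = cmod (f x)"
  shows "g \<in> Lp_space 2" "nrm g = nrm f"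
proof -
  have [measurable]: "f \<in> borel_measurable borel" using assms by (rule_tac Lp_space_measurable)
  note assms(2)[measurable]
  have *: "AE x in lborel. (cmod (g x))\<^sup>2 = (cmod (f x))\<^sup>2" using assms(3) by eventually_elim simp
  have "integrable lborel (\<lambda>x. (cmod (g x))\<^sup>2) = integrable lborel (\<lambda>x. (cmod (f x))\<^sup>2)"
    by (rule integrable_cong_AE) (use * in auto)
  then show "g \<in> Lp_space 2" using assms by (simp add: L2_iff)
  show "nrm g = nrm f" unfolding nrm_def
    by (rule arg_cong[where f=sqrt], rule integral_cong_AE) (use * in auto)
qed

lemma L2_bound:
  assumes f: "f \<in> Lp_space 2" and [measurable]: "g \<in> borel_measurable borel" and "0 \<le> K"
    and le: "AE x in lborel. cmod (g x) \<le> K * cmod (f x)"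
  shows "g \<in> Lp_space 2" "nrm g \<le> K * nrm f"
proof -
  have [measurable]: "f \<in> borel_measurable borel" using f by (rule Lp_space_measurable)
  have i: "integrable lborel (\<lambda>x. K\<^sup>2 * (cmod (f x))\<^sup>2)" using f by (simp add: L2_iff)
  have le2: "AE x in lborel. (cmod (g x))\<^sup>2 \<le> K\<^sup>2 * (cmod (f x))\<^sup>2"
    using le by eventually_elim (metis norm_ge_zero power_mono power_mult_distrib)
  have ig: "integrable lborel (\<lambda>x. (cmod (g x))\<^sup>2)"
    by (rule Bochner_Integration.integrable_bound[OF i]) (use le2 in auto)
  then show "g \<in> Lp_space 2" by (simp add: L2_iff)
  have "(nrm g)\<^sup>2 \<le> (K * nrm f)\<^sup>2"
    unfolding nrm_sq power_mult_distrib Bochner_Integration.integral_mult_right_zero[symmetric]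
    by (rule integral_mono_AE[OF ig i le2])
  then show "nrm g \<le> K * nrm f" by (rule power2_le_imp_le) (use \<open>0 \<le> K\<close> in simp)
qed

lemma L2_cmult:
  assumes "f \<in> Lp_space 2" shows "(\<lambda>x. c * f x) \<in> Lp_space 2"
proof (rule L2_bound(1)[OF assms, where K="cmod c"])
  have [measurable]: "f \<in> borel_measurable borel" using assms by (rule Lp_space_measurable)
  show "(\<lambda>x. c * f x) \<in> borel_measurable borel" by measurable
qed (auto simp: norm_mult)

lemma nrm_cmult: "nrm (\<lambda>x. c * f x) = cmod c * nrm f"
  by (simp add: nrm_def norm_mult power_mult_distrib real_sqrt_mult)

lemma L2_add:
  assumes "f \<in> Lp_space 2" "g \<in> Lp_space 2" shows "(\<lambda>x. f x + g x) \<in> Lp_space 2"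
proof -
  have [measurable]: "f \<in> borel_measurable borel" "g \<in> borel_measurable borel"
    using assms by (auto dest: Lp_space_measurable)
  have "integrable lborel (\<lambda>x. 2 * (cmod (f x))\<^sup>2 + 2 * (cmod (g x))\<^sup>2)"
    using assms by (simp add: L2_iff)
  then have "integrable lborel (\<lambda>x. (cmod (f x + g x))\<^sup>2)"
  proof (rule Bochner_Integration.integrable_bound, goal_cases)
    case 2
    have "(cmod (f x + g x))\<^sup>2 \<le> 2 * (cmod (f x))\<^sup>2 + 2 * (cmod (g x))\<^sup>2" for x
    proof -
      have "(cmod (f x + g x))\<^sup>2 \<le> (cmod (f x) + cmod (g x))\<^sup>2"
        by (intro power_mono norm_triangle_ineq) auto
      also have "\<dots> \<le> 2 * (cmod (f x))\<^sup>2 + 2 * (cmod (g x))\<^sup>2"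
        using sum_squares_bound[of "cmod (f x)" "cmod (g x)"] by (simp add: power2_sum)
      finally show ?thesis .
    qed
    then show ?case by simp
  qed measurable
  then show ?thesis by (simp add: L2_iff)
qed

lemma L2_lin: "f \<in> Lp_space 2 \<Longrightarrow> g \<in> Lp_space 2
  \<Longrightarrow> (\<lambda>x. c * f x + g x) \<in> Lp_space 2"
  by (intro L2_add L2_cmult)

lemma L2_diff: "f \<in> Lp_space 2 \<Longrightarrow> g \<in> Lp_space 2
  \<Longrightarrow> (\<lambda>x. f x - g x) \<in> Lp_space 2"
  using L2_lin[of g f "-1"] by simp

lemma L2_0[simp]: "(\<lambda>x. 0) \<in> Lp_space 2"
  by (simp add: L2_iff)

lemma tests_L2: "u \<in> tests \<Longrightarrow> u \<in> Lp_space 2"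
  by (rule tests_Lp) simp

lemma L2_integrable_mult:
  assumes "f \<in> Lp_space 2" "g \<in> Lp_space 2"
  shows "integrable lborel (\<lambda>x. f x * g x)"
proof -
  have [measurable]: "f \<in> borel_measurable borel" "g \<in> borel_measurable borel"
    using assms by (auto dest: Lp_space_measurable)
  have "integrable lborel (\<lambda>x. (cmod (f x))\<^sup>2 + (cmod (g x))\<^sup>2)"
    using assms by (simp add: L2_iff)
  then show ?thesis
  proof (rule Bochner_Integration.integrable_bound, goal_cases)
    case 2
    have "cmod (f x) * cmod (g x) \<le> (cmod (f x))\<^sup>2 + (cmod (g x))\<^sup>2" for x
    proof -
      have "2 * (cmod (f x) * cmod (g x)) \<le> (cmod (f x))\<^sup>2 + (cmod (g x))\<^sup>2"
        using sum_squares_bound[of "cmod (f x)" "cmod (g x)"] by simp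
      moreover have "0 \<le> cmod (f x) * cmod (g x)" by simp
      ultimately show ?thesis by linarith
    qed
    then show ?case by (simp add: norm_mult)
  qed measurable
qed

lemma L2_cnj: "f \<in> Lp_space 2 \<Longrightarrow> (\<lambda>x. cnj (f x)) \<in> Lp_space 2"
  by (rule L2_cong_AE(1)) (auto dest: Lp_space_measurable)

lemma nrm_cnj: "nrm (\<lambda>x. cnj (f x)) = nrm f"
  by (simp add: nrm_def)

lemma inner_integrable:
  assumes "f \<in> Lp_space 2" "g \<in> Lp_space 2"
  shows "integrable lborel (\<lambda>x. cnj (f x) * g x)"
  using assms by (intro L2_integrable_mult L2_cnj)

lemma L2_abs_CS:
  assumes "f \<in> Lp_space 2" "g \<in> Lp_space 2"
  shows "(LINT x|lborel. cmod (f x * g x)) \<le> nrm f * nrm g"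
proof -
  have [measurable]: "f \<in> borel_measurable borel" "g \<in> borel_measurable borel"
    using assms by (auto dest: Lp_space_measurable)
  have e: "(\<integral>\<^sup>+x. (ennreal (cmod (h x)))\<^sup>2 \<partial>lborel) = ennreal ((nrm h)\<^sup>2)"
    if "h \<in> Lp_space 2" for h
    unfolding nrm_sq using that
    by (subst nn_integral_eq_integral[symmetric]) (auto simp: L2_iff ennreal_power)
  have "(ennreal (LINT x|lborel. cmod (f x * g x)))\<^sup>2
      = (\<integral>\<^sup>+x. ennreal (cmod (f x)) * ennreal (cmod (g x)) \<partial>lborel)\<^sup>2"
    using integrable_norm[OF L2_integrable_mult[OF assms]]
    by (subst nn_integral_eq_integral[symmetric]) (auto simp: norm_mult ennreal_mult')
  also have "\<dots> \<le> ennreal ((nrm f)\<^sup>2) * ennreal ((nrm g)\<^sup>2)"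
    unfolding e[OF assms(1), symmetric] e[OF assms(2), symmetric]
    by (rule Cauchy_Schwarz_nn_integral) auto
  also have "\<dots> = ennreal ((nrm f * nrm g)\<^sup>2)" by (simp add: power_mult_distrib ennreal_mult')
  finally have "(LINT x|lborel. cmod (f x * g x))\<^sup>2 \<le> (nrm f * nrm g)\<^sup>2"
    by (simp add: ennreal_power)
  then show ?thesis by (rule power2_le_imp_le) simp
qed

lemma L2_CS:
  assumes "f \<in> Lp_space 2" "g \<in> Lp_space 2"
  shows "cmod (LINT x|lborel. f x * g x) \<le> nrm f * nrm g"
  using L2_abs_CS[OF assms] integral_norm_bound[of lborel "\<lambda>x. f x * g x"] by linarith

lemma inner_CS:
  assumes "f \<in> Lp_space 2" "g \<in> Lp_space 2"
  shows "cmod (inner_L2 f g) \<le> nrm f * nrm g"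
  using L2_CS[OF L2_cnj[OF assms(1)] assms(2)] by (simp add: inner_L2_def nrm_cnj)

lemma inner_lin_left:
  assumes "f \<in> Lp_space 2" "g \<in> Lp_space 2" "h \<in> Lp_space 2"
  shows "inner_L2 (\<lambda>x. c * f x + g x) h = cnj c * inner_L2 f h + inner_L2 g h"
proof -
  have "inner_L2 (\<lambda>x. c * f x + g x) h = (LINT x|lborel. cnj c * (cnj (f x) * h x) + cnj (g x) * h x)"
    unfolding inner_L2_def by (simp add: algebra_simps)
  then show ?thesis
    using inner_integrable[OF assms(1,3)] inner_integrable[OF assms(2,3)] by (simp add: inner_L2_def)
qed

lemma inner_lin_right:
  assumes "f \<in> Lp_space 2" "g \<in> Lp_space 2" "h \<in> Lp_space 2"
  shows "inner_L2 h (\<lambda>x. c * f x + g x) = c * inner_L2 h f + inner_L2 h g"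
proof -
  have "inner_L2 h (\<lambda>x. c * f x + g x) = (LINT x|lborel. c * (cnj (h x) * f x) + cnj (h x) * g x)"
    unfolding inner_L2_def by (simp add: algebra_simps)
  then show ?thesis
    using inner_integrable[OF assms(3,1)] inner_integrable[OF assms(3,2)] by (simp add: inner_L2_def)
qed

lemma inner_diff_left:
  assumes "f \<in> Lp_space 2" "g \<in> Lp_space 2" "h \<in> Lp_space 2"
  shows "inner_L2 (\<lambda>x. f x - g x) h = inner_L2 f h - inner_L2 g h"
  using inner_lin_left[OF assms(2,1,3), of "-1"] by simp

lemma inner_diff_right:
  assumes "f \<in> Lp_space 2" "g \<in> Lp_space 2" "h \<in> Lp_space 2"
  shows "inner_L2 h (\<lambda>x. f x - g x) = inner_L2 h f - inner_L2 h g"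
  using inner_lin_right[OF assms(2,1,3), of "-1"] by simp

lemma inner_cnj: "inner_L2 g f = cnj (inner_L2 f g)"
proof -
  have "cnj (LINT x|lborel. cnj (f x) * g x) = (LINT x|lborel. cnj (cnj (f x) * g x))"
    by (rule Bochner_Integration.integral_cnj[symmetric])
  then show ?thesis by (simp add: inner_L2_def mult.commute)
qed

lemma inner_self: "inner_L2 f f = complex_of_real ((nrm f)\<^sup>2)"
proof -
  have "inner_L2 f f = (LINT x|lborel. complex_of_real ((cmod (f x))\<^sup>2))"
    unfolding inner_L2_def by (intro Bochner_Integration.integral_cong)
      (auto simp: complex_norm_square mult.commute simp del: of_real_power)
  then show ?thesis by (simp add: nrm_sq integral_complex_of_real del: of_real_power)
qed

lemma inner_cong_AE:
  assumes "f \<in> borel_measurable borel" "g \<in> borel_measurable borel"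
    "f' \<in> borel_measurable borel" "g' \<in> borel_measurable borel" "ae_equal f f'" "ae_equal g g'"
  shows "inner_L2 f g = inner_L2 f' g'"
proof -
  note assms(1-4)[measurable]
  have "AE x in lborel. cnj (f x) * g x = cnj (f' x) * g' x" using assms(5,6) by eventually_elim simp
  then show ?thesis unfolding inner_L2_def by (intro integral_cong_AE) auto
qed

lemma nrm_lin_sq:
  assumes "f \<in> Lp_space 2" "g \<in> Lp_space 2"
  shows "(nrm (\<lambda>x. c * f x + g x))\<^sup>2 = (cmod c)\<^sup>2 * (nrm f)\<^sup>2 + 2 * Re (cnj c * inner_L2 f g)
    + (nrm g)\<^sup>2"
proof -
  let ?h = "\<lambda>x. c * f x + g x"
  have "complex_of_real ((nrm ?h)\<^sup>2) = cnj c * inner_L2 f ?h + inner_L2 g ?h"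
    unfolding inner_self[symmetric] using assms by (intro inner_lin_left L2_lin)
  also have "\<dots> = cnj c * (c * inner_L2 f f + inner_L2 f g) + (c * inner_L2 g f + inner_L2 g g)"
    using assms by (simp add: inner_lin_right)
  also have "\<dots> = complex_of_real ((cmod c)\<^sup>2 * (nrm f)\<^sup>2 + (nrm g)\<^sup>2)
    + (cnj c * inner_L2 f g + cnj (cnj c * inner_L2 f g))"
    unfolding inner_self inner_cnj[of g f]
    by (simp add: complex_norm_square algebra_simps del: of_real_power)
  finally have "Re (complex_of_real ((nrm ?h)\<^sup>2)) = Re \<dots>" by (rule arg_cong)
  then show ?thesis by simp
qed

lemma nrm_triangle:
  assumes "f \<in> Lp_space 2" "g \<in> Lp_space 2"
  shows "nrm (\<lambda>x. f x + g x) \<le> nrm f + nrm g"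
proof -
  have "(nrm (\<lambda>x. f x + g x))\<^sup>2 = (nrm f)\<^sup>2 + 2 * Re (inner_L2 f g) + (nrm g)\<^sup>2"
    using nrm_lin_sq[OF assms, of 1] by simp
  also have "\<dots> \<le> (nrm f)\<^sup>2 + 2 * (nrm f * nrm g) + (nrm g)\<^sup>2"
    using inner_CS[OF assms] complex_Re_le_cmod[of "inner_L2 f g"] by simp
  also have "\<dots> = (nrm f + nrm g)\<^sup>2" by (simp add: power2_sum)
  finally show ?thesis by (rule power2_le_imp_le) simp
qed

lemma nrm_diff_commute: "nrm (\<lambda>x. f x - g x) = nrm (\<lambda>x. g x - f x)"
  by (simp add: nrm_def norm_minus_commute)

lemma nrm_triangle3:
  assumes "f \<in> Lp_space 2" "g \<in> Lp_space 2" "h \<in> Lp_space 2"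
  shows "nrm (\<lambda>x. f x - h x) \<le> nrm (\<lambda>x. f x - g x) + nrm (\<lambda>x. g x - h x)"
  using nrm_triangle[OF L2_diff[OF assms(1,2)] L2_diff[OF assms(2,3)]] by simp

lemma nrm_le_diff:
  assumes "f \<in> Lp_space 2" "g \<in> Lp_space 2"
  shows "nrm f \<le> nrm g + nrm (\<lambda>x. f x - g x)"
  using nrm_triangle[OF assms(2) L2_diff[OF assms]] by simp

lemma nrm_eq_0_AE:
  assumes "f \<in> Lp_space 2" "nrm f = 0" shows "AE x in lborel. f x = 0"
proof -
  have "(LINT x|lborel. (cmod (f x))\<^sup>2) = 0" using assms nrm_sq[of f] by simp
  then have "AE x in lborel. (cmod (f x))\<^sup>2 = 0"
    using assms integral_nonneg_eq_0_iff_AE[of lborel "\<lambda>x. (cmod (f x))\<^sup>2"] by (auto simp: L2_iff)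
  then show ?thesis by eventually_elim simp
qed

lemma pint_2: "f \<in> Lp_space 2 \<Longrightarrow> pint 2 f = ennreal ((nrm f)\<^sup>2)"
  unfolding nrm_sq pint_def
  by (subst nn_integral_eq_integral[symmetric]) (auto simp: L2_iff)

text \<open>The limit comes from \<open>pint_complete\<close> for q = 2 and lies in L^2 because it
  differs from some F N by an L^2 function.\<close>

lemma L2_complete:
  assumes F: "\<And>n. F n \<in> Lp_space 2"
    and Cauchy: "\<And>e. 0 < e \<Longrightarrow> \<exists>N::nat. \<forall>m\<ge>N. \<forall>n\<ge>N. nrm (\<lambda>x. F m x - F n x) \<le> e"
  shows "\<exists>g\<in>Lp_space 2. (\<lambda>n. nrm (\<lambda>x. F n x - g x)) \<longlonglongrightarrow> 0"
proof -
  have [measurable]: "F n \<in> borel_measurable borel" for n using F by (rule Lp_space_measurable)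
  have "\<exists>g\<in>borel_measurable borel. \<forall>e>0. \<exists>N. \<forall>n\<ge>N. pint 2 (\<lambda>x. F n x - g x)
    \<le> ennreal e"
  proof (rule pint_complete)
    fix e :: real assume "0 < e"
    then obtain N where N: "\<forall>m\<ge>N. \<forall>n\<ge>N. nrm (\<lambda>x. F m x - F n x) \<le> sqrt e"
      using Cauchy[of "sqrt e"] by auto
    show "\<exists>N. \<forall>m\<ge>N. \<forall>n\<ge>N. pint 2 (\<lambda>x. F m x - F n x) \<le> ennreal e"
    proof (intro exI[of _ N] allI impI)
      fix m n assume "N \<le> m" "N \<le> n"
      then have "(nrm (\<lambda>x. F m x - F n x))\<^sup>2 \<le> (sqrt e)\<^sup>2" using N by (intro power_mono) auto
      then show "pint 2 (\<lambda>x. F m x - F n x) \<le> ennreal e"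
        using \<open>0 < e\<close> F by (simp add: pint_2 L2_diff ennreal_leI)
    qed
  qed auto
  then obtain g where gm[measurable]: "g \<in> borel_measurable borel"
    and g: "\<And>e. e > 0 \<Longrightarrow> \<exists>N. \<forall>n\<ge>N. pint 2 (\<lambda>x. F n x - g x) \<le> ennreal e"
      by blast
  have L: "(\<lambda>x. F n x - g x) \<in> Lp_space 2" if "pint 2 (\<lambda>x. F n x - g x) \<le> ennreal e" for n e
  proof -
    have "pint 2 (\<lambda>x. F n x - g x) < \<infinity>" using that by (simp add: le_less_trans)
    then show ?thesis by (auto simp: Lp_space_def Lp_norm_def pint_def Let_def)
  qed
  obtain N where "pint 2 (\<lambda>x. F N x - g x) \<le> ennreal 1" using g[of 1] by auto
  from L2_diff[OF F[of N] L[OF this]] have gL: "g \<in> Lp_space 2" by simp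
  show ?thesis
  proof (intro bexI[OF _ gL] LIMSEQ_I)
    fix e :: real assume e: "0 < e"
    then obtain N where N: "\<forall>n\<ge>N. pint 2 (\<lambda>x. F n x - g x) \<le> ennreal ((e/2)\<^sup>2)"
      using g[of "(e/2)\<^sup>2"] by auto
    show "\<exists>N. \<forall>n\<ge>N. norm (nrm (\<lambda>x. F n x - g x) - 0) < e"
    proof (intro exI[of _ N] allI impI)
      fix n assume "N \<le> n"
      then have "ennreal ((nrm (\<lambda>x. F n x - g x))\<^sup>2) \<le> ennreal ((e/2)\<^sup>2)"
        using N by (simp add: pint_2[OF L2_diff[OF F gL]])
      then have "(nrm (\<lambda>x. F n x - g x))\<^sup>2 \<le> (e/2)\<^sup>2" by (subst (asm) ennreal_le_iff) auto
      then have "nrm (\<lambda>x. F n x - g x) \<le> e/2" using e by (auto intro: power2_le_imp_le)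
      then show "norm (nrm (\<lambda>x. F n x - g x) - 0) < e" using e by simp
    qed
  qed
qed

lemma L2_Cauchy_of_convergent:
  assumes "\<And>n. F n \<in> Lp_space 2" "g \<in> Lp_space 2"
    "(\<lambda>n. nrm (\<lambda>x. F n x - g x)) \<longlonglongrightarrow> 0" "0 < e"
  shows "\<exists>N::nat. \<forall>m\<ge>N. \<forall>n\<ge>N. nrm (\<lambda>x. F m x - F n x) \<le> e"
proof -
  obtain N where N: "\<And>n. n \<ge> N \<Longrightarrow> nrm (\<lambda>x. F n x - g x) < e / 2"
    using LIMSEQ_D[OF assms(3), of "e/2"] assms(4) by auto
  show ?thesis
  proof (intro exI[of _ N] allI impI)
    fix m n assume "N \<le> m" "N \<le> n"
    then show "nrm (\<lambda>x. F m x - F n x) \<le> e"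
      using nrm_triangle3[OF assms(1,2,1), of m n] N[of m] N[of n] nrm_diff_commute[of g "F n"] by linarith
  qed
qed

lemma nrm_tendsto:
  assumes "\<And>n. F n \<in> Lp_space 2" "g \<in> Lp_space 2"
    "((\<lambda>n. nrm (\<lambda>x. F n x - g x)) \<longlongrightarrow> 0) Fl"
  shows "((\<lambda>n. nrm (F n)) \<longlongrightarrow> nrm g) Fl"
proof (rule Lim_transform_bound[of _ "\<lambda>n. nrm (\<lambda>x. F n x - g x)", THEN LIM_zero_cancel, rotated])
  show "((\<lambda>n. nrm (\<lambda>x. F n x - g x)) \<longlongrightarrow> 0) Fl" by fact
  show "\<forall>\<^sub>F n in Fl. norm (nrm (F n) - nrm g) \<le> norm (nrm (\<lambda>x. F n x - g x))"
  proof (intro always_eventually allI)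
    fix n
    show "norm (nrm (F n) - nrm g) \<le> norm (nrm (\<lambda>x. F n x - g x))"
      using nrm_le_diff[OF assms(1,2), of n] nrm_le_diff[OF assms(2,1), of n] nrm_diff_commute[of g "F n"]
      by simp
  qed
qed

lemma inner_tendsto_left:
  assumes "\<And>n. F n \<in> Lp_space 2" "g \<in> Lp_space 2" "h \<in> Lp_space 2"
    "((\<lambda>n. nrm (\<lambda>x. F n x - g x)) \<longlongrightarrow> 0) Fl"
  shows "((\<lambda>n. inner_L2 (F n) h) \<longlongrightarrow> inner_L2 g h) Fl"
proof (rule LIM_zero_cancel, rule tendsto_norm_zero_cancel,
    rule tendsto_sandwich[OF always_eventually always_eventually tendsto_const])
  show "\<forall>n. norm (inner_L2 (F n) h - inner_L2 g h) \<le> nrm (\<lambda>x. F n x - g x) * nrm h"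
    using assms inner_CS[OF L2_diff] by (auto simp: inner_diff_left[symmetric])
  show "((\<lambda>n. nrm (\<lambda>x. F n x - g x) * nrm h) \<longlongrightarrow> 0) Fl" using assms(4)
    by (rule tendsto_mult_left_zero)
qed auto

text \<open>Closedness makes these subspaces saturated under a.e. equality (take a constant sequence).\<close>

definition closed_subspace :: "wavefun set \<Rightarrow> bool" where
  "closed_subspace D \<longleftrightarrow> D \<subseteq> Lp_space 2 \<and> (\<lambda>x. 0) \<in> D \<and>
    (\<forall>f\<in>D. \<forall>g\<in>D. \<forall>c. (\<lambda>x. c * f x + g x) \<in> D) \<and>
    (\<forall>F g. (\<forall>n::nat. F n \<in> D) \<and> g \<in> Lp_space 2 \<and> (\<lambda>n. nrm (\<lambda>x. F n x - g x)) \<longlonglongrightarrow> 0 \<longrightarrow> g \<in> D)"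

text \<open>A minimising sequence for the distance to f is Cauchy by the parallelogram law, its
  limit stays in D by closedness, and the first variation of the distance gives
  orthogonality.\<close>

lemma projection_exists:
  assumes D: "closed_subspace D" and f: "f \<in> Lp_space 2"
  shows "\<exists>m\<in>D. \<forall>y\<in>D. inner_L2 y (\<lambda>x. f x - m x) = 0"
proof -
  have DL: "\<And>y. y \<in> D \<Longrightarrow> y \<in> Lp_space 2" and D0: "(\<lambda>x. 0) \<in> D"
    and Dlin: "\<And>y z c. y \<in> D \<Longrightarrow> z \<in> D \<Longrightarrow> (\<lambda>x. c * y x + z x) \<in> D"
    and Dcl: "\<And>F g. (\<And>n::nat. F n \<in> D) \<Longrightarrow> g \<in> Lp_space 2
      \<Longrightarrow> (\<lambda>n. nrm (\<lambda>x. F n x - g x)) \<longlonglongrightarrow> 0 \<Longrightarrow> g \<in> D"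
    using D unfolding closed_subspace_def by blast+
  define S where "S = (\<lambda>m. (nrm (\<lambda>x. f x - m x))\<^sup>2) ` D"
  define d where "d = Inf S"
  have bdd: "bdd_below S" unfolding S_def by (auto intro!: bdd_belowI[of _ 0])
  have dle: "d \<le> (nrm (\<lambda>x. f x - m x))\<^sup>2" if "m \<in> D" for m
    unfolding d_def by (rule cInf_lower[OF _ bdd]) (use that in \<open>auto simp: S_def\<close>)
  have "\<exists>m\<in>D. (nrm (\<lambda>x. f x - m x))\<^sup>2 < d + 1 / Suc n" for n
  proof -
    have "\<exists>s\<in>S. s < d + 1 / Suc n"
      using cInf_less_iff[OF _ bdd, of "d + 1 / Suc n"] D0 by (auto simp: d_def S_def)
    then show ?thesis by (auto simp: S_def)
  qed
  then obtain m where mD: "\<And>n. m n \<in> D" and m: "\<And>n. (nrm (\<lambda>x. f x - m n x))\<^sup>2 < d + 1 / Suc n"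
    by metis
  note mL = DL[OF mD]
  \<comment> \<open>The midpoint of m n and m k competes for the minimum: its squared distance to f
    is at least d, which by the parallelogram law forces the two near-minimisers together.\<close>
  have par: "(nrm (\<lambda>x. m k x - m n x))\<^sup>2 \<le> 2 * (1 / Suc k) + 2 * (1 / Suc n)" for k n
  proof -
    let ?a = "\<lambda>x. f x - m n x" and ?b = "\<lambda>x. f x - m k x"
    have L: "?a \<in> Lp_space 2" "?b \<in> Lp_space 2" using f mL by (auto intro: L2_diff)
    have e1: "(nrm (\<lambda>x. m k x - m n x))\<^sup>2 = (nrm ?b)\<^sup>2 - 2 * Re (inner_L2 ?b ?a) + (nrm ?a)\<^sup>2"
      using nrm_lin_sq[OF L(2,1), of "-1"] by simp
    have e2: "(nrm (\<lambda>x. ?b x + ?a x))\<^sup>2 = (nrm ?b)\<^sup>2 + 2 * Re (inner_L2 ?b ?a) + (nrm ?a)\<^sup>2"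
      using nrm_lin_sq[OF L(2,1), of 1] by simp
    have "(\<lambda>x. 1/2 * m n x + 1/2 * m k x) \<in> D"
      using Dlin[OF mD Dlin[OF mD D0, of "1/2" k], of "1/2" n] by simp
    from dle[OF this] have "d \<le> (nrm (\<lambda>x. 1/2 * (?b x + ?a x)))\<^sup>2"
      by (simp add: algebra_simps)
    also have "\<dots> = (nrm (\<lambda>x. ?b x + ?a x))\<^sup>2 / 4"
      unfolding nrm_cmult by (simp add: power_mult_distrib power2_eq_square)
    finally show ?thesis using e1 e2 m[of k] m[of n] by linarith
  qed
  have "\<exists>N::nat. \<forall>k\<ge>N. \<forall>n\<ge>N. nrm (\<lambda>x. m k x - m n x) \<le> e" if e: "0 < e" for e
  proof -
    obtain N where N: "1 / real (Suc N) < e\<^sup>2 / 4"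
      using reals_Archimedean[of "e\<^sup>2/4"] e by (auto simp: inverse_eq_divide)
    show ?thesis
    proof (intro exI[of _ N] allI impI)
      fix k n assume kn: "N \<le> k" "N \<le> n"
      have "1 / real (Suc k) \<le> 1 / real (Suc N)" "1 / real (Suc n) \<le> 1 / real (Suc N)"
        using kn by (auto intro!: divide_left_mono)
      then have "(nrm (\<lambda>x. m k x - m n x))\<^sup>2 \<le> e\<^sup>2" using par[of k n] N by linarith
      then show "nrm (\<lambda>x. m k x - m n x) \<le> e" using e by (auto intro: power2_le_imp_le)
    qed
  qed
  from L2_complete[OF mL this] obtain M where LM: "M \<in> Lp_space 2"
    and lim: "(\<lambda>n. nrm (\<lambda>x. m n x - M x)) \<longlonglongrightarrow> 0" by blast
  have MD: "M \<in> D" by (rule Dcl[OF mD LM lim])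
  let ?e = "\<lambda>x. f x - M x"
  have eL: "?e \<in> Lp_space 2" using f LM by (rule L2_diff)
  have "(\<lambda>n. (nrm (\<lambda>x. f x - m n x))\<^sup>2) \<longlonglongrightarrow> (nrm ?e)\<^sup>2"
    using lim f mL LM
    by (intro tendsto_power nrm_tendsto L2_diff) (auto simp: nrm_diff_commute[of M])
  moreover have "(\<lambda>n. d + 1 / Suc n) \<longlonglongrightarrow> d + 0"
    by (intro tendsto_add tendsto_const LIMSEQ_Suc lim_1_over_n)
  ultimately have ed: "(nrm ?e)\<^sup>2 \<le> d"
    using m by (intro LIMSEQ_le) (auto intro: less_imp_le)
  show ?thesis
  proof (intro bexI[OF _ MD] ballI)
    fix y assume y: "y \<in> D"
    note yL = DL[OF y]
    define a where "a = inner_L2 y ?e"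
    have ineq: "0 \<le> (cmod c)\<^sup>2 * (nrm y)\<^sup>2 + 2 * Re (cnj c * a)" for c
    proof -
      have D': "(\<lambda>x. (-c) * y x + M x) \<in> D" using Dlin[OF y MD] .
      have eq: "(\<lambda>x. f x - ((-c) * y x + M x)) = (\<lambda>x. c * y x + ?e x)"
        by (simp add: algebra_simps)
      have "(nrm ?e)\<^sup>2 \<le> (nrm (\<lambda>x. c * y x + ?e x))\<^sup>2"
        using order_trans[OF ed dle[OF D', unfolded eq]] .
      then show ?thesis using nrm_lin_sq[OF yL eL, of c] by (simp add: a_def)
    qed
    \<comment> \<open>For c = -t a the quadratic inequality reads t |a|^2 (t |y|^2 - 2) >= 0. Any
      positive t with t |y|^2 < 1 forces a = 0; the added 1 covers |y| = 0.\<close>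
    define t where "t = 1 / ((nrm y)\<^sup>2 + 1)"
    have "0 < (nrm y)\<^sup>2 + 1" by (intro add_nonneg_pos) auto
    then have t: "0 < t" "t * (nrm y)\<^sup>2 < 1" by (auto simp: t_def divide_less_eq)
    have r: "Re (cnj (- of_real t * a) * a) = - (t * (cmod a)\<^sup>2)"
      unfolding cmod_power2 by (simp add: power2_eq_square algebra_simps)
    have "cmod (- of_real t * a) = t * cmod a" using t by (simp add: norm_mult)
    with ineq[of "- of_real t * a"] have "0 \<le> (t * cmod a)\<^sup>2 * (nrm y)\<^sup>2 - 2 * (t * (cmod a)\<^sup>2)"
      unfolding r by simp
    then have "0 \<le> (t * (cmod a)\<^sup>2) * (t * (nrm y)\<^sup>2 - 2)"
      by (simp add: power2_eq_square algebra_simps)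
    then have "t * (cmod a)\<^sup>2 \<le> 0"
      using t(2) by (simp add: zero_le_mult_iff)
    then have "a = 0" using t by (simp add: mult_le_0_iff)
    then show "inner_L2 y ?e = 0" by (simp add: a_def)
  qed
qed

text \<open>The pairing is bilinear, without conjugation, as suits transposes; the representing
  function is therefore a multiple of the conjugate of a vector orthogonal to the kernel.\<close>

lemma Riesz_representation:
  assumes lin: "\<And>f g c. f \<in> Lp_space 2 \<Longrightarrow> g \<in> Lp_space 2
    \<Longrightarrow> l (\<lambda>x. c * f x + g x) = c * l f + l g"
    and bd: "\<And>f. f \<in> Lp_space 2 \<Longrightarrow> cmod (l f) \<le> K * nrm f"
  shows "\<exists>g\<in>Lp_space 2. \<forall>f\<in>Lp_space 2. l f = (LINT x|lborel. g x * f x)"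
proof -
  define D where "D = {f \<in> Lp_space 2. l f = 0}"
  have l0: "l (\<lambda>x. 0) = 0" using bd[of "\<lambda>x. 0"] by (simp add: nrm_def)
  have ldiff: "l (\<lambda>x. f x - g x) = l f - l g" if "f \<in> Lp_space 2" "g \<in> Lp_space 2" for f g
    using lin[OF that(2,1), of "-1"] by simp
  have D: "closed_subspace D"
    unfolding closed_subspace_def
  proof (intro conjI allI impI ballI)
    fix F g assume *: "(\<forall>n::nat. F n \<in> D) \<and> g \<in> Lp_space 2 \<and> (\<lambda>n. nrm (\<lambda>x. F n x - g x)) \<longlonglongrightarrow> 0"
    have "cmod (l g) \<le> K * nrm (\<lambda>x. F n x - g x)" for n
      using bd[OF L2_diff, of "F n" g] ldiff[of "F n" g] * by (simp add: D_def)
    moreover have "(\<lambda>n. K * nrm (\<lambda>x. F n x - g x)) \<longlonglongrightarrow> 0" using *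
      by (intro tendsto_mult_right_zero) auto
    ultimately have "cmod (l g) \<le> 0" by (intro LIMSEQ_le_const) auto
    then show "g \<in> D" using * by (simp add: D_def)
  qed (auto simp: D_def l0 lin L2_lin)
  show ?thesis
  proof (cases "\<exists>f\<in>Lp_space 2. l f \<noteq> 0")
    case True
    then obtain f where f: "f \<in> Lp_space 2" "l f \<noteq> 0" by blast
    obtain m where m: "m \<in> D" "\<And>y. y \<in> D \<Longrightarrow> inner_L2 y (\<lambda>x. f x - m x) = 0"
      using projection_exists[OF D f(1)] by blast
    define e where "e x = f x - m x" for x
    have eL: "e \<in> Lp_space 2" unfolding e_def using f m by (auto simp: D_def intro: L2_diff)
    have le: "l e \<noteq> 0" unfolding e_def using f m by (simp add: D_def ldiff)
    have ne: "nrm e \<noteq> 0" using bd[OF eL] le by auto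
    define c where "c = l e / of_real ((nrm e)\<^sup>2)"
    show ?thesis
    proof (intro bexI ballI)
      show "(\<lambda>x. c * cnj (e x)) \<in> Lp_space 2" by (intro L2_cmult L2_cnj eL)
    next
      fix h assume h: "h \<in> Lp_space 2"
      \<comment> \<open>The multiple of e is chosen to put y into the kernel; orthogonality of y and
        e then determines l h.\<close>
      define y where "y x = (- l h / l e) * e x + h x" for x
      have yL: "y \<in> Lp_space 2" unfolding y_def by (intro L2_lin eL h)
      have "l y = 0" unfolding y_def using lin[OF eL h, of "- l h / l e"] le by simp
      then have "inner_L2 y e = 0" using yL m(2)[of y] by (simp add: D_def e_def[abs_def])
      then have "inner_L2 e y = 0" by (subst inner_cnj) simp
      then have "(- l h / l e) * of_real ((nrm e)\<^sup>2) + inner_L2 e h = 0"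
        unfolding y_def using inner_lin_right[OF eL h eL, of "- l h / l e"] by (simp add: inner_self)
      then have "l h = c * inner_L2 e h" using le ne by (simp add: c_def field_simps)
      then show "l h = (LINT x|lborel. c * cnj (e x) * h x)"
        by (simp add: inner_L2_def mult.assoc)
    qed
  next
    case False
    then show ?thesis by (intro bexI[of _ "\<lambda>x. 0"]) auto
  qed
qed

text \<open>Polarisation: expanding the norm of c f + g for c = 1 and c = i gives the real and the
  imaginary part of the inner product.\<close>

lemma inner_preserved:
  assumes TL: "\<And>f. f \<in> Lp_space 2 \<Longrightarrow> T f \<in> Lp_space 2"
    and lin: "\<And>f g c. f \<in> Lp_space 2 \<Longrightarrow> g \<in> Lp_space 2
      \<Longrightarrow> ae_equal (T (\<lambda>x. c * f x + g x)) (\<lambda>x. c * T f x + T g x)"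
    and iso: "\<And>f. f \<in> Lp_space 2 \<Longrightarrow> nrm (T f) = nrm f"
    and f: "f \<in> Lp_space 2" and g: "g \<in> Lp_space 2"
  shows "inner_L2 (T f) (T g) = inner_L2 f g"
proof -
  have eq: "Re (cnj c * inner_L2 (T f) (T g)) = Re (cnj c * inner_L2 f g)" for c
  proof -
    have "nrm (\<lambda>x. c * T f x + T g x) = nrm (T (\<lambda>x. c * f x + g x))"
      by (rule L2_cong_AE(2)[OF TL[OF L2_lin[OF f g]]])
         (use lin[OF f g, of c] in \<open>auto intro!: Lp_space_measurable[OF L2_lin] TL f g elim!: eventually_mono\<close>)
    also have "\<dots> = nrm (\<lambda>x. c * f x + g x)" by (intro iso L2_lin f g)
    finally show ?thesis
      using nrm_lin_sq[OF f g, of c] nrm_lin_sq[OF TL[OF f] TL[OF g], of c] by (simp add: iso f g)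
  qed
  show ?thesis using eq[of 1] eq[of \<i>] by (intro complex_eqI) auto
qed

section \<open>Gaussians and the Fourier transform\<close>

text \<open>The factor c = 1 gives translations and c = -1 the reflection, the two substitutions
  used throughout.\<close>

lemma distr_lborel_unit_affine:
  assumes "\<bar>c\<bar> = 1"
  shows "distr lborel borel (\<lambda>x::real^3. t + c *\<^sub>R x) = lborel"
proof -
  have "c \<noteq> 0" using assms by auto
  from lborel_affine[OF this, of t] assms
  have "lborel = density (distr lborel borel (\<lambda>x::real^3. t + c *\<^sub>R x)) (\<lambda>_. 1)" by simp
  then show ?thesis by (simp add: density_1)
qed

lemma integral_unit_affine:
  fixes f :: "real^3 \<Rightarrow> 'a::{banach, second_countable_topology}"
  assumes "\<bar>c\<bar> = 1" and [measurable]: "f \<in> borel_measurable borel"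
  shows "(LINT x|lborel. f (t + c *\<^sub>R x)) = (LINT x|lborel. f x)"
  by (subst (2) distr_lborel_unit_affine[OF assms(1), of t, symmetric])
     (simp add: integral_distr)

lemma integrable_unit_affine:
  fixes f :: "real^3 \<Rightarrow> 'a::{banach, second_countable_topology}"
  assumes "\<bar>c\<bar> = 1" and [measurable]: "f \<in> borel_measurable borel"
  shows "integrable lborel (\<lambda>x. f (t + c *\<^sub>R x)) \<longleftrightarrow> integrable lborel f"
  by (subst (2) distr_lborel_unit_affine[OF assms(1), of t, symmetric])
     (simp add: integrable_distr_eq)

lemma nn_integral_unit_affine:
  fixes f :: "real^3 \<Rightarrow> ennreal"
  assumes "\<bar>c\<bar> = 1" and [measurable]: "f \<in> borel_measurable borel"
  shows "(\<integral>\<^sup>+x. f (t + c *\<^sub>R x) \<partial>lborel) = (\<integral>\<^sup>+x. f x \<partial>lborel)"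
  by (subst (2) distr_lborel_unit_affine[OF assms(1), of t, symmetric])
     (simp add: nn_integral_distr)

lemma AE_unit_affine:
  assumes "\<bar>c\<bar> = 1" and [measurable]: "Measurable.pred borel P"
  shows "(AE x::real^3 in lborel. P (t + c *\<^sub>R x)) \<longleftrightarrow> (AE x in lborel. P x)"
  by (subst (2) distr_lborel_unit_affine[OF assms(1), of t, symmetric])
     (simp add: AE_distr_iff)

lemma integral_shift:
  fixes f :: "real^3 \<Rightarrow> 'a::{banach, second_countable_topology}"
  assumes "f \<in> borel_measurable borel"
  shows "(LINT x|lborel. f (t + x)) = (LINT x|lborel. f x)"
  using integral_unit_affine[of 1 f t] assms by simp

lemma integrable_shift:
  fixes f :: "real^3 \<Rightarrow> 'a::{banach, second_countable_topology}"
  assumes "f \<in> borel_measurable borel"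
  shows "integrable lborel (\<lambda>x. f (t + x)) \<longleftrightarrow> integrable lborel f"
  using integrable_unit_affine[of 1 f t] assms by simp

lemma integral_reflect:
  fixes f :: "real^3 \<Rightarrow> 'a::{banach, second_countable_topology}"
  assumes "f \<in> borel_measurable borel"
  shows "(LINT x|lborel. f (- x)) = (LINT x|lborel. f x)"
  using integral_unit_affine[of "-1" f 0] assms by simp

lemma integrable_reflect:
  fixes f :: "real^3 \<Rightarrow> 'a::{banach, second_countable_topology}"
  assumes "f \<in> borel_measurable borel"
  shows "integrable lborel (\<lambda>x. f (- x)) \<longleftrightarrow> integrable lborel f"
  using integrable_unit_affine[of "-1" f 0] assms by simp

text \<open>Fubini for functions that factor over the coordinates; Gaussians and the integrable
  majorant \<open>decay\<close> reduce to one dimension through it.\<close>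

lemma lborel_prod_Basis:
  fixes f :: "real^3 \<Rightarrow> real \<Rightarrow> complex"
  assumes f: "\<And>b. b \<in> Basis \<Longrightarrow> integrable lborel (f b)"
  shows "integrable lborel (\<lambda>x::real^3. \<Prod>b\<in>Basis. f b (x \<bullet> b))"
    and "(LINT x|lborel. (\<Prod>b\<in>Basis. f b (x \<bullet> b))) = (\<Prod>b\<in>Basis. (LINT y|lborel. f b y))"
proof -
  interpret product_sigma_finite "\<lambda>_::real^3. lborel :: real measure" by standard
  have [measurable]: "\<And>b. b \<in> Basis \<Longrightarrow> f b \<in> borel_measurable borel"
    using f by (auto dest: borel_measurable_integrable)
  have m: "(\<lambda>f. \<Sum>b\<in>Basis. f b *\<^sub>R b) \<in> measurable (\<Pi>\<^sub>M b\<in>Basis. lborel) (borel :: (real^3) measure)"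
    by measurable
  have m2: "(\<lambda>x::real^3. \<Prod>b\<in>Basis. f b (x \<bullet> b)) \<in> borel_measurable borel"
    by measurable
  have e: "(\<Prod>b\<in>Basis. f b ((\<Sum>b\<in>Basis. x b *\<^sub>R b) \<bullet> b)) = (\<Prod>b\<in>Basis. f b (x b))"
    for x :: "real^3 \<Rightarrow> real"
    by (intro prod.cong refl) (simp add: inner_sum_left inner_Basis if_distrib sum.delta cong: if_cong)
  show "integrable lborel (\<lambda>x::real^3. \<Prod>b\<in>Basis. f b (x \<bullet> b))"
    by (subst lborel_eq) (simp add: integrable_distr_eq[OF m m2] e product_integrable_prod f)
  show "(LINT x|lborel. (\<Prod>b\<in>Basis. f b (x \<bullet> b))) = (\<Prod>b\<in>Basis. (LINT y|lborel. f b y))"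
    by (subst lborel_eq) (simp add: integral_distr[OF m m2] e product_integral_prod f)
qed

text \<open>The characteristic function of the standard normal distribution, rescaled by c = 1 /
  sqrt (2 a).\<close>

lemma gaussian_1D:
  assumes a: "0 < a"
  shows "integrable lborel (\<lambda>x. exp (\<i> * of_real (\<xi> * x)) * of_real (exp (- a * x\<^sup>2)))"
    and "(LINT x|lborel. exp (\<i> * of_real (\<xi> * x)) * of_real (exp (- a * x\<^sup>2)))
      = of_real (sqrt (pi / a) * exp (- \<xi>\<^sup>2 / (4 * a)))"
proof -
  define c where "c = 1 / sqrt (2 * a)"
  have c: "c > 0" "c\<^sup>2 = 1 / (2 * a)" using a by (auto simp: c_def power_divide)
  have std: "(LINT x|lborel. exp (\<i> * of_real (t * x)) * of_real (exp (- x\<^sup>2 / 2)))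
      = of_real (sqrt (2 * pi) * exp (- t\<^sup>2 / 2))" for t
  proof -
    have "complex_of_real (exp (- (t\<^sup>2) / 2)) = char std_normal_distribution t"
      by (simp add: char_std_normal_distribution)
    also have "\<dots> = (LINT x|lborel. std_normal_density x *\<^sub>R exp (\<i> * of_real (t * x)))"
      unfolding char_def by (subst integral_density) (auto simp: normal_density_nonneg)
    also have "\<dots> = (LINT x|lborel. of_real (1 / sqrt (2 * pi)) * (exp (\<i> * of_real (t * x)) * of_real (exp (- x\<^sup>2 / 2))))"
      by (intro Bochner_Integration.integral_cong) (auto simp: std_normal_density_def scaleR_conv_of_real)
    also have "\<dots> = of_real (1 / sqrt (2 * pi)) * (LINT x|lborel. exp (\<i> * of_real (t * x)) * of_real (exp (- x\<^sup>2 / 2)))"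
      by (rule integral_mult_right_zero)
    finally show ?thesis by (simp add: field_simps)
  qed
  have eq: "exp (\<i> * of_real (\<xi> * (0 + c * x))) * of_real (exp (- a * (0 + c * x)\<^sup>2))
      = exp (\<i> * of_real ((\<xi> * c) * x)) * complex_of_real (exp (- x\<^sup>2 / 2))" for x
    using a by (simp add: power_mult_distrib c(2) mult.assoc)
  have "(LINT x|lborel. exp (\<i> * of_real (\<xi> * x)) * of_real (exp (- a * x\<^sup>2)))
      = \<bar>c\<bar> *\<^sub>R (LINT x|lborel. exp (\<i> * of_real (\<xi> * (0 + c * x))) * of_real (exp (- a * (0 + c * x)\<^sup>2)))"
    by (rule lborel_integral_real_affine) (use c in auto)
  also have "\<dots> = of_real (c * (sqrt (2 * pi) * exp (- (\<xi> * c)\<^sup>2 / 2)))"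
    unfolding eq std using c by (simp add: scaleR_conv_of_real)
  also have "c * (sqrt (2 * pi) * exp (- (\<xi> * c)\<^sup>2 / 2)) = sqrt (pi / a) * exp (- \<xi>\<^sup>2 / (4 * a))"
    using a by (simp add: power_mult_distrib c(2)) (simp add: c_def real_sqrt_mult real_sqrt_divide field_simps)
  finally show "(LINT x|lborel. exp (\<i> * of_real (\<xi> * x)) * of_real (exp (- a * x\<^sup>2)))
      = of_real (sqrt (pi / a) * exp (- \<xi>\<^sup>2 / (4 * a)))" .
  have "integrable lborel (\<lambda>x. exp (- x\<^sup>2 / 2) / sqrt (2 * pi))"
    using integrable_normal_density[of 1 0] by (simp add: std_normal_density_def[abs_def] normal_density_def)
  then have "integrable lborel (\<lambda>x::real. sqrt (2 * pi) * (exp (- x\<^sup>2 / 2) / sqrt (2 * pi)))"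
    by (rule integrable_mult_right)
  then have "integrable lborel (\<lambda>x::real. exp (- x\<^sup>2 / 2))" by simp
  then have i: "integrable lborel (\<lambda>x::real. exp (- (0 + (1/c) * x)\<^sup>2 / 2))"
    using c by (intro lborel_integrable_real_affine) auto
  show "integrable lborel (\<lambda>x. exp (\<i> * of_real (\<xi> * x)) * of_real (exp (- a * x\<^sup>2)))"
    by (rule Bochner_Integration.integrable_bound[OF i])
       (use a in \<open>auto simp: norm_mult power_divide c(2)\<close>)
qed

lemma norm_sq_Basis: "(norm (x::real^3))\<^sup>2 = (\<Sum>b\<in>Basis. (x \<bullet> b)\<^sup>2)"
  by (metis (no_types, lifting) dot_square_norm euclidean_inner power2_eq_square sum.cong)

lemma gaussian_3D:
  assumes a: "0 < a"
  shows "integrable lborel (\<lambda>x::real^3. exp (\<i> * of_real (\<xi> \<bullet> x)) * of_real (exp (- a * (norm x)\<^sup>2)))"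
    and "(LINT x::real^3|lborel. exp (\<i> * of_real (\<xi> \<bullet> x)) * of_real (exp (- a * (norm x)\<^sup>2)))
      = of_real ((pi / a) powr (3/2) * exp (- (norm \<xi>)\<^sup>2 / (4 * a)))"
proof -
  define f where "f b y = exp (\<i> * of_real ((\<xi> \<bullet> b) * y)) * complex_of_real (exp (- a * y\<^sup>2))"
    for b :: "real^3" and y
  have f: "integrable lborel (f b)"
    "(LINT y|lborel. f b y) = of_real (sqrt (pi / a) * exp (- (\<xi> \<bullet> b)\<^sup>2 / (4 * a)))" for b
    unfolding f_def[abs_def] using gaussian_1D[OF a, of "\<xi> \<bullet> b"] by auto
  have e: "exp (\<i> * of_real (\<xi> \<bullet> x)) * of_real (exp (- a * (norm x)\<^sup>2))
    = (\<Prod>b\<in>Basis. f b (x \<bullet> b))" for x :: "real^3"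
    unfolding f_def prod.distrib norm_sq_Basis euclidean_inner[of \<xi> x]
    by (simp add: exp_sum sum_distrib_left sum_negf[symmetric] flip: of_real_prod)
  show "integrable lborel (\<lambda>x::real^3. exp (\<i> * of_real (\<xi> \<bullet> x)) * of_real (exp (- a * (norm x)\<^sup>2)))"
    unfolding e by (rule lborel_prod_Basis) (rule f)
  have "(LINT x::real^3|lborel. exp (\<i> * of_real (\<xi> \<bullet> x)) * of_real (exp (- a * (norm x)\<^sup>2)))
      = (\<Prod>b\<in>Basis. of_real (sqrt (pi / a) * exp (- (\<xi> \<bullet> b)\<^sup>2 / (4 * a))))"
    unfolding e by (subst lborel_prod_Basis) (auto simp: f)
  also have "\<dots> = of_real (sqrt (pi / a) ^ 3 * (\<Prod>b\<in>Basis. exp (- (\<xi> \<bullet> b)\<^sup>2 / (4 * a))))"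
    by (simp add: prod.distrib flip: of_real_prod)
  also have "sqrt (pi / a) ^ 3 = (pi / a) powr (3/2)"
    using a by (simp add: powr_half_sqrt[symmetric] powr_powr flip: powr_realpow)
  also have "(\<Prod>b\<in>Basis. exp (- (\<xi> \<bullet> b)\<^sup>2 / (4 * a))) = exp (- (norm \<xi>)\<^sup>2 / (4 * a))"
    unfolding norm_sq_Basis by (simp add: exp_sum sum_divide_distrib sum_negf[symmetric])
  finally show "(LINT x::real^3|lborel. exp (\<i> * of_real (\<xi> \<bullet> x)) * of_real (exp (- a * (norm x)\<^sup>2)))
      = of_real ((pi / a) powr (3/2) * exp (- (norm \<xi>)\<^sup>2 / (4 * a)))" .
qed

lemma integrable_gaussian: "0 < a \<Longrightarrow> integrable lborel (\<lambda>x::real^3. exp (- a * (norm x)\<^sup>2))"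
  using integrable_norm[OF gaussian_3D(1)[of a 0]] by (simp add: norm_mult)

lemma integral_gaussian:
  assumes "0 < a" shows "(LINT x::real^3|lborel. exp (- a * (norm x)\<^sup>2)) = (pi / a) powr (3/2)"
proof -
  have "complex_of_real (LINT x::real^3|lborel. exp (- a * (norm x)\<^sup>2)) = of_real ((pi / a) powr (3/2))"
    using gaussian_3D(2)[OF assms, of 0] by (simp add: integral_complex_of_real)
  then show ?thesis by (simp only: of_real_eq_iff)
qed

text \<open>The heat kernel at time 1 / (4 (n + 1)), of total mass 1. Counting from n + 1 makes
  \<open>gk 0\<close> a multiple of exp(-|y|^2), the weight in the hypothesis of
  \<open>approximate_identity\<close>.\<close>

definition gk :: "nat \<Rightarrow> real^3 \<Rightarrow> real" where
  "gk n y = ((n + 1) / pi) powr (3/2) * exp (- (n + 1) * (norm y)\<^sup>2)"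

lemma gk_measurable[measurable]: "gk n \<in> borel_measurable borel"
  unfolding gk_def[abs_def] by measurable

lemma gk_nonneg: "0 \<le> gk n y" by (simp add: gk_def)

lemma gk_minus: "gk n (x - y) = gk n (y - x)" by (simp add: gk_def norm_minus_commute)

lemma gk_integrable: "integrable lborel (\<lambda>x. gk n (x - y))"
proof -
  have "integrable lborel (gk n)"
    unfolding gk_def[abs_def] using integrable_gaussian[of "real n + 1"] by (simp add: algebra_simps)
  then show ?thesis using integrable_shift[of "gk n" "-y"] by simp
qed

lemma gk_integral: "(LINT x|lborel. gk n (x - y)) = 1"
proof -
  have "(LINT x|lborel. gk n (x - y)) = (LINT x|lborel. gk n x)"
    using integral_shift[of "gk n" "-y"] by simp
  also have "\<dots> = ((n + 1) / pi) powr (3/2) * (pi / (n + 1)) powr (3/2)"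
    unfolding gk_def[abs_def] using integral_gaussian[of "real n + 1"] by (simp add: algebra_simps)
  also have "\<dots> = 1" by (simp add: powr_mult[symmetric])
  finally show ?thesis .
qed

text \<open>Away from x0 the kernel is at most c n times the fixed weight exp(-|x - x0|^2) with c n
  -> 0, so integrability against this weight is enough. This admits V_1, whose boundedness becomes
  known only after it has been recovered from its transform.\<close>

lemma approximate_identity:
  fixes \<phi> :: wavefun
  assumes [measurable]: "\<phi> \<in> borel_measurable borel"
    and i: "integrable lborel (\<lambda>x. \<phi> x * of_real (exp (- (norm (x - x0))\<^sup>2)))"
    and cont: "isCont \<phi> x0"
  shows "(\<lambda>n. LINT x|lborel. \<phi> x * of_real (gk n (x - x0))) \<longlonglongrightarrow> \<phi> x0"
proof (rule LIMSEQ_I)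
  fix \<eta> :: real assume \<eta>: "0 < \<eta>"
  have gx: "integrable lborel (\<lambda>x. exp (- (norm (x - x0))\<^sup>2))"
    using integrable_shift[of "\<lambda>x. exp (- (norm x)\<^sup>2)" "-x0"] integrable_gaussian[of 1] by simp
  define \<psi> where "\<psi> x = \<phi> x - \<phi> x0" for x
  have [measurable]: "\<psi> \<in> borel_measurable borel" unfolding \<psi>_def by measurable
  have i\<psi>: "integrable lborel (\<lambda>x. \<psi> x * of_real (exp (- (norm (x - x0))\<^sup>2)))"
    unfolding \<psi>_def left_diff_distrib using i gx by (intro Bochner_Integration.integrable_diff) auto
  define J where "J = (LINT x|lborel. cmod (\<psi> x) * exp (- (norm (x - x0))\<^sup>2))"
  have iJ: "integrable lborel (\<lambda>x. cmod (\<psi> x) * exp (- (norm (x - x0))\<^sup>2))"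
    using integrable_norm[OF i\<psi>] by (simp add: norm_mult)
  obtain \<delta> where \<delta>: "0 < \<delta>"
    "\<And>x. norm (x - x0) < \<delta> \<Longrightarrow> cmod (\<psi> x) < \<eta> / 2"
    using cont \<eta> unfolding isCont_def LIM_def \<psi>_def dist_norm
    by (metis diff_self half_gt_zero norm_zero)
  \<comment> \<open>exp(-n delta^2) bounds what exp(-(n+1) |x - x0|^2) contains beyond the weight
    once |x - x0| >= delta.\<close>
  define c where "c n = ((real n + 1) / pi) powr (3/2) * exp (- (real n * \<delta>\<^sup>2))" for n :: nat
  have "c \<longlonglongrightarrow> 0" unfolding c_def using \<delta>(1) by real_asymp
  then have "(\<lambda>n. c n * J) \<longlonglongrightarrow> 0" by (rule tendsto_mult_left_zero)
  from LIMSEQ_D[OF this, of "\<eta>/2"] \<eta> obtain N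
    where N: "\<And>n. n \<ge> N \<Longrightarrow> \<bar>c n * J\<bar> < \<eta> / 2" by auto
  have pw: "cmod (\<psi> x) * gk n (x - x0) \<le> \<eta> / 2 * gk n (x - x0)
    + c n * (cmod (\<psi> x) * exp (- (norm (x - x0))\<^sup>2))" for n x
  proof (cases "norm (x - x0) < \<delta>")
    case True
    have "cmod (\<psi> x) * gk n (x - x0) \<le> \<eta> / 2 * gk n (x - x0)"
      by (rule mult_right_mono) (use \<delta>(2)[OF True] gk_nonneg in auto)
    moreover have "0 \<le> c n * (cmod (\<psi> x) * exp (- (norm (x - x0))\<^sup>2))" by (simp add: c_def)
    ultimately show ?thesis by simp
  next
    case False
    then have "\<delta>\<^sup>2 \<le> (norm (x - x0))\<^sup>2" using \<delta>(1) by (intro power_mono) auto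
    then have "real n * \<delta>\<^sup>2 \<le> real n * (norm (x - x0))\<^sup>2" by (rule mult_left_mono) simp
    then have "gk n (x - x0) \<le> c n * exp (- (norm (x - x0))\<^sup>2)"
      unfolding gk_def c_def by (auto simp: algebra_simps simp flip: exp_add intro!: mult_left_mono)
    then have "cmod (\<psi> x) * gk n (x - x0) \<le> cmod (\<psi> x) * (c n * exp (- (norm (x - x0))\<^sup>2))"
      by (rule mult_left_mono) simp
    then show ?thesis using \<eta> gk_nonneg[of n "x - x0"]
      by (simp add: algebra_simps add_increasing)
  qed
  have ib: "integrable lborel (\<lambda>x. \<eta> / 2 * gk n (x - x0)
    + c n * (cmod (\<psi> x) * exp (- (norm (x - x0))\<^sup>2)))" for n
    by (intro Bochner_Integration.integrable_add integrable_mult_right gk_integrable iJ)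
  have i1: "integrable lborel (\<lambda>x. \<psi> x * of_real (gk n (x - x0)))" for n
    by (rule Bochner_Integration.integrable_bound[OF ib[of n]])
       (use pw gk_nonneg in \<open>auto simp: norm_mult intro: order_trans[OF _ abs_ge_self]\<close>)
  show "\<exists>N. \<forall>n\<ge>N. norm ((LINT x|lborel. \<phi> x * of_real (gk n (x - x0))) - \<phi> x0) < \<eta>"
  proof (intro exI[of _ N] allI impI)
    fix n assume n: "N \<le> n"
    have ig: "integrable lborel (\<lambda>x. \<phi> x0 * complex_of_real (gk n (x - x0)))"
      using gk_integrable by simp
    have "(LINT x|lborel. \<phi> x * of_real (gk n (x - x0)))
       = (LINT x|lborel. \<psi> x * of_real (gk n (x - x0)) + \<phi> x0 * of_real (gk n (x - x0)))"
      by (simp add: \<psi>_def algebra_simps)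
    also have "\<dots> = (LINT x|lborel. \<psi> x * of_real (gk n (x - x0))) + \<phi> x0"
      using i1[of n] ig by (simp add: integral_complex_of_real gk_integral)
    finally have "norm ((LINT x|lborel. \<phi> x * of_real (gk n (x - x0))) - \<phi> x0)
        = cmod (LINT x|lborel. \<psi> x * of_real (gk n (x - x0)))" by simp
    also have "\<dots> \<le> (LINT x|lborel. \<eta> / 2 * gk n (x - x0)
      + c n * (cmod (\<psi> x) * exp (- (norm (x - x0))\<^sup>2)))"
      by (rule norm_integral_le[OF i1 ib]) (use pw gk_nonneg in \<open>auto simp: norm_mult\<close>)
    also have "\<dots> = \<eta> / 2 + c n * J"
      using gk_integrable[of n x0] iJ by (simp add: gk_integral J_def)
    also have "\<dots> < \<eta>" using N[OF n] by linarith
    finally show "norm ((LINT x|lborel. \<phi> x * of_real (gk n (x - x0))) - \<phi> x0) < \<eta>" .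
  qed
qed

section \<open>The Fourier transform: inversion and Plancherel's theorem\<close>

lemma phase_measurable[measurable]: "(\<lambda>x. exp (\<i> * of_real (\<xi> \<bullet> x))) \<in> borel_measurable borel"
  "(\<lambda>x. exp (- \<i> * of_real (\<xi> \<bullet> x))) \<in> borel_measurable borel"
  by (intro borel_measurable_continuous_onI continuous_intros)+

lemma norm_phase[simp]: "cmod (exp (\<i> * of_real y)) = 1" "cmod (exp (- (\<i> * of_real y))) = 1"
  by (simp_all add: norm_exp_eq_Re)

lemma integrable_phase:
  assumes "integrable lborel f"
  shows "integrable lborel (\<lambda>x. exp (\<i> * of_real (\<xi> \<bullet> x)) * f x)"
    "integrable lborel (\<lambda>x. exp (- (\<i> * of_real (\<xi> \<bullet> x))) * f x)"
  using assms phase_measurable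
  by (auto intro!: Bochner_Integration.integrable_bound[OF assms] simp: norm_mult)

lemma fourier_phase_measurable:
  assumes [measurable]: "f \<in> borel_measurable borel"
  shows "fourier f \<in> borel_measurable borel" "inv_fourier f \<in> borel_measurable borel"
proof -
  have [measurable]: "(\<lambda>(\<xi>, x). exp (- \<i> * of_real (\<xi> \<bullet> (x::real^3)))) \<in> borel_measurable (borel \<Otimes>\<^sub>M borel)"
    "(\<lambda>(\<xi>, x). exp (\<i> * of_real (\<xi> \<bullet> (x::real^3)))) \<in> borel_measurable (borel \<Otimes>\<^sub>M borel)"
    by measurable
  show "fourier f \<in> borel_measurable borel" "inv_fourier f \<in> borel_measurable borel"
    unfolding fourier_def[abs_def] inv_fourier_def[abs_def] by measurable
qed

lemma inv_fourier_eq: 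
  assumes [measurable]: "f \<in> borel_measurable borel"
  shows "inv_fourier f x = fourier f (- x)"
  by (simp add: inv_fourier_def fourier_def inner_commute)

lemma fourier_bound: "cmod (fourier f \<xi>) \<le> (2 * pi) powr (- 3 / 2) * (LINT x|lborel. cmod (f x))"
  using integral_norm_bound[of lborel "\<lambda>x. exp (- \<i> * of_real (\<xi> \<bullet> x)) * f x"]
  by (auto simp: fourier_def norm_mult intro!: mult_left_mono)

lemma fourier_continuous:
  assumes f: "integrable lborel f"
  shows "continuous_on UNIV (fourier f)"
proof -
  have [measurable]: "f \<in> borel_measurable borel" using f by (auto dest: borel_measurable_integrable)
  have "continuous_on UNIV (\<lambda>\<xi>. LINT x|lborel. exp (- \<i> * of_real (\<xi> \<bullet> x)) * f x)"
    unfolding continuous_on_sequentially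
  proof (intro allI ballI impI, unfold comp_def)
    fix u :: "nat \<Rightarrow> real^3" and a assume "(\<forall>n. u n \<in> UNIV) \<and> u \<longlonglongrightarrow> a"
    then have u: "u \<longlonglongrightarrow> a" by simp
    show "(\<lambda>n. LINT x|lborel. exp (- \<i> * of_real (u n \<bullet> x)) * f x)
      \<longlonglongrightarrow> (LINT x|lborel. exp (- \<i> * of_real (a \<bullet> x)) * f x)"
    proof (rule integral_dominated_convergence[where w="\<lambda>x. cmod (f x)"])
      show "integrable lborel (\<lambda>x. cmod (f x))" using f by simp
      show "AE x in lborel. (\<lambda>n. exp (- \<i> * of_real (u n \<bullet> x)) * f x)
        \<longlonglongrightarrow> exp (- \<i> * of_real (a \<bullet> x)) * f x"
        by (intro AE_I2 tendsto_intros u)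
      show "AE x in lborel. cmod (exp (- \<i> * of_real (u n \<bullet> x)) * f x) \<le> cmod (f x)" for n
        by (simp add: norm_mult)
    qed measurable
  qed
  then show ?thesis unfolding fourier_def[abs_def] by (intro continuous_on_scaleR continuous_on_const)
qed

text \<open>Fubini for the kernel exp(-i xi.x) f(x) g(xi). Inversion and Plancherel are both read
  off from it by taking g with a Gaussian factor.\<close>

lemma fourier_multiplication:
  assumes f: "integrable lborel f" and g: "integrable lborel g"
  shows "(LINT \<xi>|lborel. fourier f \<xi> * g \<xi>) = (LINT x|lborel. f x * fourier g x)"
proof -
  have [measurable]: "f \<in> borel_measurable borel" "g \<in> borel_measurable borel"
    using f g by (auto dest: borel_measurable_integrable)
  define F where "F x \<xi> = exp (- \<i> * of_real (\<xi> \<bullet> x)) * f x * g \<xi>" for x \<xi> :: "real^3"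
  have int: "integrable (lborel \<Otimes>\<^sub>M lborel) (case_prod F)"
  proof (rule lborel_pair.Fubini_integrable)
    show "case_prod F \<in> borel_measurable (lborel \<Otimes>\<^sub>M lborel)" unfolding F_def by measurable
    have "integrable lborel (\<lambda>x. cmod (f x) * (LINT \<xi>|lborel. cmod (g \<xi>)))" using f by simp
    then show "integrable lborel (\<lambda>x. (LINT \<xi>|lborel. norm (case_prod F (x, \<xi>))))"
      by (simp add: F_def norm_mult)
    have "integrable lborel (\<lambda>\<xi>. f x * (exp (- (\<i> * of_real (x \<bullet> \<xi>))) * g \<xi>))" for x
      using integrable_phase(2)[OF g] by simp
    then show "AE x in lborel. integrable lborel (\<lambda>y. case_prod F (x, y))"
      by (simp add: F_def mult_ac inner_commute)
  qed
  have "(LINT \<xi>|lborel. fourier f \<xi> * g \<xi>)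
    = (2 * pi) powr (- 3 / 2) *\<^sub>R (LINT \<xi>|lborel. (LINT x|lborel. F x \<xi>))"
  proof -
    have "fourier f \<xi> * g \<xi> = (2 * pi) powr (- 3 / 2) *\<^sub>R (LINT x|lborel. F x \<xi>)" for \<xi>
      unfolding F_def fourier_def integral_mult_left_zero by simp
    then show "(LINT \<xi>|lborel. fourier f \<xi> * g \<xi>)
        = (2 * pi) powr (- 3 / 2) *\<^sub>R (LINT \<xi>|lborel. (LINT x|lborel. F x \<xi>))"
      by (simp only: integral_scaleR_right)
  qed
  also have "(LINT \<xi>|lborel. (LINT x|lborel. F x \<xi>)) = (LINT x|lborel. (LINT \<xi>|lborel. F x \<xi>))"
    by (rule lborel_pair.Fubini_integral[OF int])
  also have "(2 * pi) powr (- 3 / 2) *\<^sub>R \<dots> = (LINT x|lborel. f x * fourier g x)"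
  proof -
    have "f x * fourier g x = (2 * pi) powr (- 3 / 2) *\<^sub>R (LINT \<xi>|lborel. F x \<xi>)" for x
    proof -
    have "(LINT \<xi>|lborel. F x \<xi>) = (LINT \<xi>|lborel. f x * (exp (- \<i> * of_real (x \<bullet> \<xi>)) * g \<xi>))"
      by (simp add: F_def mult_ac inner_commute)
    also have "\<dots> = f x * (LINT \<xi>|lborel. exp (- \<i> * of_real (x \<bullet> \<xi>)) * g \<xi>)"
      by (rule integral_mult_right_zero)
    finally show "f x * fourier g x = (2 * pi) powr (- 3 / 2) *\<^sub>R (LINT \<xi>|lborel. F x \<xi>)"
      by (simp add: fourier_def)
    qed
    then show "(2 * pi) powr (- 3 / 2) *\<^sub>R (LINT x|lborel. (LINT \<xi>|lborel. F x \<xi>))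
      = (LINT x|lborel. f x * fourier g x)"
      by (simp only: integral_scaleR_right)
  qed
  finally show ?thesis .
qed

lemma gaussian_const: "(2 * pi) powr (- 3 / 2) * (pi / (1 / (4 * (real n + 1)))) powr (3 / 2)
   = (2 * pi) powr (3 / 2) * ((real n + 1) / pi) powr (3 / 2)"
proof -
  have "(pi / (1 / (4 * (real n + 1)))) = (2 * pi) * ((2 * pi) * ((real n + 1) / pi))"
    by simp
  then have "(pi / (1 / (4 * (real n + 1)))) powr (3 / 2)
    = (2 * pi) powr (3/2) * ((2 * pi) powr (3/2) * ((real n + 1) / pi) powr (3/2))"
    by (simp only: powr_mult)
  moreover have "(2 * pi) powr (- 3 / 2) * (2 * pi) powr (3/2) = 1" by (simp flip: powr_add)
  ultimately show ?thesis by simp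
qed

text \<open>The parameter 1 / (4 (n + 1)) is dual to that of \<open>gk n\<close>. As it tends to 0
  these functions tend to plane waves, while their transforms concentrate at x.\<close>

lemma fourier_modulated_gaussian:
  "fourier (\<lambda>\<xi>. exp (\<i> * of_real (x \<bullet> \<xi>)) * complex_of_real (exp (- (1 / (4 * (real n + 1))) * (norm \<xi>)\<^sup>2))) y
    = of_real ((2 * pi) powr (3/2) * gk n (y - x))"
proof -
  let ?b = "1 / (4 * (real n + 1))"
  let ?g = "\<lambda>\<xi>. exp (\<i> * of_real (x \<bullet> \<xi>)) * complex_of_real (exp (- ?b * (norm \<xi>)\<^sup>2))"
  have b: "?b > 0" by simp
  have "fourier ?g y = (2 * pi) powr (- 3 / 2) *\<^sub>R
      (LINT \<xi>|lborel. exp (\<i> * of_real ((x - y) \<bullet> \<xi>)) * complex_of_real (exp (- ?b * (norm \<xi>)\<^sup>2)))"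
    unfolding fourier_def
    by (intro arg_cong2[where f="scaleR"] refl Bochner_Integration.integral_cong)
       (simp add: inner_diff_left algebra_simps flip: exp_add)
  also have "\<dots> = (2 * pi) powr (- 3 / 2) *\<^sub>R of_real ((pi / ?b) powr (3/2) * exp (- (norm (x - y))\<^sup>2 / (4 * ?b)))"
    by (subst gaussian_3D(2)[OF b]) simp
  also have "\<dots> = of_real (((2 * pi) powr (- 3 / 2) * (pi / ?b) powr (3/2)) * exp (- (real n + 1) * (norm (y - x))\<^sup>2))"
    by (simp add: scaleR_conv_of_real norm_minus_commute field_simps)
  also have "\<dots> = of_real ((2 * pi) powr (3/2) * gk n (y - x))"
    unfolding gaussian_const gk_def by (simp add: mult_ac)
  finally show ?thesis .
qed

lemma fourier_regularized:
  assumes f: "integrable lborel f"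
  shows "(LINT \<xi>|lborel. fourier f \<xi> * (exp (\<i> * of_real (x \<bullet> \<xi>)) * of_real (exp (- (1 / (4 * (real n + 1))) * (norm \<xi>)\<^sup>2))))
    = (2 * pi) powr (3/2) *\<^sub>R (LINT y|lborel. f y * of_real (gk n (y - x)))"
proof -
  let ?b = "1 / (4 * (real n + 1))"
  let ?g = "\<lambda>\<xi>. exp (\<i> * of_real (x \<bullet> \<xi>)) * complex_of_real (exp (- ?b * (norm \<xi>)\<^sup>2))"
  have b: "?b > 0" by simp
  have g: "integrable lborel ?g" by (rule gaussian_3D(1)[OF b])
  have e: "f y * of_real ((2 * pi) powr (3/2) * gk n (y - x))
      = (2 * pi) powr (3/2) *\<^sub>R (f y * of_real (gk n (y - x)))" for y
    by (simp add: scaleR_conv_of_real mult_ac)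
  show ?thesis
    unfolding fourier_multiplication[OF f g] fourier_modulated_gaussian e by (rule integral_scaleR_right)
qed

lemma exp_gauss_tendsto_1: "(\<lambda>n. exp (- (1 / (4 * (real n + 1))) * r)) \<longlonglongrightarrow> 1"
  by real_asymp

lemma integrable_mult_gaussian_shift:
  assumes "integrable lborel f"
  shows "integrable lborel (\<lambda>x. f x * complex_of_real (exp (- (norm (x - x0))\<^sup>2)))"
proof -
  have [measurable]: "f \<in> borel_measurable borel" using assms by (auto dest: borel_measurable_integrable)
  show ?thesis
    by (rule Bochner_Integration.integrable_bound[OF assms]) (auto simp: norm_mult intro!: mult_left_le)
qed

text \<open>Two limits of \<open>fourier_regularized\<close>: dominated convergence in frequency
  gives the inversion integral, the approximate identity gives (2 pi)^(3/2) f x.\<close>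

lemma fourier_inversion:
  assumes f: "integrable lborel f" and Ff: "integrable lborel (fourier f)" and cont: "isCont f x"
  shows "inv_fourier (fourier f) x = f x"
proof -
  have [measurable]: "f \<in> borel_measurable borel" "fourier f \<in> borel_measurable borel"
    using f Ff by (auto dest: borel_measurable_integrable)
  have "(\<lambda>n. LINT \<xi>|lborel. fourier f \<xi> * (exp (\<i> * of_real (x \<bullet> \<xi>)) * of_real (exp (- (1 / (4 * (real n + 1))) * (norm \<xi>)\<^sup>2))))
     \<longlonglongrightarrow> (LINT \<xi>|lborel. fourier f \<xi> * (exp (\<i> * of_real (x \<bullet> \<xi>)) * of_real 1))"
  proof (rule integral_dominated_convergence[where w="\<lambda>\<xi>. cmod (fourier f \<xi>)"])
    show "integrable lborel (\<lambda>\<xi>. cmod (fourier f \<xi>))" using Ff by simp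
    show "AE \<xi> in lborel. (\<lambda>n. fourier f \<xi> * (exp (\<i> * of_real (x \<bullet> \<xi>)) * of_real (exp (- (1 / (4 * (real n + 1))) * (norm \<xi>)\<^sup>2))))
      \<longlonglongrightarrow> fourier f \<xi> * (exp (\<i> * of_real (x \<bullet> \<xi>)) * of_real 1)"
      by (intro AE_I2 tendsto_mult tendsto_const tendsto_of_real exp_gauss_tendsto_1)
    show "AE \<xi> in lborel. cmod (fourier f \<xi> * (exp (\<i> * of_real (x \<bullet> \<xi>)) * of_real (exp (- (1 / (4 * (real n + 1))) * (norm \<xi>)\<^sup>2)))) \<le> cmod (fourier f \<xi>)" for n
      by (auto simp: norm_mult intro!: mult_left_le)
  qed measurable
  then have 1: "(\<lambda>n. (2 * pi) powr (3/2) *\<^sub>R (LINT y|lborel. f y * of_real (gk n (y - x))))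
      \<longlonglongrightarrow> (LINT \<xi>|lborel. exp (\<i> * of_real (\<xi> \<bullet> x)) * fourier f \<xi>)"
    unfolding fourier_regularized[OF f] by (simp add: mult_ac inner_commute)
  have 2: "(\<lambda>n. (2 * pi) powr (3/2) *\<^sub>R (LINT y|lborel. f y * of_real (gk n (y - x))))
    \<longlonglongrightarrow> (2 * pi) powr (3/2) *\<^sub>R f x"
    by (intro tendsto_scaleR tendsto_const approximate_identity integrable_mult_gaussian_shift f cont) measurable
  have "(LINT \<xi>|lborel. exp (\<i> * of_real (\<xi> \<bullet> x)) * fourier f \<xi>) = (2 * pi) powr (3/2) *\<^sub>R f x"
    by (rule LIMSEQ_unique[OF 1 2])
  then show ?thesis unfolding inv_fourier_def by (simp flip: powr_add)
qed

text \<open>Wide enough for Schwartz functions and for their Fourier transforms, and strong enough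
  for the Plancherel argument. Placing a transform here takes fewer estimates than showing it to be
  a Schwartz function.\<close>

definition nice :: "wavefun set" where
  "nice = {f. continuous_on UNIV f \<and> integrable lborel f \<and> (\<exists>K. \<forall>x. cmod (f x) \<le> K)}"

lemma nice_L2: assumes "f \<in> nice" shows "f \<in> Lp_space 2"
proof -
  obtain K where K: "\<And>x. cmod (f x) \<le> K" and f: "integrable lborel f" using assms by (auto simp: nice_def)
  have [measurable]: "f \<in> borel_measurable borel" using f by (auto dest: borel_measurable_integrable)
  have "integrable lborel (\<lambda>x. K * cmod (f x))" using f by simp
  then have "integrable lborel (\<lambda>x. (cmod (f x))\<^sup>2)"
    by (rule Bochner_Integration.integrable_bound) 
       (auto simp: power2_eq_square intro!: mult_right_mono K order_trans[OF _ abs_ge_self])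
  then show ?thesis by (simp add: L2_iff)
qed

text \<open>Pairing f with its Gaussian regularisations gives the damped integrals of |F f|^2, and
  these pairings tend to the squared norm of f. Since the damping factor increases to 1, monotone
  convergence yields square integrability and the value at once.\<close>

lemma Plancherel:
  assumes nice: "f \<in> nice"
  shows "fourier f \<in> Lp_space 2" "nrm (fourier f) = nrm f"
proof -
  obtain K where K: "\<And>x. cmod (f x) \<le> K" and f: "integrable lborel f" and cont: "\<And>x. isCont f x"
    using nice by (auto simp: nice_def continuous_on_eq_continuous_at)
  have [measurable]: "f \<in> borel_measurable borel" using f by (auto dest: borel_measurable_integrable)
  note fourier_phase_measurable(1)[of f, measurable]
  have K0: "0 \<le> K" using K[of 0] norm_ge_zero order_trans by blast
  define b where "b n = 1 / (4 * (real n + 1))" for n :: nat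
  have b: "0 < b n" for n by (simp add: b_def)
  define B where "B = (2 * pi) powr (- 3 / 2) * (LINT x|lborel. cmod (f x))"
  have FB: "cmod (fourier f \<xi>) \<le> B" for \<xi> unfolding B_def by (rule fourier_bound)
  have B0: "0 \<le> B" using FB[of 0] norm_ge_zero order_trans by blast
  \<comment> \<open>Its transform is the conjugate of f convolved with \<open>gk n\<close>, by
    \<open>fourier_regularized\<close>; the multiplication formula then turns the damped integral
    into a pairing of f with that convolution.\<close>
  define g where "g n \<xi> = cnj (fourier f \<xi>) * complex_of_real (exp (- b n * (norm \<xi>)\<^sup>2))" for n \<xi>
  have gm[measurable]: "g n \<in> borel_measurable borel" for n unfolding g_def by measurable
  have gi: "integrable lborel (g n)" for n
  proof (rule Bochner_Integration.integrable_bound)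
    show "integrable lborel (\<lambda>\<xi>::real^3. B * exp (- b n * (norm \<xi>)\<^sup>2))"
      using integrable_gaussian[OF b] by simp
    show "AE \<xi> in lborel. norm (g n \<xi>) \<le> norm (B * exp (- b n * (norm \<xi>)\<^sup>2))"
      using FB B0 by (auto simp: g_def norm_mult abs_mult intro!: mult_right_mono)
  qed measurable
  define fn where "fn n x = (LINT y|lborel. f y * of_real (gk n (y - x)))" for n x
  have Fg: "fourier (g n) x = cnj (fn n x)" for n x
  proof -
    have "cnj ((2 * pi) powr (3/2) *\<^sub>R fn n x)
      = cnj (LINT \<xi>|lborel. fourier f \<xi> * (exp (\<i> * of_real (x \<bullet> \<xi>)) * of_real (exp (- b n * (norm \<xi>)\<^sup>2))))"
      unfolding fn_def fourier_regularized[OF f, symmetric] b_def ..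
    also have "\<dots> = (LINT \<xi>|lborel. cnj (fourier f \<xi> * (exp (\<i> * of_real (x \<bullet> \<xi>)) * of_real (exp (- b n * (norm \<xi>)\<^sup>2)))))"
      by (rule Bochner_Integration.integral_cnj[symmetric])
    also have "\<dots> = (LINT \<xi>|lborel. exp (- \<i> * of_real (x \<bullet> \<xi>)) * g n \<xi>)"
      by (intro Bochner_Integration.integral_cong refl) (simp add: g_def exp_cnj)
    finally have "(LINT \<xi>|lborel. exp (- \<i> * of_real (x \<bullet> \<xi>)) * g n \<xi>)
      = (2 * pi) powr (3/2) *\<^sub>R cnj (fn n x)" by simp
    then show ?thesis unfolding fourier_def by (simp flip: powr_add)
  qed
  have fn: "(\<lambda>n. fn n x) \<longlonglongrightarrow> f x" for x
    unfolding fn_def by (intro approximate_identity integrable_mult_gaussian_shift f cont) measurable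
  have fnm[measurable]: "fn n \<in> borel_measurable borel" for n
    unfolding fn_def by measurable
  \<comment> \<open>Convolution with a kernel of mass 1 keeps the bound K, which provides the
    dominating function K |f|.\<close>
  have fnK: "cmod (fn n x) \<le> K" for n x
  proof -
    have i: "integrable lborel (\<lambda>y. K * gk n (y - x))" using gk_integrable by simp
    have "cmod (fn n x) \<le> (LINT y|lborel. K * gk n (y - x))"
      unfolding fn_def
    proof (rule norm_integral_le[OF _ i])
      show "integrable lborel (\<lambda>y. f y * complex_of_real (gk n (y - x)))"
        by (rule Bochner_Integration.integrable_bound[OF i])
           (use K0 in \<open>auto simp: norm_mult abs_mult gk_nonneg intro!: mult_right_mono K\<close>)
      show "AE y in lborel. cmod (f y * complex_of_real (gk n (y - x))) \<le> K * gk n (y - x)"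
        by (auto simp: norm_mult gk_nonneg intro!: mult_right_mono K)
    qed
    then show ?thesis by (simp add: gk_integral)
  qed
  define u where "u n \<xi> = (cmod (fourier f \<xi>))\<^sup>2 * exp (- b n * (norm \<xi>)\<^sup>2)" for n \<xi>
  have un: "complex_of_real (u n \<xi>) = fourier f \<xi> * g n \<xi>" for n \<xi>
    by (simp add: u_def g_def complex_norm_square mult.assoc del: of_real_power)
  have "(\<lambda>n. LINT x|lborel. f x * cnj (fn n x)) \<longlonglongrightarrow> (LINT x|lborel. f x * cnj (f x))"
  proof (rule integral_dominated_convergence[where w="\<lambda>x. K * cmod (f x)"])
    show "integrable lborel (\<lambda>x. K * cmod (f x))" using f by simp
    show "AE x in lborel. (\<lambda>n. f x * cnj (fn n x)) \<longlonglongrightarrow> f x * cnj (f x)"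
      by (intro AE_I2 tendsto_intros fn)
    show "AE x in lborel. cmod (f x * cnj (fn n x)) \<le> K * cmod (f x)" for n
      by (auto simp: norm_mult mult.commute[of K] intro!: mult_left_mono fnK)
  qed measurable
  also have "(LINT x|lborel. f x * cnj (f x)) = of_real ((nrm f)\<^sup>2)"
    unfolding inner_self[symmetric] inner_L2_def by (simp add: mult.commute)
  also have "(\<lambda>n. LINT x|lborel. f x * cnj (fn n x)) = (\<lambda>n. complex_of_real (LINT \<xi>|lborel. u n \<xi>))"
    unfolding integral_complex_of_real[symmetric] un Fg[symmetric] fourier_multiplication[OF f gi] ..
  finally have lim: "(\<lambda>n. LINT \<xi>|lborel. u n \<xi>) \<longlonglongrightarrow> (nrm f)\<^sup>2"
    by (simp only: tendsto_of_real_iff)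
  have ui: "integrable lborel (u n)" for n
  proof -
    have "integrable lborel (\<lambda>\<xi>. fourier f \<xi> * g n \<xi>)"
    proof (rule Bochner_Integration.integrable_bound)
      show "integrable lborel (\<lambda>\<xi>. B * cmod (g n \<xi>))" using gi by simp
      show "AE \<xi> in lborel. norm (fourier f \<xi> * g n \<xi>) \<le> norm (B * cmod (g n \<xi>))"
        using FB B0 by (auto simp: norm_mult intro!: mult_right_mono)
    qed measurable
    from integrable_Re[OF this] show ?thesis unfolding un[symmetric] by simp
  qed
  have mono: "mono (\<lambda>n. u n \<xi>)" for \<xi>
    unfolding mono_def u_def b_def
    by (auto intro!: mult_left_mono mult_right_mono divide_left_mono)
  have ulim: "(\<lambda>n. u n \<xi>) \<longlonglongrightarrow> (cmod (fourier f \<xi>))\<^sup>2" for \<xi>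
    using tendsto_mult[OF tendsto_const exp_gauss_tendsto_1, of "(cmod (fourier f \<xi>))\<^sup>2" "(norm \<xi>)\<^sup>2"]
    by (simp add: u_def b_def)
  have "integrable lborel (\<lambda>\<xi>. (cmod (fourier f \<xi>))\<^sup>2)"
    by (rule integrable_monotone_convergence[OF ui _ _ lim]) (use mono ulim in auto)
  then show "fourier f \<in> Lp_space 2" by (simp add: L2_iff)
  have "(LINT \<xi>|lborel. (cmod (fourier f \<xi>))\<^sup>2) = (nrm f)\<^sup>2"
    by (rule integral_monotone_convergence[OF ui _ _ lim]) (use mono ulim in auto)
  then show "nrm (fourier f) = nrm f" unfolding nrm_sq[symmetric] by simp
qed

lemma nrm_reflect:
  assumes "f \<in> Lp_space 2" shows "(\<lambda>x. f (- x)) \<in> Lp_space 2" "nrm (\<lambda>x. f (- x)) = nrm f"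
proof -
  have [measurable]: "f \<in> borel_measurable borel" using assms by (rule Lp_space_measurable)
  show "(\<lambda>x. f (- x)) \<in> Lp_space 2" "nrm (\<lambda>x. f (- x)) = nrm f"
    using assms integrable_reflect[of "\<lambda>x. (cmod (f x))\<^sup>2"] integral_reflect[of "\<lambda>x. (cmod (f x))\<^sup>2"]
    by (auto simp: L2_iff nrm_def)
qed

lemma Plancherel_inv:
  assumes "f \<in> nice"
  shows "inv_fourier f \<in> Lp_space 2" "nrm (inv_fourier f) = nrm f"
proof -
  have "f \<in> borel_measurable borel" using assms by (auto simp: nice_def dest: borel_measurable_integrable)
  then have "inv_fourier f = (\<lambda>x. fourier f (- x))" by (simp add: inv_fourier_eq fun_eq_iff)
  then show "inv_fourier f \<in> Lp_space 2" "nrm (inv_fourier f) = nrm f"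
    using nrm_reflect[OF Plancherel(1)[OF assms]] Plancherel(2)[OF assms] by auto
qed

section \<open>Density of Gaussians\<close>

text \<open>Continuous functions approximate indicators of open sets, Dynkin's pi-lambda argument
  passes to Borel sets, and vanishing set integrals determine the real and the imaginary
  part.\<close>

lemma AE_0_of_bounded_continuous:
  fixes v :: wavefun
  assumes v: "integrable lborel v"
    and 0: "\<And>\<phi> K. continuous_on UNIV \<phi> \<Longrightarrow> (\<And>x. cmod (\<phi> x) \<le> K)
      \<Longrightarrow> (LINT x|lborel. v x * \<phi> x) = 0"
  shows "AE x in lborel. v x = 0"
proof -
  have [measurable]: "v \<in> borel_measurable borel" using v by (auto dest: borel_measurable_integrable)
  have UNIV0: "(LINT x|lborel. v x) = 0" using 0[of "\<lambda>_. 1" 1] by simp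
  have si: "set_integrable lborel A v" if "A \<in> sets borel" for A
    unfolding set_integrable_def using that v by (intro integrable_mult_indicator) auto
  have opn: "(LINT x:S|lborel. v x) = 0" if S: "open S" for S
  \<comment> \<open>\<open>infdist\<close> to the empty set is 0 by convention, so the cut-offs
    below would vanish for S = UNIV.\<close>
  proof (cases "S = UNIV")
    case False
    then have ne: "- S \<noteq> {}" by auto
    have [measurable]: "S \<in> sets borel" using S by simp
    define \<phi> where "\<phi> n x = complex_of_real (min 1 (real n * infdist x (- S)))" for n x
    have c: "continuous_on UNIV (\<phi> n)" for n
      unfolding \<phi>_def by (intro continuous_intros)
    have [measurable]: "\<phi> n \<in> borel_measurable borel" for n
      by (rule borel_measurable_continuous_onI[OF c])
    have b: "cmod (\<phi> n x) \<le> 1" for n x by (simp add: \<phi>_def infdist_nonneg)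
    have lim: "(\<lambda>n. \<phi> n x) \<longlonglongrightarrow> indicator S x" for x
    proof (cases "x \<in> S")
      case True
      then have "infdist x (- S) \<noteq> 0" using S ne in_closed_iff_infdist_zero[of "- S" x] by auto
      then have "0 < infdist x (- S)" using infdist_nonneg[of x "- S"] by simp
      then obtain N where N: "1 \<le> real N * infdist x (- S)"
        using reals_Archimedean3[of "infdist x (- S)"] by (meson less_imp_le)
      show ?thesis
      proof (rule tendsto_eventually, unfold eventually_sequentially, intro exI[of _ N] allI impI)
        fix n assume "N \<le> n"
        then have "real N * infdist x (- S) \<le> real n * infdist x (- S)"
          by (intro mult_right_mono infdist_nonneg) simp
        then show "\<phi> n x = indicator S x" using N True by (simp add: \<phi>_def)
      qed
    next
      case False
      then have "infdist x (- S) = 0" by simp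
      then show ?thesis using False by (simp add: \<phi>_def)
    qed
    have "(\<lambda>n. LINT x|lborel. v x * \<phi> n x) \<longlonglongrightarrow> (LINT x|lborel. v x * indicator S x)"
    proof (rule integral_dominated_convergence[where w="\<lambda>x. cmod (v x)"])
      show "AE x in lborel. (\<lambda>n. v x * \<phi> n x) \<longlonglongrightarrow> v x * indicator S x"
        by (intro AE_I2 tendsto_intros lim)
      show "AE x in lborel. cmod (v x * \<phi> n x) \<le> cmod (v x)" for n
        using b by (auto simp: norm_mult intro!: mult_left_le)
      show "(\<lambda>x. v x * indicator S x) \<in> borel_measurable lborel" using S by measurable
    qed (use v in auto)
    moreover have "(\<lambda>n. LINT x|lborel. v x * \<phi> n x) = (\<lambda>n. 0)" using 0[OF c b] by auto
    ultimately have "(LINT x|lborel. v x * indicator S x) = 0" by (simp add: LIMSEQ_const_iff)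
    moreover have "(LINT x:S|lborel. v x) = (LINT x|lborel. v x * indicator S x)"
      unfolding set_lebesgue_integral_def by (intro Bochner_Integration.integral_cong) (auto simp: indicator_def)
    ultimately show ?thesis by simp
  qed (simp add: UNIV0 set_lebesgue_integral_def)
  have all: "(LINT x:A|lborel. v x) = 0" if "A \<in> sets borel" for A
  proof -
    have "Int_stable {S::(real^3) set. open S}" by (auto simp: Int_stable_def)
    moreover have "{S::(real^3) set. open S} \<subseteq> Pow UNIV" by simp
    moreover have "A \<in> sigma_sets UNIV {S. open S}" using that by (simp add: sets_borel)
    ultimately show ?thesis
    proof (induct rule: sigma_sets_induct_disjoint)
      case (compl A)
      then have A: "A \<in> sets borel" by (simp add: sets_borel)
      have "(LINT x:(UNIV - A)|lborel. v x) = (LINT x|lborel. v x) - (LINT x:A|lborel. v x)"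
      proof -
        have "indicator (UNIV - A) x *\<^sub>R v x = v x - indicator A x *\<^sub>R v x" for x
          by (simp add: indicator_def)
        then show "(LINT x:(UNIV - A)|lborel. v x) = (LINT x|lborel. v x) - (LINT x:A|lborel. v x)"
          using v si[OF A]
          by (simp add: set_integrable_def set_lebesgue_integral_def Bochner_Integration.integral_diff)
      qed
      then show ?case using compl UNIV0 by simp
    next
      case (union A)
      then have A: "\<And>i. A i \<in> sets borel" by (auto simp: sets_borel)
      have "(LINT x:(\<Union>i. A i)|lborel. v x) = (\<Sum>i. (LINT x:(A i)|lborel. v x))"
        using union(1) A by (intro lebesgue_integral_countable_add si) (auto simp: disjoint_family_on_def)
      then show ?case using union by simp
    next
      case (basic A)
      then show ?case by (simp add: opn)
    qed (simp add: set_lebesgue_integral_def)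
  qed
  have "AE x in lborel. Re (v x) = 0"
  proof (rule density_unique_real)
    fix A :: "(real^3) set" assume "A \<in> sets lborel"
    then have "Re (LINT x:A|lborel. v x) = 0" "set_integrable lborel A v" using all si by auto
    then show "(LINT x:A|lborel. Re (v x)) = (LINT x:A|lborel. 0)"
      by (simp add: set_lebesgue_integral_def set_integrable_def flip: integral_Re)
  qed (use v in auto)
  moreover have "AE x in lborel. Im (v x) = 0"
  proof (rule density_unique_real)
    fix A :: "(real^3) set" assume "A \<in> sets lborel"
    then have "Im (LINT x:A|lborel. v x) = 0" "set_integrable lborel A v" using all si by auto
    then show "(LINT x:A|lborel. Im (v x)) = (LINT x:A|lborel. 0)"
      by (simp add: set_lebesgue_integral_def set_integrable_def flip: integral_Im)
  qed (use v in auto)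
  ultimately show ?thesis by eventually_elim (simp add: complex_eq_iff)
qed

text \<open>Up to a positive constant a Gaussian centred at b / (2 a). The linear term in the
  exponent makes the family closed under products, which the density argument uses.\<close>

definition gauss :: "real \<Rightarrow> real^3 \<Rightarrow> wavefun" where
  "gauss a b x = of_real (exp (- a * (norm x)\<^sup>2 + b \<bullet> x))"

lemma gauss_measurable[measurable]: "gauss a b \<in> borel_measurable borel"
  unfolding gauss_def[abs_def] by measurable

lemma gauss_shift:
  assumes "0 < a"
  shows "gauss a b x = of_real (exp ((norm b)\<^sup>2 / (4 * a)) * exp (- a * (norm (x - (1 / (2 * a)) *\<^sub>R b))\<^sup>2))"
proof -
  have "(norm (x - (1 / (2 * a)) *\<^sub>R b))\<^sup>2 = (norm x)\<^sup>2 - (1/a) * (b \<bullet> x)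
    + (norm b)\<^sup>2 / (4 * a\<^sup>2)"
    unfolding power2_norm_eq_inner
    by (simp add: algebra_simps inner_commute power2_eq_square)
  note n = this
  have "a * (norm (x - (1 / (2 * a)) *\<^sub>R b))\<^sup>2 = a * (norm x)\<^sup>2 - b \<bullet> x
    + (norm b)\<^sup>2 / (4 * a)"
    unfolding n using assms by (simp add: field_simps power2_eq_square)
  then show ?thesis unfolding gauss_def by (simp add: algebra_simps flip: exp_add)
qed

lemma gauss_integrable:
  assumes "0 < a" shows "integrable lborel (gauss a b)"
proof -
  have "integrable lborel (\<lambda>x. exp (- a * (norm (x - (1 / (2 * a)) *\<^sub>R b))\<^sup>2))"
    using integrable_shift[of "\<lambda>x. exp (- a * (norm x)\<^sup>2)" "- (1 / (2 * a)) *\<^sub>R b"] integrable_gaussian[OF assms]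
    by simp
  then show ?thesis unfolding gauss_shift[OF assms, abs_def] by simp
qed

lemma gauss_L2: assumes "0 < a" shows "gauss a b \<in> Lp_space 2"
proof -
  have "(cmod (gauss a b x))\<^sup>2 = cmod (gauss (2 * a) (2 *\<^sub>R b) x)" for x
    by (simp add: gauss_def power2_eq_square flip: exp_add)
  then show ?thesis using integrable_norm[OF gauss_integrable[of "2 * a" "2 *\<^sub>R b"]] assms
    by (simp add: L2_iff)
qed

text \<open>Density in the form in which it is applied: a property that holds for Gaussians and
  defines a closed subspace holds on all of L^2. A function orthogonal to all Gaussians becomes
  integrable when multiplied by one, and all its Gaussian averages then vanish.\<close>

lemma L2_eq_closed_subspace:
  assumes D: "closed_subspace D" and g: "\<And>a b. 0 < a \<Longrightarrow> gauss a b \<in> D"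
  shows "D = Lp_space 2"
proof
  show "D \<subseteq> Lp_space 2" using D by (auto simp: closed_subspace_def)
  show "Lp_space 2 \<subseteq> D"
  proof
    fix f :: wavefun assume f: "f \<in> Lp_space 2"
    obtain m where m: "m \<in> D" and orth: "\<And>y. y \<in> D \<Longrightarrow> inner_L2 y (\<lambda>x. f x - m x) = 0"
      using projection_exists[OF D f] by blast
    have mL: "m \<in> Lp_space 2" using m D by (auto simp: closed_subspace_def)
    define u where "u x = f x - m x" for x
    have uL: "u \<in> Lp_space 2" unfolding u_def using f mL by (rule L2_diff)
    have [measurable]: "u \<in> borel_measurable borel" using uL by (rule Lp_space_measurable)
    have u0: "(LINT x|lborel. gauss a b x * u x) = 0" if "0 < a" for a b
      using orth[OF g[OF that, of b]] by (simp add: inner_L2_def u_def[abs_def] gauss_def)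
    define v where "v x = gauss 1 0 x * u x" for x
    have v: "integrable lborel v" unfolding v_def by (intro L2_integrable_mult gauss_L2 uL) simp
    have [measurable]: "v \<in> borel_measurable borel" unfolding v_def by measurable
    have v0: "(LINT x|lborel. v x * of_real (gk n (x - y))) = 0" for n y
    proof -
      define C where "C = ((real n + 1) / pi) powr (3/2) * exp (- (real n + 1) * (norm y)\<^sup>2)"
      \<comment> \<open>Expanding |x - y|^2 shows that the weight in v times a translated kernel is
        again a Gaussian, against which u integrates to 0.\<close>
      have "v x * of_real (gk n (x - y)) = of_real C * (gauss (1 + (real n + 1)) ((2 * (real n + 1)) *\<^sub>R y) x * u x)"
        for x
      proof -
        have n: "(norm (x - y))\<^sup>2 = (norm x)\<^sup>2 - 2 * (y \<bullet> x) + (norm y)\<^sup>2"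
          unfolding power2_norm_eq_inner by (simp add: algebra_simps inner_commute)
        have "- (real n + 1) * (norm (x - y))\<^sup>2
           = - (real n + 1) * (norm y)\<^sup>2 + (- (real n + 1) * (norm x)\<^sup>2 + (2 * (real n + 1)) * (y \<bullet> x))"
          unfolding n by (simp add: algebra_simps)
        then have "gk n (x - y) = C * exp (- (real n + 1) * (norm x)\<^sup>2 + (2 * (real n + 1)) * (y \<bullet> x))"
          unfolding gk_def C_def by (simp only: exp_add mult.assoc)
        moreover have "exp (- (1 + (real n + 1)) * (norm x)\<^sup>2 + ((2 * (real n + 1)) *\<^sub>R y) \<bullet> x)
          = exp (- 1 * (norm x)\<^sup>2) * exp (- (real n + 1) * (norm x)\<^sup>2 + (2 * (real n + 1)) * (y \<bullet> x))"
          unfolding exp_add[symmetric] by (rule arg_cong[where f=exp]) (simp add: algebra_simps)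
        ultimately show ?thesis unfolding v_def gauss_def by simp
      qed
      then have "(LINT x|lborel. v x * of_real (gk n (x - y)))
         = of_real C * (LINT x|lborel. gauss (1 + (real n + 1)) ((2 * (real n + 1)) *\<^sub>R y) x * u x)"
        by simp
      also have "\<dots> = 0" by (subst u0) auto
      finally show ?thesis .
    qed
    have "AE x in lborel. v x = 0"
    proof (rule AE_0_of_bounded_continuous[OF v])
      fix \<phi> :: wavefun and K assume c: "continuous_on UNIV \<phi>" and K: "\<And>x. cmod (\<phi> x) \<le> K"
      have K0: "0 \<le> K" using K[of 0] norm_ge_zero order_trans by blast
      have [measurable]: "\<phi> \<in> borel_measurable borel" by (rule borel_measurable_continuous_onI[OF c])
      define \<phi>n where "\<phi>n n x = (LINT y|lborel. \<phi> y * of_real (gk n (y - x)))" for n x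
      have ig: "integrable lborel (\<lambda>y. \<phi> y * complex_of_real (gk n (y - x)))" for n x
        by (rule Bochner_Integration.integrable_bound[where f="\<lambda>y. K * gk n (y - x)"])
           (use gk_integrable K0 in \<open>auto simp: norm_mult abs_mult gk_nonneg intro!: mult_right_mono K\<close>)
      have bd: "(LINT y|lborel. cmod (\<phi> y) * gk n (y - x)) \<le> K" for n x
      proof -
        have "(LINT y|lborel. cmod (\<phi> y) * gk n (y - x)) \<le> (LINT y|lborel. K * gk n (y - x))"
          using integrable_norm[OF ig] gk_integrable
          by (intro integral_mono) (auto simp: norm_mult gk_nonneg intro!: mult_right_mono K)
        then show ?thesis by (simp add: gk_integral)
      qed
      have lim: "(\<lambda>n. \<phi>n n x) \<longlonglongrightarrow> \<phi> x" for x
        unfolding \<phi>n_def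
      proof (rule approximate_identity)
        have "integrable lborel (\<lambda>y. exp (- (norm (y - x))\<^sup>2))"
          using integrable_shift[of "\<lambda>y. exp (- (norm y)\<^sup>2)" "-x"] integrable_gaussian[of 1] by simp
        then have i: "integrable lborel (\<lambda>y. K * exp (- (norm (y - x))\<^sup>2))" by simp
        show "integrable lborel (\<lambda>y. \<phi> y * complex_of_real (exp (- (norm (y - x))\<^sup>2)))"
          by (rule Bochner_Integration.integrable_bound[OF i])
             (use K0 in \<open>auto simp: norm_mult abs_mult intro!: mult_right_mono K\<close>)
        show "isCont \<phi> x" using c by (simp add: continuous_on_eq_continuous_at)
      qed measurable
      have m\<phi>n[measurable]: "\<phi>n n \<in> borel_measurable borel" for n unfolding \<phi>n_def by measurable
      have b\<phi>n: "cmod (\<phi>n n x) \<le> K" for n x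
        using integral_norm_bound[of lborel "\<lambda>y. \<phi> y * complex_of_real (gk n (y - x))"] bd[of n x]
        by (simp add: \<phi>n_def norm_mult gk_nonneg)
      \<comment> \<open>Fubini moves the smoothing from \<phi> to v, whose averages vanish.\<close>
      have z: "(LINT x|lborel. v x * \<phi>n n x) = 0" for n
      proof -
        define F where "F x y = v x * (\<phi> y * complex_of_real (gk n (y - x)))" for x y
        have int: "integrable (lborel \<Otimes>\<^sub>M lborel) (case_prod F)"
        proof (rule lborel_pair.Fubini_integrable)
          show "case_prod F \<in> borel_measurable (lborel \<Otimes>\<^sub>M lborel)" unfolding F_def by measurable
          show "AE x in lborel. integrable lborel (\<lambda>y. case_prod F (x, y))" by (simp add: F_def ig)
          have i: "integrable lborel (\<lambda>x. K * cmod (v x))" using v by simp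
          show "integrable lborel (\<lambda>x. (LINT y|lborel. norm (case_prod F (x, y))))"
          proof (rule Bochner_Integration.integrable_bound[OF i])
            show "(\<lambda>x. LINT y|lborel. norm (case_prod F (x, y))) \<in> borel_measurable lborel"
              unfolding F_def by measurable
            show "AE x in lborel. norm (LINT y|lborel. norm (case_prod F (x, y))) \<le> norm (K * cmod (v x))"
              using bd K0 by (auto simp: F_def norm_mult gk_nonneg abs_mult mult.commute[of K] intro!: mult_left_mono)
          qed
        qed
        have "(LINT x|lborel. v x * \<phi>n n x) = (LINT x|lborel. (LINT y|lborel. F x y))"
          unfolding \<phi>n_def F_def by simp
        also have "\<dots> = (LINT y|lborel. (LINT x|lborel. F x y))"
          by (rule lborel_pair.Fubini_integral[OF int, symmetric])
        also have "\<dots> = (LINT y|lborel. \<phi> y * (LINT x|lborel. v x * of_real (gk n (x - y))))"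
        proof (intro Bochner_Integration.integral_cong refl)
          fix y
          have "(LINT x|lborel. F x y) = (LINT x|lborel. \<phi> y * (v x * of_real (gk n (x - y))))"
            by (simp add: F_def gk_minus[of n y] mult_ac)
          then show "(LINT x|lborel. F x y) = \<phi> y * (LINT x|lborel. v x * of_real (gk n (x - y)))" by simp
        qed
        also have "\<dots> = 0" by (simp add: v0)
        finally show ?thesis .
      qed
      have "(\<lambda>n. LINT x|lborel. v x * \<phi>n n x) \<longlonglongrightarrow> (LINT x|lborel. v x * \<phi> x)"
      proof (rule integral_dominated_convergence[where w="\<lambda>x. K * cmod (v x)"])
        show "AE x in lborel. (\<lambda>n. v x * \<phi>n n x) \<longlonglongrightarrow> v x * \<phi> x"
          by (intro AE_I2 tendsto_intros lim)
        show "AE x in lborel. cmod (v x * \<phi>n n x) \<le> K * cmod (v x)" for n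
          using b\<phi>n by (auto simp: norm_mult mult.commute[of K] intro!: mult_left_mono)
      qed (use v in auto)
      then show "(LINT x|lborel. v x * \<phi> x) = 0" by (simp add: z LIMSEQ_const_iff)
    qed
    then have "AE x in lborel. u x = 0" by eventually_elim (simp add: v_def gauss_def)
    \<comment> \<open>f and its projection m agree almost everywhere; closedness, applied to the
      constant sequence m, puts the given representative f into D.\<close>
    then have "AE x in lborel. cmod (u x) \<le> 0 * cmod (u x)" by eventually_elim simp
    from L2_bound(2)[OF uL _ _ this] have "nrm u \<le> 0" by simp
    then have "nrm (\<lambda>x. m x - f x) = 0"
      using nrm_nonneg[of u] nrm_diff_commute[of m f] unfolding u_def[abs_def] by linarith
    then have "(\<lambda>n::nat. nrm (\<lambda>x. m x - f x)) \<longlonglongrightarrow> 0" by simp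
    moreover have "(\<forall>n::nat. F n \<in> D) \<and> g \<in> Lp_space 2 \<and> (\<lambda>n. nrm (\<lambda>x. F n x - g x)) \<longlonglongrightarrow> 0 \<longrightarrow> g \<in> D" for F g
      using D unfolding closed_subspace_def by blast
    from this[of "\<lambda>_. m" f] m f calculation show "f \<in> D" by simp
  qed
qed

section \<open>Schwartz functions\<close>

lemma schwartz_differentiable: "\<phi> \<in> schwartz \<Longrightarrow> foldr partial_deriv is \<phi> differentiable (at x)"
  by (auto simp: schwartz_def Let_def)

lemma schwartz_bounded: "\<phi> \<in> schwartz
  \<Longrightarrow> bounded (range (\<lambda>x. norm x ^ k *\<^sub>R foldr partial_deriv is \<phi> x))"
  by (auto simp: schwartz_def Let_def)

lemma schwartzI:
  assumes "\<And>is x. foldr partial_deriv is \<phi> differentiable (at x)"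
    and "\<And>is k. bounded (range (\<lambda>x. norm x ^ k *\<^sub>R foldr partial_deriv is \<phi> x))"
  shows "\<phi> \<in> schwartz"
  using assms by (auto simp: schwartz_def Let_def)

lemma partial_deriv_eqI: "(f has_derivative D) (at x) \<Longrightarrow> partial_deriv i f x = D (axis i 1)"
  unfolding partial_deriv_def by (metis frechet_derivative_at)

lemma partial_deriv_lin:
  assumes "\<And>x. f differentiable (at x)" "\<And>x. g differentiable (at x)"
  shows "partial_deriv i (\<lambda>x. c * f x + g x) = (\<lambda>x. c * partial_deriv i f x + partial_deriv i g x)"
proof
  fix x
  have "((\<lambda>x. c * f x + g x) has_derivative
      (\<lambda>h. c * frechet_derivative f (at x) h + frechet_derivative g (at x) h)) (at x)"
    using assms[of x, unfolded frechet_derivative_works]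
    by (intro has_derivative_add has_derivative_mult_right)
  from partial_deriv_eqI[OF this] show
    "partial_deriv i (\<lambda>x. c * f x + g x) x = c * partial_deriv i f x + partial_deriv i g x"
    by (simp add: partial_deriv_def)
qed

lemma schwartz_lin:
  assumes f: "f \<in> schwartz" and g: "g \<in> schwartz"
  shows "(\<lambda>x. c * f x + g x) \<in> schwartz"
proof -
  have eq: "foldr partial_deriv is (\<lambda>x. c * f x + g x)
      = (\<lambda>x. c * foldr partial_deriv is f x + foldr partial_deriv is g x)" for "is"
    by (induction "is") (simp_all add: partial_deriv_lin schwartz_differentiable[OF f] schwartz_differentiable[OF g])
  show ?thesis
  proof (rule schwartzI, unfold eq)
    fix "is" x
    show "(\<lambda>x. c * foldr partial_deriv is f x + foldr partial_deriv is g x) differentiable at x"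
      by (intro differentiable_add differentiable_mult differentiable_const
          schwartz_differentiable[OF f] schwartz_differentiable[OF g])
  next
    fix "is" k
    have "bounded (range (\<lambda>x. c * (norm x ^ k *\<^sub>R foldr partial_deriv is f x)))"
      using bounded_linear_image[OF schwartz_bounded[OF f, of k "is"] bounded_linear_mult_right[of c]]
      by (simp add: image_image)
    from bounded_plus_comp[OF this schwartz_bounded[OF g, of k "is"]]
    show "bounded (range (\<lambda>x. norm x ^ k *\<^sub>R (c * foldr partial_deriv is f x + foldr partial_deriv is g x)))"
      by (simp add: scaleR_right_distrib)
  qed
qed

lemma schwartz_partial_deriv:
  assumes "\<phi> \<in> schwartz" shows "partial_deriv i \<phi> \<in> schwartz"
proof (rule schwartzI)
  fix "is" x k
  show "foldr partial_deriv is (partial_deriv i \<phi>) differentiable at x"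
    using schwartz_differentiable[OF assms, of "is @ [i]" x] by simp
  show "bounded (range (\<lambda>x. norm x ^ k *\<^sub>R foldr partial_deriv is (partial_deriv i \<phi>) x))"
    using schwartz_bounded[OF assms, of k "is @ [i]"] by simp
qed

text \<open>The power 3 is the dimension: (1 + |x|^2)^3 dominates the product of 1 + x_i^2 over the
  coordinates, whose inverse is integrable.\<close>

definition decay :: "real^3 \<Rightarrow> real" where "decay x = 1 / (1 + (norm x)\<^sup>2) ^ 3"

lemma decay_pos: "0 < decay x" unfolding decay_def by (simp add: add_pos_nonneg)

lemma integrable_decay: "integrable lborel decay"
proof -
  have "integrable lborel (\<lambda>y::real. inverse (1 + y\<^sup>2))"
    using integrable_inverse_1_plus_square
    by (simp add: set_integrable_def einterval_def)
  then have i: "integrable lborel (\<lambda>y::real. complex_of_real (inverse (1 + y\<^sup>2)))"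
    by (rule integrable_of_real)
  have "integrable lborel (\<lambda>x::real^3. cmod (\<Prod>b\<in>Basis. complex_of_real (inverse (1
    + (x \<bullet> b)\<^sup>2))))"
    by (intro integrable_norm lborel_prod_Basis(1)[of "\<lambda>b y. complex_of_real (inverse (1 + y\<^sup>2))"] i)
  then show ?thesis
  proof (rule Bochner_Integration.integrable_bound)
    show "AE x in lborel. norm (decay x)
      \<le> norm (cmod (\<Prod>b\<in>Basis. complex_of_real (inverse (1 + (x \<bullet> b)\<^sup>2))))"
    proof (rule AE_I2)
      fix x :: "real^3"
      have "(\<Prod>b\<in>Basis. 1 + (x \<bullet> b)\<^sup>2)
        \<le> (\<Prod>b\<in>(Basis::(real^3) set). 1 + (norm x)\<^sup>2)"
      proof (intro prod_mono conjI)
        fix b :: "real^3" assume b: "b \<in> Basis"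
        have "\<bar>x \<bullet> b\<bar>\<^sup>2 \<le> (norm x)\<^sup>2" using Basis_le_norm[OF b, of x]
          by (intro power_mono) auto
        then show "1 + (x \<bullet> b)\<^sup>2 \<le> 1 + (norm x)\<^sup>2" by simp
      qed simp
      also have "\<dots> = (1 + (norm x)\<^sup>2) ^ 3" by simp
      finally have le: "(\<Prod>b\<in>Basis. 1 + (x \<bullet> b)\<^sup>2) \<le> (1 + (norm x)\<^sup>2) ^ 3" .
      have "0 < (\<Prod>b\<in>Basis. 1 + (x \<bullet> b)\<^sup>2)" by (intro prod_pos) (auto intro: add_pos_nonneg)
      then have "decay x \<le> inverse (\<Prod>b\<in>Basis. 1 + (x \<bullet> b)\<^sup>2)"
        unfolding decay_def inverse_eq_divide[symmetric] using le by (intro le_imp_inverse_le)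
      also have "\<dots> = (\<Prod>b\<in>Basis. inverse (1 + (x \<bullet> b)\<^sup>2))"
        by (simp add: prod_inversef[symmetric] comp_def)
      finally show "norm (decay x) \<le> norm (cmod (\<Prod>b\<in>Basis. complex_of_real (inverse (1
        + (x \<bullet> b)\<^sup>2))))"
        using decay_pos[of x] unfolding of_real_prod[symmetric] norm_of_real by simp
    qed
  qed (auto simp: decay_def[abs_def])
qed

lemma schwartz_decay:
  assumes "\<phi> \<in> schwartz"
  obtains C where "0 \<le> C" "\<And>x. cmod (\<phi> x) \<le> C * decay x"
proof -
  have "\<exists>C. \<forall>x::real^3. norm x ^ k * cmod (\<phi> x) \<le> C" for k
    using schwartz_bounded[OF assms, of k "[]"] by (auto simp: bounded_iff)
  then obtain C where C: "\<And>k (x::real^3). norm x ^ k * cmod (\<phi> x) \<le> C k" by metis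
  have C0: "0 \<le> C k" for k using C[of 0 k] by (metis norm_ge_zero mult_nonneg_nonneg order_trans zero_le_power)
  \<comment> \<open>The coefficients 1, 3, 3, 1 come from expanding (1 + |x|^2)^3; they weight the
    bounds of order 0, 2, 4 and 6.\<close>
  show thesis
  proof (rule that[of "C 0 + 3 * C 2 + 3 * C 4 + C 6"])
    show "0 \<le> C 0 + 3 * C 2 + 3 * C 4 + C 6" by (simp add: C0)
    fix x :: "real^3"
    have "(1 + (norm x)\<^sup>2) ^ 3 = norm x ^ 0 + 3 * norm x ^ 2 + 3 * norm x ^ 4 + norm x ^ 6"
      by (simp add: power3_eq_cube power2_eq_square numeral_eq_Suc algebra_simps)
    then have "(1 + (norm x)\<^sup>2) ^ 3 * cmod (\<phi> x) \<le> C 0 + 3 * C 2 + 3 * C 4 + C 6"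
      using C[of x 0] C[of x 2] C[of x 4] C[of x 6] by (simp add: distrib_right)
    moreover have "0 < (1 + (norm x)\<^sup>2) ^ 3" by (simp add: add_pos_nonneg)
    ultimately show "cmod (\<phi> x) \<le> (C 0 + 3 * C 2 + 3 * C 4 + C 6) * decay x"
      unfolding decay_def by (simp add: pos_le_divide_eq mult.commute)
  qed
qed

lemma schwartz_continuous: "\<phi> \<in> schwartz \<Longrightarrow> continuous_on UNIV \<phi>"
  using schwartz_differentiable[of \<phi> "[]"]
  by (auto simp: continuous_on_eq_continuous_at intro: differentiable_imp_continuous_within)

lemma schwartz_measurable: "\<phi> \<in> schwartz \<Longrightarrow> \<phi> \<in> borel_measurable borel"
  by (intro borel_measurable_continuous_onI schwartz_continuous)

lemma decay_le_1: "decay x \<le> 1"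
  unfolding decay_def by (simp add: add_pos_nonneg one_le_power)

lemma niceI:
  assumes "continuous_on UNIV f" "0 \<le> C" "\<And>x. cmod (f x) \<le> C * decay x"
  shows "f \<in> nice"
  unfolding nice_def
proof (intro CollectI conjI exI[of _ C] allI)
  have "integrable lborel (\<lambda>x. C * decay x)" using integrable_decay by simp
  then show "integrable lborel f"
    by (rule Bochner_Integration.integrable_bound)
       (use assms decay_pos in \<open>auto intro!: borel_measurable_continuous_onI simp: abs_mult less_imp_le\<close>)
  show "cmod (f x) \<le> C" for x
    using assms(2) assms(3)[of x] decay_le_1[of x] by (meson mult_left_le order_trans)
qed fact

lemma schwartz_nice: assumes "\<phi> \<in> schwartz" shows "\<phi> \<in> nice"
proof -
  obtain C where "0 \<le> C" "\<And>x. cmod (\<phi> x) \<le> C * decay x" using schwartz_decay[OF assms] by blast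
  then show ?thesis by (intro niceI schwartz_continuous assms)
qed

lemma schwartz_integrable: "\<phi> \<in> schwartz \<Longrightarrow> integrable lborel \<phi>"
  using schwartz_nice by (auto simp: nice_def)

lemma schwartz_L2: "\<phi> \<in> schwartz \<Longrightarrow> \<phi> \<in> Lp_space 2"
  by (intro nice_L2 schwartz_nice)

text \<open>27 = 3^3, from 1 + |x|^2 <= 3 (1 + |x + y|^2). It serves to dominate difference
  quotients, whose intermediate points lie within distance 1.\<close>

lemma decay_shift:
  assumes "norm y \<le> 1" shows "decay (x + y) \<le> 27 * decay x"
proof -
  have "norm x \<le> norm (x + y) + 1" using assms norm_triangle_ineq4[of "x + y" y] by simp
  then have "(norm x)\<^sup>2 \<le> (norm (x + y) + 1)\<^sup>2" by (intro power_mono) auto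
  also have "\<dots> \<le> 2 * (norm (x + y))\<^sup>2 + 2"
    using sum_squares_bound[of "norm (x + y)" 1] by (simp add: power2_sum)
  finally have "1 + (norm x)\<^sup>2 \<le> 3 * (1 + (norm (x + y))\<^sup>2)"
    by (rule order_trans[OF add_left_mono]) (simp add: algebra_simps)
  then have "(1 + (norm x)\<^sup>2) ^ 3 \<le> (3 * (1 + (norm (x + y))\<^sup>2)) ^ 3" by (intro power_mono) auto
  also have "\<dots> = 27 * (1 + (norm (x + y))\<^sup>2) ^ 3" by (simp only: power_mult_distrib) simp
  finally show ?thesis unfolding decay_def
    by (simp add: field_simps add_pos_nonneg)
qed

section \<open>Fourier transforms of Schwartz functions\<close>

lemma partial_deriv_line:
  assumes "\<phi> differentiable (at (x + s *\<^sub>R axis i 1))"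
  shows "((\<lambda>t. \<phi> (x + t *\<^sub>R axis i 1)) has_vector_derivative partial_deriv i \<phi> (x
    + s *\<^sub>R axis i 1)) (at s)"
proof -
  have "((\<lambda>t. x + t *\<^sub>R axis i (1::real)) has_vector_derivative axis i 1) (at s)"
    by (auto intro!: derivative_eq_intros)
  from vector_derivative_diff_chain_within[of "\<lambda>t. x
    + t *\<^sub>R axis i 1" "axis i 1" s UNIV \<phi>, OF _ has_derivative_at_withinI]
    this assms[unfolded frechet_derivative_works]
  show ?thesis unfolding partial_deriv_def by (auto simp: comp_def)
qed

lemma phase_derivative:
  "(\<lambda>n. (exp (\<i> * of_real (c * (1 / Suc n))) - 1) / of_real (1 / Suc n))
    \<longlonglongrightarrow> \<i> * of_real c"
proof -
  have "((\<lambda>z. exp (\<i> * of_real c * z)) has_field_derivative (\<i> * of_real c)) (at 0)"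
    by (auto intro!: derivative_eq_intros)
  then have D: "((\<lambda>h. (exp (\<i> * of_real c * h) - 1) / h) \<longlongrightarrow> \<i> * of_real c) (at 0)"
    by (simp add: DERIV_def)
  have "filterlim (\<lambda>n. complex_of_real (1 / Suc n)) (at 0) sequentially"
    unfolding filterlim_at
  proof (intro conjI always_eventually allI)
    show "(\<lambda>n. complex_of_real (1 / Suc n)) \<longlonglongrightarrow> 0"
      using tendsto_of_real[OF LIMSEQ_Suc[OF lim_1_over_n[where 'a=real]], where 'a=complex] by simp
    show "complex_of_real (1 / Suc n) \<noteq> 0" for n
      unfolding of_real_eq_0_iff by simp
  qed simp
  from filterlim_compose[OF D this] show ?thesis by (simp add: mult_ac)
qed

text \<open>By translation, the transform of a difference quotient is (exp(i xi_i h) - 1) / h times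
  the transform; letting h = 1 / (n + 1) tend to 0 on both sides gives the rule.\<close>

lemma fourier_partial_deriv:
  assumes \<phi>: "\<phi> \<in> schwartz"
  shows "fourier (partial_deriv i \<phi>) \<xi> = \<i> * of_real (\<xi> $ i) * fourier \<phi> \<xi>"
proof -
  let ?e = "axis i 1 :: real^3"
  have ne: "norm ?e = 1" by (simp add: norm_axis_1)
  note \<phi>' = schwartz_partial_deriv[OF \<phi>, of i]
  have [measurable]: "\<phi> \<in> borel_measurable borel" "partial_deriv i \<phi> \<in> borel_measurable borel"
    using \<phi> \<phi>' by (auto intro: schwartz_measurable)
  have diff: "\<phi> differentiable (at x)" for x using schwartz_differentiable[OF \<phi>, of "[]"] by simp
  obtain C where C: "0 \<le> C" "\<And>x. cmod (partial_deriv i \<phi> x) \<le> C * decay x"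
    using schwartz_decay[OF \<phi>'] by blast
  define h where "h n = 1 / real (Suc n)" for n
  have h: "0 < h n" "h n \<le> 1" for n by (auto simp: h_def)
  define q where "q n x = (\<phi> (x + h n *\<^sub>R ?e) - \<phi> x) / of_real (h n)" for n x
  have qm[measurable]: "q n \<in> borel_measurable borel" for n unfolding q_def by measurable
  have lim: "(\<lambda>n. q n x) \<longlonglongrightarrow> partial_deriv i \<phi> x" for x
  proof -
    have "((\<lambda>t. \<phi> (x + t *\<^sub>R ?e)) has_vector_derivative partial_deriv i \<phi> x) (at 0)"
      using partial_deriv_line[of \<phi> x 0 i] diff by simp
    then have "((\<lambda>t. norm (\<phi> (x
      + t *\<^sub>R ?e) - \<phi> x - t *\<^sub>R partial_deriv i \<phi> x) / norm t) \<longlongrightarrow> 0) (at 0)"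
      unfolding has_vector_derivative_def has_derivative_at by simp
    moreover have "\<forall>\<^sub>F t in at 0. norm (\<phi> (x
      + t *\<^sub>R ?e) - \<phi> x - t *\<^sub>R partial_deriv i \<phi> x) / norm t
        = norm ((\<phi> (x + t *\<^sub>R ?e) - \<phi> x) /\<^sub>R t - partial_deriv i \<phi> x)"
      unfolding eventually_at_filter
    proof (intro always_eventually allI impI)
      fix t :: real assume "t \<noteq> 0"
      then have "(\<phi> (x + t *\<^sub>R ?e) - \<phi> x) /\<^sub>R t - partial_deriv i \<phi> x
          = (\<phi> (x + t *\<^sub>R ?e) - \<phi> x - t *\<^sub>R partial_deriv i \<phi> x) /\<^sub>R t"
        by (simp add: scaleR_diff_right)
      then show "norm (\<phi> (x + t *\<^sub>R ?e) - \<phi> x - t *\<^sub>R partial_deriv i \<phi> x) / norm t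
        = norm ((\<phi> (x + t *\<^sub>R ?e) - \<phi> x) /\<^sub>R t - partial_deriv i \<phi> x)"
        by (simp add: divide_inverse mult.commute)
    qed
    ultimately have "((\<lambda>t. norm ((\<phi> (x
      + t *\<^sub>R ?e) - \<phi> x) /\<^sub>R t - partial_deriv i \<phi> x)) \<longlongrightarrow> 0) (at 0)"
      by (simp add: tendsto_cong)
    then have D: "((\<lambda>t. (\<phi> (x
      + t *\<^sub>R ?e) - \<phi> x) /\<^sub>R t) \<longlongrightarrow> partial_deriv i \<phi> x) (at 0)"
      by (rule LIM_zero_cancel[OF tendsto_norm_zero_cancel])
    have "filterlim h (at 0) sequentially"
      unfolding filterlim_at h_def
      using LIMSEQ_Suc[OF lim_1_over_n[where 'a=real]] by (auto intro!: always_eventually)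
    from filterlim_compose[OF D this] show ?thesis
      by (simp add: q_def scaleR_conv_of_real divide_inverse mult.commute)
  qed
  \<comment> \<open>The mean value theorem bounds the quotient by the derivative at a point within
    distance 1, so one integrable function dominates all n.\<close>
  have qb: "cmod (q n x) \<le> 27 * C * decay x" for n x
  proof -
    have "\<exists>s\<in>{0<..<h n}. norm (\<phi> (x + h n *\<^sub>R ?e) - \<phi> (x + 0 *\<^sub>R ?e))
      \<le> norm ((h n - 0) *\<^sub>R partial_deriv i \<phi> (x + s *\<^sub>R ?e))"
    proof (rule mvt_general[where f="\<lambda>t. \<phi> (x
      + t *\<^sub>R ?e)" and f'="\<lambda>s k. k *\<^sub>R partial_deriv i \<phi> (x + s *\<^sub>R ?e)"])
      show "0 < h n" by (rule h)
      show "continuous_on {0..h n} (\<lambda>t. \<phi> (x + t *\<^sub>R ?e))"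
        by (rule continuous_at_imp_continuous_on, rule ballI,
            rule has_vector_derivative_continuous[OF partial_deriv_line[OF diff]])
      show "((\<lambda>t. \<phi> (x + t *\<^sub>R ?e)) has_derivative (\<lambda>k. k *\<^sub>R partial_deriv i \<phi> (x
        + s *\<^sub>R ?e))) (at s)" for s
        by (rule partial_deriv_line[OF diff, unfolded has_vector_derivative_def])
    qed
    then obtain s where s: "0 < s" "s < h n"
      "cmod (\<phi> (x + h n *\<^sub>R ?e) - \<phi> x) \<le> h n * cmod (partial_deriv i \<phi> (x + s *\<^sub>R ?e))"
      using h[of n] by auto
    have "decay (x + s *\<^sub>R ?e) \<le> 27 * decay x"
      by (rule decay_shift) (use s h[of n] ne in auto)
    then have "C * decay (x + s *\<^sub>R ?e) \<le> C * (27 * decay x)" using C(1) by (rule mult_left_mono)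
    then have "cmod (partial_deriv i \<phi> (x + s *\<^sub>R ?e)) \<le> 27 * C * decay x"
      using C(2)[of "x + s *\<^sub>R ?e"] by simp
    then have "h n * cmod (partial_deriv i \<phi> (x + s *\<^sub>R ?e)) \<le> h n * (27 * C * decay x)"
      using h[of n] by (intro mult_left_mono) auto
    with s(3) have "cmod (\<phi> (x + h n *\<^sub>R ?e) - \<phi> x) \<le> h n * (27 * C * decay x)" by linarith
    then show ?thesis using h[of n] by (simp add: q_def norm_divide pos_divide_le_eq mult.commute)
  qed
  have L1: "(\<lambda>n. LINT x|lborel. exp (- \<i> * of_real (\<xi> \<bullet> x)) * q n x) \<longlonglongrightarrow>
      (LINT x|lborel. exp (- \<i> * of_real (\<xi> \<bullet> x)) * partial_deriv i \<phi> x)"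
  proof (rule integral_dominated_convergence[where w="\<lambda>x. 27 * C * decay x"])
    show "integrable lborel (\<lambda>x. 27 * C * decay x)" using integrable_decay by simp
    show "AE x in lborel. (\<lambda>n. exp (- \<i> * of_real (\<xi> \<bullet> x)) * q n x)
      \<longlonglongrightarrow> exp (- \<i> * of_real (\<xi> \<bullet> x)) * partial_deriv i \<phi> x"
      by (intro AE_I2 tendsto_intros lim)
    show "AE x in lborel. cmod (exp (- \<i> * of_real (\<xi> \<bullet> x)) * q n x) \<le> 27 * C * decay x" for n
      using qb by (auto simp: norm_mult)
  qed measurable
  define I where "I = (LINT x|lborel. exp (- \<i> * of_real (\<xi> \<bullet> x)) * \<phi> x)"
  have e: "(LINT x|lborel. exp (- \<i> * of_real (\<xi> \<bullet> x)) * q n x)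
      = (exp (\<i> * of_real (\<xi> $ i * (1 / Suc n))) - 1) / of_real (1 / Suc n) * I" for n
  proof -
    have i1: "integrable lborel (\<lambda>x. exp (- \<i> * of_real (\<xi> \<bullet> x)) * \<phi> x)"
      using integrable_phase(2)[OF schwartz_integrable[OF \<phi>]] by simp
    have i2: "integrable lborel (\<lambda>x. exp (- \<i> * of_real (\<xi> \<bullet> x)) * \<phi> (x + h n *\<^sub>R ?e))"
      using integrable_phase(2)[of "\<lambda>x. \<phi> (x
        + h n *\<^sub>R ?e)"] integrable_shift[of \<phi> "h n *\<^sub>R ?e"] schwartz_integrable[OF \<phi>]
      by (simp add: add.commute)
    have "(LINT x|lborel. exp (- \<i> * of_real (\<xi> \<bullet> x)) * \<phi> (x + h n *\<^sub>R ?e))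
        = (LINT x|lborel. exp (- \<i> * of_real (\<xi> \<bullet> ((h n *\<^sub>R ?e + x) - h n *\<^sub>R ?e))) * \<phi> (h n *\<^sub>R ?e + x))"
      by (simp add: add.commute)
    also have "\<dots> = (LINT x|lborel. exp (- \<i> * of_real (\<xi> \<bullet> (x - h n *\<^sub>R ?e))) * \<phi> x)"
      by (rule integral_shift[where f="\<lambda>x. exp (- \<i> * of_real (\<xi> \<bullet> (x - h n *\<^sub>R ?e))) * \<phi> x"]) measurable
    also have "\<dots> = (LINT x|lborel. exp (\<i> * of_real (\<xi> $ i * h n)) * (exp (- \<i> * of_real (\<xi> \<bullet> x)) * \<phi> x))"
      by (intro Bochner_Integration.integral_cong refl)
         (simp add: inner_diff_right inner_axis algebra_simps flip: exp_add)
    also have "\<dots> = exp (\<i> * of_real (\<xi> $ i * h n)) * I" unfolding I_def by (rule integral_mult_right_zero)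
    finally have s: "(LINT x|lborel. exp (- \<i> * of_real (\<xi> \<bullet> x)) * \<phi> (x + h n *\<^sub>R ?e))
      = exp (\<i> * of_real (\<xi> $ i * h n)) * I" .
    have "(LINT x|lborel. exp (- \<i> * of_real (\<xi> \<bullet> x)) * q n x)
      = (LINT x|lborel. (exp (- \<i> * of_real (\<xi> \<bullet> x)) * \<phi> (x + h n *\<^sub>R ?e) - exp (- \<i> * of_real (\<xi> \<bullet> x)) * \<phi> x) / of_real (h n))"
      by (simp add: q_def algebra_simps diff_divide_distrib)
    also have "\<dots> = (exp (\<i> * of_real (\<xi> $ i * h n)) * I - I) / of_real (h n)"
      unfolding integral_divide_zero Bochner_Integration.integral_diff[OF i2 i1] s I_def[symmetric] ..
    also have "\<dots> = (exp (\<i> * of_real (\<xi> $ i * h n)) - 1) / of_real (h n) * I"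
      by (simp add: algebra_simps diff_divide_distrib)
    finally show ?thesis by (simp add: h_def)
  qed
  have L2: "(\<lambda>n. LINT x|lborel. exp (- \<i> * of_real (\<xi> \<bullet> x)) * q n x)
    \<longlonglongrightarrow> \<i> * of_real (\<xi> $ i) * I"
    unfolding e by (intro tendsto_mult tendsto_const phase_derivative)
  show ?thesis unfolding fourier_def LIMSEQ_unique[OF L1 L2] I_def by simp
qed

text \<open>Iterating the derivative rule and bounding a transform by the L^1 norm turns smoothness
  into decay.\<close>

lemma fourier_partial_deriv_power:
  assumes "\<phi> \<in> schwartz"
  shows "\<exists>C\<ge>0. \<forall>\<xi>. \<bar>\<xi> $ i\<bar> ^ n * cmod (fourier \<phi> \<xi>) \<le> C"
proof -
  have *: "(partial_deriv i ^^ n) \<phi> \<in> schwartz \<and> (\<forall>\<xi>. fourier ((partial_deriv i ^^ n) \<phi>) \<xi>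
    = (\<i> * of_real (\<xi> $ i)) ^ n * fourier \<phi> \<xi>)"
    by (induction n) (auto simp: assms fourier_partial_deriv schwartz_partial_deriv)
  define C where "C = (2 * pi) powr (- 3 / 2) * (LINT x|lborel. cmod ((partial_deriv i ^^ n) \<phi> x))"
  have "\<bar>\<xi> $ i\<bar> ^ n * cmod (fourier \<phi> \<xi>) \<le> C" for \<xi>
    using fourier_bound[of "(partial_deriv i ^^ n) \<phi>" \<xi>] * by (simp add: C_def norm_mult norm_power)
  moreover have "0 \<le> C" by (simp add: C_def)
  ultimately show ?thesis by blast
qed

lemma norm_sq_vec: "(norm (x::real^3))\<^sup>2 = (\<Sum>i\<in>UNIV. (x $ i)\<^sup>2)"
  unfolding power2_norm_eq_inner inner_vec_def by (simp add: power2_eq_square)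

text \<open>64 = 4^3: the sum is at most four times the largest of 1, a, b, c.\<close>

lemma sum_cube_bound:
  fixes a b c :: real assumes "0 \<le> a" "0 \<le> b" "0 \<le> c"
  shows "(1 + (a + b + c)) ^ 3 \<le> 64 * (1 + (a ^ 3 + b ^ 3 + c ^ 3))"
proof -
  define M where "M = max (max 1 a) (max b c)"
  have "(1 + (a + b + c)) ^ 3 \<le> (4 * M) ^ 3"
    using assms by (intro power_mono) (auto simp: M_def)
  also have "\<dots> = 64 * M ^ 3" by (simp add: power_mult_distrib)
  also have "M ^ 3 \<le> 1 + (a ^ 3 + b ^ 3 + c ^ 3)"
    using assms unfolding M_def max_def by (auto intro: add_nonneg_nonneg add_increasing add_increasing2)
  finally show ?thesis by simp
qed

text \<open>Six derivatives in each coordinate direction control |xi_i|^6 and hence (1 + |xi|^2)^3,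
  which is the decay that \<open>niceI\<close> asks for.\<close>

lemma schwartz_fourier_nice:
  assumes \<phi>: "\<phi> \<in> schwartz" shows "fourier \<phi> \<in> nice"
proof -
  obtain C where C: "\<And>i. 0 \<le> C i" "\<And>i \<xi>. \<bar>\<xi> $ i\<bar> ^ 6 * cmod (fourier \<phi> \<xi>) \<le> C i"
    using fourier_partial_deriv_power[OF \<phi>, of _ 6] by metis
  obtain B where B: "0 \<le> B" "\<And>\<xi>. cmod (fourier \<phi> \<xi>) \<le> B"
    using fourier_partial_deriv_power[OF \<phi>, of 1 0] by auto
  define D where "D = 64 * (B + (C 1 + C 2 + C 3))"
  show ?thesis
  proof (rule niceI)
    show "continuous_on UNIV (fourier \<phi>)" by (intro fourier_continuous schwartz_integrable \<phi>)
    show "0 \<le> D" by (simp add: D_def B C)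
    fix \<xi> :: "real^3"
    have "(1 + (norm \<xi>)\<^sup>2) ^ 3
      \<le> 64 * (1 + (\<bar>\<xi> $ 1\<bar> ^ 6 + \<bar>\<xi> $ 2\<bar> ^ 6 + \<bar>\<xi> $ 3\<bar> ^ 6))"
      using sum_cube_bound[of "(\<xi> $ 1)\<^sup>2" "(\<xi> $ 2)\<^sup>2" "(\<xi> $ 3)\<^sup>2"]
      by (simp add: norm_sq_vec sum_3 flip: power_mult)
    then have "(1 + (norm \<xi>)\<^sup>2) ^ 3 * cmod (fourier \<phi> \<xi>)
      \<le> 64 * (1 + (\<bar>\<xi> $ 1\<bar> ^ 6 + \<bar>\<xi> $ 2\<bar> ^ 6 + \<bar>\<xi> $ 3\<bar> ^ 6)) * cmod (fourier \<phi> \<xi>)"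
      by (rule mult_right_mono) simp
    also have "\<dots> = 64 * (cmod (fourier \<phi> \<xi>) + (\<bar>\<xi> $ 1\<bar> ^ 6 * cmod (fourier \<phi> \<xi>)
        + \<bar>\<xi> $ 2\<bar> ^ 6 * cmod (fourier \<phi> \<xi>) + \<bar>\<xi> $ 3\<bar> ^ 6 * cmod (fourier \<phi> \<xi>)))"
      by (simp add: algebra_simps)
    also have "\<dots> \<le> D" unfolding D_def
      by (intro mult_left_mono add_mono B C) simp
    finally have "(1 + (norm \<xi>)\<^sup>2) ^ 3 * cmod (fourier \<phi> \<xi>) \<le> D" .
    moreover have "0 < (1 + (norm \<xi>)\<^sup>2) ^ 3" by (simp add: add_pos_nonneg)
    ultimately show "cmod (fourier \<phi> \<xi>) \<le> D * decay \<xi>"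
      unfolding decay_def by (simp add: pos_le_divide_eq mult.commute)
  qed
qed

section \<open>Polynomials times Gaussians\<close>

text \<open>The complex polynomials in the coordinates, generated so that derivatives and growth can
  be treated by induction.\<close>

inductive_set cpoly :: "wavefun set" where
  cpoly_const: "(\<lambda>x. c) \<in> cpoly"
| cpoly_coord: "(\<lambda>x. of_real (x $ i)) \<in> cpoly"
| cpoly_add: "p \<in> cpoly \<Longrightarrow> q \<in> cpoly \<Longrightarrow> (\<lambda>x. p x + q x) \<in> cpoly"
| cpoly_mult: "p \<in> cpoly \<Longrightarrow> q \<in> cpoly \<Longrightarrow> (\<lambda>x. p x * q x) \<in> cpoly"

lemma cpoly_derivative:
  assumes "p \<in> cpoly"
  shows "\<exists>p'. (\<forall>i. p' i \<in> cpoly) \<and> (\<forall>x. (p has_derivative (\<lambda>h. \<Sum>i\<in>UNIV. of_real (h $ i) * p' i x)) (at x))"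
  using assms
proof induction
  case (cpoly_const c)
  show ?case by (intro exI[of _ "\<lambda>i x. 0"]) (auto intro: cpoly.cpoly_const)
next
  case (cpoly_coord j)
  have "((\<lambda>x. complex_of_real (x $ j)) has_derivative (\<lambda>h. of_real (h $ j))) (at x)" for x
    by (intro bounded_linear_imp_has_derivative bounded_linear_compose[OF bounded_linear_of_real] bounded_linear_vec_nth)
  moreover have "(\<Sum>i\<in>UNIV. of_real (h $ i) * (if i = j then 1 else 0 :: complex)) = of_real (h $ j)"
    for h :: "real^3"
    by (simp add: if_distrib cong: if_cong)
  ultimately show ?case
    by (intro exI[of _ "\<lambda>i x. if i = j then 1 else 0"]) (auto intro: cpoly.cpoly_const)
next
  case (cpoly_add p q)
  then obtain p' q' where p': "\<And>i. p' i \<in> cpoly"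
    "\<And>x. (p has_derivative (\<lambda>h. \<Sum>i\<in>UNIV. of_real (h $ i) * p' i x)) (at x)"
    and q': "\<And>i. q' i \<in> cpoly"
      "\<And>x. (q has_derivative (\<lambda>h. \<Sum>i\<in>UNIV. of_real (h $ i) * q' i x)) (at x)"
    by blast
  show ?case
  proof (intro exI[of _ "\<lambda>i x. p' i x + q' i x"] conjI allI)
    show "(\<lambda>x. p' i x + q' i x) \<in> cpoly" for i by (intro cpoly.cpoly_add p' q')
    show "((\<lambda>x. p x + q x) has_derivative (\<lambda>h. \<Sum>i\<in>UNIV. of_real (h $ i) * (p' i x
      + q' i x))) (at x)" for x
      using has_derivative_add[OF p'(2) q'(2), of x] by (simp add: distrib_left sum.distrib)
  qed
next
  case (cpoly_mult p q)
  then obtain p' q' where p': "\<And>i. p' i \<in> cpoly"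
    "\<And>x. (p has_derivative (\<lambda>h. \<Sum>i\<in>UNIV. of_real (h $ i) * p' i x)) (at x)"
    and q': "\<And>i. q' i \<in> cpoly"
      "\<And>x. (q has_derivative (\<lambda>h. \<Sum>i\<in>UNIV. of_real (h $ i) * q' i x)) (at x)"
    by blast
  show ?case
  proof (intro exI[of _ "\<lambda>i x. p x * q' i x + p' i x * q x"] conjI allI)
    show "(\<lambda>x. p x * q' i x + p' i x * q x) \<in> cpoly" for i
      by (intro cpoly.cpoly_add cpoly.cpoly_mult cpoly_mult p' q')
    show "((\<lambda>x. p x * q x) has_derivative (\<lambda>h. \<Sum>i\<in>UNIV. of_real (h $ i) * (p x * q' i x
      + p' i x * q x))) (at x)" for x
      using has_derivative_mult[OF p'(2) q'(2), of x]
      by (simp add: distrib_left sum.distrib sum_distrib_left sum_distrib_right mult_ac)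
  qed
qed

text \<open>An exponential bound passes to sums and products by adding the rates, and a Gaussian
  still beats it.\<close>

lemma cpoly_growth: "p \<in> cpoly \<Longrightarrow> \<exists>C n. 0
  \<le> C \<and> (\<forall>x. cmod (p x) \<le> C * exp (real n * norm x))"
proof (induction rule: cpoly.induct)
  case (cpoly_const c)
  show ?case by (intro exI[of _ "cmod c"] exI[of _ 0]) auto
next
  case (cpoly_coord i)
  have "\<bar>x $ i\<bar> \<le> exp (norm x)" for x :: "real^3"
    using component_le_norm_cart[of x i] exp_ge_add_one_self[of "norm x"] by linarith
  then show ?case by (intro exI[of _ 1] exI[of _ 1]) auto
next
  case (cpoly_add p q)
  then obtain C n D m where C: "0 \<le> C" "\<And>x. cmod (p x) \<le> C * exp (real n * norm x)"
    and D: "0 \<le> D" "\<And>x. cmod (q x) \<le> D * exp (real m * norm x)" by blast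
  have "cmod (p x + q x) \<le> (C + D) * exp (real (n + m) * norm x)" for x
  proof -
    have "C * exp (real n * norm x) \<le> C * exp (real (n + m) * norm x)"
      "D * exp (real m * norm x) \<le> D * exp (real (n + m) * norm x)"
      using C(1) D(1) by (auto intro!: mult_left_mono mult_right_mono)
    then show ?thesis using norm_triangle_ineq[of "p x" "q x"] C(2)[of x] D(2)[of x]
      by (simp add: distrib_right)
  qed
  then show ?case using C D by (intro exI[of _ "C + D"] exI[of _ "n + m"]) auto
next
  case (cpoly_mult p q)
  then obtain C n D m where C: "0 \<le> C" "\<And>x. cmod (p x) \<le> C * exp (real n * norm x)"
    and D: "0 \<le> D" "\<And>x. cmod (q x) \<le> D * exp (real m * norm x)" by blast
  have "cmod (p x * q x) \<le> (C * D) * exp (real (n + m) * norm x)" for x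
  proof -
    have "cmod (p x) * cmod (q x) \<le> (C * exp (real n * norm x)) * (D * exp (real m * norm x))"
      using C D by (intro mult_mono) auto
    moreover have "exp (real (n + m) * norm x) = exp (real n * norm x) * exp (real m * norm x)"
      by (simp add: distrib_right exp_add)
    ultimately show ?thesis by (simp add: norm_mult mult_ac)
  qed
  then show ?case using C D by (intro exI[of _ "C * D"] exI[of _ "n + m"]) auto
qed

text \<open>Complex parameters make room for everything applied to a Gaussian here: the free
  multiplier adds i t to z, Galilei maps change \<beta>, and the Fourier transform of
  \<open>gauss\<close> is a multiple of such a function. Decay is governed by Re z > 0.\<close>

definition cgauss :: "complex \<Rightarrow> (3 \<Rightarrow> complex) \<Rightarrow> wavefun" where
  "cgauss z \<beta> x = exp (- z * of_real ((norm x)\<^sup>2) + (\<Sum>i\<in>UNIV. \<beta> i * of_real (x $ i)))"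

text \<open>Fixed z and \<beta>, arbitrary polynomial factor: closed under derivatives and under
  multiplication by coordinates, so Schwartz bounds for one member follow from plain bounds for
  all.\<close>

definition gclass :: "complex \<Rightarrow> (3 \<Rightarrow> complex) \<Rightarrow> wavefun set" where
  "gclass z \<beta> = {\<lambda>x. p x * cgauss z \<beta> x |p. p \<in> cpoly}"

lemma gclassE:
  assumes "w \<in> gclass z \<beta>" obtains p where "p \<in> cpoly" "w = (\<lambda>x. p x * cgauss z \<beta> x)"
  using assms unfolding gclass_def by blast

lemma gclassI: "p \<in> cpoly \<Longrightarrow> (\<lambda>x. p x * cgauss z \<beta> x) \<in> gclass z \<beta>"
  unfolding gclass_def by blast

lemma gclass_mult: assumes "q \<in> cpoly" "w \<in> gclass z \<beta>" shows "(\<lambda>x. q x * w x) \<in> gclass z \<beta>"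
proof -
  obtain p where p: "p \<in> cpoly" "w = (\<lambda>x. p x * cgauss z \<beta> x)" using assms(2) by (rule gclassE)
  show ?thesis using gclassI[OF cpoly_mult[OF assms(1) p(1)], of z \<beta>] by (simp add: p(2) mult.assoc)
qed

lemma gclass_add: assumes "w \<in> gclass z \<beta>" "w' \<in> gclass z \<beta>" shows
  "(\<lambda>x. w x + w' x) \<in> gclass z \<beta>"
proof -
  obtain p where p: "p \<in> cpoly" "w = (\<lambda>x. p x * cgauss z \<beta> x)" using assms(1) by (rule gclassE)
  obtain q where q: "q \<in> cpoly" "w' = (\<lambda>x. q x * cgauss z \<beta> x)" using assms(2) by (rule gclassE)
  show ?thesis using gclassI[OF cpoly_add[OF p(1) q(1)], of z \<beta>] by (simp add: p(2) q(2) distrib_right)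
qed

lemma gclass_const_mult: "w \<in> gclass z \<beta> \<Longrightarrow> (\<lambda>x. c * w x) \<in> gclass z \<beta>"
  by (rule gclass_mult[OF cpoly_const])

lemma gclass_sum:
  fixes W :: "3 \<Rightarrow> wavefun"
  assumes "\<And>i. W i \<in> gclass z \<beta>" shows "(\<lambda>x. \<Sum>i\<in>UNIV. W i x) \<in> gclass z \<beta>"
  unfolding sum_3 by (intro gclass_add assms)

lemma gclass_normsq: "w \<in> gclass z \<beta>
  \<Longrightarrow> (\<lambda>x. of_real ((norm x)\<^sup>2) * w x) \<in> gclass z \<beta>"
proof -
  assume w: "w \<in> gclass z \<beta>"
  have "(\<lambda>x. \<Sum>i\<in>UNIV. of_real (x $ i) * (of_real (x $ i) * w x)) \<in> gclass z \<beta>"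
    by (intro gclass_sum gclass_mult cpoly_coord w)
  moreover have "of_real ((norm x)\<^sup>2) * w x = (\<Sum>i\<in>UNIV. of_real (x $ i) * (of_real (x $ i) * w x))" for x
    unfolding norm_sq_vec by (simp add: sum_distrib_right power2_eq_square mult.assoc)
  ultimately show ?thesis by (simp only:)
qed

lemma sum_axis: "(\<Sum>i\<in>UNIV. of_real ((axis j 1 :: real^3) $ i) * F i) = (F j :: complex)"
proof -
  have "of_real ((axis j 1 :: real^3) $ i) * F i = (if i = j then F i else 0)" for i
    by (simp add: axis_def)
  then show ?thesis by simp
qed

lemma cgauss_in_gclass: "(\<lambda>x. c * cgauss z \<beta> x) \<in> gclass z \<beta>"
  by (rule gclassI[OF cpoly_const])

lemma cgauss_derivative:
  "(cgauss z \<beta> has_derivative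
     (\<lambda>h. \<Sum>i\<in>UNIV. of_real (h $ i) * ((- 2 * z * of_real (x $ i) + \<beta> i) * cgauss z \<beta> x))) (at x)"
proof -
  have "((\<lambda>x. - z * of_real (x \<bullet> x) + (\<Sum>i\<in>UNIV. \<beta> i * of_real (x $ i))) has_derivative
      (\<lambda>h. - z * of_real (x \<bullet> h + h \<bullet> x) + (\<Sum>i\<in>UNIV. \<beta> i * of_real (h $ i)))) (at x)"
    by (intro has_derivative_add has_derivative_mult_right has_derivative_of_real has_derivative_inner
        has_derivative_ident has_derivative_sum bounded_linear_imp_has_derivative bounded_linear_vec_nth)
  from has_derivative_compose[OF this DERIV_exp[unfolded has_field_derivative_def]]
  have "(cgauss z \<beta> has_derivative
     (\<lambda>h. cgauss z \<beta> x * (- z * of_real (x \<bullet> h + h \<bullet> x) + (\<Sum>i\<in>UNIV. \<beta> i * of_real (h $ i))))) (at x)"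
    unfolding cgauss_def[abs_def] power2_norm_eq_inner by (simp add: mult.commute)
  moreover have "cgauss z \<beta> x * (- z * of_real (x \<bullet> h + h \<bullet> x)
    + (\<Sum>i\<in>UNIV. \<beta> i * of_real (h $ i)))
     = (\<Sum>i\<in>UNIV. of_real (h $ i) * ((- 2 * z * of_real (x $ i) + \<beta> i) * cgauss z \<beta> x))" for h
    by (simp add: inner_vec_def sum_3 algebra_simps)
  ultimately show ?thesis by simp
qed

lemma gclass_derivative:
  assumes "w \<in> gclass z \<beta>"
  shows "(w has_derivative (\<lambda>h. \<Sum>i\<in>UNIV. of_real (h $ i) * partial_deriv i w x)) (at x)"
    and "partial_deriv i w \<in> gclass z \<beta>"
proof -
  obtain p where p: "p \<in> cpoly" "w = (\<lambda>x. p x * cgauss z \<beta> x)" using assms by (rule gclassE)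
  obtain p' where p': "\<And>i. p' i \<in> cpoly"
    "\<And>x. (p has_derivative (\<lambda>h. \<Sum>i\<in>UNIV. of_real (h $ i) * p' i x)) (at x)"
    using cpoly_derivative[OF p(1)] by blast
  define r where "r i x = p x * (- 2 * z * of_real (x $ i) + \<beta> i) + p' i x" for i x
  have r: "r i \<in> cpoly" for i
    unfolding r_def by (intro cpoly_add cpoly_mult cpoly_const cpoly_coord p p')
  have D: "(w has_derivative (\<lambda>h. \<Sum>i\<in>UNIV. of_real (h $ i) * (r i x * cgauss z \<beta> x))) (at x)" for x
    using has_derivative_mult[OF p'(2)[of x] cgauss_derivative[of z \<beta> x]]
    by (simp add: p(2) r_def sum_3 algebra_simps)
  have pd: "partial_deriv i w x = r i x * cgauss z \<beta> x" for i x
    by (subst partial_deriv_eqI[OF D[of x]]) (rule sum_axis)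
  show "(w has_derivative (\<lambda>h. \<Sum>i\<in>UNIV. of_real (h $ i) * partial_deriv i w x)) (at x)"
    unfolding pd by (rule D)
  have "partial_deriv i w = (\<lambda>x. r i x * cgauss z \<beta> x)" using pd by blast
  then show "partial_deriv i w \<in> gclass z \<beta>" using gclassI[OF r] by simp
qed

lemma gclass_bound:
  assumes z: "0 < Re z" and "w \<in> gclass z \<beta>"
  shows "\<exists>C. 0 \<le> C \<and> (\<forall>x. norm x ^ k * cmod (w x) \<le> C)"
proof -
  obtain p where p: "p \<in> cpoly" "w = (\<lambda>x. p x * cgauss z \<beta> x)" using assms(2) by (rule gclassE)
  obtain C n where C: "0 \<le> C" "\<And>x. cmod (p x) \<le> C * exp (real n * norm x)" using cpoly_growth[OF p(1)] by blast
  define B where "B = (\<Sum>i\<in>UNIV. \<bar>Re (\<beta> i)\<bar>)"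
  define M where "M = real k + real n + B"
  have g: "cmod (cgauss z \<beta> x) \<le> exp (- Re z * (norm x)\<^sup>2 + B * norm x)" for x
  proof -
    have "(\<Sum>i\<in>UNIV. Re (\<beta> i) * x $ i) \<le> (\<Sum>i\<in>UNIV. \<bar>Re (\<beta> i)\<bar> * norm x)"
    proof (intro sum_mono)
      fix i
      have "Re (\<beta> i) * x $ i \<le> \<bar>Re (\<beta> i)\<bar> * \<bar>x $ i\<bar>" by (metis abs_ge_self abs_mult)
      also have "\<dots> \<le> \<bar>Re (\<beta> i)\<bar> * norm x" by (intro mult_left_mono component_le_norm_cart) auto
      finally show "Re (\<beta> i) * x $ i \<le> \<bar>Re (\<beta> i)\<bar> * norm x" .
    qed
    then show ?thesis by (simp add: cgauss_def norm_exp_eq_Re B_def sum_distrib_right)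
  qed
  have "norm x ^ k * cmod (w x) \<le> C * exp (M\<^sup>2 / (4 * Re z))" for x
  proof -
    have "norm x ^ k \<le> exp (norm x) ^ k"
      using exp_ge_add_one_self[of "norm x"] by (intro power_mono) (linarith, simp)
    then have 1: "norm x ^ k \<le> exp (real k * norm x)" by (simp add: exp_of_nat_mult)
    have "norm x ^ k * (cmod (p x) * cmod (cgauss z \<beta> x))
      \<le> exp (real k * norm x) * (C * exp (real n * norm x) * exp (- Re z * (norm x)\<^sup>2 + B * norm x))"
      using C g by (intro mult_mono 1) auto
    also have "\<dots> = C * exp (- Re z * (norm x)\<^sup>2 + M * norm x)"
      by (simp add: M_def algebra_simps flip: exp_add)
    also have "\<dots> \<le> C * exp (M\<^sup>2 / (4 * Re z))"
    proof (intro mult_left_mono C)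
      \<comment> \<open>Completing the square shows the exponent to be at most M^2 / (4 Re
        z).\<close>
      have "0 \<le> (2 * Re z * norm x - M)\<^sup>2" by simp
      also have "\<dots> = 4 * Re z * (Re z * (norm x)\<^sup>2 - M * norm x) + M\<^sup>2"
        by (simp add: power2_eq_square algebra_simps)
      finally have "- Re z * (norm x)\<^sup>2 + M * norm x \<le> M\<^sup>2 / (4 * Re z)"
        using z by (simp add: field_simps)
      then show "exp (- Re z * (norm x)\<^sup>2 + M * norm x) \<le> exp (M\<^sup>2 / (4 * Re z))" by simp
    qed
    finally show ?thesis by (simp add: p(2) norm_mult)
  qed
  then show ?thesis using C(1) by (intro exI[of _ "C * exp (M\<^sup>2 / (4 * Re z))"]) auto
qed

lemma gclass_schwartz:
  assumes z: "0 < Re z" and w: "w \<in> gclass z \<beta>" shows "w \<in> schwartz"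
proof -
  have g: "foldr partial_deriv is w \<in> gclass z \<beta>" for "is"
    by (induction "is") (auto simp: w gclass_derivative)
  show ?thesis
  proof (rule schwartzI)
    show "foldr partial_deriv is w differentiable at x" for "is" x
      using gclass_derivative(1)[OF g] unfolding differentiable_def by blast
    show "bounded (range (\<lambda>x. norm x ^ k *\<^sub>R foldr partial_deriv is w x))" for "is" k
      using gclass_bound[OF z g, of k "is"] unfolding bounded_iff by auto
  qed
qed

text \<open>Differentiation under the integral with an explicit error: Taylor's bound for exp(i
  theta) leaves at most (2 pi)^(-3/2) K |y - x|^2, where K is the second moment of |w|.\<close>

lemma inv_fourier_derivative:
  assumes z: "0 < Re z" and w: "w \<in> gclass z \<beta>"
  shows "(inv_fourier w has_derivative
      (\<lambda>h. \<Sum>i\<in>UNIV. of_real (h $ i) * inv_fourier (\<lambda>\<xi>. \<i> * of_real (\<xi> $ i) * w \<xi>) x)) (at x)"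
proof -
  let ?c = "(2 * pi) powr (- 3 / 2)"
  define D where "D h = (\<Sum>i\<in>UNIV. of_real (h $ i) * inv_fourier (\<lambda>\<xi>. \<i> * of_real (\<xi> $ i) * w \<xi>) x)" for h :: "real^3"
  have int: "integrable lborel v" if "v \<in> gclass z \<beta>" for v
    by (intro schwartz_integrable gclass_schwartz[OF z that])
  have wi: "integrable lborel (\<lambda>\<xi>. exp (\<i> * of_real (\<xi> \<bullet> y)) * w \<xi>)" for y
    using integrable_phase(1)[OF int[OF w], of y] by (simp add: inner_commute)
  have ci: "integrable lborel (\<lambda>\<xi>. exp (\<i> * of_real (\<xi> \<bullet> y)) * (\<i> * of_real (\<xi> $ i) * w \<xi>))" for y i
    using integrable_phase(1)[OF int[OF gclass_const_mult[OF gclass_mult[OF cpoly_coord w]]], of y "\<i>" i]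
    by (simp add: inner_commute mult.assoc)
  have ni: "integrable lborel (\<lambda>\<xi>. (norm \<xi>)\<^sup>2 * cmod (w \<xi>))"
    using integrable_norm[OF int[OF gclass_normsq[OF w]]] by (simp add: norm_mult del: of_real_power)
  define K where "K = (LINT \<xi>|lborel. (norm \<xi>)\<^sup>2 * cmod (w \<xi>))"
  have D_eq: "D h = ?c *\<^sub>R (LINT \<xi>|lborel. exp (\<i> * of_real (\<xi> \<bullet> x)) * (\<i> * of_real (\<xi> \<bullet> h) * w \<xi>))"
    and Di: "integrable lborel (\<lambda>\<xi>. exp (\<i> * of_real (\<xi> \<bullet> x)) * (\<i> * of_real (\<xi> \<bullet> h) * w \<xi>))" for h
  proof -
    have e: "exp (\<i> * of_real (\<xi> \<bullet> x)) * (\<i> * of_real (\<xi> \<bullet> h) * w \<xi>)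
      = (\<Sum>i\<in>UNIV. of_real (h $ i) * (exp (\<i> * of_real (\<xi> \<bullet> x)) * (\<i> * of_real (\<xi> $ i) * w \<xi>)))" for \<xi>
      by (simp add: inner_vec_def[of \<xi> h] sum_3 algebra_simps)
    show "integrable lborel (\<lambda>\<xi>. exp (\<i> * of_real (\<xi> \<bullet> x)) * (\<i> * of_real (\<xi> \<bullet> h) * w \<xi>))"
      unfolding e by (intro Bochner_Integration.integrable_sum integrable_mult_right ci)
    show "D h = ?c *\<^sub>R (LINT \<xi>|lborel. exp (\<i> * of_real (\<xi> \<bullet> x)) * (\<i> * of_real (\<xi> \<bullet> h) * w \<xi>))"
      unfolding e
      by (subst Bochner_Integration.integral_sum)
         (auto intro!: integrable_mult_right ci simp: D_def inv_fourier_def scaleR_sum_right)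
  qed
  have bl: "bounded_linear D"
    unfolding D_def
    by (intro bounded_linear_sum bounded_linear_mult_const bounded_linear_compose[OF bounded_linear_of_real] bounded_linear_vec_nth)
  have est: "norm (inv_fourier w y - inv_fourier w x - D (y - x)) \<le> ?c * K * (norm (y - x))\<^sup>2" for y
  proof -
    have X: "inv_fourier w y - inv_fourier w x - D (y - x)
      = ?c *\<^sub>R (LINT \<xi>|lborel. exp (\<i> * of_real (\<xi> \<bullet> y)) * w \<xi> - exp (\<i> * of_real (\<xi> \<bullet> x)) * w \<xi>
           - exp (\<i> * of_real (\<xi> \<bullet> x)) * (\<i> * of_real (\<xi> \<bullet> (y - x)) * w \<xi>))"
      unfolding inv_fourier_def D_eq using wi Di by (simp add: scaleR_diff_right)
    have "norm (inv_fourier w y - inv_fourier w x - D (y - x))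
      = ?c * cmod (LINT \<xi>|lborel. exp (\<i> * of_real (\<xi> \<bullet> y)) * w \<xi> - exp (\<i> * of_real (\<xi> \<bullet> x)) * w \<xi>
           - exp (\<i> * of_real (\<xi> \<bullet> x)) * (\<i> * of_real (\<xi> \<bullet> (y - x)) * w \<xi>))" unfolding X by simp
    also have "\<dots> \<le> ?c * (LINT \<xi>|lborel. (norm (y - x))\<^sup>2 * ((norm \<xi>)\<^sup>2 * cmod (w \<xi>)))"
    proof (rule mult_left_mono[OF norm_integral_le], goal_cases)
      case 3
      show ?case
      proof (rule AE_I2)
        fix \<xi> :: "real^3"
        let ?\<theta> = "\<xi> \<bullet> (y - x)"
        have "exp (\<i> * of_real (\<xi> \<bullet> y)) * w \<xi> - exp (\<i> * of_real (\<xi> \<bullet> x)) * w \<xi>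
             - exp (\<i> * of_real (\<xi> \<bullet> x)) * (\<i> * of_real ?\<theta> * w \<xi>)
           = exp (\<i> * of_real (\<xi> \<bullet> x)) * (exp (\<i> * of_real ?\<theta>) - (\<Sum>k\<le>1. (\<i> * of_real ?\<theta>) ^ k / fact k)) * w \<xi>"
        proof -
          have y: "exp (\<i> * of_real (\<xi> \<bullet> y))
            = exp (\<i> * of_real (\<xi> \<bullet> x)) * exp (\<i> * of_real ?\<theta>)"
            unfolding exp_add[symmetric] by (simp add: inner_diff_right algebra_simps)
          have s: "(\<Sum>k\<le>1. (\<i> * of_real ?\<theta>) ^ k / fact k) = 1 + \<i> * of_real ?\<theta>" by simp
          show ?thesis unfolding y s
            by (simp only: left_diff_distrib right_diff_distrib distrib_left distrib_right mult_1_right mult.assoc diff_diff_eq)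
        qed
        then have "norm (exp (\<i> * of_real (\<xi> \<bullet> y)) * w \<xi> - exp (\<i> * of_real (\<xi> \<bullet> x)) * w \<xi>
             - exp (\<i> * of_real (\<xi> \<bullet> x)) * (\<i> * of_real ?\<theta> * w \<xi>))
           = cmod (exp (\<i> * of_real ?\<theta>) - (\<Sum>k\<le>1. (\<i> * of_real ?\<theta>) ^ k / fact k)) * cmod (w \<xi>)"
          by (simp only: norm_mult norm_phase)
        also have "\<dots> \<le> (norm (y - x) * norm \<xi>)\<^sup>2 * cmod (w \<xi>)"
        proof (intro mult_right_mono)
          have "cmod (exp (\<i> * of_real ?\<theta>) - (\<Sum>k\<le>1. (\<i> * of_real ?\<theta>) ^ k / fact k))
            \<le> \<bar>?\<theta>\<bar> ^ Suc 1 / fact (Suc 1)"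
            by (rule iexp_approx1)
          also have "\<dots> \<le> \<bar>?\<theta>\<bar>\<^sup>2" by (simp add: numeral_2_eq_2)
          also have "\<dots> \<le> (norm (y - x) * norm \<xi>)\<^sup>2"
            using Cauchy_Schwarz_ineq2[of \<xi> "y - x"] by (intro power_mono) (auto simp: mult.commute)
          finally show "cmod (exp (\<i> * of_real ?\<theta>) - (\<Sum>k\<le>1. (\<i> * of_real ?\<theta>) ^ k / fact k))
            \<le> (norm (y - x) * norm \<xi>)\<^sup>2" .
        qed simp
        finally show "norm (exp (\<i> * of_real (\<xi> \<bullet> y)) * w \<xi> - exp (\<i> * of_real (\<xi> \<bullet> x)) * w \<xi>
             - exp (\<i> * of_real (\<xi> \<bullet> x)) * (\<i> * of_real ?\<theta> * w \<xi>))
            \<le> (norm (y - x))\<^sup>2 * ((norm \<xi>)\<^sup>2 * cmod (w \<xi>))" by (simp add: power_mult_distrib mult.assoc)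
      qed
    next
      case 1
      show ?case by (intro Bochner_Integration.integrable_diff wi Di)
    next
      case 2
      show ?case by (intro integrable_mult_right ni)
    qed simp
    also have "\<dots> = ?c * K * (norm (y - x))\<^sup>2" by (simp add: K_def)
    finally show ?thesis .
  qed
  show ?thesis
    unfolding D_def[symmetric] has_derivative_iff_norm
  proof (intro conjI bl)
    show "((\<lambda>y. norm (inv_fourier w y - inv_fourier w x - D (y - x)) / norm (y - x)) \<longlongrightarrow> 0) (at x)"
    proof (rule tendsto_sandwich[OF always_eventually _ tendsto_const])
      show "\<forall>\<^sub>F y in at x. norm (inv_fourier w y - inv_fourier w x - D (y - x)) / norm (y - x)
        \<le> ?c * K * norm (y - x)"
        unfolding eventually_at_filter
      proof (intro always_eventually allI impI)
        fix y assume "y \<noteq> x"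
        then show "norm (inv_fourier w y - inv_fourier w x - D (y - x)) / norm (y - x) \<le> ?c * K * norm (y - x)"
          using est[of y] by (simp add: divide_le_eq power2_eq_square mult.assoc)
      qed
      have "((\<lambda>y. ?c * K * norm (y - x)) \<longlongrightarrow> ?c * K * norm (x - x)) (at x)"
        by (intro tendsto_intros)
      then show "((\<lambda>y. ?c * K * norm (y - x)) \<longlongrightarrow> 0) (at x)" by simp
    qed simp
  qed
qed

lemma partial_deriv_inv_fourier:
  assumes "0 < Re z" "w \<in> gclass z \<beta>"
  shows "partial_deriv i (inv_fourier w) = inv_fourier (\<lambda>\<xi>. \<i> * of_real (\<xi> $ i) * w \<xi>)"
proof
  fix x
  show "partial_deriv i (inv_fourier w) x = inv_fourier (\<lambda>\<xi>. \<i> * of_real (\<xi> $ i) * w \<xi>) x"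
    by (subst partial_deriv_eqI[OF inv_fourier_derivative[OF assms]]) (rule sum_axis)
qed

lemma gclass_imult: "w \<in> gclass z \<beta>
  \<Longrightarrow> (\<lambda>\<xi>. \<i> * of_real (\<xi> $ i) * w \<xi>) \<in> gclass z \<beta>"
  using gclass_const_mult[OF gclass_mult[OF cpoly_coord], of w z \<beta> "\<i>" i] by (simp add: mult.assoc)

lemma gclass_measurable: "0 < Re z \<Longrightarrow> w \<in> gclass z \<beta>
  \<Longrightarrow> w \<in> borel_measurable borel"
  by (intro schwartz_measurable gclass_schwartz)

text \<open>The derivative rule for the Fourier transform, read at the reflected point -x.\<close>

lemma coord_inv_fourier:
  assumes z: "0 < Re z" and w: "w \<in> gclass z \<beta>"
  shows "of_real (x $ i) * inv_fourier w x = inv_fourier (\<lambda>\<xi>. \<i> * partial_deriv i w \<xi>) x"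
proof -
  note w' = gclass_derivative(2)[OF w, of i]
  have "inv_fourier (\<lambda>\<xi>. \<i> * partial_deriv i w \<xi>) x = \<i> * inv_fourier (partial_deriv i w) x"
    unfolding inv_fourier_def
    by (subst mult.left_commute) (simp add: scaleR_conv_of_real)
  also have "\<dots> = \<i> * fourier (partial_deriv i w) (- x)"
    by (simp add: inv_fourier_eq gclass_measurable[OF z w'])
  also have "\<dots> = of_real (x $ i) * fourier w (- x)"
    by (simp add: fourier_partial_deriv[OF gclass_schwartz[OF z w]] flip: mult.assoc)
  also have "\<dots> = of_real (x $ i) * inv_fourier w x"
    by (simp add: inv_fourier_eq gclass_measurable[OF z w])
  finally show ?thesis by simp
qed

lemma inv_fourier_add:
  assumes "integrable lborel f" "integrable lborel g"
  shows "inv_fourier (\<lambda>\<xi>. f \<xi> + g \<xi>) x = inv_fourier f x + inv_fourier g x"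
  using integrable_phase(1)[OF assms(1), of x] integrable_phase(1)[OF assms(2), of x]
  by (simp add: inv_fourier_def distrib_left scaleR_right_distrib inner_commute)

lemma inv_fourier_cmult: "inv_fourier (\<lambda>\<xi>. c * f \<xi>) x = c * inv_fourier f x"
proof -
  have "(LINT \<xi>|lborel. exp (\<i> * of_real (x \<bullet> \<xi>)) * (c * f \<xi>))
    = c * (LINT \<xi>|lborel. exp (\<i> * of_real (x \<bullet> \<xi>)) * f \<xi>)"
    unfolding integral_mult_right_zero[symmetric] by (simp add: mult_ac)
  then show ?thesis by (simp add: inv_fourier_def inner_commute)
qed

lemma inv_fourier_bound: "cmod (inv_fourier f \<xi>) \<le> (2 * pi) powr (- 3 / 2) * (LINT x|lborel. cmod (f x))"
  using integral_norm_bound[of lborel "\<lambda>x. exp (\<i> * of_real (\<xi> \<bullet> x)) * f x"]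
  by (auto simp: inv_fourier_def norm_mult inner_commute intro!: mult_left_mono)

text \<open>Each factor |x|^2 turns into second derivatives of w, which stay in the class;
  boundedness of inverse transforms thus yields decay of any order.\<close>

lemma inv_fourier_gclass_decay:
  assumes z: "0 < Re z" and w: "w \<in> gclass z \<beta>"
  shows "\<exists>w'\<in>gclass z \<beta>. \<forall>x. of_real (norm x ^ (2 * m)) * inv_fourier w x = inv_fourier w' x"
proof (induction m)
  case 0
  show ?case using w by (intro bexI[of _ w]) auto
next
  case (Suc m)
  then obtain v where v: "v \<in> gclass z \<beta>" "\<And>x. of_real (norm x ^ (2 * m)) * inv_fourier w x = inv_fourier v x"
    by blast
  define v' where "v' i = (\<lambda>\<xi>. \<i> * partial_deriv i v \<xi>)" for i
  have v': "v' i \<in> gclass z \<beta>" for i unfolding v'_def by (intro gclass_const_mult gclass_derivative v)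
  define v'' where "v'' i = (\<lambda>\<xi>. \<i> * partial_deriv i (v' i) \<xi>)" for i
  have v'': "v'' i \<in> gclass z \<beta>" for i unfolding v''_def by (intro gclass_const_mult gclass_derivative v')
  have i: "integrable lborel (v'' i)" for i by (intro schwartz_integrable gclass_schwartz[OF z v''])
  show ?case
  proof (intro bexI allI)
    show "(\<lambda>\<xi>. v'' 1 \<xi> + v'' 2 \<xi> + v'' 3 \<xi>) \<in> gclass z \<beta>" by (intro gclass_add v'')
    fix x
    have "of_real (norm x ^ (2 * Suc m)) * inv_fourier w x = of_real ((norm x)\<^sup>2) * inv_fourier v x"
      by (simp add: v(2)[symmetric] power2_eq_square mult_ac)
    also have "\<dots> = (\<Sum>i\<in>UNIV. of_real (x $ i) * (of_real (x $ i) * inv_fourier v x))"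
      unfolding norm_sq_vec by (simp add: sum_distrib_right power2_eq_square mult.assoc)
    also have "\<dots> = (\<Sum>i\<in>UNIV. inv_fourier (v'' i) x)"
      unfolding coord_inv_fourier[OF z v(1)] v'_def[symmetric] coord_inv_fourier[OF z v'] v''_def[symmetric] ..
    also have "\<dots> = inv_fourier (\<lambda>\<xi>. v'' 1 \<xi> + v'' 2 \<xi> + v'' 3 \<xi>) x"
      using i by (simp add: sum_3 inv_fourier_add)
    finally show "of_real (norm x ^ (2 * Suc m)) * inv_fourier w x
      = inv_fourier (\<lambda>\<xi>. v'' 1 \<xi> + v'' 2 \<xi> + v'' 3 \<xi>) x" .
  qed
qed

text \<open>The weak equation of the propagator admits as test functions only members of
  \<open>schwartz\<close>, so evolved Gaussians must be Schwartz functions in full. Derivatives and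
  even powers of |x| keep the form \<open>inv_fourier v\<close> with v in the class, and such
  functions are bounded.\<close>

lemma inv_fourier_gclass_schwartz:
  assumes z: "0 < Re z" and w: "w \<in> gclass z \<beta>"
  shows "inv_fourier w \<in> schwartz"
proof -
  have g: "\<exists>v\<in>gclass z \<beta>. foldr partial_deriv is (inv_fourier w) = inv_fourier v" for "is"
  proof (induction "is")
    case Nil
    show ?case using w by auto
  next
    case (Cons i "is")
    then show ?case using partial_deriv_inv_fourier[OF z] gclass_imult by fastforce
  qed
  show ?thesis
  proof (rule schwartzI)
    fix "is" x
    obtain v where v: "v \<in> gclass z \<beta>" "foldr partial_deriv is (inv_fourier w) = inv_fourier v" using g by blast
    show "foldr partial_deriv is (inv_fourier w) differentiable at x"
      unfolding v(2) using inv_fourier_derivative[OF z v(1)] unfolding differentiable_def by blast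
  next
    fix "is" k
    obtain v where v: "v \<in> gclass z \<beta>" "foldr partial_deriv is (inv_fourier w) = inv_fourier v" using g by blast
    obtain v' where v': "v' \<in> gclass z \<beta>"
      "\<And>x. of_real (norm x ^ (2 * k)) * inv_fourier v x = inv_fourier v' x"
      using inv_fourier_gclass_decay[OF z v(1)] by blast
    define B where "B f = (2 * pi) powr (- 3 / 2) * (LINT x|lborel. cmod (f x))" for f :: wavefun
    have "norm (norm x ^ k *\<^sub>R inv_fourier v x) \<le> B v + B v'" for x
    proof -
      \<comment> \<open>Decay is available for even powers; r <= 1 + r^2 covers the others.\<close>
      have "norm x ^ k \<le> 1 + norm x ^ (2 * k)"
      proof -
        have "2 * norm x ^ k \<le> 1 + (norm x ^ k)\<^sup>2"
          using sum_squares_bound[of 1 "norm x ^ k"] by simp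
        moreover have "0 \<le> norm x ^ k" by simp
        moreover have "norm x ^ (2 * k) = (norm x ^ k)\<^sup>2" by (simp add: mult.commute flip: power_mult)
        ultimately show ?thesis by linarith
      qed
      then have "norm x ^ k * cmod (inv_fourier v x) \<le> (1 + norm x ^ (2 * k)) * cmod (inv_fourier v x)"
        by (rule mult_right_mono) simp
      also have "\<dots> = cmod (inv_fourier v x) + cmod (inv_fourier v' x)"
        unfolding v'(2)[symmetric] by (simp add: norm_mult norm_power distrib_right)
      also have "\<dots> \<le> B v + B v'" unfolding B_def by (intro add_mono inv_fourier_bound)
      finally show ?thesis by simp
    qed
    then show "bounded (range (\<lambda>x. norm x ^ k *\<^sub>R foldr partial_deriv is (inv_fourier w) x))"
      unfolding v(2) bounded_iff by blast
  qed
qed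

lemma laplacian_inv_fourier:
  assumes z: "0 < Re z" and w: "w \<in> gclass z \<beta>"
  shows "laplacian (inv_fourier w) x = inv_fourier (\<lambda>\<xi>. - (of_real ((norm \<xi>)\<^sup>2) * w \<xi>)) x"
proof -
  define v where "v i = (\<lambda>\<xi>. \<i> * of_real (\<xi> $ i) * (\<i> * of_real (\<xi> $ i) * w \<xi>))" for i
  have v: "v i \<in> gclass z \<beta>" for i unfolding v_def by (intro gclass_imult w)
  have i: "integrable lborel (v i)" for i by (intro schwartz_integrable gclass_schwartz[OF z v])
  have "laplacian (inv_fourier w) x = (\<Sum>i\<in>UNIV. inv_fourier (v i) x)"
    unfolding laplacian_def partial_deriv_inv_fourier[OF z w] partial_deriv_inv_fourier[OF z gclass_imult[OF w]] v_def ..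
  also have "\<dots> = inv_fourier (\<lambda>\<xi>. v 1 \<xi> + v 2 \<xi> + v 3 \<xi>) x"
    using i by (simp add: sum_3 inv_fourier_add)
  also have "(\<lambda>\<xi>. v 1 \<xi> + v 2 \<xi> + v 3 \<xi>)
    = (\<lambda>\<xi>. - (of_real ((norm \<xi>)\<^sup>2) * w \<xi>))"
  proof
    fix \<xi>
    have "v i \<xi> = - (of_real ((\<xi> $ i)\<^sup>2) * w \<xi>)" for i
    proof -
      have "v i \<xi> = (\<i> * \<i>) * (of_real (\<xi> $ i) * of_real (\<xi> $ i) * w \<xi>)"
        unfolding v_def by (simp only: mult_ac)
      then show "v i \<xi> = - (of_real ((\<xi> $ i)\<^sup>2) * w \<xi>)" by (simp add: power2_eq_square)
    qed
    then show "v 1 \<xi> + v 2 \<xi> + v 3 \<xi> = - (of_real ((norm \<xi>)\<^sup>2) * w \<xi>)"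
      by (simp add: norm_sq_vec sum_3 algebra_simps)
  qed
  finally show ?thesis .
qed

section \<open>The free evolution\<close>

lemma Lp_norm_2_tendsto_iff:
  assumes "\<And>n. G n \<in> Lp_space 2"
  shows "((\<lambda>n. Lp_norm 2 (G n)) \<longlongrightarrow> 0) F
    \<longleftrightarrow> ((\<lambda>n. nrm (G n)) \<longlongrightarrow> 0) F"
proof
  assume "((\<lambda>n. Lp_norm 2 (G n)) \<longlongrightarrow> 0) F"
  then have *: "\<forall>\<^sub>F n in F. nrm (G n) \<le> e" if "0 < e" for e
    using that unfolding ennreal_tendsto_0_iff Lp_norm_2[OF assms] by simp
  show "((\<lambda>n. nrm (G n)) \<longlongrightarrow> 0) F"
  proof (rule tendstoI)
    fix e :: real assume "0 < e"
    then show "\<forall>\<^sub>F n in F. dist (nrm (G n)) 0 < e"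
      using *[of "e/2"] by (auto elim: eventually_mono)
  qed
next
  assume *: "((\<lambda>n. nrm (G n)) \<longlongrightarrow> 0) F"
  show "((\<lambda>n. Lp_norm 2 (G n)) \<longlongrightarrow> 0) F"
    unfolding ennreal_tendsto_0_iff Lp_norm_2[OF assms]
  proof (intro allI impI)
    fix e :: real assume "0 < e"
    then show "\<forall>\<^sub>F n in F. ennreal (nrm (G n)) \<le> ennreal e"
      using order_tendstoD(2)[OF *, of e] by (auto elim!: eventually_mono intro: ennreal_leI)
  qed
qed

lemma Lp_converges_2_iff:
  assumes "\<And>n. F n \<in> Lp_space 2" "f \<in> Lp_space 2"
  shows "Lp_converges 2 F f \<longleftrightarrow> (\<lambda>n. nrm (\<lambda>x. F n x - f x)) \<longlonglongrightarrow> 0"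
  unfolding Lp_converges_def by (simp add: Lp_norm_2_tendsto_iff L2_diff assms)

lemma L2_limit_unique:
  assumes "\<And>n. F n \<in> Lp_space 2" "g \<in> Lp_space 2" "h \<in> Lp_space 2" "Fl \<noteq> bot"
    "((\<lambda>n. nrm (\<lambda>x. F n x - g x)) \<longlongrightarrow> 0) Fl"
      "((\<lambda>n. nrm (\<lambda>x. F n x - h x)) \<longlongrightarrow> 0) Fl"
  shows "ae_equal g h"
proof -
  have "nrm (\<lambda>x. g x - h x) \<le> nrm (\<lambda>x. F n x - g x) + nrm (\<lambda>x. F n x - h x)" for n
    using nrm_triangle3[OF assms(2,1,3), of n] by (simp add: nrm_diff_commute[of g])
  moreover have "((\<lambda>n. nrm (\<lambda>x. F n x - g x) + nrm (\<lambda>x. F n x - h x)) \<longlongrightarrow> 0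
    + 0) Fl"
    by (intro tendsto_add assms)
  ultimately have "nrm (\<lambda>x. g x - h x) \<le> 0"
    using assms(4) by (intro tendsto_lowerbound[of _ 0 Fl]) auto
  then have "nrm (\<lambda>x. g x - h x) = 0" using nrm_nonneg[of "\<lambda>x. g x - h x"] by linarith
  from nrm_eq_0_AE[OF L2_diff[OF assms(2,3)] this] show ?thesis by eventually_elim simp
qed

text \<open>Linearity is required up to null sets, since the operators in question return arbitrary
  representatives. The free evolution, the propagator, the approximants and their limit are all of
  this kind.\<close>

definition L2_isometry :: "(wavefun \<Rightarrow> wavefun) \<Rightarrow> bool" where
  "L2_isometry T \<longleftrightarrow>
    (\<forall>f\<in>Lp_space 2. T f \<in> Lp_space 2 \<and> nrm (T f) = nrm f) \<and>
    (\<forall>f\<in>Lp_space 2. \<forall>g\<in>Lp_space 2. \<forall>c. ae_equal (T (\<lambda>x. c * f x + g x)) (\<lambda>x. c * T f x + T g x))"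

lemma L2_isometryD:
  assumes "L2_isometry T"
  shows "f \<in> Lp_space 2 \<Longrightarrow> T f \<in> Lp_space 2" "f \<in> Lp_space 2 \<Longrightarrow> nrm (T f) = nrm f"
    "f \<in> Lp_space 2 \<Longrightarrow> g \<in> Lp_space 2
      \<Longrightarrow> ae_equal (T (\<lambda>x. c * f x + g x)) (\<lambda>x. c * T f x + T g x)"
  using assms unfolding L2_isometry_def by blast+

lemma L2_isometry_inner:
  assumes "L2_isometry T" "f \<in> Lp_space 2" "g \<in> Lp_space 2"
  shows "inner_L2 (T f) (T g) = inner_L2 f g"
  by (rule inner_preserved) (use L2_isometryD[OF assms(1)] assms in auto)

lemma L2_isometry_diff:
  assumes T: "L2_isometry T" and f: "f \<in> Lp_space 2" and g: "g \<in> Lp_space 2"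
  shows "nrm (\<lambda>x. T f x - T g x) = nrm (\<lambda>x. f x - g x)"
proof -
  have "nrm (\<lambda>x. -1 * T g x + T f x) = nrm (T (\<lambda>x. -1 * g x + f x))"
    by (rule L2_cong_AE(2)[OF L2_isometryD(1)[OF T L2_lin[OF g f]]])
       (use L2_isometryD(3)[OF T g f, of "-1"] in
         \<open>auto intro!: Lp_space_measurable[OF L2_diff] L2_isometryD(1)[OF T] f g elim!: eventually_mono simp: norm_minus_commute\<close>)
  also have "\<dots> = nrm (\<lambda>x. -1 * g x + f x)" by (intro L2_isometryD(2)[OF T] L2_lin f g)
  finally show ?thesis by simp
qed

text \<open>The images of f and g are as close in norm as f and g themselves, so compatibility with
  null sets is automatic.\<close>

lemma L2_isometry_cong:
  assumes T: "L2_isometry T" and f: "f \<in> Lp_space 2" and g: "g \<in> Lp_space 2" and e: "ae_equal f g"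
  shows "ae_equal (T f) (T g)"
proof -
  have "AE x in lborel. cmod ((\<lambda>x. 0) x) = cmod (f x - g x)" using e by eventually_elim simp
  from L2_cong_AE(2)[OF L2_diff[OF f g] _ this] have "nrm (\<lambda>x. f x - g x) = 0" by (simp add: nrm_def)
  then have "nrm (\<lambda>x. T f x - T g x) = 0" by (simp add: L2_isometry_diff[OF T f g])
  from nrm_eq_0_AE[OF L2_diff this] show ?thesis
    using L2_isometryD(1)[OF T] f g by (auto elim!: eventually_mono)
qed

lemma L2_isometry_comp:
  assumes S: "L2_isometry S" and T: "L2_isometry T"
  shows "L2_isometry (\<lambda>f. S (T f))"
  unfolding L2_isometry_def
proof (intro conjI ballI allI)
  fix f g :: wavefun and c assume f: "f \<in> Lp_space 2" and g: "g \<in> Lp_space 2"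
  note Tf = L2_isometryD(1)[OF T f] and Tg = L2_isometryD(1)[OF T g]
  have "ae_equal (S (T (\<lambda>x. c * f x + g x))) (S (\<lambda>x. c * T f x + T g x))"
    by (intro L2_isometry_cong[OF S] L2_isometryD(3)[OF T] L2_isometryD(1)[OF T] L2_lin f g)
  moreover have "ae_equal (S (\<lambda>x. c * T f x + T g x)) (\<lambda>x. c * S (T f) x + S (T g) x)"
    by (rule L2_isometryD(3)[OF S Tf Tg])
  ultimately show "ae_equal (S (T (\<lambda>x. c * f x + g x))) (\<lambda>x. c * S (T f) x + S (T g) x)"
    by eventually_elim simp
qed (use L2_isometryD[OF S] L2_isometryD[OF T] in auto)

lemma L2_isometry_tendsto:
  assumes "L2_isometry T" "\<And>n. F n \<in> Lp_space 2" "f \<in> Lp_space 2"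
    "((\<lambda>n. nrm (\<lambda>x. F n x - f x)) \<longlongrightarrow> 0) Fl"
  shows "((\<lambda>n. nrm (\<lambda>x. T (F n) x - T f x)) \<longlongrightarrow> 0) Fl"
  using assms by (simp add: L2_isometry_diff)

lemma tendsto_nrm_lin:
  assumes F: "\<And>n. F n \<in> Lp_space 2" "f \<in> Lp_space 2"
    "((\<lambda>n. nrm (\<lambda>x. F n x - f x)) \<longlongrightarrow> 0) Fl"
    and G: "\<And>n. G n \<in> Lp_space 2" "g \<in> Lp_space 2"
      "((\<lambda>n. nrm (\<lambda>x. G n x - g x)) \<longlongrightarrow> 0) Fl"
  shows "((\<lambda>n. nrm (\<lambda>x. (c * F n x + G n x) - (c * f x + g x))) \<longlongrightarrow> 0) Fl"
proof (rule tendsto_sandwich[OF always_eventually always_eventually tendsto_const])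
  have "((\<lambda>n. cmod c * nrm (\<lambda>x. F n x - f x)
    + nrm (\<lambda>x. G n x - g x)) \<longlongrightarrow> cmod c * 0 + 0) Fl"
    by (intro tendsto_add tendsto_mult tendsto_const F G)
  then show "((\<lambda>n. cmod c * nrm (\<lambda>x. F n x - f x)
    + nrm (\<lambda>x. G n x - g x)) \<longlongrightarrow> 0) Fl" by simp
  show "\<forall>n. nrm (\<lambda>x. (c * F n x + G n x) - (c * f x + g x)) \<le> cmod c * nrm (\<lambda>x. F n x - f x)
    + nrm (\<lambda>x. G n x - g x)"
  proof
    fix n
    have "nrm (\<lambda>x. c * (F n x - f x) + (G n x - g x)) \<le> nrm (\<lambda>x. c * (F n x - f x))
      + nrm (\<lambda>x. G n x - g x)"
      by (intro nrm_triangle L2_cmult L2_diff F G)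
    moreover have "(\<lambda>x. c * (F n x - f x) + (G n x - g x)) = (\<lambda>x. (c * F n x + G n x) - (c * f x + g x))"
      by (simp add: algebra_simps)
    ultimately show "nrm (\<lambda>x. (c * F n x + G n x) - (c * f x + g x)) \<le> cmod c * nrm (\<lambda>x. F n x - f x)
      + nrm (\<lambda>x. G n x - g x)"
      by (simp only: nrm_cmult)
  qed
qed auto

text \<open>The functions on which two isometries agree a.e. form a closed subspace, so Gaussians
  decide.\<close>

lemma L2_isometry_eq_on_gauss:
  assumes S: "L2_isometry S" and T: "L2_isometry T"
    and g: "\<And>a b. 0 < a \<Longrightarrow> ae_equal (S (gauss a b)) (T (gauss a b))"
    and f: "f \<in> Lp_space 2"
  shows "ae_equal (S f) (T f)"
proof -
  define D where "D = {f \<in> Lp_space 2. ae_equal (S f) (T f)}"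
  have "closed_subspace D"
    unfolding closed_subspace_def
  proof (intro conjI ballI allI impI)
    have "nrm (S (\<lambda>x. 0)) = 0" "nrm (T (\<lambda>x. 0)) = 0"
      using L2_isometryD(2)[OF S, of "\<lambda>x. 0"] L2_isometryD(2)[OF T, of "\<lambda>x. 0"] by (auto simp: nrm_def)
    then have "AE x in lborel. S (\<lambda>x. 0) x = 0" "AE x in lborel. T (\<lambda>x. 0) x = 0"
      using L2_isometryD(1)[OF S] L2_isometryD(1)[OF T] by (auto intro: nrm_eq_0_AE)
    then show "(\<lambda>x. 0) \<in> D" unfolding D_def by (auto elim: AE_mp)
  next
    fix f g c assume fg: "f \<in> D" "g \<in> D"
    then have f: "f \<in> Lp_space 2" "ae_equal (S f) (T f)" and g: "g \<in> Lp_space 2" "ae_equal (S g) (T g)"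
      by (auto simp: D_def)
    have "ae_equal (S (\<lambda>x. c * f x + g x)) (T (\<lambda>x. c * f x + g x))"
      using L2_isometryD(3)[OF S f(1) g(1), of c] L2_isometryD(3)[OF T f(1) g(1), of c] f(2) g(2)
      by eventually_elim simp
    then show "(\<lambda>x. c * f x + g x) \<in> D" using f g by (simp add: D_def L2_lin)
  next
    fix F g assume *: "(\<forall>n::nat. F n \<in> D) \<and> g \<in> Lp_space 2 \<and> (\<lambda>n. nrm (\<lambda>x. F n x - g x)) \<longlonglongrightarrow> 0"
    then have F: "\<And>n. F n \<in> Lp_space 2" and ST: "\<And>n. ae_equal (S (F n)) (T (F n))" and gL: "g \<in> Lp_space 2"
      by (auto simp: D_def)
    note SF = L2_isometryD(1)[OF S F] and TF = L2_isometryD(1)[OF T F]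
      and Sg = L2_isometryD(1)[OF S gL] and Tg = L2_isometryD(1)[OF T gL]
    have 1: "(\<lambda>n. nrm (\<lambda>x. S (F n) x - S g x)) \<longlonglongrightarrow> 0"
      by (rule L2_isometry_tendsto[OF S F gL]) (use * in auto)
    have 2: "(\<lambda>n. nrm (\<lambda>x. T (F n) x - T g x)) \<longlonglongrightarrow> 0"
      by (rule L2_isometry_tendsto[OF T F gL]) (use * in auto)
    have "nrm (\<lambda>x. T (F n) x - T g x) = nrm (\<lambda>x. S (F n) x - T g x)" for n
      by (rule L2_cong_AE(2)[OF L2_diff[OF SF Tg] Lp_space_measurable[OF L2_diff[OF TF Tg]]])
         (use ST[of n] in \<open>auto elim!: eventually_mono\<close>)
    with 2 have 3: "(\<lambda>n. nrm (\<lambda>x. S (F n) x - T g x)) \<longlonglongrightarrow> 0" by simp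
    have "ae_equal (S g) (T g)"
      by (rule L2_limit_unique[OF SF Sg Tg _ 1 3]) simp
    then show "g \<in> D" using gL by (simp add: D_def)
  qed (auto simp: D_def)
  moreover have "gauss a b \<in> D" if "0 < a" for a b using g[OF that] gauss_L2[OF that] by (simp add: D_def)
  ultimately have "D = Lp_space 2" by (rule L2_eq_closed_subspace)
  then show ?thesis using f by (auto simp: D_def)
qed

lemma gauss_eq_cgauss: "gauss a b = cgauss (of_real a) (\<lambda>i. of_real (b $ i))"
proof
  fix x
  have "b \<bullet> x = (\<Sum>i\<in>UNIV. b $ i * x $ i)" by (simp add: inner_vec_def)
  then show "gauss a b x = cgauss (of_real a) (\<lambda>i. of_real (b $ i)) x"
    unfolding gauss_def cgauss_def exp_of_real[symmetric] by simp
qed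

lemma gauss_schwartz: "0 < a \<Longrightarrow> gauss a b \<in> schwartz"
  using gclass_schwartz[of "of_real a" "gauss a b"] cgauss_in_gclass[of 1 "of_real a"]
  by (auto simp: gauss_eq_cgauss)

text \<open>The functions approximable by Schwartz functions form a closed subspace that contains
  the Gaussians.\<close>

lemma schwartz_dense:
  assumes f: "f \<in> Lp_space 2"
  shows "\<exists>F. (\<forall>n::nat. F n \<in> schwartz) \<and> (\<lambda>n. nrm (\<lambda>x. F n x - f x))
    \<longlonglongrightarrow> 0"
proof -
  define D where "D = {f \<in> Lp_space 2. \<forall>e>0. \<exists>s\<in>schwartz. nrm (\<lambda>x. s x - f x) < e}"
  have z: "(\<lambda>x. 0) \<in> schwartz"
    using schwartz_lin[OF gauss_schwartz[of 1 0] gauss_schwartz[of 1 0], of "-1"] by simp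
  have selfD: "s \<in> D" if "s \<in> schwartz" for s
    using that schwartz_L2 unfolding D_def by (auto intro!: bexI[of _ s] simp: nrm_def)
  have "closed_subspace D"
    unfolding closed_subspace_def
  proof (intro conjI ballI allI impI)
    show "(\<lambda>x. 0) \<in> D" by (rule selfD[OF z])
  next
    fix f g c assume fg: "f \<in> D" "g \<in> D"
    then have L: "f \<in> Lp_space 2" "g \<in> Lp_space 2" by (auto simp: D_def)
    have "\<exists>s\<in>schwartz. nrm (\<lambda>x. s x - (c * f x + g x)) < e" if e: "0 < e" for e
    proof -
      \<comment> \<open>The shift by 1 keeps the denominator positive when c = 0.\<close>
      define d where "d = e / (2 * (cmod c + 1))"
      have d: "0 < d" using e by (simp add: d_def add_nonneg_pos)
      obtain s where s: "s \<in> schwartz" "nrm (\<lambda>x. s x - f x) < d" using fg d by (auto simp: D_def)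
      obtain r where r: "r \<in> schwartz" "nrm (\<lambda>x. r x - g x) < e / 2" using fg e half_gt_zero unfolding D_def
        by blast
      have "nrm (\<lambda>x. c * (s x - f x) + (r x - g x)) \<le> nrm (\<lambda>x. c * (s x - f x))
        + nrm (\<lambda>x. r x - g x)"
        by (intro nrm_triangle L2_cmult L2_diff L schwartz_L2 s r)
      then have 1: "nrm (\<lambda>x. c * (s x - f x) + (r x - g x)) \<le> cmod c * nrm (\<lambda>x. s x - f x)
        + nrm (\<lambda>x. r x - g x)"
        by (simp only: nrm_cmult)
      have 2: "cmod c * nrm (\<lambda>x. s x - f x) \<le> cmod c * d"
        using s by (intro mult_left_mono) auto
      have c1: "0 < cmod c + 1" by (intro add_nonneg_pos) auto
      have "cmod c * d \<le> (cmod c + 1) * d" using d by (intro mult_right_mono) auto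
      also have "\<dots> = e / 2"
      proof -
        define k where "k = cmod c + 1"
        have "0 < k" using c1 by (simp add: k_def)
        then have "k * (e / (2 * k)) = e / 2" by simp
        then show "(cmod c + 1) * d = e / 2" by (simp add: d_def k_def)
      qed
      finally have "nrm (\<lambda>x. c * (s x - f x) + (r x - g x)) < e" using 1 2 r(2) by linarith
      moreover have "(\<lambda>x. c * (s x - f x) + (r x - g x)) = (\<lambda>x. (c * s x + r x) - (c * f x + g x))"
        by (simp add: algebra_simps)
      ultimately show ?thesis using schwartz_lin[OF s(1) r(1), of c]
        by (intro bexI[of _ "\<lambda>x. c * s x + r x"]) auto
    qed
    then show "(\<lambda>x. c * f x + g x) \<in> D" using L by (simp add: D_def L2_lin)
  next
    fix F g assume *: "(\<forall>n::nat. F n \<in> D) \<and> g \<in> Lp_space 2 \<and> (\<lambda>n. nrm (\<lambda>x. F n x - g x)) \<longlonglongrightarrow> 0"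
    then have F: "\<And>n. F n \<in> Lp_space 2" and gL: "g \<in> Lp_space 2" by (auto simp: D_def)
    have "\<exists>s\<in>schwartz. nrm (\<lambda>x. s x - g x) < e" if e: "0 < e" for e
    proof -
      obtain n where n: "nrm (\<lambda>x. F n x - g x) < e/2"
        using * order_tendstoD(2)[of "\<lambda>n. nrm (\<lambda>x. F n x - g x)" 0 sequentially "e/2"] e
        by (auto simp: eventually_sequentially)
      obtain s where s: "s \<in> schwartz" "nrm (\<lambda>x. s x - F n x) < e/2" using * e half_gt_zero unfolding D_def
        by blast
      have "nrm (\<lambda>x. s x - g x) \<le> nrm (\<lambda>x. s x - F n x) + nrm (\<lambda>x. F n x - g x)"
        by (intro nrm_triangle3 schwartz_L2 s F gL)
      then show ?thesis using s n by (intro bexI[of _ s]) auto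
    qed
    then show "g \<in> D" using gL by (simp add: D_def)
  qed (auto simp: D_def)
  moreover have "gauss a b \<in> D" if "0 < a" for a b by (rule selfD[OF gauss_schwartz[OF that]])
  ultimately have "D = Lp_space 2" by (rule L2_eq_closed_subspace)
  then have "\<exists>s\<in>schwartz. nrm (\<lambda>x. s x - f x) < e" if "0 < e" for e using f that unfolding D_def by blast
  then have "\<forall>n. \<exists>s\<in>schwartz. nrm (\<lambda>x. s x - f x) < 1 / Suc n" by simp
  then obtain F where F: "\<And>n. F n \<in> schwartz" "\<And>n. nrm (\<lambda>x. F n x - f x) < 1 / Suc n" by metis
  have "(\<lambda>n. nrm (\<lambda>x. F n x - f x)) \<longlonglongrightarrow> 0"
    by (rule tendsto_sandwich[OF _ _ tendsto_const LIMSEQ_Suc[OF lim_1_over_n]])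
       (use F in \<open>auto intro!: always_eventually intro: less_imp_le simp del: of_nat_Suc\<close>)
  then show ?thesis using F by blast
qed

section \<open>The free group on Schwartz functions and on L^2\<close>

definition evo :: "real \<Rightarrow> wavefun \<Rightarrow> wavefun" where
  "evo t \<phi> = inv_fourier (\<lambda>\<xi>. exp (- \<i> * of_real (t * (norm \<xi>)\<^sup>2)) * fourier \<phi> \<xi>)"

lemma free_evolution_eq: "free_evolution t = cont_extension 2 schwartz (evo t)"
  unfolding free_evolution_def evo_def[abs_def] ..

lemma phase_sq_measurable[measurable]:
  "(\<lambda>\<xi>::real^3. exp (- \<i> * of_real (t * (norm \<xi>)\<^sup>2))) \<in> borel_measurable borel"
  by measurable

lemma nice_phase_mult:
  assumes "f \<in> nice"
  shows "(\<lambda>\<xi>. exp (- \<i> * of_real (t * (norm \<xi>)\<^sup>2)) * f \<xi>) \<in> nice"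
    "nrm (\<lambda>\<xi>. exp (- \<i> * of_real (t * (norm \<xi>)\<^sup>2)) * f \<xi>) = nrm f"
proof -
  have f: "continuous_on UNIV f" "integrable lborel f" "\<exists>K. \<forall>x. cmod (f x) \<le> K" using assms
    by (auto simp: nice_def)
  have [measurable]: "f \<in> borel_measurable borel" using f by (auto dest: borel_measurable_integrable)
  have n: "cmod (exp (- \<i> * of_real (t * (norm \<xi>)\<^sup>2)) * f \<xi>) = cmod (f \<xi>)" for \<xi>
    by (simp add: norm_mult norm_exp_eq_Re)
  have "integrable lborel (\<lambda>\<xi>. exp (- \<i> * of_real (t * (norm \<xi>)\<^sup>2)) * f \<xi>)"
    by (rule Bochner_Integration.integrable_bound[OF f(2)]) (use n in auto)
  moreover have "continuous_on UNIV (\<lambda>\<xi>. exp (- \<i> * of_real (t * (norm \<xi>)\<^sup>2)) * f \<xi>)"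
    by (intro continuous_intros f)
  ultimately show "(\<lambda>\<xi>. exp (- \<i> * of_real (t * (norm \<xi>)\<^sup>2)) * f \<xi>) \<in> nice"
    using f(3) n unfolding nice_def by (simp only: mem_Collect_eq simp_thms)
  show "nrm (\<lambda>\<xi>. exp (- \<i> * of_real (t * (norm \<xi>)\<^sup>2)) * f \<xi>) = nrm f"
    unfolding nrm_def n ..
qed

lemma evo_L2:
  assumes "\<phi> \<in> schwartz" shows "evo t \<phi> \<in> Lp_space 2" "nrm (evo t \<phi>) = nrm \<phi>"
  unfolding evo_def
  using Plancherel_inv[OF nice_phase_mult(1)[OF schwartz_fourier_nice[OF assms]]]
    nice_phase_mult(2)[OF schwartz_fourier_nice[OF assms]] Plancherel(2)[OF schwartz_nice[OF assms]] by auto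

lemma fourier_lin:
  assumes "integrable lborel f" "integrable lborel g"
  shows "fourier (\<lambda>x. c * f x + g x) \<xi> = c * fourier f \<xi> + fourier g \<xi>"
proof -
  have i: "integrable lborel (\<lambda>x. exp (- \<i> * of_real (\<xi> \<bullet> x)) * f x)"
    "integrable lborel (\<lambda>x. exp (- \<i> * of_real (\<xi> \<bullet> x)) * g x)"
    using integrable_phase(2)[OF assms(1)] integrable_phase(2)[OF assms(2)] by simp_all
  have "(LINT x|lborel. exp (- \<i> * of_real (\<xi> \<bullet> x)) * (c * f x + g x))
     = (LINT x|lborel. c * (exp (- \<i> * of_real (\<xi> \<bullet> x)) * f x) + exp (- \<i> * of_real (\<xi> \<bullet> x)) * g x)"
    by (simp add: algebra_simps)
  also have "\<dots> = c * (LINT x|lborel. exp (- \<i> * of_real (\<xi> \<bullet> x)) * f x)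
    + (LINT x|lborel. exp (- \<i> * of_real (\<xi> \<bullet> x)) * g x)"
    by (subst Bochner_Integration.integral_add[OF integrable_mult_right[OF i(1)] i(2)])
       (simp only: integral_mult_right_zero)
  finally show ?thesis by (simp add: fourier_def scaleR_right_distrib)
qed

lemma evo_lin:
  assumes "f \<in> schwartz" "g \<in> schwartz"
  shows "evo t (\<lambda>x. c * f x + g x) = (\<lambda>x. c * evo t f x + evo t g x)"
proof
  fix x
  let ?m = "\<lambda>\<xi>::real^3. exp (- \<i> * of_real (t * (norm \<xi>)\<^sup>2))"
  have i: "integrable lborel (\<lambda>\<xi>. ?m \<xi> * fourier f \<xi>)"
    "integrable lborel (\<lambda>\<xi>. ?m \<xi> * fourier g \<xi>)"
    using nice_phase_mult(1)[OF schwartz_fourier_nice[OF assms(1)], of t] nice_phase_mult(1)[OF schwartz_fourier_nice[OF assms(2)], of t]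
    by (auto simp: nice_def)
  have "evo t (\<lambda>x. c * f x + g x) x
    = inv_fourier (\<lambda>\<xi>. c * (?m \<xi> * fourier f \<xi>) + ?m \<xi> * fourier g \<xi>) x"
  proof -
    have F: "fourier (\<lambda>x. c * f x + g x) = (\<lambda>\<xi>. c * fourier f \<xi> + fourier g \<xi>)"
      using fourier_lin[OF schwartz_integrable[OF assms(1)] schwartz_integrable[OF assms(2)]] by blast
    show "evo t (\<lambda>x. c * f x + g x) x
      = inv_fourier (\<lambda>\<xi>. c * (?m \<xi> * fourier f \<xi>) + ?m \<xi> * fourier g \<xi>) x"
      unfolding evo_def F by (simp add: algebra_simps)
  qed
  also have "\<dots> = c * evo t f x + evo t g x"
    unfolding evo_def using inv_fourier_add[OF integrable_mult_right[OF i(1)] i(2)] by (simp add: inv_fourier_cmult)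
  finally show "evo t (\<lambda>x. c * f x + g x) x = c * evo t f x + evo t g x" .
qed

lemma evo_diff:
  assumes "f \<in> schwartz" "g \<in> schwartz"
  shows "nrm (\<lambda>x. evo t f x - evo t g x) = nrm (\<lambda>x. f x - g x)"
  using evo_lin[OF assms(2,1), of t "-1"] evo_L2(2)[OF schwartz_lin[OF assms(2,1), of "-1"], of t] by simp

lemma evo_0: assumes "\<phi> \<in> schwartz" shows "evo 0 \<phi> = \<phi>"
proof
  fix x
  show "evo 0 \<phi> x = \<phi> x"
    unfolding evo_def
    using fourier_inversion[of \<phi> x] schwartz_integrable[OF assms] schwartz_fourier_nice[OF assms] schwartz_continuous[OF assms]
    by (simp add: nice_def continuous_on_eq_continuous_at)
qed

text \<open>Shows that the choice in \<open>cont_extension\<close> succeeds: the images of one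
  approximating sequence converge by completeness, and by isometry every other sequence leads to the
  same limit.\<close>

lemma free_evolution_limit:
  assumes f: "f \<in> Lp_space 2"
  shows "free_evolution t f \<in> Lp_space 2"
    and "(\<And>n. F n \<in> schwartz) \<Longrightarrow> (\<lambda>n. nrm (\<lambda>x. F n x - f x))
      \<longlonglongrightarrow> 0
      \<Longrightarrow> (\<lambda>n. nrm (\<lambda>x. evo t (F n) x - free_evolution t f x)) \<longlonglongrightarrow> 0"
proof -
  let ?P = "\<lambda>g. g \<in> Lp_space 2 \<and>
       (\<forall>F. range F \<subseteq> schwartz \<and> Lp_converges 2 F f \<longrightarrow> Lp_converges 2 (\<lambda>n. evo t (F n)) g)"
  obtain G where G: "\<And>n::nat. G n \<in> schwartz"
    "(\<lambda>n. nrm (\<lambda>x. G n x - f x)) \<longlonglongrightarrow> 0"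
    using schwartz_dense[OF f] by blast
  have "\<exists>g\<in>Lp_space 2. (\<lambda>n. nrm (\<lambda>x. evo t (G n) x - g x)) \<longlonglongrightarrow> 0"
  proof (rule L2_complete[OF evo_L2(1)[OF G(1)]])
    fix e :: real assume "0 < e"
    then show "\<exists>N. \<forall>m\<ge>N. \<forall>n\<ge>N. nrm (\<lambda>x. evo t (G m) x - evo t (G n) x) \<le> e"
      unfolding evo_diff[OF G(1) G(1)] by (intro L2_Cauchy_of_convergent[OF schwartz_L2[OF G(1)] f G(2)])
  qed
  then obtain g where g: "g \<in> Lp_space 2"
    "(\<lambda>n. nrm (\<lambda>x. evo t (G n) x - g x)) \<longlonglongrightarrow> 0" by blast
  have "?P g"
  proof (intro conjI g allI impI)
    fix F assume *: "range F \<subseteq> schwartz \<and> Lp_converges 2 F f"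
    then have F: "\<And>n. F n \<in> schwartz" by auto
    have Ff: "(\<lambda>n. nrm (\<lambda>x. F n x - f x)) \<longlonglongrightarrow> 0"
      using * Lp_converges_2_iff[OF schwartz_L2[OF F] f] by simp
    have "(\<lambda>n. nrm (\<lambda>x. evo t (F n) x - g x)) \<longlonglongrightarrow> 0"
    proof (rule tendsto_sandwich[OF always_eventually always_eventually tendsto_const])
      have "(\<lambda>n. (nrm (\<lambda>x. F n x - f x) + nrm (\<lambda>x. G n x - f x))
        + nrm (\<lambda>x. evo t (G n) x - g x)) \<longlonglongrightarrow> (0 + 0) + 0"
        by (intro tendsto_add Ff G g)
      then show "(\<lambda>n. nrm (\<lambda>x. F n x - f x) + nrm (\<lambda>x. G n x - f x)
        + nrm (\<lambda>x. evo t (G n) x - g x)) \<longlonglongrightarrow> 0" by simp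
      show "\<forall>n. nrm (\<lambda>x. evo t (F n) x - g x) \<le> nrm (\<lambda>x. F n x - f x)
        + nrm (\<lambda>x. G n x - f x) + nrm (\<lambda>x. evo t (G n) x - g x)"
      proof
        fix n
        have "nrm (\<lambda>x. evo t (F n) x - g x) \<le> nrm (\<lambda>x. evo t (F n) x - evo t (G n) x)
          + nrm (\<lambda>x. evo t (G n) x - g x)"
          by (intro nrm_triangle3 evo_L2 F G g)
        also have "nrm (\<lambda>x. evo t (F n) x - evo t (G n) x) \<le> nrm (\<lambda>x. F n x - f x)
          + nrm (\<lambda>x. G n x - f x)"
          unfolding evo_diff[OF F G(1)] nrm_diff_commute[of "G n" f]
          by (intro nrm_triangle3 schwartz_L2 F G f)
        finally show "nrm (\<lambda>x. evo t (F n) x - g x) \<le> nrm (\<lambda>x. F n x - f x)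
          + nrm (\<lambda>x. G n x - f x) + nrm (\<lambda>x. evo t (G n) x - g x)"
          by simp
      qed
    qed auto
    then show "Lp_converges 2 (\<lambda>n. evo t (F n)) g"
      by (simp add: Lp_converges_2_iff evo_L2 F g)
  qed
  then have P: "?P (free_evolution t f)"
    unfolding free_evolution_eq cont_extension_def by (rule someI[where P="?P"])
  then show L: "free_evolution t f \<in> Lp_space 2" by simp
  assume F: "\<And>n. F n \<in> schwartz" "(\<lambda>n. nrm (\<lambda>x. F n x - f x)) \<longlonglongrightarrow> 0"
  then have "Lp_converges 2 F f" by (simp add: Lp_converges_2_iff schwartz_L2 f)
  then have "Lp_converges 2 (\<lambda>n. evo t (F n)) (free_evolution t f)" using P F by auto
  then show "(\<lambda>n. nrm (\<lambda>x. evo t (F n) x - free_evolution t f x)) \<longlonglongrightarrow> 0"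
    by (simp add: Lp_converges_2_iff evo_L2 F L)
qed

lemma free_evolution_schwartz:
  assumes "\<phi> \<in> schwartz" shows "ae_equal (free_evolution t \<phi>) (evo t \<phi>)"
proof -
  have "(\<lambda>n::nat. nrm (\<lambda>x. evo t \<phi> x - free_evolution t \<phi> x)) \<longlonglongrightarrow> 0"
    by (rule free_evolution_limit(2)[OF schwartz_L2[OF assms]]) (auto simp: assms nrm_def)
  moreover have "(\<lambda>n::nat. nrm (\<lambda>x. evo t \<phi> x - evo t \<phi> x)) \<longlonglongrightarrow> 0"
    by (simp add: nrm_def)
  ultimately show ?thesis
    by (rule L2_limit_unique[rotated 4])
       (auto intro: evo_L2 assms free_evolution_limit schwartz_L2)
qed

lemma free_evolution_isometry: "L2_isometry (free_evolution t)"
  unfolding L2_isometry_def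
proof (intro conjI ballI allI)
  fix f assume f: "f \<in> Lp_space 2"
  obtain F where F: "\<And>n::nat. F n \<in> schwartz"
    "(\<lambda>n. nrm (\<lambda>x. F n x - f x)) \<longlonglongrightarrow> 0"
    using schwartz_dense[OF f] by blast
  note lim = free_evolution_limit(2)[OF f F, of t]
  show Ef: "free_evolution t f \<in> Lp_space 2" by (rule free_evolution_limit(1)[OF f])
  have "(\<lambda>n. nrm (evo t (F n))) \<longlonglongrightarrow> nrm (free_evolution t f)"
    by (rule nrm_tendsto[OF evo_L2(1)[OF F(1)] Ef lim])
  then have "(\<lambda>n. nrm (F n)) \<longlonglongrightarrow> nrm (free_evolution t f)" by (simp add: evo_L2 F)
  moreover have "(\<lambda>n. nrm (F n)) \<longlonglongrightarrow> nrm f"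
    by (rule nrm_tendsto[OF schwartz_L2[OF F(1)] f F(2)])
  ultimately show "nrm (free_evolution t f) = nrm f" by (rule LIMSEQ_unique)
  fix g c assume g: "g \<in> Lp_space 2"
  obtain G where G: "\<And>n::nat. G n \<in> schwartz"
    "(\<lambda>n. nrm (\<lambda>x. G n x - g x)) \<longlonglongrightarrow> 0"
    using schwartz_dense[OF g] by blast
  note limG = free_evolution_limit(2)[OF g G, of t] and Eg = free_evolution_limit(1)[OF g, of t]
  have "(\<lambda>n. nrm (\<lambda>x. (c * F n x + G n x) - (c * f x + g x))) \<longlonglongrightarrow> 0"
    by (rule tendsto_nrm_lin[OF schwartz_L2[OF F(1)] f F(2) schwartz_L2[OF G(1)] g G(2)])
  from free_evolution_limit(2)[OF L2_lin[OF f g] schwartz_lin[OF F(1) G(1)] this, of t]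
  have 1: "(\<lambda>n. nrm (\<lambda>x. (c * evo t (F n) x + evo t (G n) x) - free_evolution t (\<lambda>x. c * f x
    + g x) x)) \<longlonglongrightarrow> 0"
    unfolding evo_lin[OF F(1) G(1)] .
  have 2: "(\<lambda>n. nrm (\<lambda>x. (c * evo t (F n) x + evo t (G n) x) - (c * free_evolution t f x
    + free_evolution t g x))) \<longlonglongrightarrow> 0"
    by (rule tendsto_nrm_lin[OF evo_L2(1)[OF F(1)] Ef lim evo_L2(1)[OF G(1)] Eg limG])
  show "ae_equal (free_evolution t (\<lambda>x. c * f x + g x)) (\<lambda>x. c * free_evolution t f x
    + free_evolution t g x)"
    by (rule L2_limit_unique[OF _ _ _ _ 1 2])
       (auto intro!: L2_lin evo_L2 F G free_evolution_limit f g)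
qed

lemma free_evolution_0: assumes "f \<in> Lp_space 2" shows "ae_equal (free_evolution 0 f) f"
proof -
  have "L2_isometry (\<lambda>f. f)" by (auto simp: L2_isometry_def)
  moreover have "ae_equal (free_evolution 0 (gauss a b)) (gauss a b)" if "0 < a" for a b
    using free_evolution_schwartz[OF gauss_schwartz[OF that], of 0 b] by (simp add: evo_0 gauss_schwartz that)
  ultimately show ?thesis
    using L2_isometry_eq_on_gauss[OF free_evolution_isometry _ _ assms, of "\<lambda>f. f" 0] by blast
qed

text \<open>\<open>galilei t b = e\<^sup>i\<^sup>t\<^sup>H e\<^sup>i\<^sup>b\<^sup>x e\<^sup>-\<^sup>i\<^sup>t\<^sup>H\<close> for the free Hamiltonian \<open>H\<close>: conjugating a plane wave with the
  free evolution gives a translation composed with phases, hence an isometry of every \<open>L\<^sup>p\<close>.\<close>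

definition galilei :: "real \<Rightarrow> real^3 \<Rightarrow> wavefun \<Rightarrow> wavefun" where
  "galilei t b f x = exp (\<i> * of_real (t * (norm b)\<^sup>2)) * exp (\<i> * of_real (b \<bullet> x)) * f (x
    + (2 * t) *\<^sub>R b)"

lemma galilei_measurable[measurable]:
  assumes [measurable]: "f \<in> borel_measurable borel"
  shows "galilei t b f \<in> borel_measurable borel"
  unfolding galilei_def[abs_def] by measurable

lemma cmod_galilei: "cmod (galilei t b f x) = cmod (f (x + (2 * t) *\<^sub>R b))"
  by (simp add: galilei_def norm_mult)

lemma galilei_L2:
  assumes "f \<in> Lp_space 2" shows "galilei t b f \<in> Lp_space 2" "nrm (galilei t b f) = nrm f"
proof -
  have [measurable]: "f \<in> borel_measurable borel" using assms by (rule Lp_space_measurable)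
  show "galilei t b f \<in> Lp_space 2" "nrm (galilei t b f) = nrm f"
    using assms integrable_shift[of "\<lambda>x. (cmod (f x))\<^sup>2" "(2 * t) *\<^sub>R b"] integral_shift[of "\<lambda>x. (cmod (f x))\<^sup>2" "(2 * t) *\<^sub>R b"]
    by (auto simp: L2_iff nrm_def cmod_galilei add.commute)
qed

lemma galilei_isometry: "L2_isometry (galilei t b)"
  unfolding L2_isometry_def by (auto simp: galilei_L2) (simp add: galilei_def algebra_simps)

lemma phase_isometry: "L2_isometry (\<lambda>f x. exp (\<i> * of_real (b \<bullet> x)) * f x)"
  unfolding L2_isometry_def
proof (intro conjI ballI allI)
  fix f assume f: "f \<in> Lp_space 2"
  have [measurable]: "f \<in> borel_measurable borel" using f by (rule Lp_space_measurable)
  show "(\<lambda>x. exp (\<i> * of_real (b \<bullet> x)) * f x) \<in> Lp_space 2"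
    "nrm (\<lambda>x. exp (\<i> * of_real (b \<bullet> x)) * f x) = nrm f"
    by (rule L2_cong_AE[OF f]; simp add: norm_mult)+
qed (simp add: algebra_simps)

lemma Lp_norm_galilei:
  assumes p: "1 \<le> p" and [measurable]: "f \<in> borel_measurable borel"
  shows "Lp_norm p (galilei t b f) \<le> Lp_norm p f"
proof (cases "Lp_norm p f < \<infinity>")
  case True
  then obtain C where C: "0 \<le> C" "Lp_norm p f = ennreal C" by (rule Lp_norm_finiteE)
  from p show ?thesis
  proof (cases rule: exponent_cases)
    case 1
    then have "AE x in lborel. cmod (f x) \<le> C" using C Lp_norm_inf_le_iff[of f C] by simp
    then have "AE x in lborel. cmod (f ((2 * t) *\<^sub>R b + 1 *\<^sub>R x)) \<le> C"
      by (subst AE_unit_affine[where P="\<lambda>x. cmod (f x) \<le> C"]) auto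
    then have "AE x in lborel. cmod (galilei t b f x) \<le> C" by (simp add: cmod_galilei add.commute)
    then show ?thesis using C 1 Lp_norm_inf_le_iff[of "galilei t b f" C] by simp
  next
    case (2 q)
    have "pint q (galilei t b f) = (\<integral>\<^sup>+x. ennreal (cmod (f ((2 * t) *\<^sub>R b
      + 1 *\<^sub>R x)) powr q) \<partial>lborel)"
      by (simp add: pint_def cmod_galilei add.commute)
    also have "\<dots> = pint q f" unfolding pint_def
      by (rule nn_integral_unit_affine[where f="\<lambda>x. ennreal (cmod (f x) powr q)"]) auto
    finally show ?thesis
      using C 2 Lp_norm_le_iff[of q C f] Lp_norm_le_iff[of q C "galilei t b f"] by simp
  qed
next
  case False
  then show ?thesis by (metis infinity_ennreal_def less_top top_greatest)
qed

lemma fourier_galilei: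
  assumes [measurable]: "f \<in> borel_measurable borel"
  shows "fourier (galilei t b f) \<xi>
    = exp (\<i> * of_real (t * (norm b)\<^sup>2 + 2 * t * ((\<xi> - b) \<bullet> b))) * fourier f (\<xi> - b)"
proof -
  let ?y = "(2 * t) *\<^sub>R b" and ?\<theta> = "t * (norm b)\<^sup>2 + 2 * t * ((\<xi> - b) \<bullet> b)"
  have "exp (- \<i> * of_real (\<xi> \<bullet> x)) * galilei t b f x
     = exp (\<i> * of_real ?\<theta>) * (exp (- \<i> * of_real ((\<xi> - b) \<bullet> (?y + x))) * f (?y + x))" for x
  proof -
    have "exp (- \<i> * of_real (\<xi> \<bullet> x)) * (exp (\<i> * of_real (t * (norm b)\<^sup>2)) * exp (\<i> * of_real (b \<bullet> x)))
      = exp (\<i> * of_real ?\<theta>) * exp (- \<i> * of_real ((\<xi> - b) \<bullet> (?y + x)))"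
      unfolding exp_add[symmetric]
      by (rule arg_cong[where f=exp]) (simp add: inner_diff_left inner_add_right algebra_simps)
    then show ?thesis unfolding galilei_def by (simp add: add.commute flip: mult.assoc)
  qed
  then have "(LINT x|lborel. exp (- \<i> * of_real (\<xi> \<bullet> x)) * galilei t b f x)
     = exp (\<i> * of_real ?\<theta>) * (LINT x|lborel. exp (- \<i> * of_real ((\<xi> - b) \<bullet> (?y + x))) * f (?y + x))"
    by (simp only: integral_mult_right_zero)
  also have "(LINT x|lborel. exp (- \<i> * of_real ((\<xi> - b) \<bullet> (?y + x))) * f (?y + x))
     = (LINT x|lborel. exp (- \<i> * of_real ((\<xi> - b) \<bullet> x)) * f x)"
    by (rule integral_shift[where f="\<lambda>x. exp (- \<i> * of_real ((\<xi> - b) \<bullet> x)) * f x"]) measurable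
  finally show ?thesis by (simp add: fourier_def)
qed

text \<open>The phase t |b|^2 and the shift 2 t b in \<open>galilei\<close> are made for this
  identity: they complete |xi|^2 to |xi - b|^2 in the multiplier, and shifting the frequency by b
  leaves the plane wave.\<close>

lemma evo_galilei:
  assumes [measurable]: "f \<in> borel_measurable borel"
  shows "evo t (galilei t b f) x = exp (\<i> * of_real (b \<bullet> x)) * evo t f x"
proof -
  note [measurable] = fourier_phase_measurable(1)[OF assms]
  define G where "G \<eta> = exp (\<i> * of_real (\<eta> \<bullet> x)) * (exp (- \<i> * of_real (t * (norm \<eta>)\<^sup>2)) * fourier f \<eta>)" for \<eta>
  have [measurable]: "G \<in> borel_measurable borel"
  proof -
    have "(\<lambda>\<eta>. exp (\<i> * of_real (\<eta> \<bullet> x))) \<in> borel_measurable borel"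
      using phase_measurable(1)[of x] by (simp add: inner_commute)
    then show ?thesis unfolding G_def by measurable
  qed
  have "exp (\<i> * of_real (\<xi> \<bullet> x)) * (exp (- \<i> * of_real (t * (norm \<xi>)\<^sup>2)) * fourier (galilei t b f) \<xi>)
     = exp (\<i> * of_real (b \<bullet> x)) * G (- b + \<xi>)" for \<xi>
  proof -
    have n: "(norm (\<xi> - b))\<^sup>2 = (norm \<xi>)\<^sup>2 - 2 * (\<xi> \<bullet> b) + (norm b)\<^sup>2"
      unfolding power2_norm_eq_inner by (simp add: algebra_simps inner_commute)
    have b2: "b \<bullet> b = (norm b)\<^sup>2" by (simp add: power2_norm_eq_inner)
    have "exp (\<i> * of_real (\<xi> \<bullet> x)) * (exp (- \<i> * of_real (t * (norm \<xi>)\<^sup>2)) * exp (\<i> * of_real (t * (norm b)\<^sup>2 + 2 * t * ((\<xi> - b) \<bullet> b))))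
       = exp (\<i> * of_real (b \<bullet> x)) * (exp (\<i> * of_real ((\<xi> - b) \<bullet> x)) * exp (- \<i> * of_real (t * (norm (\<xi> - b))\<^sup>2)))"
      unfolding exp_add[symmetric] n
      by (rule arg_cong[where f=exp]) (simp add: inner_diff_left b2 algebra_simps)
    then show ?thesis unfolding fourier_galilei[OF assms] G_def by (simp flip: mult.assoc)
  qed
  then have "(LINT \<xi>|lborel. exp (\<i> * of_real (\<xi> \<bullet> x)) * (exp (- \<i> * of_real (t * (norm \<xi>)\<^sup>2)) * fourier (galilei t b f) \<xi>))
     = exp (\<i> * of_real (b \<bullet> x)) * (LINT \<xi>|lborel. G (- b + \<xi>))"
    by (simp only: integral_mult_right_zero)
  also have "(LINT \<xi>|lborel. G (- b + \<xi>)) = (LINT \<xi>|lborel. G \<xi>)" by (rule integral_shift) measurable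
  finally have "(LINT \<xi>|lborel. exp (\<i> * of_real (x \<bullet> \<xi>)) * (exp (- \<i> * of_real (t * (norm \<xi>)\<^sup>2)) * fourier (galilei t b f) \<xi>))
     = exp (\<i> * of_real (b \<bullet> x)) * (LINT \<xi>|lborel. G \<xi>)" by (simp add: inner_commute)
  then show ?thesis unfolding evo_def inv_fourier_def G_def by (simp add: inner_commute)
qed

text \<open>The shift changes the linear coefficient by -2 a times itself and the modulation adds i
  b, so the result is a complex Gaussian with the same quadratic part.\<close>

lemma galilei_gauss_schwartz:
  assumes a: "0 < a" shows "galilei t b (gauss a c) \<in> schwartz"
proof -
  let ?y = "(2 * t) *\<^sub>R b"
  define \<beta> where "\<beta> i = of_real (c $ i - 2 * a * ?y $ i) + \<i> * of_real (b $ i)" for i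
  define k where "k = exp (\<i> * of_real (t * (norm b)\<^sup>2)) * of_real (exp (- a * (norm ?y)\<^sup>2 + c \<bullet> ?y))"
  have "galilei t b (gauss a c) x = k * cgauss (of_real a) \<beta> x" for x
  proof -
    have n: "(norm (x + ?y))\<^sup>2 = (norm x)\<^sup>2 + 2 * (?y \<bullet> x) + (norm ?y)\<^sup>2"
      unfolding power2_norm_eq_inner by (simp add: algebra_simps inner_commute)
    have s: "(\<Sum>i\<in>UNIV. \<beta> i * of_real (x $ i)) = of_real (c \<bullet> x - 2 * a * (?y \<bullet> x))
      + \<i> * of_real (b \<bullet> x)"
      unfolding \<beta>_def inner_vec_def by (simp add: sum_3 algebra_simps)
    have "exp (\<i> * of_real (b \<bullet> x)) * of_real (exp (- a * (norm (x + ?y))\<^sup>2 + c \<bullet> (x + ?y)))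
      = of_real (exp (- a * (norm ?y)\<^sup>2 + c \<bullet> ?y)) * exp (- of_real a * of_real ((norm x)\<^sup>2) + (\<Sum>i\<in>UNIV. \<beta> i * of_real (x $ i)))"
      unfolding s n exp_of_real[symmetric] exp_add[symmetric]
      by (rule arg_cong[where f=exp]) (simp add: inner_add_right algebra_simps)
    then show ?thesis unfolding galilei_def gauss_def k_def cgauss_def by (simp add: mult.assoc)
  qed
  then have "galilei t b (gauss a c) = (\<lambda>x. k * cgauss (of_real a) \<beta> x)" by blast
  then show ?thesis using gclass_schwartz[OF _ cgauss_in_gclass, of "of_real a" k \<beta>] a by simp
qed

text \<open>Both sides are isometries, so it suffices to compare them on Gaussians, where
  \<open>free_evolution\<close> is \<open>evo\<close> and the identity is pointwise.\<close>

lemma free_evolution_galilei: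
  assumes "f \<in> Lp_space 2"
  shows "ae_equal (free_evolution t (galilei t b f)) (\<lambda>x. exp (\<i> * of_real (b \<bullet> x)) * free_evolution t f x)"
proof (rule L2_isometry_eq_on_gauss[OF L2_isometry_comp[OF free_evolution_isometry galilei_isometry]
      L2_isometry_comp[OF phase_isometry free_evolution_isometry] _ assms])
  fix a :: real and c :: "real^3" assume a: "0 < a"
  show "ae_equal (free_evolution t (galilei t b (gauss a c))) (\<lambda>x. exp (\<i> * of_real (b \<bullet> x)) * free_evolution t (gauss a c) x)"
    using free_evolution_schwartz[OF galilei_gauss_schwartz[OF a], of t t b c] free_evolution_schwartz[OF gauss_schwartz[OF a], of t c]
    by eventually_elim (simp add: evo_galilei)
qed

text \<open>Recentring at y = b / (2 a) reduces to the centred Gaussian; the shift reappears as an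
  imaginary linear term.\<close>

lemma fourier_gauss:
  assumes a: "0 < a"
  shows "\<exists>k \<beta>. fourier (gauss a b) = (\<lambda>\<xi>. k * cgauss (of_real (1 / (4 * a))) \<beta> \<xi>)"
proof -
  define y where "y = (1 / (2 * a)) *\<^sub>R b"
  define C where "C = exp ((norm b)\<^sup>2 / (4 * a))"
  define k where "k = complex_of_real ((2 * pi) powr (- 3 / 2) * (C * (pi / a) powr (3/2)))"
  have "fourier (gauss a b) \<xi> = k * cgauss (of_real (1 / (4 * a))) (\<lambda>i. - \<i> * of_real (y $ i)) \<xi>"
    for \<xi>
  proof -
    define f where "f x = exp (- \<i> * of_real (\<xi> \<bullet> x)) * gauss a b x" for x
    have [measurable]: "f \<in> borel_measurable borel" unfolding f_def by measurable
    have "(LINT x|lborel. f x) = (LINT x|lborel. f (y + x))" by (rule integral_shift[symmetric]) measurable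
    also have "\<dots> = (LINT x|lborel. (exp (- \<i> * of_real (\<xi> \<bullet> y)) * of_real C) * (exp (\<i> * of_real (- \<xi> \<bullet> x)) * of_real (exp (- a * (norm x)\<^sup>2))))"
      unfolding f_def gauss_shift[OF a] y_def[symmetric] C_def[symmetric]
      by (intro Bochner_Integration.integral_cong refl)
        (simp add: inner_add_right algebra_simps exp_add exp_diff exp_minus field_simps)
    also have "\<dots> = (exp (- \<i> * of_real (\<xi> \<bullet> y)) * of_real C) * of_real ((pi / a) powr (3/2) * exp (- (norm \<xi>)\<^sup>2 / (4 * a)))"
      unfolding integral_mult_right_zero gaussian_3D(2)[OF a, of "- \<xi>"] by simp
    finally have "fourier (gauss a b) \<xi>
      = k * (exp (- \<i> * of_real (\<xi> \<bullet> y)) * of_real (exp (- (norm \<xi>)\<^sup>2 / (4 * a))))"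
      unfolding fourier_def f_def k_def by (simp add: scaleR_conv_of_real mult_ac)
    also have "exp (- \<i> * of_real (\<xi> \<bullet> y)) * of_real (exp (- (norm \<xi>)\<^sup>2 / (4 * a)))
      = cgauss (of_real (1 / (4 * a))) (\<lambda>i. - \<i> * of_real (y $ i)) \<xi>"
      unfolding cgauss_def exp_of_real[symmetric] exp_add[symmetric]
      by (rule arg_cong[where f=exp]) (simp add: inner_vec_def sum_3 algebra_simps)
    finally show ?thesis .
  qed
  then show ?thesis by blast
qed

section \<open>The potential as a superposition of plane waves\<close>

lemma modulated_gaussian_schwartz:
  assumes "0 < b"
  shows "(\<lambda>\<xi>. exp (\<i> * of_real (x \<bullet> \<xi>)) * complex_of_real (exp (- b * (norm \<xi>)\<^sup>2))) \<in> schwartz"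
proof -
  have "exp (\<i> * of_real (x \<bullet> \<xi>)) * complex_of_real (exp (- b * (norm \<xi>)\<^sup>2))
      = 1 * cgauss (of_real b) (\<lambda>i. \<i> * of_real (x $ i)) \<xi>" for \<xi>
    unfolding cgauss_def exp_of_real[symmetric] exp_add[symmetric]
    by (simp add: inner_vec_def sum_3 algebra_simps)
  then have "(\<lambda>\<xi>. exp (\<i> * of_real (x \<bullet> \<xi>)) * complex_of_real (exp (- b * (norm \<xi>)\<^sup>2)))
      = (\<lambda>\<xi>. 1 * cgauss (of_real b) (\<lambda>i. \<i> * of_real (x $ i)) \<xi>)" by blast
  then show ?thesis using gclass_schwartz[OF _ cgauss_in_gclass, of "of_real b" 1] assms by simp
qed

text \<open>Testing the distributional transform with modulated Gaussians recovers v at points of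
  continuity. The identity has to hold everywhere and not just a.e.: it will be used at the points
  g(t) x, and g(t) may vanish.\<close>

lemma inv_fourier_of_fourier_transform:
  assumes FT: "is_fourier_transform v W" and cont: "continuous_on UNIV v"
    and fin: "(\<integral>\<^sup>+\<xi>. ennreal (cmod (W \<xi>)) \<partial>lborel) < \<infinity>"
  shows "integrable lborel W" and "v x = inv_fourier W x"
proof -
  define b where "b n = 1 / (4 * (real n + 1))" for n :: nat
  have b: "0 < b n" for n by (simp add: b_def)
  define \<phi> where "\<phi> n x \<xi>
    = exp (\<i> * of_real (x \<bullet> \<xi>)) * complex_of_real (exp (- b n * (norm \<xi>)\<^sup>2))" for n and x \<xi> :: "real^3"
  have \<phi>S: "\<phi> n x \<in> schwartz" for n x unfolding \<phi>_def by (rule modulated_gaussian_schwartz[OF b])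
  have F\<phi>: "fourier (\<phi> n x) y = of_real ((2 * pi) powr (3/2) * gk n (y - x))" for n x y
    unfolding \<phi>_def b_def by (rule fourier_modulated_gaussian)
  have i1: "integrable lborel (\<lambda>y. v y * fourier (\<phi> n x) y)"
    and i2: "integrable lborel (\<lambda>\<xi>. W \<xi> * \<phi> n x \<xi>)"
    and eq: "(LINT \<xi>|lborel. W \<xi> * \<phi> n x \<xi>) = (LINT y|lborel. v y * fourier (\<phi> n x) y)" for n x
    using FT \<phi>S[of n x] unfolding is_fourier_transform_def by blast+
  \<comment> \<open>By the distributional definition W times a nowhere vanishing Gaussian is
    integrable, hence W is Borel.\<close>
  have [measurable]: "W \<in> borel_measurable borel"
  proof -
    have [measurable]: "(\<lambda>\<xi>. W \<xi> * \<phi> 0 0 \<xi>) \<in> borel_measurable borel"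
      using i2[of 0 0] by (auto dest: borel_measurable_integrable)
    have [measurable]: "\<phi> 0 0 \<in> borel_measurable borel" by (rule schwartz_measurable[OF \<phi>S])
    have "W = (\<lambda>\<xi>. W \<xi> * \<phi> 0 0 \<xi> / \<phi> 0 0 \<xi>)" by (simp add: \<phi>_def fun_eq_iff)
    also have "\<dots> \<in> borel_measurable borel" by measurable
    finally show ?thesis .
  qed
  show W: "integrable lborel W" using fin by (intro integrableI_bounded) auto
  have [measurable]: "v \<in> borel_measurable borel" by (rule borel_measurable_continuous_onI[OF cont])
  \<comment> \<open>The kernel for n = 0 is a multiple of exp(-|y - x|^2), so pairing with it yields
    the hypothesis of \<open>approximate_identity\<close>.\<close>
  have iv: "integrable lborel (\<lambda>y. v y * complex_of_real (exp (- (norm (y - x))\<^sup>2)))"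
  proof -
    define C where "C = complex_of_real ((2 * pi) powr (3/2) * ((1 / pi) powr (3/2)))"
    have C: "C \<noteq> 0" by (simp add: C_def)
    have e: "v y * complex_of_real (exp (- (norm (y - x))\<^sup>2)) = inverse C * (v y * fourier (\<phi> 0 x) y)" for y
    proof -
      have "v y * fourier (\<phi> 0 x) y = C * (v y * complex_of_real (exp (- (norm (y - x))\<^sup>2)))"
        unfolding F\<phi> gk_def C_def by (simp add: mult_ac)
      then have "inverse C * (v y * fourier (\<phi> 0 x) y)
        = (inverse C * C) * (v y * complex_of_real (exp (- (norm (y - x))\<^sup>2)))"
        by (simp only: mult.assoc)
      then show ?thesis unfolding left_inverse[OF C] by (simp only: mult_1_left)
    qed
    show ?thesis unfolding e by (intro integrable_mult_right i1)
  qed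
  have 1: "(\<lambda>n. (2 * pi) powr (3/2) *\<^sub>R (LINT y|lborel. v y * of_real (gk n (y - x))))
    \<longlonglongrightarrow> (2 * pi) powr (3/2) *\<^sub>R v x"
    using cont by (intro tendsto_scaleR tendsto_const approximate_identity iv)
      (auto simp: continuous_on_eq_continuous_at)
  have e: "(2 * pi) powr (3/2) *\<^sub>R (LINT y|lborel. v y * of_real (gk n (y - x)))
    = (LINT \<xi>|lborel. W \<xi> * \<phi> n x \<xi>)" for n
  proof -
    have "v y * fourier (\<phi> n x) y = (2 * pi) powr (3/2) *\<^sub>R (v y * of_real (gk n (y - x)))" for y
      unfolding F\<phi> by (simp add: scaleR_conv_of_real mult_ac)
    then show ?thesis unfolding eq by (simp only: integral_scaleR_right)
  qed
  have 2: "(\<lambda>n. LINT \<xi>|lborel. W \<xi> * \<phi> n x \<xi>)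
    \<longlonglongrightarrow> (LINT \<xi>|lborel. W \<xi> * (exp (\<i> * of_real (x \<bullet> \<xi>)) * of_real 1))"
  proof (rule integral_dominated_convergence[where w="\<lambda>\<xi>. cmod (W \<xi>)"])
    show "integrable lborel (\<lambda>\<xi>. cmod (W \<xi>))" using W by simp
    show "AE \<xi> in lborel. (\<lambda>n. W \<xi> * \<phi> n x \<xi>)
      \<longlonglongrightarrow> W \<xi> * (exp (\<i> * of_real (x \<bullet> \<xi>)) * of_real 1)"
      unfolding \<phi>_def b_def by (intro AE_I2 tendsto_mult tendsto_const tendsto_of_real exp_gauss_tendsto_1)
    show "AE \<xi> in lborel. cmod (W \<xi> * \<phi> n x \<xi>) \<le> cmod (W \<xi>)" for n
      using b[of n] by (auto simp: \<phi>_def norm_mult intro!: mult_left_le)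
    show "(\<lambda>\<xi>. W \<xi> * \<phi> n x \<xi>) \<in> borel_measurable lborel" for n using i2
      by (rule borel_measurable_integrable)
  qed measurable
  have "(2 * pi) powr (3/2) *\<^sub>R v x
    = (LINT \<xi>|lborel. W \<xi> * (exp (\<i> * of_real (x \<bullet> \<xi>)) * of_real 1))"
    by (rule LIMSEQ_unique[OF 1 2[folded e]])
  then have "inv_fourier W x = (2 * pi) powr (- 3 / 2) *\<^sub>R ((2 * pi) powr (3/2) *\<^sub>R v x)"
    by (simp add: inv_fourier_def mult_ac inner_commute)
  then show "v x = inv_fourier W x" by (simp flip: powr_add)
qed

lemma phase_arg_measurable[measurable]:
  "(\<lambda>x. exp (\<i> * of_real (r * (x \<bullet> (a::real^3))))) \<in> borel_measurable borel"
  by (intro borel_measurable_continuous_onI continuous_intros)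

text \<open>Provides what the locale below asks of V. A bound M for the pairings of F with all plane
  waves passes to V by Fubini for the Fourier integral and by exchanging sum and integral for the
  series. Being uniform in the frequency, it leaves no trace of g and gs in k.\<close>

lemma superposition_bounds:
  fixes W :: wavefun and f :: "nat \<Rightarrow> complex" and g :: real and gs :: "nat \<Rightarrow> real"
    and a :: "nat \<Rightarrow> real^3"
  assumes W: "integrable lborel W" and f: "summable (\<lambda>j. cmod (f j))"
    and V: "\<And>x. complex_of_real (V x) = inv_fourier W (g *\<^sub>R x)
            + (2 * pi) powr (- 3 / 2) *\<^sub>R (\<Sum>j. f j * exp (\<i> * of_real (gs j * (x \<bullet> a j))))"
  defines "k \<equiv> (2 * pi) powr (- 3 / 2) * ((LINT \<xi>|lborel. cmod (W \<xi>)) + (\<Sum>j. cmod (f j)))"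
  shows "V \<in> borel_measurable borel" "\<bar>V x\<bar> \<le> k"
    and "integrable lborel F \<Longrightarrow> (\<And>b. cmod (LINT x|lborel. F x * exp (\<i> * of_real (b \<bullet> x)))
      \<le> M)
      \<Longrightarrow> cmod (LINT x|lborel. F x * of_real (V x)) \<le> k * M"
proof -
  let ?c = "(2 * pi) powr (- 3 / 2)"
  have [measurable]: "W \<in> borel_measurable borel" using W by (auto dest: borel_measurable_integrable)
  define E where "E j x = exp (\<i> * of_real (gs j * (x \<bullet> a j)))" for j and x :: "real^3"
  have E1: "cmod (E j x) = 1" for j x unfolding E_def by (rule norm_phase)
  have [measurable]: "E j \<in> borel_measurable borel" for j unfolding E_def by measurable
  have sE: "summable (\<lambda>j. cmod (f j * E j x))" for x using f by (simp add: norm_mult E1)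
  define S where "S x = (\<Sum>j. f j * E j x)" for x
  have [measurable]: "S \<in> borel_measurable borel" unfolding S_def by measurable
  note [measurable] = fourier_phase_measurable(2)[of W]
  have V': "complex_of_real (V x) = inv_fourier W (g *\<^sub>R x) + ?c *\<^sub>R S x" for x
    unfolding V S_def E_def ..
  have "V = (\<lambda>x. Re (inv_fourier W (g *\<^sub>R x) + ?c *\<^sub>R S x))" unfolding V'[symmetric] by simp
  also have "\<dots> \<in> borel_measurable borel" by measurable
  finally show Vm: "V \<in> borel_measurable borel" .
  note Vm[measurable]
  show "\<bar>V x\<bar> \<le> k"
  proof -
    have "cmod (S x) \<le> (\<Sum>j. cmod (f j))"
      unfolding S_def using summable_norm[OF sE[of x]] by (simp add: norm_mult E1)
    then have "cmod (?c *\<^sub>R S x) \<le> ?c * (\<Sum>j. cmod (f j))" by (simp add: mult_left_mono)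
    moreover have "cmod (inv_fourier W (g *\<^sub>R x)) \<le> ?c * (LINT \<xi>|lborel. cmod (W \<xi>))"
      by (rule inv_fourier_bound)
    moreover have "cmod (complex_of_real (V x)) \<le> cmod (inv_fourier W (g *\<^sub>R x)) + cmod (?c *\<^sub>R S x)"
      unfolding V' by (rule norm_triangle_ineq)
    ultimately have "cmod (complex_of_real (V x)) \<le> k" unfolding k_def distrib_left by linarith
    then show ?thesis by simp
  qed
  assume F: "integrable lborel F" and M: "\<And>b. cmod (LINT x|lborel. F x * exp (\<i> * of_real (b \<bullet> x))) \<le> M"
  have [measurable]: "F \<in> borel_measurable borel" using F by (auto dest: borel_measurable_integrable)
  have iF1: "integrable lborel (\<lambda>x. F x * inv_fourier W (g *\<^sub>R x))"
  proof (rule Bochner_Integration.integrable_bound)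
    show "integrable lborel (\<lambda>x. cmod (F x) * (?c * (LINT \<xi>|lborel. cmod (W \<xi>))))" using F by simp
    show "AE x in lborel. norm (F x * inv_fourier W (g *\<^sub>R x))
      \<le> norm (cmod (F x) * (?c * (LINT \<xi>|lborel. cmod (W \<xi>))))"
    proof (rule AE_I2)
      fix x
      have "cmod (F x) * cmod (inv_fourier W (g *\<^sub>R x)) \<le> cmod (F x) * (?c * (LINT \<xi>|lborel. cmod (W \<xi>)))"
        by (intro mult_left_mono inv_fourier_bound) simp
      then show "norm (F x * inv_fourier W (g *\<^sub>R x))
        \<le> norm (cmod (F x) * (?c * (LINT \<xi>|lborel. cmod (W \<xi>))))"
        by (simp add: norm_mult)
    qed
  qed measurable
  have iFE: "integrable lborel (\<lambda>x. f j * (F x * E j x))" for j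
    by (intro integrable_mult_right Bochner_Integration.integrable_bound[OF F]) (auto simp: norm_mult E1)
  have "(LINT x|lborel. F x * S x) = (\<Sum>j. f j * (LINT x|lborel. F x * E j x))"
    and iFS: "integrable lborel (\<lambda>x. F x * S x)"
  proof -
    have e: "F x * S x = (\<Sum>j. f j * (F x * E j x))" for x
      unfolding S_def by (subst suminf_mult[OF summable_norm_cancel[OF sE], symmetric]) (simp add: mult_ac)
    have s1: "summable (\<lambda>j. cmod (f j * (F x * E j x)))" for x
      using summable_mult2[OF f, of "cmod (F x)"] by (simp add: norm_mult E1)
    have s2: "summable (\<lambda>j. LINT x|lborel. cmod (f j * (F x * E j x)))"
      using summable_mult2[OF f, of "LINT x|lborel. cmod (F x)"] by (simp add: norm_mult E1)
    show "(LINT x|lborel. F x * S x) = (\<Sum>j. f j * (LINT x|lborel. F x * E j x))"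
      unfolding e by (subst integral_suminf[OF iFE _ s2]) (auto simp: s1)
    show "integrable lborel (\<lambda>x. F x * S x)"
      unfolding e by (rule integrable_suminf[OF iFE _ s2]) (auto simp: s1)
  qed
  moreover have "cmod (\<Sum>j. f j * (LINT x|lborel. F x * E j x)) \<le> (\<Sum>j. cmod (f j) * M)"
  proof (rule norm_suminf_le)
    show "summable (\<lambda>j. cmod (f j) * M)" using f by (rule summable_mult2)
    show "cmod (f j * (LINT x|lborel. F x * E j x)) \<le> cmod (f j) * M" for j
      using M[of "gs j *\<^sub>R a j"] by (simp add: E_def norm_mult inner_commute mult_left_mono)
  qed
  ultimately have bS: "cmod (LINT x|lborel. F x * S x) \<le> (\<Sum>j. cmod (f j)) * M"
    using suminf_mult2[OF f] by simp
  have b1: "cmod (LINT x|lborel. F x * inv_fourier W (g *\<^sub>R x)) \<le> ?c * ((LINT \<xi>|lborel. cmod (W \<xi>)) * M)"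
  proof -
    define H where "H x \<xi> = F x * (exp (\<i> * of_real (\<xi> \<bullet> (g *\<^sub>R x))) * W \<xi>)"
      for x \<xi> :: "real^3"
    have int: "integrable (lborel \<Otimes>\<^sub>M lborel) (case_prod H)"
    proof (rule lborel_pair.Fubini_integrable)
      show "case_prod H \<in> borel_measurable (lborel \<Otimes>\<^sub>M lborel)" unfolding H_def by measurable
      have "integrable lborel (\<lambda>x. cmod (F x) * (LINT \<xi>|lborel. cmod (W \<xi>)))" using F by simp
      then show "integrable lborel (\<lambda>x. (LINT \<xi>|lborel. norm (case_prod H (x, \<xi>))))"
        by (simp add: H_def norm_mult)
      have "integrable lborel (\<lambda>\<xi>. F x * (exp (\<i> * of_real ((g *\<^sub>R x) \<bullet> \<xi>)) * W \<xi>))"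
        for x
        by (intro integrable_mult_right integrable_phase(1)[OF W])
      then have "integrable lborel (\<lambda>\<xi>. case_prod H (x, \<xi>))" for x
        unfolding H_def prod.case by (subst inner_commute)
      then show "AE x in lborel. integrable lborel (\<lambda>y. case_prod H (x, y))" by simp
    qed
    have "(LINT x|lborel. F x * inv_fourier W (g *\<^sub>R x))
      = ?c *\<^sub>R (LINT x|lborel. (LINT \<xi>|lborel. H x \<xi>))"
    proof -
      have "F x * inv_fourier W (g *\<^sub>R x) = ?c *\<^sub>R (LINT \<xi>|lborel. H x \<xi>)" for x
        unfolding H_def inv_fourier_def integral_mult_right_zero by simp
      then show ?thesis by (simp only: integral_scaleR_right)
    qed
    also have "(LINT x|lborel. (LINT \<xi>|lborel. H x \<xi>)) = (LINT \<xi>|lborel. (LINT x|lborel. H x \<xi>))"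
      by (rule lborel_pair.Fubini_integral[OF int, symmetric])
    also have "\<dots> = (LINT \<xi>|lborel. W \<xi> * (LINT x|lborel. F x * exp (\<i> * of_real ((g *\<^sub>R \<xi>) \<bullet> x))))"
    proof -
      have "(LINT x|lborel. H x \<xi>)
        = (LINT x|lborel. W \<xi> * (F x * exp (\<i> * of_real ((g *\<^sub>R \<xi>) \<bullet> x))))" for \<xi>
        by (simp add: H_def mult_ac)
      then show ?thesis by (simp only: integral_mult_right_zero)
    qed
    finally have "cmod (LINT x|lborel. F x * inv_fourier W (g *\<^sub>R x))
      = ?c * cmod (LINT \<xi>|lborel. W \<xi> * (LINT x|lborel. F x * exp (\<i> * of_real ((g *\<^sub>R \<xi>) \<bullet> x))))" by simp
    also have "\<dots> \<le> ?c * (LINT \<xi>|lborel. cmod (W \<xi>) * M)"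
    proof (rule mult_left_mono[OF norm_integral_le])
      show "integrable lborel (\<lambda>\<xi>. cmod (W \<xi>) * M)" using W by simp
      show "AE \<xi> in lborel. cmod (W \<xi> * (LINT x|lborel. F x * exp (\<i> * of_real ((g *\<^sub>R \<xi>) \<bullet> x)))) \<le> cmod (W \<xi>) * M"
        unfolding norm_mult by (intro AE_I2 mult_left_mono M) simp
      have "integrable lborel (\<lambda>\<xi>. LINT x|lborel. H x \<xi>)" by (rule lborel_pair.integrable_snd[OF int])
      moreover have "(LINT x|lborel. H x \<xi>)
        = W \<xi> * (LINT x|lborel. F x * exp (\<i> * of_real ((g *\<^sub>R \<xi>) \<bullet> x)))" for \<xi>
      proof -
        have "(LINT x|lborel. H x \<xi>)
          = (LINT x|lborel. W \<xi> * (F x * exp (\<i> * of_real ((g *\<^sub>R \<xi>) \<bullet> x))))"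
          by (simp add: H_def mult_ac)
        then show ?thesis by (simp only: integral_mult_right_zero)
      qed
      ultimately show "integrable lborel (\<lambda>\<xi>. W \<xi> * (LINT x|lborel. F x * exp (\<i> * of_real ((g *\<^sub>R \<xi>) \<bullet> x))))" by (simp only:)
    qed simp
    finally show ?thesis by simp
  qed
  have "(LINT x|lborel. F x * of_real (V x))
    = (LINT x|lborel. F x * inv_fourier W (g *\<^sub>R x) + ?c *\<^sub>R (F x * S x))"
    unfolding V' by (simp add: distrib_left)
  also have "\<dots> = (LINT x|lborel. F x * inv_fourier W (g *\<^sub>R x)) + ?c *\<^sub>R (LINT x|lborel. F x * S x)"
    using iF1 iFS by simp
  finally have "cmod (LINT x|lborel. F x * of_real (V x))
     \<le> cmod (LINT x|lborel. F x * inv_fourier W (g *\<^sub>R x)) + ?c * cmod (LINT x|lborel. F x * S x)"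
    using norm_triangle_ineq[of "LINT x|lborel. F x * inv_fourier W (g *\<^sub>R x)" "?c *\<^sub>R (LINT x|lborel. F x * S x)"] by simp
  also have "\<dots> \<le> ?c * ((LINT \<xi>|lborel. cmod (W \<xi>)) * M) + ?c * ((\<Sum>j. cmod (f j)) * M)"
    by (intro add_mono b1 mult_left_mono bS) simp
  also have "\<dots> = k * M" by (simp add: k_def algebra_simps)
  finally show "cmod (LINT x|lborel. F x * of_real (V x)) \<le> k * M" .
qed

section \<open>The Duhamel formula\<close>

text \<open>The smallness condition makes t -> D a t differentiable with derivative 0. The Duhamel
  identity is proved in this way because its integrand is only integrable in time.\<close>

lemma additive_interval_function_0:
  fixes D :: "real \<Rightarrow> real \<Rightarrow> complex"
  assumes "a \<le> b"
    and add: "\<And>r s t. a \<le> r \<Longrightarrow> r \<le> s \<Longrightarrow> s \<le> t \<Longrightarrow> t \<le> b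
      \<Longrightarrow> D r t = D r s + D s t"
    and small: "\<And>s0 e. s0 \<in> {a..b} \<Longrightarrow> 0 < e
      \<Longrightarrow> \<exists>d>0. \<forall>s\<in>{a..b}. \<forall>t\<in>{a..b}.
        s \<le> t \<longrightarrow> \<bar>s - s0\<bar> < d \<longrightarrow> \<bar>t - s0\<bar> < d \<longrightarrow> cmod (D s t) \<le> e * (t - s)"
  shows "D a b = 0"
proof -
  have "((\<lambda>t. D a t) has_derivative (\<lambda>h. 0)) (at s0 within {a..b})" if s0: "s0 \<in> {a..b}" for s0
    unfolding has_derivative_within_alt
  proof (intro conjI allI impI bounded_linear_zero)
    fix e :: real assume "0 < e"
    then obtain d where d: "d > 0"
      and D: "\<And>s t. s \<in> {a..b} \<Longrightarrow> t \<in> {a..b} \<Longrightarrow> s \<le> t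
        \<Longrightarrow> \<bar>s - s0\<bar> < d \<Longrightarrow> \<bar>t - s0\<bar> < d
        \<Longrightarrow> cmod (D s t) \<le> e * (t - s)"
      using small[OF s0] by metis
    show "\<exists>d>0. \<forall>y\<in>{a..b}. norm (y - s0) < d \<longrightarrow> norm (D a y - D a s0 - 0)
      \<le> e * norm (y - s0)"
    proof (intro exI[of _ d] conjI d ballI impI)
      fix y assume y: "y \<in> {a..b}" "norm (y - s0) < d"
      show "norm (D a y - D a s0 - 0) \<le> e * norm (y - s0)"
      proof (cases "s0 \<le> y")
        case True
        then have "D a y = D a s0 + D s0 y" using s0 y by (intro add) auto
        then show ?thesis using D[of s0 y] s0 y d True by simp
      next
        case False
        then have "D a s0 = D a y + D y s0" using s0 y by (intro add) auto
        then show ?thesis using D[of y s0] s0 y d False by (simp add: abs_minus_commute)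
      qed
    qed
  qed
  from has_derivative_zero_constant[OF convex_real_interval(5) this]
  obtain c where c: "\<And>t. t \<in> {a..b} \<Longrightarrow> D a t = c" by blast
  have "D a a = 0" using add[of a a a] \<open>a \<le> b\<close> by simp
  then show ?thesis using c[of a] c[of b] \<open>a \<le> b\<close> by simp
qed

text \<open>The norms on the right are those of H_0 phi and H_0^2 phi. Plancherel reduces the bounds
  to Taylor estimates of exp(-i (t - s) |xi|^2), uniformly in t and s.\<close>

lemma gauss_evolution:
  assumes a: "0 < a"
  shows "evo t (gauss a b) \<in> schwartz"
    and "nrm (\<lambda>x. - laplacian (evo t (gauss a b)) x)
      = nrm (\<lambda>\<xi>. of_real ((norm \<xi>)\<^sup>2) * fourier (gauss a b) \<xi>)"
    and "(\<lambda>x. - laplacian (evo t (gauss a b)) x) \<in> Lp_space 2"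
    and "nrm (\<lambda>x. evo t (gauss a b) x - evo s (gauss a b) x)
        \<le> \<bar>t - s\<bar> * nrm (\<lambda>\<xi>. of_real ((norm \<xi>)\<^sup>2) * fourier (gauss a b) \<xi>)"
    and "nrm (\<lambda>x. evo t (gauss a b) x - evo s (gauss a b) x
      + \<i> * of_real (t - s) * (- laplacian (evo s (gauss a b)) x))
        \<le> (t - s)\<^sup>2 * nrm (\<lambda>\<xi>. of_real ((norm \<xi>)\<^sup>2) * (of_real ((norm \<xi>)\<^sup>2) * fourier (gauss a b) \<xi>))"
proof -
  obtain k \<beta> where k: "fourier (gauss a b) = (\<lambda>\<xi>. k * cgauss (of_real (1 / (4 * a))) \<beta> \<xi>)"
    using fourier_gauss[OF a] by blast
  let ?F = "fourier (gauss a b)"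
  define m where "m t \<xi> = exp (- \<i> * of_real (t * (norm \<xi>)\<^sup>2))" for t and \<xi> :: "real^3"
  \<comment> \<open>The free multiplier changes the parameter 1 / (4 a) of the transformed Gaussian
    to 1 / (4 a) + i t, which keeps its positive real part.\<close>
  define z where "z t = of_real (1 / (4 * a)) + \<i> * of_real t" for t
  have z: "0 < Re (z t)" for t using a by (simp add: z_def)
  have z0: "0 < Re (complex_of_real (1 / (4 * a)))" using a by simp
  define w where "w t \<xi> = m t \<xi> * ?F \<xi>" for t \<xi>
  have weq: "w t = (\<lambda>\<xi>. k * cgauss (z t) \<beta> \<xi>)" for t
  proof
    fix \<xi>
    have "m t \<xi> * cgauss (of_real (1 / (4 * a))) \<beta> \<xi> = cgauss (z t) \<beta> \<xi>"
      unfolding m_def cgauss_def z_def exp_add[symmetric] by (rule arg_cong[where f=exp]) (simp add: algebra_simps)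
    then show "w t \<xi> = k * cgauss (z t) \<beta> \<xi>" unfolding w_def k by simp
  qed
  have w: "w t \<in> gclass (z t) \<beta>" for t unfolding weq by (rule cgauss_in_gclass)
  have F: "?F \<in> gclass (of_real (1 / (4 * a))) \<beta>" unfolding k by (rule cgauss_in_gclass)
  have evo: "evo t (gauss a b) = inv_fourier (w t)" for t
    unfolding evo_def w_def[abs_def] m_def ..
  show "evo t (gauss a b) \<in> schwartz" unfolding evo by (rule inv_fourier_gclass_schwartz[OF z w])
  have lap: "(\<lambda>x. - laplacian (evo t (gauss a b)) x)
    = inv_fourier (\<lambda>\<xi>. of_real ((norm \<xi>)\<^sup>2) * w t \<xi>)" for t
  proof
    fix x
    have "(\<lambda>\<xi>. - (of_real ((norm \<xi>)\<^sup>2) * w t \<xi>))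
      = (\<lambda>\<xi>. (-1) * (of_real ((norm \<xi>)\<^sup>2) * w t \<xi>))" by simp
    then show "- laplacian (evo t (gauss a b)) x
      = inv_fourier (\<lambda>\<xi>. of_real ((norm \<xi>)\<^sup>2) * w t \<xi>) x"
      unfolding evo laplacian_inv_fourier[OF z w] by (simp only: inv_fourier_cmult) simp
  qed
  have nw: "(\<lambda>\<xi>. of_real ((norm \<xi>)\<^sup>2) * w t \<xi>) \<in> nice" for t
    by (intro schwartz_nice gclass_schwartz[OF z[of t], of _ \<beta>] gclass_normsq w)
  have wn: "w t \<in> nice" for t by (intro schwartz_nice gclass_schwartz[OF z w])
  have cm: "cmod (m t \<xi>) = 1" for t \<xi> by (simp add: m_def norm_exp_eq_Re)
  show "nrm (\<lambda>x. - laplacian (evo t (gauss a b)) x)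
    = nrm (\<lambda>\<xi>. of_real ((norm \<xi>)\<^sup>2) * ?F \<xi>)"
    unfolding lap Plancherel_inv(2)[OF nw] unfolding nrm_def by (simp add: w_def norm_mult cm)
  show "(\<lambda>x. - laplacian (evo t (gauss a b)) x) \<in> Lp_space 2" unfolding lap by (rule Plancherel_inv(1)[OF nw])
  have L1: "(\<lambda>\<xi>. of_real ((norm \<xi>)\<^sup>2) * ?F \<xi>) \<in> Lp_space 2"
    by (intro schwartz_L2 gclass_schwartz[OF z0, of _ \<beta>] gclass_normsq F)
  have L2: "(\<lambda>\<xi>. of_real ((norm \<xi>)\<^sup>2) * (of_real ((norm \<xi>)\<^sup>2) * ?F \<xi>)) \<in> Lp_space 2"
    by (intro schwartz_L2 gclass_schwartz[OF z0, of _ \<beta>] gclass_normsq F)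
  have [measurable]: "?F \<in> borel_measurable borel" by (rule gclass_measurable[OF z0 F])
  have [measurable]: "m t \<in> borel_measurable borel" for t unfolding m_def by measurable
  have [measurable]: "w t \<in> borel_measurable borel" for t unfolding w_def by measurable
  have nice_lin: "(\<lambda>\<xi>. c * f \<xi> + g \<xi>) \<in> nice" if fg: "f \<in> nice" "g \<in> nice" for f g c
  proof -
    obtain Kf Kg where K: "\<And>x. cmod (f x) \<le> Kf" "\<And>x. cmod (g x) \<le> Kg" using fg unfolding nice_def by blast
    have "cmod (c * f x + g x) \<le> cmod c * Kf + Kg" for x
      by (intro order_trans[OF norm_triangle_ineq] add_mono K) (auto simp: norm_mult intro!: mult_left_mono K)
    then show ?thesis using fg by (auto simp: nice_def intro!: continuous_intros)
  qed
  have inv_lin: "inv_fourier (\<lambda>\<xi>. c * f \<xi> + g \<xi>) = (\<lambda>x. c * inv_fourier f x + inv_fourier g x)"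
    if "f \<in> nice" "g \<in> nice" for f g c
  proof
    fix x
    show "inv_fourier (\<lambda>\<xi>. c * f \<xi> + g \<xi>) x = c * inv_fourier f x + inv_fourier g x"
      using that inv_fourier_add[of "\<lambda>\<xi>. c * f \<xi>" g x] by (simp add: nice_def inv_fourier_cmult)
  qed
  have mdiff: "m t \<xi> - m s \<xi> = m s \<xi> * (exp (\<i> * of_real (- (t - s) * (norm \<xi>)\<^sup>2)) - 1)"
    for t s \<xi>
  proof -
    have "m t \<xi> = m s \<xi> * exp (\<i> * of_real (- (t - s) * (norm \<xi>)\<^sup>2))"
      unfolding m_def exp_add[symmetric] by (rule arg_cong[where f=exp]) (simp add: algebra_simps)
    then show ?thesis by (simp add: algebra_simps)
  qed
  show "nrm (\<lambda>x. evo t (gauss a b) x - evo s (gauss a b) x)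
    \<le> \<bar>t - s\<bar> * nrm (\<lambda>\<xi>. of_real ((norm \<xi>)\<^sup>2) * ?F \<xi>)"
  proof -
    have "(\<lambda>x. evo t (gauss a b) x - evo s (gauss a b) x)
      = inv_fourier (\<lambda>\<xi>. (-1) * w s \<xi> + w t \<xi>)"
      unfolding inv_lin[OF wn wn] evo by simp
    then have "nrm (\<lambda>x. evo t (gauss a b) x - evo s (gauss a b) x)
      = nrm (\<lambda>\<xi>. (-1) * w s \<xi> + w t \<xi>)"
      by (simp only: Plancherel_inv(2)[OF nice_lin[OF wn wn]])
    also have "\<dots> \<le> \<bar>t - s\<bar> * nrm (\<lambda>\<xi>. of_real ((norm \<xi>)\<^sup>2) * ?F \<xi>)"
    proof (rule L2_bound(2)[OF L1])
      show "AE \<xi> in lborel. cmod ((-1) * w s \<xi> + w t \<xi>)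
        \<le> \<bar>t - s\<bar> * cmod (of_real ((norm \<xi>)\<^sup>2) * ?F \<xi>)"
      proof (rule AE_I2)
        fix \<xi> :: "real^3"
        let ?\<theta> = "- (t - s) * (norm \<xi>)\<^sup>2"
        have "cmod (exp (\<i> * of_real ?\<theta>) - (\<Sum>k\<le>0. (\<i> * of_real ?\<theta>) ^ k / fact k))
          \<le> \<bar>?\<theta>\<bar> ^ Suc 0 / fact (Suc 0)"
          by (rule iexp_approx1)
        then have "cmod (exp (\<i> * of_real ?\<theta>) - 1) \<le> \<bar>t - s\<bar> * (norm \<xi>)\<^sup>2"
          by (simp add: abs_mult abs_minus_commute[of t s])
        then have "cmod (exp (\<i> * of_real ?\<theta>) - 1) * cmod (?F \<xi>)
          \<le> (\<bar>t - s\<bar> * (norm \<xi>)\<^sup>2) * cmod (?F \<xi>)"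
          by (rule mult_right_mono) simp
        moreover have "(-1) * w s \<xi> + w t \<xi> = m s \<xi> * (exp (\<i> * of_real ?\<theta>) - 1) * ?F \<xi>"
          unfolding mdiff[symmetric] by (simp add: w_def algebra_simps)
        then have "cmod ((-1) * w s \<xi> + w t \<xi>) = cmod (exp (\<i> * of_real ?\<theta>) - 1) * cmod (?F \<xi>)"
          by (simp only: norm_mult cm mult_1_left)
        moreover have "cmod (of_real ((norm \<xi>)\<^sup>2) * ?F \<xi>) = (norm \<xi>)\<^sup>2 * cmod (?F \<xi>)"
          by (simp add: norm_mult norm_power)
        ultimately show "cmod ((-1) * w s \<xi> + w t \<xi>)
          \<le> \<bar>t - s\<bar> * cmod (of_real ((norm \<xi>)\<^sup>2) * ?F \<xi>)"
          by (simp only: mult.assoc)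
      qed
    qed auto
    finally show ?thesis .
  qed
  show "nrm (\<lambda>x. evo t (gauss a b) x - evo s (gauss a b) x
    + \<i> * of_real (t - s) * (- laplacian (evo s (gauss a b)) x))
        \<le> (t - s)\<^sup>2 * nrm (\<lambda>\<xi>. of_real ((norm \<xi>)\<^sup>2) * (of_real ((norm \<xi>)\<^sup>2) * ?F \<xi>))"
  proof -
    define v where "v \<xi> = (\<i> * of_real (t - s)) * (of_real ((norm \<xi>)\<^sup>2) * w s \<xi>)
      + ((-1) * w s \<xi> + w t \<xi>)" for \<xi>
    have "(\<lambda>x. evo t (gauss a b) x - evo s (gauss a b) x
      + \<i> * of_real (t - s) * (- laplacian (evo s (gauss a b)) x))
       = inv_fourier v"
    proof -
      have l: "- laplacian (evo s (gauss a b)) x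
        = inv_fourier (\<lambda>\<xi>. of_real ((norm \<xi>)\<^sup>2) * w s \<xi>) x" for x
        using lap[of s] by (rule fun_cong)
      show ?thesis
        unfolding v_def[abs_def] inv_lin[OF nw nice_lin[OF wn wn]] inv_lin[OF wn wn] l unfolding evo
          by (simp add: algebra_simps)
    qed
    moreover have "v \<in> nice" unfolding v_def by (intro nice_lin nw wn)
    ultimately have "nrm (\<lambda>x. evo t (gauss a b) x - evo s (gauss a b) x
      + \<i> * of_real (t - s) * (- laplacian (evo s (gauss a b)) x)) = nrm v"
      by (simp only: Plancherel_inv(2))
    also have "\<dots> \<le> (t - s)\<^sup>2 * nrm (\<lambda>\<xi>. of_real ((norm \<xi>)\<^sup>2) * (of_real ((norm \<xi>)\<^sup>2) * ?F \<xi>))"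
    proof (rule L2_bound(2)[OF L2])
      show "AE \<xi> in lborel. cmod (v \<xi>)
        \<le> (t - s)\<^sup>2 * cmod (of_real ((norm \<xi>)\<^sup>2) * (of_real ((norm \<xi>)\<^sup>2) * ?F \<xi>))"
      proof (rule AE_I2)
        fix \<xi> :: "real^3"
        let ?\<theta> = "- (t - s) * (norm \<xi>)\<^sup>2"
        have sm: "(\<Sum>k\<le>1. (\<i> * of_real ?\<theta>) ^ k / fact k) = 1 + \<i> * of_real ?\<theta>" by simp
        have "cmod (exp (\<i> * of_real ?\<theta>) - (\<Sum>k\<le>1. (\<i> * of_real ?\<theta>) ^ k / fact k))
          \<le> \<bar>?\<theta>\<bar> ^ Suc 1 / fact (Suc 1)"
          by (rule iexp_approx1)
        also have "\<dots> \<le> \<bar>?\<theta>\<bar>\<^sup>2" by (simp add: numeral_2_eq_2)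
        also have "\<dots> = (t - s)\<^sup>2 * ((norm \<xi>)\<^sup>2 * (norm \<xi>)\<^sup>2)"
          unfolding power2_abs power_mult_distrib power2_minus by (simp add: power2_eq_square)
        finally have 1: "cmod (exp (\<i> * of_real ?\<theta>) - 1 - \<i> * of_real ?\<theta>)
          \<le> (t - s)\<^sup>2 * ((norm \<xi>)\<^sup>2 * (norm \<xi>)\<^sup>2)"
          unfolding sm by (simp add: diff_diff_eq)
        have "v \<xi> = ((m t \<xi> - m s \<xi>) - m s \<xi> * (\<i> * of_real ?\<theta>)) * ?F \<xi>"
          unfolding v_def w_def by (simp add: algebra_simps)
        also have "(m t \<xi> - m s \<xi>) - m s \<xi> * (\<i> * of_real ?\<theta>)
          = m s \<xi> * (exp (\<i> * of_real ?\<theta>) - 1 - \<i> * of_real ?\<theta>)"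
          unfolding mdiff by (simp only: right_diff_distrib)
        finally have v: "cmod (v \<xi>)
          = cmod (exp (\<i> * of_real ?\<theta>) - 1 - \<i> * of_real ?\<theta>) * cmod (?F \<xi>)"
          by (simp only: norm_mult cm mult_1_left)
        have "cmod (exp (\<i> * of_real ?\<theta>) - 1 - \<i> * of_real ?\<theta>) * cmod (?F \<xi>)
          \<le> (t - s)\<^sup>2 * ((norm \<xi>)\<^sup>2 * (norm \<xi>)\<^sup>2) * cmod (?F \<xi>)"
          by (intro mult_right_mono 1) simp
        then show "cmod (v \<xi>) \<le> (t - s)\<^sup>2 * cmod (of_real ((norm \<xi>)\<^sup>2) * (of_real ((norm \<xi>)\<^sup>2) * ?F \<xi>))"
          unfolding v by (simp add: norm_mult norm_power mult.assoc)
      qed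
    qed (auto simp: v_def[abs_def])
    finally show ?thesis .
  qed
qed

section \<open>Consequences of the propagator axioms\<close>

lemma is_propagatorD:
  assumes P: "is_propagator V U"
  shows "0 \<le> t \<Longrightarrow> 0 \<le> s \<Longrightarrow> f \<in> Lp_space 2 \<Longrightarrow> Lp_norm 2 (U t s f)
    = Lp_norm 2 f"
    and "0 \<le> t \<Longrightarrow> 0 \<le> s \<Longrightarrow> f \<in> Lp_space 2
      \<Longrightarrow> g \<in> Lp_space 2 \<Longrightarrow>
       ae_equal (U t s (\<lambda>x. c * f x + g x)) (\<lambda>x. c * U t s f x + U t s g x)"
    and "0 \<le> t \<Longrightarrow> f \<in> Lp_space 2 \<Longrightarrow> ae_equal (U t t f) f"
    and "0 \<le> t \<Longrightarrow> 0 \<le> r \<Longrightarrow> 0 \<le> s \<Longrightarrow> f \<in> Lp_space 2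
      \<Longrightarrow> ae_equal (U t r (U r s f)) (U t s f)"
    and "0 \<le> t \<Longrightarrow> 0 \<le> s \<Longrightarrow> f \<in> Lp_space 2 \<Longrightarrow>
       ((\<lambda>\<tau>. Lp_norm 2 (\<lambda>x. U \<tau> s f x - U t s f x)) \<longlongrightarrow> 0) (at t within {0..})"
    and "0 \<le> s \<Longrightarrow> f \<in> Lp_space 2 \<Longrightarrow> \<phi> \<in> schwartz \<Longrightarrow> 0 \<le> t1
      \<Longrightarrow> t1 \<le> t2 \<Longrightarrow>
       set_integrable lebesgue {t1..t2} (\<lambda>\<tau>. inner_L2 (\<lambda>x. - laplacian \<phi> x) (U \<tau> s f)
                    + inner_L2 \<phi> (\<lambda>x. of_real (V x \<tau>) * U \<tau> s f x)) \<and>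
       \<i> * (inner_L2 \<phi> (U t2 s f) - inner_L2 \<phi> (U t1 s f))
         = (LINT \<tau>:{t1..t2}|lebesgue. inner_L2 (\<lambda>x. - laplacian \<phi> x) (U \<tau> s f)
                    + inner_L2 \<phi> (\<lambda>x. of_real (V x \<tau>) * U \<tau> s f x))"
  subgoal by (rule P[unfolded is_propagator_def, THEN conjunct1, rule_format])
  subgoal by (rule P[unfolded is_propagator_def, THEN conjunct2, THEN conjunct1, rule_format])
  subgoal by (rule P[unfolded is_propagator_def, THEN conjunct2, THEN conjunct2, THEN conjunct1, rule_format])
  subgoal by (rule P[unfolded is_propagator_def, THEN conjunct2, THEN conjunct2, THEN conjunct2, THEN conjunct1, rule_format])
  subgoal by (rule P[unfolded is_propagator_def, THEN conjunct2, THEN conjunct2, THEN conjunct2, THEN conjunct2, THEN conjunct1, rule_format])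
  subgoal by (rule P[unfolded is_propagator_def Let_def, THEN conjunct2, THEN conjunct2, THEN conjunct2, THEN conjunct2, THEN conjunct2, rule_format])
  done

text \<open>All that is used of the potential: for times in the conull set \<open>G\<close> it is bounded by \<open>k\<close>,
  and (\<open>V_phase\<close>) it is a superposition of plane waves of total mass \<open>k\<close>.\<close>

locale flow =
  fixes V :: "real^3 \<Rightarrow> real \<Rightarrow> real"
    and U :: "real \<Rightarrow> real \<Rightarrow> wavefun \<Rightarrow> wavefun"
    and G :: "real set" and k :: "real \<Rightarrow> real"
  assumes propagator: "is_propagator V U"
    and G_sets: "G \<in> sets lebesgue" and G_AE: "AE t in lebesgue. 0 \<le> t \<longrightarrow> t \<in> G"
    and k_nonneg: "\<And>t. 0 \<le> k t" and k_integrable: "set_integrable lebesgue {0..} k"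
    and V_measurable: "\<And>t. t \<in> G \<Longrightarrow> (\<lambda>x. V x t) \<in> borel_measurable borel"
    and V_le: "\<And>t x. t \<in> G \<Longrightarrow> \<bar>V x t\<bar> \<le> k t"
    and V_phase: "\<And>t F M. t \<in> G \<Longrightarrow> integrable lborel F \<Longrightarrow>
      (\<And>b. cmod (LINT x|lborel. F x * exp (\<i> * of_real (b \<bullet> x))) \<le> M) \<Longrightarrow>
      cmod (LINT x|lborel. F x * of_real (V x t)) \<le> k t * M"
begin

lemma U_isometry: assumes "0 \<le> t" "0 \<le> s" shows "L2_isometry (U t s)"
proof -
  have *: "Lp_norm 2 (U t s f) = Lp_norm 2 f" if "f \<in> Lp_space 2" for f
    by (rule is_propagatorD(1)[OF propagator assms that])
  have L: "U t s f \<in> Lp_space 2" if "f \<in> Lp_space 2" for f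
    using *[OF that] that by (simp add: Lp_space_def)
  have N: "nrm (U t s f) = nrm f" if "f \<in> Lp_space 2" for f
    using *[OF that] by (simp add: Lp_norm_2 L that)
  show ?thesis unfolding L2_isometry_def
    by (intro conjI ballI allI L N is_propagatorD(2)[OF propagator assms])
qed

lemma U_L2: "0 \<le> t \<Longrightarrow> 0 \<le> s \<Longrightarrow> f \<in> Lp_space 2
  \<Longrightarrow> U t s f \<in> Lp_space 2"
  by (rule L2_isometryD(1)[OF U_isometry])

lemma U_nrm: "0 \<le> t \<Longrightarrow> 0 \<le> s \<Longrightarrow> f \<in> Lp_space 2 \<Longrightarrow> nrm (U t s f)
  = nrm f"
  by (rule L2_isometryD(2)[OF U_isometry])

lemma U_refl: "0 \<le> t \<Longrightarrow> f \<in> Lp_space 2 \<Longrightarrow> ae_equal (U t t f) f"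
  by (rule is_propagatorD(3)[OF propagator])

lemma U_comp: "0 \<le> t \<Longrightarrow> 0 \<le> r \<Longrightarrow> 0 \<le> s \<Longrightarrow> f \<in> Lp_space 2
  \<Longrightarrow> ae_equal (U t r (U r s f)) (U t s f)"
  by (rule is_propagatorD(4)[OF propagator])

lemma U_continuous:
  assumes "0 \<le> t" "f \<in> Lp_space 2" "0 < e"
  shows "\<exists>d>0. \<forall>\<tau>\<ge>0. \<bar>\<tau> - t\<bar> < d
    \<longrightarrow> nrm (\<lambda>x. U \<tau> 0 f x - U t 0 f x) < e"
proof -
  have "((\<lambda>\<tau>. Lp_norm 2 (\<lambda>x. U \<tau> 0 f x - U t 0 f x)) \<longlongrightarrow> 0) (at t within {0..})"
    using assms by (intro is_propagatorD(5)[OF propagator]) auto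
  then have "\<forall>\<^sub>F \<tau> in at t within {0..}. Lp_norm 2 (\<lambda>x. U \<tau> 0 f x - U t 0 f x)
    \<le> ennreal (e/2)"
    using assms unfolding ennreal_tendsto_0_iff by simp
  then obtain d where d: "d > 0"
    "\<And>\<tau>. \<tau> \<in> {0..} \<Longrightarrow> \<tau> \<noteq> t \<Longrightarrow> dist \<tau> t < d
      \<Longrightarrow> Lp_norm 2 (\<lambda>x. U \<tau> 0 f x - U t 0 f x) \<le> ennreal (e/2)"
    unfolding eventually_at by blast
  show ?thesis
  proof (intro exI[of _ d] conjI d allI impI)
    fix \<tau> :: real assume \<tau>: "0 \<le> \<tau>" "\<bar>\<tau> - t\<bar> < d"
    show "nrm (\<lambda>x. U \<tau> 0 f x - U t 0 f x) < e"
    proof (cases "\<tau> = t")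
      case False
      then have "ennreal (nrm (\<lambda>x. U \<tau> 0 f x - U t 0 f x)) \<le> ennreal (e/2)"
        using d(2)[of \<tau>] \<tau> assms by (simp add: dist_real_def Lp_norm_2 L2_diff U_L2)
      then have "nrm (\<lambda>x. U \<tau> 0 f x - U t 0 f x) \<le> e / 2" using assms by (subst (asm) ennreal_le_iff) auto
      then show ?thesis using assms by simp
    qed (use assms in \<open>simp add: nrm_def\<close>)
  qed
qed

lemma U_weak:
  assumes "f \<in> Lp_space 2" "\<phi> \<in> schwartz" "0 \<le> t1" "t1 \<le> t2"
  shows "set_integrable lebesgue {t1..t2} (\<lambda>\<tau>. inner_L2 (\<lambda>x. - laplacian \<phi> x) (U \<tau> 0 f)
                    + inner_L2 \<phi> (\<lambda>x. of_real (V x \<tau>) * U \<tau> 0 f x))"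
    and "\<i> * (inner_L2 \<phi> (U t2 0 f) - inner_L2 \<phi> (U t1 0 f))
      = (LINT \<tau>:{t1..t2}|lebesgue. inner_L2 (\<lambda>x. - laplacian \<phi> x) (U \<tau> 0 f)
                    + inner_L2 \<phi> (\<lambda>x. of_real (V x \<tau>) * U \<tau> 0 f x))"
  using is_propagatorD(6)[OF propagator order_refl assms] by auto

lemma k_set_integrable: "0 \<le> s \<Longrightarrow> set_integrable lebesgue {s..t} k"
  by (rule set_integrable_subset[OF k_integrable]) auto

lemma k_integrable_on: "0 \<le> s \<Longrightarrow> k integrable_on {s..t}"
  by (rule set_lebesgue_integral_eq_integral(1)[OF k_set_integrable])

lemma k_integral_nonneg: "0 \<le> integral {s..t} k"
  by (cases "k integrable_on {s..t}")
    (auto intro: Henstock_Kurzweil_Integration.integral_nonneg k_nonneg simp: not_integrable_integral)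

lemma k_integral_combine: "0 \<le> r \<Longrightarrow> r \<le> s \<Longrightarrow> s \<le> t
  \<Longrightarrow> integral {r..t} k = integral {r..s} k + integral {s..t} k"
  by (rule Henstock_Kurzweil_Integration.integral_combine[symmetric]) (auto intro: k_integrable_on)

lemma V_L2:
  assumes "t \<in> G" "f \<in> Lp_space 2"
  shows "(\<lambda>x. of_real (V x t) * f x) \<in> Lp_space 2" "nrm (\<lambda>x. of_real (V x t) * f x) \<le> k t * nrm f"
proof -
  have [measurable]: "f \<in> borel_measurable borel" "(\<lambda>x. V x t) \<in> borel_measurable borel"
    using assms by (auto intro: Lp_space_measurable V_measurable)
  have "AE x in lborel. cmod (of_real (V x t) * f x) \<le> k t * cmod (f x)"
    using V_le[OF assms(1)] by (auto simp: norm_mult intro!: mult_right_mono)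
  from L2_bound[OF assms(2) _ k_nonneg this]
  show "(\<lambda>x. of_real (V x t) * f x) \<in> Lp_space 2" "nrm (\<lambda>x. of_real (V x t) * f x) \<le> k t * nrm f"
    by auto
qed

text \<open>The matrix element of U(0,t) e^(-i t H_0) between \<phi> and u, conjugate-linear in
  \<phi>, with the propagator moved to the side of u.\<close>

definition amp :: "real \<Rightarrow> wavefun \<Rightarrow> wavefun \<Rightarrow> complex" where
  "amp t \<phi> u = inner_L2 (free_evolution t \<phi>) (U t 0 u)"

text \<open>Formally i times the time derivative of \<open>amp\<close>, in which the contributions
  of H_0 cancel. The value 0 off \<open>G\<close> makes the bound by \<open>k\<close> hold at all
  times.\<close>

definition src :: "real \<Rightarrow> wavefun \<Rightarrow> wavefun \<Rightarrow> complex" where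
  "src t \<phi> u = (if t \<in> G \<and> 0
    \<le> t then inner_L2 (free_evolution t \<phi>) (\<lambda>x. of_real (V x t) * U t 0 u x) else 0)"

lemma E_L2: "f \<in> Lp_space 2 \<Longrightarrow> free_evolution t f \<in> Lp_space 2"
  and E_nrm: "f \<in> Lp_space 2 \<Longrightarrow> nrm (free_evolution t f) = nrm f"
  using L2_isometryD[OF free_evolution_isometry] by blast+

lemma amp_bound:
  assumes "0 \<le> t" "\<phi> \<in> Lp_space 2" "u \<in> Lp_space 2"
  shows "cmod (amp t \<phi> u) \<le> nrm \<phi> * nrm u"
  unfolding amp_def using inner_CS[OF E_L2[OF assms(2)] U_L2[OF assms(1) _ assms(3), of 0], of t] assms
  by (simp add: E_nrm U_nrm)

lemma src_bound:
  assumes "\<phi> \<in> Lp_space 2" "u \<in> Lp_space 2"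
  shows "cmod (src t \<phi> u) \<le> k t * (nrm \<phi> * nrm u)"
proof (cases "t \<in> G \<and> 0 \<le> t")
  case True
  note W = V_L2[of t "U t 0 u"]
  have "cmod (src t \<phi> u) \<le> nrm \<phi> * nrm (\<lambda>x. of_real (V x t) * U t 0 u x)"
    using inner_CS[OF E_L2[OF assms(1)] W(1), of t] True assms by (simp add: src_def E_nrm U_L2)
  also have "\<dots> \<le> nrm \<phi> * (k t * nrm u)"
    using W(2) True assms by (intro mult_left_mono) (auto simp: U_L2 U_nrm)
  finally show ?thesis by (simp add: mult_ac)
next
  case False
  then show ?thesis using k_nonneg by (auto simp: src_def)
qed

lemma E_lin_inner:
  assumes "f \<in> Lp_space 2" "g \<in> Lp_space 2" "h \<in> Lp_space 2"
  shows "inner_L2 (free_evolution t (\<lambda>x. c * f x + g x)) h = cnj c * inner_L2 (free_evolution t f) h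
    + inner_L2 (free_evolution t g) h"
proof -
  have "inner_L2 (free_evolution t (\<lambda>x. c * f x + g x)) h
    = inner_L2 (\<lambda>x. c * free_evolution t f x + free_evolution t g x) h"
    by (rule inner_cong_AE)
       (use L2_isometryD(3)[OF free_evolution_isometry assms(1,2)] in
        \<open>auto intro!: Lp_space_measurable[of _ 2] E_L2 L2_lin assms\<close>)
  then show ?thesis by (simp add: inner_lin_left E_L2 assms)
qed

lemma amp_lin:
  assumes "0 \<le> t" "f \<in> Lp_space 2" "g \<in> Lp_space 2" "u \<in> Lp_space 2"
  shows "amp t (\<lambda>x. c * f x + g x) u = cnj c * amp t f u + amp t g u"
  unfolding amp_def using assms by (intro E_lin_inner U_L2) auto

lemma src_lin:
  assumes "f \<in> Lp_space 2" "g \<in> Lp_space 2" "u \<in> Lp_space 2"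
  shows "src t (\<lambda>x. c * f x + g x) u = cnj c * src t f u + src t g u"
  unfolding src_def using assms by (auto intro!: E_lin_inner V_L2 U_L2)

lemma amp_diff:
  assumes "0 \<le> t" "f \<in> Lp_space 2" "g \<in> Lp_space 2" "u \<in> Lp_space 2"
  shows "cmod (amp t f u - amp t g u) \<le> nrm (\<lambda>x. f x - g x) * nrm u"
  using amp_bound[OF assms(1) L2_diff[OF assms(2,3)] assms(4)] amp_lin[OF assms(1,3,2,4), of "-1"] by simp

lemma src_diff:
  assumes "f \<in> Lp_space 2" "g \<in> Lp_space 2" "u \<in> Lp_space 2"
  shows "cmod (src t f u - src t g u) \<le> k t * (nrm (\<lambda>x. f x - g x) * nrm u)"
  using src_bound[OF L2_diff[OF assms(1,2)] assms(3), of t] src_lin[OF assms(2,1,3), of t "-1"] by simp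

lemma set_integrable_k_bound:
  fixes f :: "real \<Rightarrow> complex"
  assumes s: "0 \<le> s"
    and m: "(\<lambda>\<tau>. indicator {s..t} \<tau> *\<^sub>R f \<tau>) \<in> borel_measurable lebesgue"
    and b: "\<And>\<tau>. \<tau> \<in> {s..t} \<Longrightarrow> cmod (f \<tau>) \<le> k \<tau> * M"
  shows "set_integrable lebesgue {s..t} f"
  unfolding set_integrable_def
proof (rule Bochner_Integration.integrable_bound[OF _ m])
  show "integrable lebesgue (\<lambda>\<tau>. (indicator {s..t} \<tau> *\<^sub>R k \<tau>) * M)"
    using k_set_integrable[OF s, of t] unfolding set_integrable_def by simp
  show "AE \<tau> in lebesgue. norm (indicator {s..t} \<tau> *\<^sub>R f \<tau>)
    \<le> norm ((indicator {s..t} \<tau> *\<^sub>R k \<tau>) * M)"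
    using b by (auto simp: indicator_def intro: order_trans[OF _ abs_ge_self])
qed

lemma integral_k_bound:
  fixes f :: "real \<Rightarrow> complex"
  assumes s: "0 \<le> s" and f: "f integrable_on {s..t}"
    and b: "\<And>\<tau>. \<tau> \<in> {s..t} \<Longrightarrow> cmod (f \<tau>) \<le> k \<tau> * M"
  shows "cmod (integral {s..t} f) \<le> integral {s..t} k * M"
proof -
  have "cmod (integral {s..t} f) \<le> integral {s..t} (\<lambda>\<tau>. k \<tau> * M)"
    by (rule Henstock_Kurzweil_Integration.integral_norm_bound_integral[OF f _ b])
       (auto intro: integrable_on_mult_left k_integrable_on s)
  then show ?thesis by simp
qed

definition duhamel :: "wavefun \<Rightarrow> wavefun \<Rightarrow> bool" where
  "duhamel u \<phi> \<longleftrightarrow> (\<forall>t1 t2. 0 \<le> t1 \<longrightarrow> t1 \<le> t2 \<longrightarrow>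
     set_integrable lebesgue {t1..t2} (\<lambda>\<tau>. src \<tau> \<phi> u) \<and>
     \<i> * (amp t2 \<phi> u - amp t1 \<phi> u) = integral {t1..t2} (\<lambda>\<tau>. src \<tau> \<phi> u))"

text \<open>On [s,t] the moving test function is replaced by its value at time s, to which the weak
  equation applies. The resulting errors are locally o(t - s), so the additive defect D
  vanishes.\<close>

lemma duhamel_gauss:
  assumes a: "0 < a" and u: "u \<in> Lp_space 2"
  shows "duhamel u (gauss a b)"
  unfolding duhamel_def
proof (intro allI impI)
  fix t1 t2 :: real assume t1: "0 \<le> t1" and t12: "t1 \<le> t2"
  define \<phi> where "\<phi> = gauss a b"
  define \<psi> where "\<psi> \<tau> = U \<tau> 0 u" for \<tau>
  define \<gamma> where "\<gamma> s = evo s \<phi>" for s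
  define L where "L s x = - laplacian (\<gamma> s) x" for s x
  define C2 where "C2 = nrm (\<lambda>\<xi>. of_real ((norm \<xi>)\<^sup>2) * fourier \<phi> \<xi>)"
  define C4 where "C4 = nrm (\<lambda>\<xi>. of_real ((norm \<xi>)\<^sup>2) * (of_real ((norm \<xi>)\<^sup>2) * fourier \<phi> \<xi>))"
  define N where "N = nrm u"
  have N0: "0 \<le> N" "0 \<le> C2" "0 \<le> C4" by (auto simp: N_def C2_def C4_def)
  have \<psi>L: "\<psi> \<tau> \<in> Lp_space 2" and \<psi>N: "nrm (\<psi> \<tau>) = N" if "0 \<le> \<tau>" for \<tau>
    unfolding \<psi>_def N_def using that u by (auto intro: U_L2 U_nrm)
  have \<gamma>S: "\<gamma> s \<in> schwartz" for s unfolding \<gamma>_def \<phi>_def by (rule gauss_evolution(1)[OF a])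
  have \<gamma>L: "\<gamma> s \<in> Lp_space 2" for s by (rule schwartz_L2[OF \<gamma>S])
  have \<phi>S: "\<phi> \<in> schwartz" unfolding \<phi>_def by (rule gauss_schwartz[OF a])
  have \<phi>L: "\<phi> \<in> Lp_space 2" by (rule schwartz_L2[OF \<phi>S])
  have LL: "L s \<in> Lp_space 2" for s unfolding L_def[abs_def] \<gamma>_def \<phi>_def by (rule gauss_evolution(3)[OF a])
  have Ln: "nrm (L s) = C2" for s unfolding L_def[abs_def] \<gamma>_def C2_def \<phi>_def by (rule gauss_evolution(2)[OF a])
  have \<gamma>d: "nrm (\<lambda>x. \<gamma> t x - \<gamma> s x) \<le> \<bar>t - s\<bar> * C2" for s t
    unfolding \<gamma>_def C2_def \<phi>_def by (rule gauss_evolution(4)[OF a])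
  have \<gamma>d2: "nrm (\<lambda>x. \<gamma> t x - \<gamma> s x + \<i> * of_real (t - s) * L s x)
    \<le> (t - s)\<^sup>2 * C4" for s t
    unfolding \<gamma>_def C4_def L_def \<phi>_def by (rule gauss_evolution(5)[OF a])
  have E\<gamma>: "ae_equal (free_evolution s \<phi>) (\<gamma> s)" for s unfolding \<gamma>_def
    by (rule free_evolution_schwartz[OF \<phi>S])
  have E_inner: "inner_L2 (free_evolution s \<phi>) h = inner_L2 (\<gamma> s) h" if "h \<in> Lp_space 2" for s h
    by (rule inner_cong_AE)
       (auto intro!: Lp_space_measurable[of _ 2] E\<gamma> that \<phi>L \<gamma>L E_L2)
  \<comment> \<open>The source term with the test function frozen at time s and everything else
    taken at time \<tau>; its diagonal s = \<tau> is \<open>src\<close>.\<close>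
  define B where "B s \<tau> = (if \<tau> \<in> G \<and> 0
    \<le> \<tau> then inner_L2 (\<gamma> s) (\<lambda>x. of_real (V x \<tau>) * \<psi> \<tau> x) else 0)" for s \<tau>
  define Cm where "Cm s \<tau> = inner_L2 (L s) (\<psi> \<tau>)" for s \<tau>
  have amp: "amp \<tau> \<phi> u = inner_L2 (\<gamma> \<tau>) (\<psi> \<tau>)" if "0 \<le> \<tau>" for \<tau>
    unfolding amp_def \<psi>_def[symmetric] by (rule E_inner[OF \<psi>L[OF that]])
  have src: "src \<tau> \<phi> u = B \<tau> \<tau>" for \<tau>
    unfolding src_def B_def \<psi>_def[symmetric] using E_inner[OF V_L2(1)[OF _ \<psi>L]] by auto
  have Bd: "cmod (B s \<tau> - B r \<tau>) \<le> k \<tau> * (\<bar>s - r\<bar> * C2 * N)" for s r \<tau>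
  proof (cases "\<tau> \<in> G \<and> 0 \<le> \<tau>")
    case True
    note W = V_L2[of \<tau> "\<psi> \<tau>"]
    have "B s \<tau> - B r \<tau> = inner_L2 (\<lambda>x. \<gamma> s x - \<gamma> r x) (\<lambda>x. of_real (V x \<tau>) * \<psi> \<tau> x)"
      using True by (simp add: B_def inner_diff_left \<gamma>L W \<psi>L)
    also have "cmod \<dots> \<le> nrm (\<lambda>x. \<gamma> s x - \<gamma> r x) * nrm (\<lambda>x. of_real (V x \<tau>) * \<psi> \<tau> x)"
      using True by (intro inner_CS L2_diff \<gamma>L W \<psi>L) auto
    also have "\<dots> \<le> (\<bar>s - r\<bar> * C2) * (k \<tau> * N)"
      using True W(2) N0 by (intro mult_mono \<gamma>d) (auto simp: \<psi>L \<psi>N)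
    finally show ?thesis by (simp add: mult_ac)
  next
    case False
    then show ?thesis using k_nonneg[of \<tau>] N0 by (auto simp: B_def)
  qed
  \<comment> \<open>Strong continuity of the propagator makes the H_0 term continuous in time;
    subtracting it from the integrable sum in the weak equation leaves the potential term integrable
    on its own.\<close>
  have Cm_cont: "continuous_on {p..q} (Cm s)" if p0: "0 \<le> p" for p q s
    unfolding continuous_on_iff
  proof (intro ballI allI impI)
    fix t e :: real assume t: "t \<in> {p..q}" and e: "0 < e"
    have "0 < e / (C2 + 1)" using e N0 by simp
    then obtain d where d: "d > 0" "\<And>\<tau>. 0 \<le> \<tau> \<Longrightarrow> \<bar>\<tau> - t\<bar> < d
      \<Longrightarrow> nrm (\<lambda>x. U \<tau> 0 u x - U t 0 u x) < e / (C2 + 1)"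
      using U_continuous[of t u "e / (C2 + 1)"] t p0 u by auto
    show "\<exists>d>0. \<forall>\<tau>\<in>{p..q}. dist \<tau> t < d \<longrightarrow> dist (Cm s \<tau>) (Cm s t) < e"
    proof (intro exI[of _ d] conjI d ballI impI)
      fix \<tau> assume \<tau>: "\<tau> \<in> {p..q}" "dist \<tau> t < d"
      have n: "nrm (\<lambda>x. \<psi> \<tau> x - \<psi> t x) < e / (C2 + 1)" using d(2)[of \<tau>] \<tau> p0
        by (simp add: \<psi>_def dist_real_def)
      have "Cm s \<tau> - Cm s t = inner_L2 (L s) (\<lambda>x. \<psi> \<tau> x - \<psi> t x)"
        using \<tau> t p0 by (simp add: Cm_def inner_diff_right \<psi>L LL)
      also have "cmod \<dots> \<le> C2 * nrm (\<lambda>x. \<psi> \<tau> x - \<psi> t x)"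
        using inner_CS[OF LL L2_diff[OF \<psi>L \<psi>L], of \<tau> t s] \<tau> t p0 by (simp add: Ln)
      also have "\<dots> \<le> C2 * (e / (C2 + 1))" using n N0 by (intro mult_left_mono) auto
      also have "\<dots> < e"
      proof -
        have "C2 * (e / (C2 + 1)) = e * (C2 / (C2 + 1))" by simp
        also have "\<dots> < e * 1" using e N0 by (intro mult_strict_left_mono) auto
        finally show "C2 * (e / (C2 + 1)) < e" by simp
      qed
      finally show "dist (Cm s \<tau>) (Cm s t) < e" by (simp add: dist_norm)
    qed
  qed
  have Cm_int: "set_integrable lebesgue {p..q} (Cm s)" if "0 \<le> p" for p q s
    by (rule absolutely_integrable_continuous_real[OF Cm_cont[OF that]])
  have weak: "set_integrable lebesgue {p..q} (B s)"
      "\<i> * (inner_L2 (\<gamma> s) (\<psi> q) - inner_L2 (\<gamma> s) (\<psi> p)) = integral {p..q} (Cm s)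
        + integral {p..q} (B s)"
    if p: "0 \<le> p" "p \<le> q" for p q s
  proof -
    let ?B = "\<lambda>\<tau>. inner_L2 (\<gamma> s) (\<lambda>x. of_real (V x \<tau>) * \<psi> \<tau> x)"
    have Leq: "L s = (\<lambda>x. - laplacian (\<gamma> s) x)" by (simp add: L_def fun_eq_iff)
    have w: "set_integrable lebesgue {p..q} (\<lambda>\<tau>. Cm s \<tau> + ?B \<tau>)"
        "\<i> * (inner_L2 (\<gamma> s) (\<psi> q) - inner_L2 (\<gamma> s) (\<psi> p))
          = (LINT \<tau>:{p..q}|lebesgue. Cm s \<tau> + ?B \<tau>)"
      using U_weak[OF u \<gamma>S[of s] p] unfolding Cm_def \<psi>_def Leq by auto
    have wi: "set_integrable lebesgue {p..q} ?B"
      using set_integral_diff(1)[OF w(1) Cm_int[OF p(1)], of s] by simp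
    \<comment> \<open>\<open>B\<close> differs from the raw potential term only off G. Since G is
      measurable and conull in [0, infinity), integrability and integral carry over.\<close>
    have eq: "indicator {p..q} \<tau> *\<^sub>R B s \<tau>
      = indicator G \<tau> *\<^sub>R (indicator {p..q} \<tau> *\<^sub>R ?B \<tau>)" for \<tau>
      using p by (auto simp: B_def indicator_def)
    show Bi: "set_integrable lebesgue {p..q} (B s)"
      unfolding set_integrable_def eq
      by (rule integrable_mult_indicator[OF G_sets wi[unfolded set_integrable_def]])
    have "(LINT \<tau>:{p..q}|lebesgue. ?B \<tau>) = (LINT \<tau>:{p..q}|lebesgue. B s \<tau>)"
      unfolding set_lebesgue_integral_def
    proof (rule integral_cong_AE)
      show "(\<lambda>\<tau>. indicator {p..q} \<tau> *\<^sub>R ?B \<tau>) \<in> borel_measurable lebesgue"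
        using wi unfolding set_integrable_def by (rule borel_measurable_integrable)
      show "(\<lambda>\<tau>. indicator {p..q} \<tau> *\<^sub>R B s \<tau>) \<in> borel_measurable lebesgue"
        using Bi unfolding set_integrable_def by (rule borel_measurable_integrable)
      show "AE \<tau> in lebesgue. indicator {p..q} \<tau> *\<^sub>R ?B \<tau>
        = indicator {p..q} \<tau> *\<^sub>R B s \<tau>"
        using G_AE by eventually_elim (use p in \<open>auto simp: B_def indicator_def\<close>)
    qed
    then show "\<i> * (inner_L2 (\<gamma> s) (\<psi> q) - inner_L2 (\<gamma> s) (\<psi> p)) = integral {p..q} (Cm s)
      + integral {p..q} (B s)"
      unfolding w(2) using set_integral_add(2)[OF Cm_int[OF p(1)] wi, of s]
      by (simp add: set_lebesgue_integral_eq_integral(2) Cm_int p Bi)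
  qed
  define J where "J \<tau> = B \<tau> \<tau>" for \<tau>
  have Jb: "cmod (J \<tau>) \<le> k \<tau> * (nrm \<phi> * N)" for \<tau>
    using src_bound[OF \<phi>L u, of \<tau>] unfolding src J_def N_def .
  \<comment> \<open>Measurability of the diagonal: freezing s at the point below \<tau> of the grid
    of mesh 1 / (n + 1) gives a countable patchwork of measurable functions, and by
    \<open>Bd\<close> these converge pointwise to J.\<close>
  have Jm: "(\<lambda>\<tau>. indicator {t1..t2} \<tau> *\<^sub>R J \<tau>) \<in> borel_measurable lebesgue"
  proof (rule borel_measurable_LIMSEQ_metric)
    define f where "f n i \<tau> = indicator {t1..t2} \<tau> *\<^sub>R B (of_int i / (real n + 1)) \<tau>" for n :: nat
      and i :: int and \<tau> :: real
    have f: "f n i \<in> borel_measurable lebesgue" for n i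
      unfolding f_def using weak(1)[OF t1 t12] unfolding set_integrable_def by (rule borel_measurable_integrable)
    have fl: "(\<lambda>\<tau>. \<lfloor>(real n + 1) * \<tau>\<rfloor>) \<in> measurable lebesgue (count_space UNIV)" for n
    proof -
      have "(\<lambda>\<tau>. \<lfloor>(real n + 1) * \<tau>\<rfloor>) \<in> measurable borel (count_space UNIV)"
        by measurable
      then have "(\<lambda>\<tau>. \<lfloor>(real n + 1) * \<tau>\<rfloor>) \<in> measurable lborel (count_space UNIV)"
        by simp
      then show ?thesis by (rule measurable_completion)
    qed
    show "(\<lambda>\<tau>. f n \<lfloor>(real n + 1) * \<tau>\<rfloor> \<tau>) \<in> borel_measurable lebesgue" for n
      by (rule measurable_compose_countable[OF f fl])
    fix \<tau> :: real
    show "(\<lambda>n. f n \<lfloor>(real n + 1) * \<tau>\<rfloor> \<tau>)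
      \<longlonglongrightarrow> indicator {t1..t2} \<tau> *\<^sub>R J \<tau>"
    proof (rule LIM_zero_cancel, rule tendsto_norm_zero_cancel, rule tendsto_sandwich[OF always_eventually always_eventually tendsto_const])
      show "\<forall>n. norm (f n \<lfloor>(real n + 1) * \<tau>\<rfloor> \<tau> - indicator {t1..t2} \<tau> *\<^sub>R J \<tau>) \<le> (1 / (real n + 1)) * (k \<tau> * (C2 * N))"
      proof
        fix n :: nat
        let ?r = "of_int \<lfloor>(real n + 1) * \<tau>\<rfloor> / (real n + 1)"
        have "\<bar>of_int \<lfloor>(real n + 1) * \<tau>\<rfloor> - (real n + 1) * \<tau>\<bar> \<le> 1" by linarith
        moreover have "?r - \<tau> = (of_int \<lfloor>(real n + 1) * \<tau>\<rfloor> - (real n + 1) * \<tau>) / (real n + 1)"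
          by (simp add: field_simps)
        ultimately have "\<bar>?r - \<tau>\<bar> \<le> 1 / (real n + 1)" by (simp add: divide_right_mono)
        then have r: "k \<tau> * (\<bar>?r - \<tau>\<bar> * C2 * N) \<le> k \<tau> * (1 / (real n + 1) * C2 * N)"
          using k_nonneg N0 by (intro mult_left_mono mult_right_mono) auto
        have "norm (f n \<lfloor>(real n + 1) * \<tau>\<rfloor> \<tau> - indicator {t1..t2} \<tau> *\<^sub>R J \<tau>)
          \<le> cmod (B ?r \<tau> - B \<tau> \<tau>)"
          by (auto simp: f_def J_def indicator_def)
        also have "\<dots> \<le> k \<tau> * (\<bar>?r - \<tau>\<bar> * C2 * N)" by (rule Bd)
        finally show "norm (f n \<lfloor>(real n + 1) * \<tau>\<rfloor> \<tau> - indicator {t1..t2} \<tau> *\<^sub>R J \<tau>) \<le> (1 / (real n + 1)) * (k \<tau> * (C2 * N))"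
          using r by (simp add: mult_ac)
      qed
      have "(\<lambda>n. 1 / (real n + 1)) \<longlonglongrightarrow> 0" by real_asymp
      then show "(\<lambda>n. (1 / (real n + 1)) * (k \<tau> * (C2 * N))) \<longlonglongrightarrow> 0"
        by (rule tendsto_mult_left_zero)
    qed auto
  qed
  have Ji: "set_integrable lebesgue {t1..t2} J"
    by (rule set_integrable_k_bound[OF t1 Jm Jb])
  have Jint: "J integrable_on {s..t}" if "t1 \<le> s" "t \<le> t2" for s t
    using integrable_on_subinterval[OF set_lebesgue_integral_eq_integral(1)[OF Ji], of s t] that by auto
  define D where "D s t = \<i> * (amp t \<phi> u - amp s \<phi> u) - integral {s..t} J" for s t
  have "D t1 t2 = 0"
  proof (rule additive_interval_function_0[OF t12])
    fix r s t assume "t1 \<le> r" "r \<le> s" "s \<le> t" "t \<le> t2"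
    then have "integral {r..t} J = integral {r..s} J + integral {s..t} J"
      by (intro Henstock_Kurzweil_Integration.integral_combine[symmetric] Jint) auto
    then show "D r t = D r s + D s t" by (simp add: D_def algebra_simps)
  next
    fix s0 e :: real assume s0: "s0 \<in> {t1..t2}" and e: "0 < e"
    \<comment> \<open>e1 bounds the variation of the wave function, e2 the k-mass of the interval
      and d3 its length, each such that the corresponding error stays below (t - s) e / 4. The added
      1 guards against vanishing norms.\<close>
    define e1 where "e1 = e / (8 * (C2 + 1))"
    define e2 where "e2 = e / (4 * (C2 * N + 1))"
    define d3 where "d3 = e / (8 * (C4 * N + 1))"
    have pos: "0 < C2 + 1" "0 < C2 * N + 1" "0 < C4 * N + 1" using N0 by (auto intro: add_nonneg_pos)
    have e': "0 < e1" "0 < e2" "0 < d3" using e pos by (auto simp: e1_def e2_def d3_def)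
    have frac: "x * (e / (c * (x + 1))) \<le> e / c" if "0 \<le> x" "0 < c" for x c
    proof -
      have "x * (e / (c * (x + 1))) = (e / c) * (x / (x + 1))" by (simp add: field_simps)
      also have "\<dots> \<le> (e / c) * 1" using that e by (intro mult_left_mono) auto
      finally show ?thesis by simp
    qed
    obtain d1 where d1: "d1 > 0" "\<And>\<tau>. 0 \<le> \<tau> \<Longrightarrow> \<bar>\<tau> - s0\<bar> < d1
      \<Longrightarrow> nrm (\<lambda>x. \<psi> \<tau> x - \<psi> s0 x) < e1"
      using U_continuous[of s0 u e1] s0 t1 u e' unfolding \<psi>_def by auto
    have "continuous_on {t1..t2} (\<lambda>x. integral {t1..x} k)"
      by (rule indefinite_integral_continuous_1[OF k_integrable_on[OF t1]])
    then obtain d2 where d2: "d2 > 0"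
      "\<And>x. x \<in> {t1..t2} \<Longrightarrow> dist x s0 < d2
        \<Longrightarrow> dist (integral {t1..x} k) (integral {t1..s0} k) < e2 / 2"
      using s0 e' half_gt_zero[of e2] unfolding continuous_on_iff by metis
    define d where "d = min d1 (min d2 d3)"
    show "\<exists>d>0. \<forall>s\<in>{t1..t2}. \<forall>t\<in>{t1..t2}. s \<le> t \<longrightarrow> \<bar>s - s0\<bar> < d
      \<longrightarrow> \<bar>t - s0\<bar> < d \<longrightarrow> cmod (D s t) \<le> e * (t - s)"
    proof (intro exI[of _ d] conjI ballI impI)
      show "0 < d" using d1 d2 e' by (simp add: d_def)
      fix s t assume s: "s \<in> {t1..t2}" and t: "t \<in> {t1..t2}" and st: "s \<le> t" and sd: "\<bar>s - s0\<bar> < d"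
        and td: "\<bar>t - s0\<bar> < d"
      have ge0: "0 \<le> s" "0 \<le> t" using s t t1 by auto
      have near: "\<bar>\<tau> - s0\<bar> < d" if "\<tau> \<in> {s..t}" for \<tau> using that sd td by auto
      \<comment> \<open>The Taylor remainder of the evolved Gaussian after its first order term, of
        norm at most (t - s)^2 C4. That first order term will cancel the H_0 term of the weak
        equation, up to the variation of \<psi>.\<close>
      define r where "r x = \<gamma> t x - \<gamma> s x + \<i> * of_real (t - s) * L s x" for x
      have rL: "r \<in> Lp_space 2"
      proof -
        have "(\<lambda>x. (\<i> * of_real (t - s)) * L s x + (\<gamma> t x - \<gamma> s x)) \<in> Lp_space 2"
          by (intro L2_lin L2_diff LL \<gamma>L)
        then show ?thesis unfolding r_def by (simp add: add.commute)
      qed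
      have "(\<lambda>x. (- \<i> * of_real (t - s)) * L s x + r x) = (\<lambda>x. \<gamma> t x - \<gamma> s x)"
        by (simp add: r_def)
      then have "inner_L2 (\<lambda>x. \<gamma> t x - \<gamma> s x) (\<psi> t) = cnj (- \<i> * of_real (t - s)) * Cm s t
        + inner_L2 r (\<psi> t)"
        using inner_lin_left[OF LL rL \<psi>L[OF ge0(2)], of "- \<i> * of_real (t - s)" s] by (simp only: Cm_def)
      then have i1: "\<i> * inner_L2 (\<lambda>x. \<gamma> t x - \<gamma> s x) (\<psi> t) = - (of_real (t - s) * Cm s t)
        + \<i> * inner_L2 r (\<psi> t)"
      proof -
        assume *: "inner_L2 (\<lambda>x. \<gamma> t x - \<gamma> s x) (\<psi> t) = cnj (- \<i> * of_real (t - s)) * Cm s t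
          + inner_L2 r (\<psi> t)"
        have "cnj (- \<i> * of_real (t - s)) = \<i> * of_real (t - s)" by simp
        then show ?thesis unfolding * by (simp add: distrib_left mult.assoc del: of_real_diff)
      qed
      have "\<i> * (amp t \<phi> u - amp s \<phi> u) = \<i> * inner_L2 (\<lambda>x. \<gamma> t x - \<gamma> s x) (\<psi> t)
        + \<i> * (inner_L2 (\<gamma> s) (\<psi> t) - inner_L2 (\<gamma> s) (\<psi> s))"
        using ge0 by (simp add: amp inner_diff_left \<gamma>L \<psi>L algebra_simps)
      also have "\<dots> = \<i> * inner_L2 r (\<psi> t) + (integral {s..t} (Cm s) - of_real (t - s) * Cm s t)
        + integral {s..t} (B s)"
        unfolding i1 weak(2)[OF ge0(1) st] by simp
      also have "integral {s..t} (Cm s) - of_real (t - s) * Cm s t = integral {s..t} (\<lambda>\<tau>. Cm s \<tau> - Cm s t)"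
      proof -
        have "Cm s integrable_on {s..t}" by (rule set_lebesgue_integral_eq_integral(1)[OF Cm_int[OF ge0(1)]])
        then show ?thesis using st
          by (subst Henstock_Kurzweil_Integration.integral_diff) (auto simp: scaleR_conv_of_real)
      qed
      \<comment> \<open>Three errors: the Taylor remainder, of order (t - s)^2; the variation of the
        wave function in the H_0 term; and the variation of the test function in the potential term,
        at most a multiple of (t - s) times the k-mass of [s,t]. The last is o(t - s) even for
        unbounded k.\<close>
      finally have "D s t = \<i> * inner_L2 r (\<psi> t) + integral {s..t} (\<lambda>\<tau>. Cm s \<tau> - Cm s t)
        + (integral {s..t} (B s) - integral {s..t} J)"
        unfolding D_def by simp
      also have "integral {s..t} (B s) - integral {s..t} J = integral {s..t} (\<lambda>\<tau>. B s \<tau> - J \<tau>)"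
        using s t by (intro Henstock_Kurzweil_Integration.integral_diff[symmetric] Jint set_lebesgue_integral_eq_integral(1)[OF weak(1)[OF ge0(1) st]]) auto
      finally have "cmod (D s t) \<le> cmod (inner_L2 r (\<psi> t))
        + cmod (integral {s..t} (\<lambda>\<tau>. Cm s \<tau> - Cm s t)) + cmod (integral {s..t} (\<lambda>\<tau>. B s \<tau> - J \<tau>))"
        by (metis (no_types, lifting) norm_mult norm_ii mult_1 norm_triangle_mono norm_triangle_ineq order_refl)
      moreover have "cmod (inner_L2 r (\<psi> t)) \<le> (t - s) * (e / 4)"
      proof -
        have "cmod (inner_L2 r (\<psi> t)) \<le> nrm r * N" using inner_CS[OF rL \<psi>L[OF ge0(2)]] \<psi>N[OF ge0(2)]
          by simp
        also have "\<dots> \<le> (t - s)\<^sup>2 * C4 * N" unfolding r_def using \<gamma>d2[of t s] N0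
          by (intro mult_right_mono) auto
        also have "\<dots> = (t - s) * ((t - s) * (C4 * N))" by (simp add: power2_eq_square mult_ac)
        also have "\<dots> \<le> (t - s) * (2 * d3 * (C4 * N))"
        proof (intro mult_left_mono mult_right_mono)
          show "t - s \<le> 2 * d3" using sd td unfolding d_def by linarith
        qed (use st N0 in auto)
        also have "2 * d3 * (C4 * N) = 2 * ((C4 * N) * (e / (8 * (C4 * N + 1))))" by (simp add: d3_def)
        also have "(t - s) * \<dots> \<le> (t - s) * (2 * (e / 8))"
          using frac[of "C4 * N" 8] N0 st by (intro mult_left_mono) auto
        finally show ?thesis by simp
      qed
      moreover have "cmod (integral {s..t} (\<lambda>\<tau>. Cm s \<tau> - Cm s t)) \<le> (t - s) * (e / 4)"
      proof -
        have i: "(\<lambda>\<tau>. Cm s \<tau> - Cm s t) integrable_on {s..t}"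
          by (intro integrable_diff set_lebesgue_integral_eq_integral(1)[OF Cm_int[OF ge0(1)]] integrable_const_ivl)
        have "cmod (integral {s..t} (\<lambda>\<tau>. Cm s \<tau> - Cm s t)) \<le> integral {s..t} (\<lambda>\<tau>. e / 4)"
        proof (rule Henstock_Kurzweil_Integration.integral_norm_bound_integral[OF i integrable_const_ivl])
          fix \<tau> assume \<tau>: "\<tau> \<in> {s..t}"
          then have \<tau>0: "0 \<le> \<tau>" using ge0 by auto
          have "Cm s \<tau> - Cm s t = inner_L2 (L s) (\<lambda>x. \<psi> \<tau> x - \<psi> t x)"
            by (simp add: Cm_def inner_diff_right \<psi>L LL \<tau>0 ge0)
          also have "cmod \<dots> \<le> C2 * nrm (\<lambda>x. \<psi> \<tau> x - \<psi> t x)"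
            using inner_CS[OF LL L2_diff[OF \<psi>L[OF \<tau>0] \<psi>L[OF ge0(2)]], of s] by (simp add: Ln)
          also have "nrm (\<lambda>x. \<psi> \<tau> x - \<psi> t x) \<le> nrm (\<lambda>x. \<psi> \<tau> x - \<psi> s0 x)
            + nrm (\<lambda>x. \<psi> s0 x - \<psi> t x)"
            using s0 t1 by (intro nrm_triangle3 \<psi>L \<tau>0 ge0) auto
          also have "\<dots> \<le> e1 + e1"
            using d1(2)[OF \<tau>0] d1(2)[OF ge0(2)] near[OF \<tau>] td unfolding nrm_diff_commute[of "\<psi> s0"]
              by (intro add_mono) (auto simp: d_def)
          also have "C2 * (e1 + e1) = 2 * (C2 * (e / (8 * (C2 + 1))))" by (simp add: e1_def)
          also have "\<dots> \<le> 2 * (e / 8)" using frac[of C2 8] N0 by (intro mult_left_mono) auto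
          finally show "cmod (Cm s \<tau> - Cm s t) \<le> e / 4" using N0 by (simp add: mult_left_mono)
        qed
        then show ?thesis using st by simp
      qed
      moreover have "cmod (integral {s..t} (\<lambda>\<tau>. B s \<tau> - J \<tau>)) \<le> (t - s) * (e / 4)"
      proof -
        have i: "(\<lambda>\<tau>. B s \<tau> - J \<tau>) integrable_on {s..t}"
          using s t by (intro integrable_diff Jint set_lebesgue_integral_eq_integral(1)[OF weak(1)[OF ge0(1) st]]) auto
        have "cmod (integral {s..t} (\<lambda>\<tau>. B s \<tau> - J \<tau>)) \<le> integral {s..t} k * ((t - s) * C2 * N)"
        proof (rule integral_k_bound[OF ge0(1) i])
          fix \<tau> assume "\<tau> \<in> {s..t}"
          then have "\<bar>s - \<tau>\<bar> * C2 * N \<le> (t - s) * C2 * N" using N0 by (intro mult_right_mono) auto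
          then have "k \<tau> * (\<bar>s - \<tau>\<bar> * C2 * N) \<le> k \<tau> * ((t - s) * C2 * N)" using k_nonneg
            by (intro mult_left_mono)
          then show "cmod (B s \<tau> - J \<tau>) \<le> k \<tau> * ((t - s) * C2 * N)" using Bd[of s \<tau> \<tau>]
            unfolding J_def by linarith
        qed
        \<comment> \<open>The indefinite integral of k is continuous at s0, so short intervals near
          s0 carry little k-mass.\<close>
        also have "integral {s..t} k \<le> e2"
        proof -
          have "integral {t1..t} k = integral {t1..s} k + integral {s..t} k"
            using s st t1 by (intro k_integral_combine) auto
          moreover have "dist (integral {t1..t} k) (integral {t1..s0} k) < e2 / 2"
            "dist (integral {t1..s} k) (integral {t1..s0} k) < e2 / 2"
            using d2(2)[OF t] d2(2)[OF s] sd td by (auto simp: d_def dist_real_def)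
          ultimately show ?thesis unfolding dist_real_def by linarith
        qed
        also have "e2 * ((t - s) * C2 * N) = (t - s) * ((C2 * N) * (e / (4 * (C2 * N + 1))))" by (simp add: e2_def)
        also have "\<dots> \<le> (t - s) * (e / 4)"
          using frac[of "C2 * N" 4] N0 st by (intro mult_left_mono) auto
        finally show ?thesis using N0 st by (simp add: mult_right_mono)
      qed
      ultimately have "cmod (D s t) \<le> (t - s) * (e / 4) + (t - s) * (e / 4) + (t - s) * (e / 4)" by linarith
      also have "\<dots> = (t - s) * (e / 4 + e / 4 + e / 4)" by (simp only: distrib_left)
      also have "\<dots> \<le> (t - s) * e" using st e by (intro mult_left_mono) auto
      finally show "cmod (D s t) \<le> e * (t - s)" by (simp add: mult.commute)
    qed
  qed
  then show "set_integrable lebesgue {t1..t2} (\<lambda>\<tau>. src \<tau> (gauss a b) u) \<and>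
     \<i> * (amp t2 (gauss a b) u - amp t1 (gauss a b) u) = integral {t1..t2} (\<lambda>\<tau>. src \<tau> (gauss a b) u)"
    using Ji unfolding D_def J_def[abs_def] src[symmetric] \<phi>_def by simp
qed


text \<open>The functions satisfying the formula form a closed subspace: \<open>amp\<close> and
  \<open>src\<close> are Lipschitz in \<phi> with constants |u| and k |u|, so L^2 limits pass
  through the time integral.\<close>

lemma duhamel_all:
  assumes u: "u \<in> Lp_space 2" and \<phi>: "\<phi> \<in> Lp_space 2"
  shows "duhamel u \<phi>"
proof -
  define D where "D = {\<phi> \<in> Lp_space 2. duhamel u \<phi>}"
  have "closed_subspace D"
    unfolding closed_subspace_def
  proof (intro conjI ballI allI impI)
    have n0: "nrm (\<lambda>x. 0) = 0" by (simp add: nrm_def)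
    have "src \<tau> (\<lambda>x. 0) u = 0" for \<tau> using src_bound[OF L2_0 u, of \<tau>] by (simp add: n0)
    moreover have "amp t (\<lambda>x. 0) u = 0" if "0 \<le> t" for t using amp_bound[OF that L2_0 u] by (simp add: n0)
    ultimately show "(\<lambda>x. 0) \<in> D" unfolding D_def duhamel_def by (auto simp: set_integrable_def)
  next
    fix f g c assume "f \<in> D" "g \<in> D"
    then have f: "f \<in> Lp_space 2" "duhamel u f" and g: "g \<in> Lp_space 2" "duhamel u g" by (auto simp: D_def)
    have "duhamel u (\<lambda>x. c * f x + g x)"
      unfolding duhamel_def
    proof (intro allI impI)
      fix t1 t2 :: real assume t: "0 \<le> t1" "t1 \<le> t2"
      have fi: "set_integrable lebesgue {t1..t2} (\<lambda>\<tau>. src \<tau> f u)"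
          "\<i> * (amp t2 f u - amp t1 f u) = integral {t1..t2} (\<lambda>\<tau>. src \<tau> f u)"
        and gi: "set_integrable lebesgue {t1..t2} (\<lambda>\<tau>. src \<tau> g u)"
          "\<i> * (amp t2 g u - amp t1 g u) = integral {t1..t2} (\<lambda>\<tau>. src \<tau> g u)"
        using f(2) g(2) t unfolding duhamel_def by blast+
      note fo = set_lebesgue_integral_eq_integral(1)[OF fi(1)] and go = set_lebesgue_integral_eq_integral(1)[OF gi(1)]
      have e: "(\<lambda>\<tau>. src \<tau> (\<lambda>x. c * f x + g x) u)
        = (\<lambda>\<tau>. cnj c * src \<tau> f u + src \<tau> g u)"
        by (simp add: src_lin f g u)
      have "set_integrable lebesgue {t1..t2} (\<lambda>\<tau>. cnj c * src \<tau> f u + src \<tau> g u)"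
        by (intro set_integral_add(1) set_integrable_mult_right fi gi)
      moreover have "integral {t1..t2} (\<lambda>\<tau>. cnj c * src \<tau> f u + src \<tau> g u)
          = cnj c * integral {t1..t2} (\<lambda>\<tau>. src \<tau> f u) + integral {t1..t2} (\<lambda>\<tau>. src \<tau> g u)"
        by (subst Henstock_Kurzweil_Integration.integral_add[OF integrable_on_mult_right[OF fo] go])
           (simp only: Henstock_Kurzweil_Integration.integral_mult_right)
      moreover have "\<i> * (amp t2 (\<lambda>x. c * f x + g x) u - amp t1 (\<lambda>x. c * f x + g x) u)
          = cnj c * (\<i> * (amp t2 f u - amp t1 f u)) + \<i> * (amp t2 g u - amp t1 g u)"
      proof -
        have "amp t1 (\<lambda>x. c * f x + g x) u = cnj c * amp t1 f u + amp t1 g u"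
          "amp t2 (\<lambda>x. c * f x + g x) u = cnj c * amp t2 f u + amp t2 g u"
          using t by (auto intro!: amp_lin f g u)
        then show "\<i> * (amp t2 (\<lambda>x. c * f x + g x) u - amp t1 (\<lambda>x. c * f x + g x) u)
          = cnj c * (\<i> * (amp t2 f u - amp t1 f u)) + \<i> * (amp t2 g u - amp t1 g u)"
          by (simp only: ring_distribs mult_ac)  (simp add: algebra_simps)
      qed
      ultimately show "set_integrable lebesgue {t1..t2} (\<lambda>\<tau>. src \<tau> (\<lambda>x. c * f x + g x) u) \<and>
          \<i> * (amp t2 (\<lambda>x. c * f x + g x) u - amp t1 (\<lambda>x. c * f x + g x) u) = integral {t1..t2} (\<lambda>\<tau>. src \<tau> (\<lambda>x. c * f x + g x) u)"
        unfolding e fi(2) gi(2) by simp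
    qed
    then show "(\<lambda>x. c * f x + g x) \<in> D" using f g by (simp add: D_def L2_lin)
  next
    fix F g assume *: "(\<forall>n::nat. F n \<in> D) \<and> g \<in> Lp_space 2 \<and> (\<lambda>n. nrm (\<lambda>x. F n x - g x)) \<longlonglongrightarrow> 0"
    then have F: "\<And>n. F n \<in> Lp_space 2" "\<And>n. duhamel u (F n)" and g: "g \<in> Lp_space 2"
      and lim: "(\<lambda>n. nrm (\<lambda>x. F n x - g x)) \<longlonglongrightarrow> 0" by (auto simp: D_def)
    have lim0: "(\<lambda>n. nrm (\<lambda>x. F n x - g x) * c) \<longlonglongrightarrow> 0" for c using lim
      by (rule tendsto_mult_left_zero)
    have "duhamel u g"
      unfolding duhamel_def
    proof (intro allI impI)
      fix t1 t2 :: real assume t: "0 \<le> t1" "t1 \<le> t2"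
      have Fi: "set_integrable lebesgue {t1..t2} (\<lambda>\<tau>. src \<tau> (F n) u)"
          "\<i> * (amp t2 (F n) u - amp t1 (F n) u) = integral {t1..t2} (\<lambda>\<tau>. src \<tau> (F n) u)" for n
        using F(2)[of n] t unfolding duhamel_def by blast+
      have amp_lim: "(\<lambda>n. amp s (F n) u) \<longlonglongrightarrow> amp s g u" if "0 \<le> s" for s
      proof (rule LIM_zero_cancel, rule tendsto_norm_zero_cancel, rule tendsto_sandwich[OF always_eventually always_eventually tendsto_const lim0])
        show "\<forall>n. norm (amp s (F n) u - amp s g u) \<le> nrm (\<lambda>x. F n x - g x) * nrm u"
          using amp_diff[OF that F(1) g u] by blast
      qed simp
      have m: "(\<lambda>\<tau>. indicator {t1..t2} \<tau> *\<^sub>R src \<tau> g u) \<in> borel_measurable lebesgue"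
      proof (rule borel_measurable_LIMSEQ_metric)
        show "(\<lambda>\<tau>. indicator {t1..t2} \<tau> *\<^sub>R src \<tau> (F n) u) \<in> borel_measurable lebesgue"
          for n
          using Fi(1)[of n] unfolding set_integrable_def by (rule borel_measurable_integrable)
        fix \<tau>
        have "(\<lambda>n. src \<tau> (F n) u) \<longlonglongrightarrow> src \<tau> g u"
        proof (rule LIM_zero_cancel, rule tendsto_norm_zero_cancel, rule tendsto_sandwich[OF always_eventually always_eventually tendsto_const lim0])
          show "\<forall>n. norm (src \<tau> (F n) u - src \<tau> g u)
            \<le> nrm (\<lambda>x. F n x - g x) * (k \<tau> * nrm u)"
            using src_diff[OF F(1) g u, of \<tau>] by (simp add: mult_ac)
        qed simp
        then show "(\<lambda>n. indicator {t1..t2} \<tau> *\<^sub>R src \<tau> (F n) u)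
          \<longlonglongrightarrow> indicator {t1..t2} \<tau> *\<^sub>R src \<tau> g u"
          by (intro tendsto_scaleR tendsto_const)
      qed
      have gi: "set_integrable lebesgue {t1..t2} (\<lambda>\<tau>. src \<tau> g u)"
        by (rule set_integrable_k_bound[OF t(1) m src_bound[OF g u]])
      have il: "(\<lambda>n. integral {t1..t2} (\<lambda>\<tau>. src \<tau> (F n) u))
        \<longlonglongrightarrow> integral {t1..t2} (\<lambda>\<tau>. src \<tau> g u)"
      proof (rule LIM_zero_cancel, rule tendsto_norm_zero_cancel, rule tendsto_sandwich[OF always_eventually always_eventually tendsto_const lim0])
        show "\<forall>n. norm (integral {t1..t2} (\<lambda>\<tau>. src \<tau> (F n) u) - integral {t1..t2} (\<lambda>\<tau>. src \<tau> g u))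
            \<le> nrm (\<lambda>x. F n x - g x) * (nrm u * integral {t1..t2} k)"
        proof
          fix n
          note fo = set_lebesgue_integral_eq_integral(1)[OF Fi(1)[of n]] and go = set_lebesgue_integral_eq_integral(1)[OF gi]
          have "norm (integral {t1..t2} (\<lambda>\<tau>. src \<tau> (F n) u - src \<tau> g u))
            \<le> integral {t1..t2} k * (nrm (\<lambda>x. F n x - g x) * nrm u)"
            by (rule integral_k_bound[OF t(1) integrable_diff[OF fo go] src_diff[OF F(1) g u]])
          then show "norm (integral {t1..t2} (\<lambda>\<tau>. src \<tau> (F n) u) - integral {t1..t2} (\<lambda>\<tau>. src \<tau> g u))
            \<le> nrm (\<lambda>x. F n x - g x) * (nrm u * integral {t1..t2} k)"
            by (simp add: Henstock_Kurzweil_Integration.integral_diff[OF fo go] mult_ac)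
        qed
      qed simp
      have "(\<lambda>n. \<i> * (amp t2 (F n) u - amp t1 (F n) u))
        \<longlonglongrightarrow> \<i> * (amp t2 g u - amp t1 g u)"
        using t by (intro tendsto_intros amp_lim) auto
      then have "\<i> * (amp t2 g u - amp t1 g u) = integral {t1..t2} (\<lambda>\<tau>. src \<tau> g u)"
        unfolding Fi(2) by (rule LIMSEQ_unique[OF _ il])
      then show "set_integrable lebesgue {t1..t2} (\<lambda>\<tau>. src \<tau> g u) \<and>
          \<i> * (amp t2 g u - amp t1 g u) = integral {t1..t2} (\<lambda>\<tau>. src \<tau> g u)" using gi by blast
    qed
    then show "g \<in> D" using g by (simp add: D_def)
  qed (auto simp: D_def)
  moreover have "gauss a b \<in> D" if "0 < a" for a b
    using that by (simp add: D_def gauss_L2 duhamel_gauss u)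
  ultimately have "D = Lp_space 2" by (rule L2_eq_closed_subspace)
  then show ?thesis using \<phi> by (auto simp: D_def)
qed

text \<open>Here the Galilei maps enter: a plane wave between e^(-i t H_0) \<phi> and the wave
  function can be absorbed into \<phi>, so each plane wave in V contributes an amplitude of the same
  kind at the same time.\<close>

lemma src_galilei_bound:
  assumes \<phi>: "\<phi> \<in> Lp_space 2" and u: "u \<in> Lp_space 2" and t: "0 \<le> t"
    and M: "\<And>b. cmod (amp t (galilei t b \<phi>) u) \<le> M"
  shows "cmod (src t \<phi> u) \<le> k t * M"
proof (cases "t \<in> G")
  case True
  define F where "F x = cnj (free_evolution t \<phi> x) * U t 0 u x" for x
  have F: "integrable lborel F" unfolding F_def using t by (intro inner_integrable E_L2 U_L2 \<phi> u) auto
  have "cmod (LINT x|lborel. F x * exp (\<i> * of_real (b \<bullet> x))) \<le> M" for b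
  proof -
    \<comment> \<open>The inner product conjugates its left factor, so a plane wave of frequency b
      corresponds to \<open>galilei\<close> with -b.\<close>
    have "amp t (galilei t (- b) \<phi>) u
      = inner_L2 (\<lambda>x. exp (\<i> * of_real (- b \<bullet> x)) * free_evolution t \<phi> x) (U t 0 u)"
      unfolding amp_def
    proof (rule inner_cong_AE)
      show "ae_equal (free_evolution t (galilei t (- b) \<phi>)) (\<lambda>x. exp (\<i> * of_real (- b \<bullet> x)) * free_evolution t \<phi> x)"
        by (rule free_evolution_galilei[OF \<phi>])
    qed (rule Lp_space_measurable[OF E_L2[OF galilei_L2(1)[OF \<phi>]]] Lp_space_measurable[OF U_L2[OF t order_refl u]]
          Lp_space_measurable[OF L2_isometryD(1)[OF phase_isometry[of "- b"] E_L2[OF \<phi>, of t]]] | simp)+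
    also have "\<dots> = (LINT x|lborel. F x * exp (\<i> * of_real (b \<bullet> x)))"
      unfolding inner_L2_def F_def by (simp add: exp_cnj mult_ac)
    finally show ?thesis using M[of "- b"] by simp
  qed
  from V_phase[OF True F this]
  have "cmod (LINT x|lborel. F x * of_real (V x t)) \<le> k t * M" .
  moreover have "src t \<phi> u = (LINT x|lborel. F x * of_real (V x t))"
    using True t by (simp add: src_def inner_L2_def F_def mult_ac)
  ultimately show ?thesis by simp
next
  case False
  have "0 \<le> M" using M[of 0] norm_ge_zero order_trans by blast
  then show ?thesis using False k_nonneg by (simp add: src_def)
qed

text \<open>Duhamel controls an increment through the Galilei images of \<phi> at intermediate
  times; a class of functions that contains all of them closes the Gronwall argument.\<close>

lemma amp_increment:
  assumes \<phi>: "\<phi> \<in> Lp_space 2" and u: "u \<in> Lp_space 2" and t: "0 \<le> s" "s \<le> t"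
    and M: "\<And>\<tau> b. s \<le> \<tau> \<Longrightarrow> \<tau> \<le> t
      \<Longrightarrow> cmod (amp \<tau> (galilei \<tau> b \<phi>) u) \<le> M"
  shows "cmod (amp t \<phi> u - amp s \<phi> u) \<le> integral {s..t} k * M"
proof -
  have D: "set_integrable lebesgue {s..t} (\<lambda>\<tau>. src \<tau> \<phi> u)"
      "\<i> * (amp t \<phi> u - amp s \<phi> u) = integral {s..t} (\<lambda>\<tau>. src \<tau> \<phi> u)"
    using duhamel_all[OF u \<phi>] t unfolding duhamel_def by blast+
  have "cmod (integral {s..t} (\<lambda>\<tau>. src \<tau> \<phi> u)) \<le> integral {s..t} k * M"
    by (rule integral_k_bound[OF t(1) set_lebesgue_integral_eq_integral(1)[OF D(1)]])
       (use t M in \<open>auto intro!: src_galilei_bound[OF \<phi> u]\<close>)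
  then show ?thesis unfolding D(2)[symmetric] by (simp add: norm_mult)
qed

text \<open>Working with the supremum over \<open>C\<close> on short time intervals, no measurability in time of that
  supremum is needed.\<close>

lemma amp_gronwall:
  assumes C: "C \<subseteq> Lp_space 2"
    and inv: "\<And>t b \<phi>. \<phi> \<in> C \<Longrightarrow> galilei t b \<phi> \<in> C"
    and \<rho>: "\<And>\<phi>. \<phi> \<in> C \<Longrightarrow> nrm \<phi> \<le> \<rho>" and u: "u \<in> Lp_space 2"
    and B: "\<And>\<phi>. \<phi> \<in> C \<Longrightarrow> cmod (amp 0 \<phi> u) \<le> B" and t: "0 \<le> t"
      and \<phi>: "\<phi> \<in> C"
  shows "cmod (amp t \<phi> u) \<le> B * exp (integral {0..t} k)"
proof -
  define H where "H = integral {0..t} k"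
  have H0: "0 \<le> H" unfolding H_def by (rule k_integral_nonneg)
  \<comment> \<open>On an interval of k-mass at most \<delta> < 1 the supremum satisfies S <= N +
    \<delta> S. Solving for S presupposes that it is finite, which the L^2 bound \<rho>
    ensures.\<close>
  have step: "cmod (amp r \<phi> u) \<le> N / (1 - \<delta>)"
    if s: "0 \<le> s" "s \<le> r" and \<delta>: "integral {s..r} k \<le> \<delta>" "\<delta> < 1"
      and N: "\<And>\<phi>. \<phi> \<in> C \<Longrightarrow> cmod (amp s \<phi> u) \<le> N" and \<phi>: "\<phi> \<in> C"
        for s r \<delta> N \<phi>
  proof -
    define S where "S = (SUP x\<in>{s..r} \<times> C. cmod (amp (fst x) (snd x) u))"
    have bdd: "bdd_above ((\<lambda>x. cmod (amp (fst x) (snd x) u)) ` ({s..r} \<times> C))"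
    proof (rule bdd_aboveI2)
      fix x assume "x \<in> {s..r} \<times> C"
      then have x: "0 \<le> fst x" "snd x \<in> C" using s by auto
      have "cmod (amp (fst x) (snd x) u) \<le> nrm (snd x) * nrm u" using x C by (intro amp_bound u) auto
      also have "\<dots> \<le> \<rho> * nrm u" using \<rho>[OF x(2)] by (intro mult_right_mono) auto
      finally show "cmod (amp (fst x) (snd x) u) \<le> \<rho> * nrm u" .
    qed
    have le: "cmod (amp \<tau> \<psi> u) \<le> S" if "\<tau> \<in> {s..r}" "\<psi> \<in> C" for \<tau> \<psi>
      unfolding S_def using cSUP_upper[OF _ bdd, of "(\<tau>, \<psi>)"] that by simp
    have "cmod (amp s \<phi> u) \<le> S" by (rule le) (use s \<phi> in auto)
    then have S0: "0 \<le> S" using norm_ge_zero[of "amp s \<phi> u"] by linarith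
    have "cmod (amp \<tau> \<psi> u) \<le> N + \<delta> * S" if \<tau>: "\<tau> \<in> {s..r}" and \<psi>: "\<psi> \<in> C"
      for \<tau> \<psi>
    proof -
      have "cmod (amp \<tau> \<psi> u - amp s \<psi> u) \<le> integral {s..\<tau>} k * S"
        by (rule amp_increment) (use \<tau> \<psi> s C in \<open>auto intro!: u le inv\<close>)
      also have "\<dots> \<le> \<delta> * S"
      proof (rule mult_right_mono[OF _ S0])
        have "integral {s..r} k = integral {s..\<tau>} k + integral {\<tau>..r} k" using \<tau> s
          by (intro k_integral_combine) auto
        then show "integral {s..\<tau>} k \<le> \<delta>" using \<delta>(1) k_integral_nonneg[of \<tau> r] by linarith
      qed
      finally have "cmod (amp \<tau> \<psi> u) \<le> cmod (amp s \<psi> u) + \<delta> * S"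
        using norm_triangle_sub[of "amp \<tau> \<psi> u" "amp s \<psi> u"] by linarith
      then show ?thesis using N[OF \<psi>] by linarith
    qed
    then have "S \<le> N + \<delta> * S"
      unfolding S_def using s \<phi> by (intro cSUP_least) auto
    then have "S \<le> N / (1 - \<delta>)" using \<delta> by (simp add: pos_le_divide_eq algebra_simps)
    then show ?thesis using le[of r \<phi>] s \<phi> by auto
  qed
  \<comment> \<open>Cutting [0,t] into n pieces of equal k-mass H / n, rather than of equal length,
    gives n factors 1 / (1 - H / n), whose product tends to exp H. Taking n > H keeps each mass
    below 1.\<close>
  have fin: "cmod (amp t \<phi> u) \<le> B / (1 - H / real n) ^ n" if n: "real n > H" "0 < n" for n
  proof -
    have d1: "H / real n < 1" using n by simp
    have d0: "0 < 1 - H / real n" using d1 by simp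
    have cont: "continuous_on {0..t} (\<lambda>x. integral {0..x} k)"
      by (rule indefinite_integral_continuous_1[OF k_integrable_on]) simp
    have ex: "\<exists>x\<in>{0..t}. integral {0..x} k = real i * (H / real n)" if "i \<le> n" for i
    proof -
      have "real i * (H / real n) \<le> real n * (H / real n)" using that H0 n by (intro mult_right_mono) auto
      then have "real i * (H / real n) \<le> H" using n by simp
      then have "\<exists>x\<ge>0. x \<le> t \<and> integral {0..x} k = real i * (H / real n)"
        using IVT'[of "\<lambda>x. integral {0..x} k" 0 "real i * (H / real n)" t] t cont H0 by (auto simp: H_def)
      then show ?thesis by auto
    qed
    \<comment> \<open>Stated for every x whose k-mass from 0 is at most i H / n, so that points
      between the cuts are covered and each cut can start the next step.\<close>
    have claim: "\<forall>x\<in>{0..t}. integral {0..x} k \<le> real i * (H / real n)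
      \<longrightarrow> (\<forall>\<phi>\<in>C. cmod (amp x \<phi> u) \<le> B / (1 - H / real n) ^ i)"
      if "i \<le> n" for i
      using that
    proof (induction i)
      case 0
      show ?case
      proof (intro ballI impI)
        fix x \<phi> assume x: "x \<in> {0..t}" "integral {0..x} k \<le> real 0 * (H / real n)" and \<phi>: "\<phi> \<in> C"
        \<comment> \<open>For i = 0 the interval [0,x] carries no k-mass, and the step applies with
          \<delta> = 0.\<close>
        have "cmod (amp x \<phi> u) \<le> B / (1 - 0)"
          by (rule step[of 0 x 0 B]) (use x \<phi> B in auto)
        then show "cmod (amp x \<phi> u) \<le> B / (1 - H / real n) ^ 0" by simp
      qed
    next
      case (Suc i)
      then have IH: "\<And>x \<phi>. x \<in> {0..t} \<Longrightarrow> integral {0..x} k \<le> real i * (H / real n)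
        \<Longrightarrow> \<phi> \<in> C \<Longrightarrow> cmod (amp x \<phi> u) \<le> B / (1 - H / real n) ^ i"
        by auto
      obtain s where s: "s \<in> {0..t}" "integral {0..s} k = real i * (H / real n)" using ex[of i] Suc.prems by auto
      show ?case
      proof (intro ballI impI)
        fix x \<phi> assume x: "x \<in> {0..t}" "integral {0..x} k \<le> real (Suc i) * (H / real n)"
          and \<phi>: "\<phi> \<in> C"
        have B0: "0 \<le> B" using B[OF \<phi>] norm_ge_zero order_trans by blast
        show "cmod (amp x \<phi> u) \<le> B / (1 - H / real n) ^ Suc i"
        proof (cases "s \<le> x")
          case True
          have "integral {0..x} k = integral {0..s} k + integral {s..x} k"
            using s True by (intro k_integral_combine) auto
          then have "integral {s..x} k \<le> H / real n" using x s by (simp add: distrib_right add_divide_distrib)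
          then have "cmod (amp x \<phi> u) \<le> (B / (1 - H / real n) ^ i) / (1 - H / real n)"
            using s True d1 \<phi> by (intro step[of s x]) (auto intro: IH)
          then show ?thesis by (simp add: mult.commute)
        next
          case False
          have "integral {0..s} k = integral {0..x} k + integral {x..s} k"
            using x False by (intro k_integral_combine) auto
          then have "integral {0..x} k \<le> real i * (H / real n)" using s k_integral_nonneg[of x s] by linarith
          then have "cmod (amp x \<phi> u) \<le> B / (1 - H / real n) ^ i" by (intro IH x \<phi>)
          also have "\<dots> \<le> B / (1 - H / real n) ^ Suc i"
          proof (rule divide_left_mono)
            show "(1 - H / real n) ^ Suc i \<le> (1 - H / real n) ^ i"
              using d0 H0 by (intro power_decreasing) auto
          qed (use B0 d0 in auto)
          finally show ?thesis .
        qed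
      qed
    qed
    have "integral {0..t} k \<le> real n * (H / real n)" using n by (simp add: H_def)
    then show ?thesis using claim[of n] t \<phi> by auto
  qed
  have "(\<lambda>n. (1 + (- H) / real n) ^ n) \<longlonglongrightarrow> exp (- H)" by (rule tendsto_exp_limit_sequentially)
  then have "(\<lambda>n. B / (1 + (- H) / real n) ^ n) \<longlonglongrightarrow> B / exp (- H)"
    by (intro tendsto_divide tendsto_const) auto
  moreover have "\<forall>\<^sub>F n in sequentially. cmod (amp t \<phi> u) \<le> B / (1 + (- H) / real n) ^ n"
  proof -
    obtain n0 where n0: "H < real n0" using reals_Archimedean2 by blast
    show ?thesis unfolding eventually_sequentially
    proof (intro exI[of _ "Suc n0"] allI impI)
      fix n assume "Suc n0 \<le> n"
      then have "H < real n" "0 < n" using n0 by auto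
      then show "cmod (amp t \<phi> u) \<le> B / (1 + (- H) / real n) ^ n" using fin by simp
    qed
  qed
  ultimately have "cmod (amp t \<phi> u) \<le> B / exp (- H)"
    by (intro tendsto_lowerbound) auto
  then show ?thesis by (simp add: exp_minus H_def field_simps)
qed

section \<open>Bounds on L^p for the approximants and the wave operator\<close>

definition total :: real where "total = (LINT t:{0..}|lebesgue. k t)"

text \<open>The k-mass of [t, infinity). It makes the approximants Cauchy and is the rate of their
  convergence.\<close>

definition tail :: "real \<Rightarrow> real" where "tail t = total - integral {0..t} k"

lemma integral_tendsto_total: "((\<lambda>t. integral {0..t} k) \<longlongrightarrow> total) at_top"
proof -
  have "((\<lambda>t. LINT x:{0..t}|lebesgue. k x) \<longlongrightarrow> total) at_top"
    unfolding total_def by (rule tendsto_set_lebesgue_integral_at_top[OF _ k_integrable]) auto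
  then show ?thesis by (simp add: set_lebesgue_integral_eq_integral(2) k_set_integrable)
qed

lemma tail_tendsto: "(tail \<longlongrightarrow> 0) at_top"
  using tendsto_diff[OF tendsto_const integral_tendsto_total, of total] by (simp add: tail_def[abs_def])

lemma integral_le_total: assumes "0 \<le> t" shows "integral {0..t} k \<le> total"
proof (rule tendsto_lowerbound[OF integral_tendsto_total])
  show "\<forall>\<^sub>F s in at_top. integral {0..t} k \<le> integral {0..s} k"
    using eventually_ge_at_top[of t]
  proof eventually_elim
    case (elim s)
    have "integral {0..s} k = integral {0..t} k + integral {t..s} k"
      using assms elim by (intro k_integral_combine) auto
    then show ?case using k_integral_nonneg[of t s] by linarith
  qed
qed simp

lemma tail_nonneg: "0 \<le> t \<Longrightarrow> 0 \<le> tail t"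
  using integral_le_total by (simp add: tail_def)

lemma integral_le_tail: assumes "0 \<le> s" "s \<le> t" shows "integral {s..t} k \<le> tail s"
  using k_integral_combine[of 0 s t] integral_le_total[of t] assms by (simp add: tail_def)

lemma wave_approx_isometry: "0 \<le> t \<Longrightarrow> L2_isometry (wave_approx U t)"
  using L2_isometry_comp[OF U_isometry[of 0 t] free_evolution_isometry[of t]]
  by (simp add: wave_approx_def[abs_def])

text \<open>Unitarity and the composition law move U(0,t) to the other factor as U(t,0).\<close>

lemma wave_approx_inner:
  assumes t: "0 \<le> t" and \<phi>: "\<phi> \<in> Lp_space 2" and u: "u \<in> Lp_space 2"
  shows "inner_L2 (wave_approx U t \<phi>) u = amp t \<phi> u"
proof -
  note E = E_L2[OF \<phi>, of t]
  have UE: "U 0 t (free_evolution t \<phi>) \<in> Lp_space 2" using t E by (intro U_L2) auto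
  have "inner_L2 (wave_approx U t \<phi>) u = inner_L2 (U t 0 (U 0 t (free_evolution t \<phi>))) (U t 0 u)"
    unfolding wave_approx_def using L2_isometry_inner[OF U_isometry[OF t order_refl] UE u] by simp
  also have "\<dots> = inner_L2 (free_evolution t \<phi>) (U t 0 u)"
  proof (rule inner_cong_AE)
    show "ae_equal (U t 0 (U 0 t (free_evolution t \<phi>))) (free_evolution t \<phi>)"
      using U_comp[OF t order_refl t E] U_refl[OF t E] by eventually_elim simp
  qed (auto intro!: Lp_space_measurable[of _ 2] U_L2 E t u)
  finally show ?thesis by (simp add: amp_def)
qed

lemma amp_0:
  assumes \<phi>: "\<phi> \<in> Lp_space 2" and u: "u \<in> Lp_space 2"
  shows "amp 0 \<phi> u = inner_L2 \<phi> u"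
  unfolding amp_def
  by (rule inner_cong_AE)
     (auto intro!: Lp_space_measurable[of _ 2] U_L2 E_L2 \<phi> u free_evolution_0 U_refl)

lemma integral_eq_cnj_inner: "(LINT x|lborel. f x * v x) = cnj (inner_L2 f (\<lambda>x. cnj (v x)))"
  unfolding inner_L2_def by (subst Bochner_Integration.integral_cnj[symmetric]) simp

text \<open>The class for the Gronwall argument. Galilei maps increase neither norm; the L^p radius
  r enters the bound, while the L^2 radius \<rho> makes the supremum finite.\<close>

definition Lp_class :: "ennreal \<Rightarrow> real \<Rightarrow> real \<Rightarrow> wavefun set" where
  "Lp_class p r \<rho> = {\<phi> \<in> Lp_space 2. Lp_norm p \<phi> \<le> ennreal r \<and> nrm \<phi> \<le> \<rho>}"

lemma Lp_class_galilei:
  assumes "1 \<le> p" "\<phi> \<in> Lp_class p r \<rho>" shows "galilei t b \<phi> \<in> Lp_class p r \<rho>"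
  using assms Lp_norm_galilei[of p \<phi> t b]
  by (auto simp: Lp_class_def galilei_L2 Lp_space_measurable)

text \<open>At t = 0 the amplitude is, up to conjugation, the plain pairing with v, so duality
  supplies the initial value r s, which Gronwall propagates.\<close>

lemma amp_Lp_bound:
  assumes p: "1 \<le> p" and \<phi>: "\<phi> \<in> Lp_space 2" and r: "0 \<le> r" "Lp_norm p \<phi> \<le> ennreal r"
    and v: "v \<in> tests" "dual_bound p v s" and t: "0 \<le> t"
  shows "cmod (amp t \<phi> (\<lambda>x. cnj (v x))) \<le> r * s * exp (integral {0..t} k)"
proof (rule amp_gronwall[where C="Lp_class p r (nrm \<phi>)" and \<rho>="nrm \<phi>"])
  show "\<psi> \<in> Lp_class p r (nrm \<phi>) \<Longrightarrow> galilei t b \<psi> \<in> Lp_class p r (nrm \<phi>)"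
    for t b \<psi>
    by (rule Lp_class_galilei[OF p])
  show vL: "(\<lambda>x. cnj (v x)) \<in> Lp_space 2" by (intro L2_cnj tests_L2 v)
  show "\<phi> \<in> Lp_class p r (nrm \<phi>)" using \<phi> r by (simp add: Lp_class_def)
  fix \<psi> assume "\<psi> \<in> Lp_class p r (nrm \<phi>)"
  then have \<psi>: "\<psi> \<in> Lp_space 2" "Lp_norm p \<psi> \<le> ennreal r" by (auto simp: Lp_class_def)
  have "cmod (LINT x|lborel. \<psi> x * v x) \<le> r * s"
    using v(2) r \<psi> Lp_space_measurable[OF \<psi>(1)] unfolding dual_bound_def by blast
  then show "cmod (amp 0 \<psi> (\<lambda>x. cnj (v x))) \<le> r * s"
    by (simp add: amp_0[OF \<psi>(1) vL] integral_eq_cnj_inner)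
qed (use t in \<open>auto simp: Lp_class_def\<close>)

text \<open>A second use of Duhamel, now with the Gronwall bound inserted: the increment costs the
  k-mass of [t1,t2], hence at most the tail from t1 on, uniformly in t2.\<close>

lemma amp_Lp_increment:
  assumes p: "1 \<le> p" and \<phi>: "\<phi> \<in> Lp_space 2" and r: "0 \<le> r" "Lp_norm p \<phi> \<le> ennreal r"
    and v: "v \<in> tests" "dual_bound p v s" and s: "0 \<le> s" and t: "0 \<le> t1" "t1 \<le> t2"
  shows "cmod (amp t2 \<phi> (\<lambda>x. cnj (v x)) - amp t1 \<phi> (\<lambda>x. cnj (v x)))
    \<le> tail t1 * (r * s * exp total)"
proof -
  have "cmod (amp t2 \<phi> (\<lambda>x. cnj (v x)) - amp t1 \<phi> (\<lambda>x. cnj (v x)))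
    \<le> integral {t1..t2} k * (r * s * exp total)"
  proof (rule amp_increment[OF \<phi> _ t])
    show "(\<lambda>x. cnj (v x)) \<in> Lp_space 2" by (intro L2_cnj tests_L2 v)
    fix \<tau> b assume \<tau>: "t1 \<le> \<tau>" "\<tau> \<le> t2"
    have "cmod (amp \<tau> (galilei \<tau> b \<phi>) (\<lambda>x. cnj (v x))) \<le> r * s * exp (integral {0..\<tau>} k)"
      by (rule amp_Lp_bound[OF p galilei_L2(1)[OF \<phi>] r(1) _ v])
         (use \<tau> t in \<open>auto intro: order_trans[OF Lp_norm_galilei[OF p Lp_space_measurable[OF \<phi>]] r(2)]\<close>)
    also have "\<dots> \<le> r * s * exp total"
      using r s \<tau> t by (intro mult_left_mono) (auto intro: integral_le_total)
    finally show "cmod (amp \<tau> (galilei \<tau> b \<phi>) (\<lambda>x. cnj (v x))) \<le> r * s * exp total" .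
  qed
  also have "\<dots> \<le> tail t1 * (r * s * exp total)"
    using r s t by (intro mult_right_mono integral_le_tail) auto
  finally show ?thesis .
qed

lemma wave_approx_L2: "0 \<le> t \<Longrightarrow> \<phi> \<in> Lp_space 2
  \<Longrightarrow> wave_approx U t \<phi> \<in> Lp_space 2"
  by (rule L2_isometryD(1)[OF wave_approx_isometry])

lemma wave_approx_Lp:
  assumes p: "1 \<le> p" and \<phi>: "\<phi> \<in> Lp_space 2" and r: "0 \<le> r" "Lp_norm p \<phi> \<le> ennreal r"
    and t: "0 \<le> t"
  shows "Lp_norm p (wave_approx U t \<phi>) \<le> ennreal (exp total * r)"
proof (rule Lp_norm_le_by_duality[OF p])
  show "wave_approx U t \<phi> \<in> borel_measurable borel" by (intro Lp_space_measurable[of _ 2] wave_approx_L2 t \<phi>)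
  fix v s assume v: "v \<in> tests" and s: "0 \<le> s" and d: "dual_bound p v s"
  have vL: "(\<lambda>x. cnj (v x)) \<in> Lp_space 2" by (intro L2_cnj tests_L2 v)
  have "cmod (LINT x|lborel. wave_approx U t \<phi> x * v x) \<le> r * s * exp (integral {0..t} k)"
    using amp_Lp_bound[OF p \<phi> r v d t] by (simp add: integral_eq_cnj_inner wave_approx_inner[OF t \<phi> vL])
  also have "\<dots> \<le> r * s * exp total"
    using r s t by (intro mult_left_mono) (auto intro: integral_le_total)
  finally show "cmod (LINT x|lborel. wave_approx U t \<phi> x * v x) \<le> exp total * r * s" by (simp add: mult_ac)
qed (use r in simp)

lemma wave_approx_Lp_diff:
  assumes p: "1 \<le> p" and \<phi>: "\<phi> \<in> Lp_space 2" and r: "0 \<le> r" "Lp_norm p \<phi> \<le> ennreal r"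
    and t: "0 \<le> t1" "t1 \<le> t2"
  shows "Lp_norm p (\<lambda>x. wave_approx U t2 \<phi> x - wave_approx U t1 \<phi> x)
    \<le> ennreal (tail t1 * exp total * r)"
proof (rule Lp_norm_le_by_duality[OF p])
  have L: "wave_approx U t1 \<phi> \<in> Lp_space 2" "wave_approx U t2 \<phi> \<in> Lp_space 2"
    using t by (auto intro!: wave_approx_L2 \<phi>)
  then show "(\<lambda>x. wave_approx U t2 \<phi> x - wave_approx U t1 \<phi> x) \<in> borel_measurable borel"
    by (intro Lp_space_measurable[OF L2_diff])
  fix v s assume v: "v \<in> tests" and s: "0 \<le> s" and d: "dual_bound p v s"
  have vL: "(\<lambda>x. cnj (v x)) \<in> Lp_space 2" by (intro L2_cnj tests_L2 v)
  have "cmod (LINT x|lborel. (wave_approx U t2 \<phi> x - wave_approx U t1 \<phi> x) * v x)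
      = cmod (amp t2 \<phi> (\<lambda>x. cnj (v x)) - amp t1 \<phi> (\<lambda>x. cnj (v x)))"
    using t by (simp add: integral_eq_cnj_inner inner_diff_left L vL wave_approx_inner[OF _ \<phi> vL] flip: complex_cnj_diff)
  also have "\<dots> \<le> tail t1 * (r * s * exp total)" by (rule amp_Lp_increment[OF p \<phi> r v d s t])
  finally show "cmod (LINT x|lborel. (wave_approx U t2 \<phi> x - wave_approx U t1 \<phi> x) * v x)
    \<le> tail t1 * exp total * r * s"
    by (simp add: mult_ac)
qed (use r t tail_nonneg in simp)

text \<open>Existence of the strong limit is the case p = 2 of the increment bound. Completeness
  gives a limit along integer times, and the bound by \<open>tail\<close> carries the convergence to
  all real times.\<close>

lemma wave_operator_limit:
  assumes \<phi>: "\<phi> \<in> Lp_space 2"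
  shows "wave_operator U \<phi> \<in> Lp_space 2"
    and "((\<lambda>t. nrm (\<lambda>x. wave_approx U t \<phi> x - wave_operator U \<phi> x)) \<longlongrightarrow> 0) at_top"
proof -
  let ?c = "exp total * nrm \<phi>"
  let ?P = "\<lambda>g. g \<in> Lp_space 2 \<and> ((\<lambda>t. Lp_norm 2 (\<lambda>x. wave_approx U t \<phi> x - g x)) \<longlongrightarrow> 0) at_top"
  have d: "nrm (\<lambda>x. wave_approx U t2 \<phi> x - wave_approx U t1 \<phi> x) \<le> tail t1 * ?c"
    if t: "0 \<le> t1" "t1 \<le> t2" for t1 t2
  proof -
    have L: "(\<lambda>x. wave_approx U t2 \<phi> x - wave_approx U t1 \<phi> x) \<in> Lp_space 2"
      using t by (intro L2_diff wave_approx_L2 \<phi>) auto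
    have "ennreal (nrm (\<lambda>x. wave_approx U t2 \<phi> x - wave_approx U t1 \<phi> x))
      \<le> ennreal (tail t1 * exp total * nrm \<phi>)"
      unfolding Lp_norm_2[OF L, symmetric]
      by (rule wave_approx_Lp_diff[OF _ \<phi> _ _ t]) (simp_all add: Lp_norm_2 \<phi>)
    then show ?thesis using tail_nonneg[OF t(1)] by (subst (asm) ennreal_le_iff) (auto simp: mult_ac)
  qed
  have lim: "((\<lambda>t. tail t * ?c) \<longlongrightarrow> 0) at_top" using tail_tendsto by (rule tendsto_mult_left_zero)
  have small: "\<exists>N\<ge>0. \<forall>t\<ge>N. tail t * ?c < e" if e0: "0 < e" for e
  proof -
    obtain N where "\<forall>t\<ge>N. tail t * ?c < e"
      using order_tendstoD(2)[OF lim e0] unfolding eventually_at_top_linorder by blast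
    then show ?thesis by (intro exI[of _ "max N 0"]) auto
  qed
  have "\<exists>g\<in>Lp_space 2. (\<lambda>n. nrm (\<lambda>x. wave_approx U (real n) \<phi> x - g x))
    \<longlonglongrightarrow> 0"
  proof (rule L2_complete)
    fix e :: real assume e: "0 < e"
    then obtain T where T: "0 \<le> T" "\<And>t. t \<ge> T \<Longrightarrow> tail t * ?c < e" using small by blast
    obtain N where N: "T \<le> real N" using real_arch_simple by blast
    show "\<exists>N. \<forall>m\<ge>N. \<forall>n\<ge>N. nrm (\<lambda>x. wave_approx U (real m) \<phi> x - wave_approx U (real n) \<phi> x) \<le> e"
    proof (intro exI[of _ N] allI impI)
      fix m n assume mn: "N \<le> m" "N \<le> n"
      then have Tmn: "T \<le> real m" "T \<le> real n" using N by linarith+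
      show "nrm (\<lambda>x. wave_approx U (real m) \<phi> x - wave_approx U (real n) \<phi> x) \<le> e"
      proof (cases "n \<le> m")
        case True
        then show ?thesis using d[of "real n" "real m"] T(2)[OF Tmn(2)] by simp
      next
        case False
        then show ?thesis using d[of "real m" "real n"] T(2)[OF Tmn(1)] nrm_diff_commute[of "wave_approx U (real m) \<phi>"]
          by simp
      qed
    qed
  qed (simp add: wave_approx_L2 \<phi>)
  then obtain g where g: "g \<in> Lp_space 2"
    "(\<lambda>n. nrm (\<lambda>x. wave_approx U (real n) \<phi> x - g x)) \<longlonglongrightarrow> 0" by blast
  have glim: "nrm (\<lambda>x. wave_approx U t \<phi> x - g x) \<le> tail t * ?c" if t: "0 \<le> t" for t
  proof -
    have L: "wave_approx U t \<phi> \<in> Lp_space 2" by (rule wave_approx_L2[OF t \<phi>])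
    have "(\<lambda>n. nrm (\<lambda>x. wave_approx U (real n) \<phi> x - g x) + tail t * ?c) \<longlonglongrightarrow> 0
      + tail t * ?c"
      by (intro tendsto_add tendsto_const g)
    moreover have "\<forall>\<^sub>F n in sequentially. nrm (\<lambda>x. wave_approx U t \<phi> x - g x)
      \<le> nrm (\<lambda>x. wave_approx U (real n) \<phi> x - g x) + tail t * ?c"
    proof -
      obtain N where N: "t \<le> real N" using real_arch_simple by blast
      show ?thesis unfolding eventually_sequentially
      proof (intro exI[of _ N] allI impI)
        fix n assume "N \<le> n"
        then have n: "t \<le> real n" using N by linarith
        have "nrm (\<lambda>x. wave_approx U t \<phi> x - g x)
          \<le> nrm (\<lambda>x. wave_approx U t \<phi> x - wave_approx U (real n) \<phi> x) + nrm (\<lambda>x. wave_approx U (real n) \<phi> x - g x)"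
          by (intro nrm_triangle3 L wave_approx_L2 \<phi> g) simp
        then show "nrm (\<lambda>x. wave_approx U t \<phi> x - g x)
          \<le> nrm (\<lambda>x. wave_approx U (real n) \<phi> x - g x) + tail t * ?c"
          using d[OF t n] nrm_diff_commute[of "wave_approx U t \<phi>" "wave_approx U (real n) \<phi>"] by linarith
      qed
    qed
    ultimately show ?thesis by (intro tendsto_lowerbound[of _ "tail t * ?c" sequentially]) auto
  qed
  have "?P g"
  proof (intro conjI g)
    show "((\<lambda>t. Lp_norm 2 (\<lambda>x. wave_approx U t \<phi> x - g x)) \<longlongrightarrow> 0) at_top"
      unfolding ennreal_tendsto_0_iff
    proof (intro allI impI)
      fix e :: real assume "0 < e"
      then obtain T where T: "0 \<le> T" "\<And>t. t \<ge> T \<Longrightarrow> tail t * ?c < e" using small by blast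
      show "\<forall>\<^sub>F t in at_top. Lp_norm 2 (\<lambda>x. wave_approx U t \<phi> x - g x) \<le> ennreal e"
        using eventually_ge_at_top[of T]
      proof eventually_elim
        case (elim t)
        then have t: "0 \<le> t" using T by simp
        show ?case using glim[OF t] T(2)[OF elim] t
          by (simp add: Lp_norm_2 L2_diff wave_approx_L2 \<phi> g ennreal_leI)
      qed
    qed
  qed
  then have P: "?P (wave_operator U \<phi>)" unfolding wave_operator_def by (rule someI[where P="?P"])
  then show W: "wave_operator U \<phi> \<in> Lp_space 2" by simp
  show "((\<lambda>t. nrm (\<lambda>x. wave_approx U t \<phi> x - wave_operator U \<phi> x)) \<longlongrightarrow> 0) at_top"
  proof (rule tendstoI)
    fix e :: real assume e: "0 < e"
    have "\<forall>\<^sub>F t in at_top. Lp_norm 2 (\<lambda>x. wave_approx U t \<phi> x - wave_operator U \<phi> x)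
      \<le> ennreal (e/2)"
      using P e unfolding ennreal_tendsto_0_iff by simp
    then show "\<forall>\<^sub>F t in at_top. dist (nrm (\<lambda>x. wave_approx U t \<phi> x - wave_operator U \<phi> x)) 0 < e"
      using eventually_ge_at_top[of 0]
    proof eventually_elim
      case (elim t)
      then have "ennreal (nrm (\<lambda>x. wave_approx U t \<phi> x - wave_operator U \<phi> x)) \<le> ennreal (e/2)"
        by (simp add: Lp_norm_2 L2_diff wave_approx_L2 \<phi> W)
      then have "nrm (\<lambda>x. wave_approx U t \<phi> x - wave_operator U \<phi> x) \<le> e/2" using e
        by (subst (asm) ennreal_le_iff) auto
      then show ?case using e by simp
    qed
  qed
qed

lemma wave_operator_limit_nat:
  assumes "\<phi> \<in> Lp_space 2"
  shows "(\<lambda>n. nrm (\<lambda>x. wave_approx U (real n) \<phi> x - wave_operator U \<phi> x))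
    \<longlonglongrightarrow> 0"
  by (rule filterlim_compose[OF wave_operator_limit(2)[OF assms] filterlim_real_sequentially])

lemma wave_operator_isometry: "L2_isometry (wave_operator U)"
  unfolding L2_isometry_def
proof (intro conjI ballI allI)
  fix f assume f: "f \<in> Lp_space 2"
  note Wf = wave_operator_limit(1)[OF f] and lim = wave_operator_limit_nat[OF f]
  have Lf: "wave_approx U (real n) f \<in> Lp_space 2" for n by (rule wave_approx_L2) (auto simp: f)
  show "wave_operator U f \<in> Lp_space 2" by fact
  have "(\<lambda>n. nrm (wave_approx U (real n) f)) \<longlonglongrightarrow> nrm (wave_operator U f)"
    by (rule nrm_tendsto[OF Lf Wf lim])
  then have "(\<lambda>n::nat. nrm f) \<longlonglongrightarrow> nrm (wave_operator U f)"
    using L2_isometryD(2)[OF wave_approx_isometry f] by simp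
  then show "nrm (wave_operator U f) = nrm f" by (simp add: LIMSEQ_const_iff)
  fix g c assume g: "g \<in> Lp_space 2"
  note Wg = wave_operator_limit(1)[OF g] and limg = wave_operator_limit_nat[OF g]
  have Lg: "wave_approx U (real n) g \<in> Lp_space 2" for n by (rule wave_approx_L2) (auto simp: g)
  note fg = L2_lin[OF f g, of c]
  have Lfg: "wave_approx U (real n) (\<lambda>x. c * f x + g x) \<in> Lp_space 2" for n by (rule wave_approx_L2)
    (auto simp: fg)
  note Wfg = wave_operator_limit(1)[OF fg]
  have "nrm (\<lambda>x. (c * wave_approx U (real n) f x + wave_approx U (real n) g x) - wave_operator U (\<lambda>x. c * f x
    + g x) x)
      = nrm (\<lambda>x. wave_approx U (real n) (\<lambda>x. c * f x + g x) x - wave_operator U (\<lambda>x. c * f x + g x) x)" for n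
  proof (rule L2_cong_AE(2)[OF L2_diff[OF Lfg Wfg] Lp_space_measurable[OF L2_diff[OF L2_lin[OF Lf Lg] Wfg]]])
    have "ae_equal (wave_approx U (real n) (\<lambda>x. c * f x + g x)) (\<lambda>x. c * wave_approx U (real n) f x
      + wave_approx U (real n) g x)"
      by (rule L2_isometryD(3)[OF wave_approx_isometry f g]) simp
    then show "AE x in lborel. cmod ((c * wave_approx U (real n) f x
      + wave_approx U (real n) g x) - wave_operator U (\<lambda>x. c * f x + g x) x)
      = cmod (wave_approx U (real n) (\<lambda>x. c * f x + g x) x - wave_operator U (\<lambda>x. c * f x + g x) x)"
      by eventually_elim simp
  qed
  with wave_operator_limit_nat[OF fg]
  have 1: "(\<lambda>n. nrm (\<lambda>x. (c * wave_approx U (real n) f x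
    + wave_approx U (real n) g x) - wave_operator U (\<lambda>x. c * f x + g x) x)) \<longlonglongrightarrow> 0"
    by simp
  have 2: "(\<lambda>n. nrm (\<lambda>x. (c * wave_approx U (real n) f x
    + wave_approx U (real n) g x) - (c * wave_operator U f x + wave_operator U g x))) \<longlonglongrightarrow> 0"
    by (rule tendsto_nrm_lin[OF Lf Wf lim Lg Wg limg])
  show "ae_equal (wave_operator U (\<lambda>x. c * f x + g x)) (\<lambda>x. c * wave_operator U f x + wave_operator U g x)"
    by (rule L2_limit_unique[OF L2_lin[OF Lf Lg] Wfg L2_lin[OF Wf Wg] _ 1 2]) simp
qed

lemma wave_operator_integral_tendsto:
  assumes \<phi>: "\<phi> \<in> Lp_space 2" and v: "v \<in> tests"
  shows "(\<lambda>n. LINT x|lborel. wave_approx U (real n) \<phi> x * v x)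
    \<longlonglongrightarrow> (LINT x|lborel. wave_operator U \<phi> x * v x)"
proof -
  have vL: "(\<lambda>x. cnj (v x)) \<in> Lp_space 2" by (intro L2_cnj tests_L2 v)
  show ?thesis unfolding integral_eq_cnj_inner
    by (intro tendsto_cnj inner_tendsto_left wave_operator_limit_nat wave_operator_limit(1) \<phi> vL wave_approx_L2) simp
qed

text \<open>L^2 convergence is enough: pairings with test functions converge, their bounds persist,
  and duality returns an L^p bound for the limit.\<close>

lemma wave_operator_Lp:
  assumes p: "1 \<le> p" and \<phi>: "\<phi> \<in> Lp_space 2" and r: "0 \<le> r" "Lp_norm p \<phi> \<le> ennreal r"
  shows "Lp_norm p (wave_operator U \<phi>) \<le> ennreal (exp total * r)"
proof (rule Lp_norm_le_by_duality[OF p])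
  show "wave_operator U \<phi> \<in> borel_measurable borel"
    by (intro Lp_space_measurable[of _ 2] wave_operator_limit(1) \<phi>)
  fix v s assume v: "v \<in> tests" and s: "0 \<le> s" and d: "dual_bound p v s"
  have "cmod (LINT x|lborel. wave_approx U (real n) \<phi> x * v x) \<le> exp total * r * s" for n
  proof -
    have "wave_approx U (real n) \<phi> \<in> borel_measurable borel"
      by (intro Lp_space_measurable[of _ 2] wave_approx_L2 \<phi>) simp
    then show ?thesis using d wave_approx_Lp[OF p \<phi> r, of "real n"] r unfolding dual_bound_def by auto
  qed
  then show "cmod (LINT x|lborel. wave_operator U \<phi> x * v x) \<le> exp total * r * s"
    by (intro tendsto_upperbound[OF tendsto_norm[OF wave_operator_integral_tendsto[OF \<phi> v]]]) auto
qed (use r in simp)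

text \<open>The increment bound with t2 -> infinity, taken inside the pairings, where the L^2 limit
  defining Omega is available.\<close>

lemma wave_operator_Lp_diff:
  assumes p: "1 \<le> p" and \<phi>: "\<phi> \<in> Lp_space 2" and r: "0 \<le> r" "Lp_norm p \<phi> \<le> ennreal r"
    and t: "0 \<le> t"
  shows "Lp_norm p (\<lambda>x. wave_approx U t \<phi> x - wave_operator U \<phi> x) \<le> ennreal (tail t * exp total * r)"
proof (rule Lp_norm_le_by_duality[OF p])
  note L = wave_approx_L2[OF t \<phi>] and W = wave_operator_limit(1)[OF \<phi>]
  show "(\<lambda>x. wave_approx U t \<phi> x - wave_operator U \<phi> x) \<in> borel_measurable borel"
    by (rule Lp_space_measurable[OF L2_diff[OF L W]])
  fix v s assume v: "v \<in> tests" and s: "0 \<le> s" and d: "dual_bound p v s"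
  have vL: "(\<lambda>x. cnj (v x)) \<in> Lp_space 2" by (intro L2_cnj tests_L2 v)
  have L': "wave_approx U (real n) \<phi> \<in> Lp_space 2" for n by (intro wave_approx_L2 \<phi>) simp
  have e: "(LINT x|lborel. (wave_approx U t \<phi> x - g x) * v x)
    = (LINT x|lborel. wave_approx U t \<phi> x * v x) - (LINT x|lborel. g x * v x)"
    if "g \<in> Lp_space 2" for g
    using L2_integrable_mult[OF L tests_L2[OF v]] L2_integrable_mult[OF that tests_L2[OF v]]
    by (simp add: left_diff_distrib)
  have "(\<lambda>n. LINT x|lborel. (wave_approx U t \<phi> x - wave_approx U (real n) \<phi> x) * v x)
      \<longlonglongrightarrow> (LINT x|lborel. (wave_approx U t \<phi> x - wave_operator U \<phi> x) * v x)"
    unfolding e[OF L'] e[OF W] by (intro tendsto_diff tendsto_const wave_operator_integral_tendsto \<phi> v)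
  moreover have "\<forall>\<^sub>F n in sequentially. cmod (LINT x|lborel. (wave_approx U t \<phi> x - wave_approx U (real n) \<phi> x) * v x) \<le> tail t * exp total * r * s"
  proof -
    obtain N where N: "t \<le> real N" using real_arch_simple by blast
    show ?thesis unfolding eventually_sequentially
    proof (intro exI[of _ N] allI impI)
      fix n assume "N \<le> n"
      then have n: "t \<le> real n" using N by linarith
      have "cmod (LINT x|lborel. (wave_approx U t \<phi> x - wave_approx U (real n) \<phi> x) * v x)
         = cmod (amp (real n) \<phi> (\<lambda>x. cnj (v x)) - amp t \<phi> (\<lambda>x. cnj (v x)))"
        using t by (simp add: integral_eq_cnj_inner inner_diff_left L L' vL wave_approx_inner[OF _ \<phi> vL] norm_minus_commute flip: complex_cnj_diff)
      also have "\<dots> \<le> tail t * (r * s * exp total)" by (rule amp_Lp_increment[OF p \<phi> r v d s t n])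
      finally show "cmod (LINT x|lborel. (wave_approx U t \<phi> x - wave_approx U (real n) \<phi> x) * v x)
        \<le> tail t * exp total * r * s"
        by (simp add: mult_ac)
    qed
  qed
  ultimately show "cmod (LINT x|lborel. (wave_approx U t \<phi> x - wave_operator U \<phi> x) * v x)
    \<le> tail t * exp total * r * s"
    by (intro tendsto_upperbound[OF tendsto_norm]) auto
qed (use r tail_nonneg[OF t] in simp)

end

section \<open>Extension by continuity\<close>

text \<open>A bound on L^2 functions, phrased with a real majorant r of the norm so that the
  constants remain real throughout.\<close>

definition Lp_bounded :: "ennreal \<Rightarrow> real \<Rightarrow> (wavefun \<Rightarrow> wavefun) \<Rightarrow> bool" where
  "Lp_bounded p C T \<longleftrightarrow> (\<forall>\<phi>\<in>Lp_space 2. \<forall>r\<ge>0. Lp_norm p \<phi> \<le> ennreal r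
    \<longrightarrow> Lp_norm p (T \<phi>) \<le> ennreal (C * r))"

lemma Lp_boundedD:
  "Lp_bounded p C T \<Longrightarrow> \<phi> \<in> Lp_space 2 \<Longrightarrow> 0 \<le> r \<Longrightarrow> Lp_norm p \<phi>
    \<le> ennreal r \<Longrightarrow> Lp_norm p (T \<phi>) \<le> ennreal (C * r)"
  unfolding Lp_bounded_def by blast

lemma Lp_bounded_in_Lp:
  assumes "Lp_bounded p C T" "\<phi> \<in> Lp_space p" "\<phi> \<in> Lp_space 2"
  shows "T \<phi> \<in> Lp_space p"
proof -
  obtain r where r: "0 \<le> r" "Lp_norm p \<phi> = ennreal r"
    using assms(2) unfolding Lp_space_def by (metis Lp_norm_finiteE mem_Collect_eq)
  then have "Lp_norm p (T \<phi>) \<le> ennreal (C * r)" using Lp_boundedD[OF assms(1,3) r(1)] by simp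
  then show ?thesis unfolding Lp_space_def by (simp add: le_less_trans)
qed

lemma Lp_bounded_diff:
  assumes p: "1 \<le> p" and T: "L2_isometry T" and B: "Lp_bounded p C T"
    and f: "f \<in> Lp_space 2" and g: "g \<in> Lp_space 2"
    and r: "0 \<le> r" "Lp_norm p (\<lambda>x. f x - g x) \<le> ennreal r"
  shows "Lp_norm p (\<lambda>x. T f x - T g x) \<le> ennreal (C * r)"
proof -
  note d = L2_diff[OF f g]
  have "ae_equal (T (\<lambda>x. -1 * g x + f x)) (\<lambda>x. -1 * T g x + T f x)" by (rule L2_isometryD(3)[OF T g f])
  then have "AE x in lborel. cmod (T f x - T g x) = cmod (T (\<lambda>x. f x - g x) x)" by eventually_elim simp
  then have "Lp_norm p (\<lambda>x. T f x - T g x) = Lp_norm p (T (\<lambda>x. f x - g x))"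
    by (intro Lp_norm_cong_AE p Lp_space_measurable[of _ 2] L2_diff L2_isometryD(1)[OF T] f g d)
  then show ?thesis using Lp_boundedD[OF B d r] by simp
qed

lemma Lp_norm_tendsto_0_add:
  assumes q: "1 \<le> q"
    and [measurable]: "\<And>n. G n \<in> borel_measurable borel" "\<And>n. K n \<in> borel_measurable borel"
    and G: "((\<lambda>n. Lp_norm (ennreal q) (G n)) \<longlongrightarrow> 0) Fl"
      and K: "((\<lambda>n. Lp_norm (ennreal q) (K n)) \<longlongrightarrow> 0) Fl"
  shows "((\<lambda>n. Lp_norm (ennreal q) (\<lambda>x. G n x + K n x)) \<longlongrightarrow> 0) Fl"
proof (subst Lp_norm_tendsto_0_iff[OF q], measurable, intro allI impI)
  fix e :: real assume e: "0 < e"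
  define d where "d = e / (2 * 2 powr q)"
  have d: "0 < d" using e by (simp add: d_def)
  have "\<forall>\<^sub>F n in Fl. pint q (G n) \<le> ennreal d" "\<forall>\<^sub>F n in Fl. pint q (K n) \<le> ennreal d"
    using G K d by (auto simp: Lp_norm_tendsto_0_iff[OF q])
  then show "\<forall>\<^sub>F n in Fl. pint q (\<lambda>x. G n x + K n x) \<le> ennreal e"
  proof eventually_elim
    case (elim n)
    have "pint q (\<lambda>x. G n x + K n x) \<le> ennreal (2 powr q) * (pint q (G n) + pint q (K n))"
      using q by (intro pint_add_le) auto
    also have "\<dots> \<le> ennreal (2 powr q) * (ennreal d + ennreal d)"
      by (intro mult_left_mono add_mono elim) simp
    also have "\<dots> = ennreal e" using d by (simp add: d_def flip: ennreal_plus ennreal_mult)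
    finally show ?case .
  qed
qed

lemma Lp_bounded_tendsto_0:
  assumes p: "1 \<le> p" and T: "L2_isometry T" and B: "Lp_bounded p C T" "0 \<le> C"
    and F: "\<And>n. F n \<in> Lp_space 2" and G: "\<And>n. G n \<in> Lp_space 2"
    and lim: "((\<lambda>n. Lp_norm p (\<lambda>x. F n x - G n x)) \<longlongrightarrow> 0) Fl"
  shows "((\<lambda>n. Lp_norm p (\<lambda>x. T (F n) x - T (G n) x)) \<longlongrightarrow> 0) Fl"
  unfolding ennreal_tendsto_0_iff
proof (intro allI impI)
  fix e :: real assume e: "0 < e"
  define d where "d = e / (C + 1)"
  have d: "0 < d" using e B by (simp add: d_def)
  have "C * d = e * (C / (C + 1))" by (simp add: d_def)
  also have "\<dots> \<le> e * 1" using e B by (intro mult_left_mono) auto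
  finally have Cd: "C * d \<le> e" by simp
  have "\<forall>\<^sub>F n in Fl. Lp_norm p (\<lambda>x. F n x - G n x) \<le> ennreal d" using lim d
    unfolding ennreal_tendsto_0_iff by blast
  then show "\<forall>\<^sub>F n in Fl. Lp_norm p (\<lambda>x. T (F n) x - T (G n) x) \<le> ennreal e"
  proof eventually_elim
    case (elim n)
    have "Lp_norm p (\<lambda>x. T (F n) x - T (G n) x) \<le> ennreal (C * d)"
      using d by (intro Lp_bounded_diff[OF p T B(1) F G _ elim]) simp
    then show ?case using Cd by (meson ennreal_leI order_trans)
  qed
qed

lemma Lp_norm_minus_commute: "Lp_norm p (\<lambda>x. f x - g x) = Lp_norm p (\<lambda>x. g x - f x)"
proof -
  have "Lp_norm p u = Lp_norm p (\<lambda>x. - u x)" for u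
    unfolding Lp_norm_def by simp
  from this[of "\<lambda>x. f x - g x"] show ?thesis by simp
qed

text \<open>The images of the truncations of f form a Cauchy sequence by boundedness; any other
  admissible sequence approaches the truncations in norm, so its images have the same limit.\<close>

lemma on_Lp_exists_finite:
  assumes q: "1 \<le> q" and T: "L2_isometry T" and B: "Lp_bounded (ennreal q) C T" "0 \<le> C"
    and f: "f \<in> Lp_space (ennreal q)"
  shows "\<exists>g. g \<in> Lp_space (ennreal q) \<and>
    (\<forall>F. range F \<subseteq> Lp_space (ennreal q) \<inter> Lp_space 2 \<and> Lp_converges (ennreal q) F f \<longrightarrow> Lp_converges (ennreal q) (\<lambda>n. T (F n)) g)"
proof -
  let ?p = "ennreal q"
  have p: "1 \<le> ?p" using q by simp
  have fm[measurable]: "f \<in> borel_measurable borel" using f by (rule Lp_space_measurable)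
  define t where "t n = trunc n f" for n
  have tt: "t n \<in> tests" for n unfolding t_def by (rule trunc_tests) measurable
  have t2: "t n \<in> Lp_space 2" and tp: "t n \<in> Lp_space ?p" for n using tt by (auto intro: tests_L2 tests_Lp[OF p])
  have [measurable]: "t n \<in> borel_measurable borel" for n using tt by (rule tests_measurable)
  have Tt2: "T (t n) \<in> Lp_space 2" for n by (rule L2_isometryD(1)[OF T t2])
  have [measurable]: "T (t n) \<in> borel_measurable borel" for n using Tt2 by (rule Lp_space_measurable)
  have tf: "(\<lambda>n. Lp_norm ?p (\<lambda>x. t n x - f x)) \<longlonglongrightarrow> 0"
    using trunc_converges[OF p f] by (simp add: Lp_converges_def t_def[abs_def])
  have "\<exists>g\<in>borel_measurable borel. \<forall>e>0. \<exists>N. \<forall>n\<ge>N. pint q (\<lambda>x. T (t n) x - g x) \<le> ennreal e"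
  proof (rule pint_complete)
    fix e :: real assume e: "0 < e"
    define e1 where "e1 = e powr (1/q)"
    have e1: "0 < e1" using e by (simp add: e1_def)
    \<comment> \<open>T enlarges distances by at most the factor C, and C + 1 is positive even for C
      = 0. The constant \<eta> below makes up for the factor 2^q of the quasi-triangle
      inequality.\<close>
    define d where "d = e1 / (C + 1)"
    have d: "0 < d" using e1 B by (simp add: d_def)
    have "C * d = e1 * (C / (C + 1))" by (simp add: d_def)
    also have "\<dots> \<le> e1 * 1" using e1 B by (intro mult_left_mono) auto
    finally have Cd: "C * d \<le> e1" by simp
    define \<eta> where "\<eta> = d powr q / (2 * 2 powr q)"
    have \<eta>: "0 < \<eta>" using d by (simp add: \<eta>_def)
    obtain N where N: "\<And>n. n \<ge> N \<Longrightarrow> pint q (\<lambda>x. t n x - f x) \<le> ennreal \<eta>"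
      using tf \<eta> by (subst (asm) Lp_norm_tendsto_0_iff[OF q]) (auto simp: eventually_sequentially)
    show "\<exists>N. \<forall>m\<ge>N. \<forall>n\<ge>N. pint q (\<lambda>x. T (t m) x - T (t n) x) \<le> ennreal e"
    proof (intro exI[of _ N] allI impI)
      fix m n assume mn: "N \<le> m" "N \<le> n"
      have "pint q (\<lambda>x. (t m x - f x) + (f x - t n x))
        \<le> ennreal (2 powr q) * (pint q (\<lambda>x. t m x - f x) + pint q (\<lambda>x. f x - t n x))"
        using q by (intro pint_add_le) auto
      also have "pint q (\<lambda>x. f x - t n x) = pint q (\<lambda>x. t n x - f x)"
        by (simp add: pint_def norm_minus_commute)
      also have "ennreal (2 powr q) * (pint q (\<lambda>x. t m x - f x) + pint q (\<lambda>x. t n x - f x))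
        \<le> ennreal (2 powr q) * (ennreal \<eta> + ennreal \<eta>)"
        by (intro mult_left_mono add_mono N mn) simp
      also have "\<dots> = ennreal (d powr q)" using \<eta> by (simp add: \<eta>_def flip: ennreal_plus ennreal_mult)
      finally have "Lp_norm ?p (\<lambda>x. t m x - t n x) \<le> ennreal d" using q d by (subst Lp_norm_le_iff) auto
      then have "Lp_norm ?p (\<lambda>x. T (t m) x - T (t n) x) \<le> ennreal (C * d)"
        using d by (intro Lp_bounded_diff[OF p T B(1) t2 t2]) auto
      also have "\<dots> \<le> ennreal e1" by (rule ennreal_leI[OF Cd])
      finally show "pint q (\<lambda>x. T (t m) x - T (t n) x) \<le> ennreal e"
        using q e e1 by (subst (asm) Lp_norm_le_iff) (auto simp: e1_def powr_powr)
    qed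
  qed (use q in auto)
  then obtain g where [measurable]: "g \<in> borel_measurable borel"
    and g: "\<And>e. 0 < e \<Longrightarrow> \<exists>N. \<forall>n\<ge>N. pint q (\<lambda>x. T (t n) x - g x)
      \<le> ennreal e" by blast
  have Tg: "(\<lambda>n. Lp_norm ?p (\<lambda>x. T (t n) x - g x)) \<longlonglongrightarrow> 0"
    by (subst Lp_norm_tendsto_0_iff[OF q]) (use g in \<open>auto simp: eventually_sequentially\<close>)
  have gp: "g \<in> Lp_space ?p"
  proof -
    obtain N where "Lp_norm ?p (\<lambda>x. T (t N) x - g x) \<le> ennreal 1"
      using Tg unfolding ennreal_tendsto_0_iff eventually_sequentially by (metis order_refl zero_less_one)
    then have "(\<lambda>x. T (t N) x - g x) \<in> Lp_space ?p" by (simp add: Lp_space_def le_less_trans)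
    from Lp_space_diff[OF p Lp_bounded_in_Lp[OF B(1) tp t2[of N]] this] show ?thesis by simp
  qed
  show ?thesis
  proof (intro exI[of _ g] conjI gp allI impI)
    fix F assume *: "range F \<subseteq> Lp_space ?p \<inter> Lp_space 2 \<and> Lp_converges ?p F f"
    then have F: "F n \<in> Lp_space 2" for n by auto
    have [measurable]: "F n \<in> borel_measurable borel" for n using F by (rule Lp_space_measurable)
    have [measurable]: "T (F n) \<in> borel_measurable borel" for n by (rule Lp_space_measurable[OF L2_isometryD(1)[OF T F]])
    have Ff: "(\<lambda>n. Lp_norm ?p (\<lambda>x. F n x - f x)) \<longlonglongrightarrow> 0" using *
      by (simp add: Lp_converges_def)
    have "(\<lambda>n. Lp_norm ?p (\<lambda>x. (F n x - f x) + (f x - t n x))) \<longlonglongrightarrow> 0"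
      using tf Lp_norm_minus_commute[of ?p f] by (intro Lp_norm_tendsto_0_add[OF q] Ff) auto
    then have "(\<lambda>n. Lp_norm ?p (\<lambda>x. F n x - t n x)) \<longlonglongrightarrow> 0" by simp
    from Lp_bounded_tendsto_0[OF p T B F t2 this]
    have "(\<lambda>n. Lp_norm ?p (\<lambda>x. T (F n) x - T (t n) x)) \<longlonglongrightarrow> 0" .
    from Lp_norm_tendsto_0_add[OF q _ _ this Tg]
    have "(\<lambda>n. Lp_norm ?p (\<lambda>x. T (F n) x - g x)) \<longlonglongrightarrow> 0" by simp
    then show "Lp_converges ?p (\<lambda>n. T (F n)) g" by (simp add: Lp_converges_def)
  qed
qed

section \<open>The extension to L^infinity\<close>

lemma bounded_mult_integrable:
  fixes h \<theta> :: wavefun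
  assumes [measurable]: "h \<in> borel_measurable borel" and h: "AE x in lborel. cmod (h x) \<le> c" and "0 \<le> c"
    and \<theta>: "integrable lborel \<theta>"
  shows "integrable lborel (\<lambda>x. h x * \<theta> x)"
    "cmod (LINT x|lborel. h x * \<theta> x) \<le> c * (LINT x|lborel. cmod (\<theta> x))"
proof -
  have [measurable]: "\<theta> \<in> borel_measurable borel" using \<theta> by (auto dest: borel_measurable_integrable)
  have i: "integrable lborel (\<lambda>x. c * cmod (\<theta> x))" using \<theta> by simp
  have le: "AE x in lborel. cmod (h x * \<theta> x) \<le> c * cmod (\<theta> x)"
    using h by eventually_elim (simp add: norm_mult mult_right_mono)
  show I: "integrable lborel (\<lambda>x. h x * \<theta> x)"
    by (rule Bochner_Integration.integrable_bound[OF i]) (use le in \<open>auto elim!: eventually_mono\<close>)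
  show "cmod (LINT x|lborel. h x * \<theta> x) \<le> c * (LINT x|lborel. cmod (\<theta> x))"
    using norm_integral_le[OF I i le] by simp
qed

lemma Lp_space_1_integrable: "\<phi> \<in> Lp_space 1 \<Longrightarrow> integrable lborel \<phi>"
  by (intro integrableI_bounded) (auto simp: Lp_space_def Lp_norm_def Let_def less_top split: if_splits)

text \<open>The conjugate sign of u has norm at most 1 in L^infinity, and its pairing with u is the
  L^1 norm of u.\<close>

lemma dual_bound_inf_L1:
  assumes u: "u \<in> tests" and d: "dual_bound \<infinity> u s"
  shows "(LINT x|lborel. cmod (u x)) \<le> s"
proof -
  have [measurable]: "u \<in> borel_measurable borel" using u by (rule tests_measurable)
  define \<phi> where "\<phi> x = cnj (sgn (u x))" for x
  have m[measurable]: "\<phi> \<in> borel_measurable borel" unfolding \<phi>_def by measurable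
  have le1: "Lp_norm \<infinity> \<phi> \<le> ennreal 1" by (subst Lp_norm_inf_le_iff) (auto simp: \<phi>_def norm_sgn)
  have "cmod (LINT x|lborel. \<phi> x * u x) \<le> 1 * s"
    by (rule d[unfolded dual_bound_def, rule_format, OF m zero_le_one le1])
  moreover have "\<phi> x * u x = complex_of_real (cmod (u x))" for x
  proof (cases "u x = 0")
    case False
    have "cnj (u x) * u x = of_real (cmod (u x)) * of_real (cmod (u x))"
      using complex_norm_square[of "u x"] by (simp add: power2_eq_square mult.commute)
    then show ?thesis using False by (simp add: \<phi>_def sgn_div_norm scaleR_conv_of_real field_simps)
  qed (simp add: \<phi>_def)
  ultimately have "cmod (LINT x|lborel. complex_of_real (cmod (u x))) \<le> s" by simp
  then show ?thesis unfolding integral_complex_of_real norm_of_real by linarith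
qed

text \<open>For \<open>p = \<infinity>\<close> the extension is dual to the transpose of \<open>T\<close> acting on \<open>L\<^sup>1\<close>.  The transpose comes
  from Riesz representation on \<open>L\<^sup>2\<close>; its \<open>L\<^sup>\<infinity>\<close> dual is obtained from a second Riesz representation,
  after multiplying the argument by a Gaussian to map \<open>L\<^sup>2\<close> into \<open>L\<^sup>1\<close>.\<close>

lemma L2_transpose:
  assumes T: "L2_isometry T" and B: "Lp_bounded \<infinity> C T" "0 \<le> C"
  obtains S where "\<And>\<phi>. \<phi> \<in> Lp_space 2 \<Longrightarrow> S \<phi> \<in> Lp_space 2"
    "\<And>\<phi> F. \<phi> \<in> Lp_space 2 \<Longrightarrow> F \<in> Lp_space 2
      \<Longrightarrow> (LINT x|lborel. T F x * \<phi> x) = (LINT x|lborel. F x * S \<phi> x)"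
    "\<And>\<phi> \<psi> c. \<phi> \<in> Lp_space 2 \<Longrightarrow> \<psi> \<in> Lp_space 2
      \<Longrightarrow> ae_equal (S (\<lambda>x. c * \<phi> x + \<psi> x)) (\<lambda>x. c * S \<phi> x + S \<psi> x)"
    "\<And>\<phi>. \<phi> \<in> Lp_space 2 \<Longrightarrow> integrable lborel \<phi>
      \<Longrightarrow> integrable lborel (S \<phi>)"
    "\<And>\<phi>. \<phi> \<in> Lp_space 2 \<Longrightarrow> integrable lborel \<phi>
      \<Longrightarrow> (LINT x|lborel. cmod (S \<phi> x)) \<le> C * (LINT x|lborel. cmod (\<phi> x))"
proof -
  have lin: "(LINT x|lborel. T (\<lambda>x. c * f x + g x) x * \<phi> x) = c * (LINT x|lborel. T f x * \<phi> x)
    + (LINT x|lborel. T g x * \<phi> x)"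
    if f: "f \<in> Lp_space 2" and g: "g \<in> Lp_space 2" and \<phi>: "\<phi> \<in> Lp_space 2" for f g c \<phi>
  proof -
    note L = L2_isometryD(1)[OF T]
    have [measurable]: "T (\<lambda>x. c * f x + g x) \<in> borel_measurable borel" "T f \<in> borel_measurable borel"
        "T g \<in> borel_measurable borel" "\<phi> \<in> borel_measurable borel"
      by (auto intro!: Lp_space_measurable[of _ 2] L L2_lin f g \<phi>)
    have "(LINT x|lborel. T (\<lambda>x. c * f x + g x) x * \<phi> x)
      = (LINT x|lborel. c * (T f x * \<phi> x) + T g x * \<phi> x)"
    proof (rule integral_cong_AE)
      show "AE x in lborel. T (\<lambda>x. c * f x + g x) x * \<phi> x = c * (T f x * \<phi> x) + T g x * \<phi> x"
        using L2_isometryD(3)[OF T f g, of c] by eventually_elim (simp add: algebra_simps)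
    qed measurable
    then show ?thesis
      using L2_integrable_mult[OF L[OF f] \<phi>] L2_integrable_mult[OF L[OF g] \<phi>] by simp
  qed
  have "\<forall>\<phi>\<in>Lp_space 2. \<exists>S. S \<in> Lp_space 2 \<and> (\<forall>F\<in>Lp_space 2. (LINT x|lborel. T F x * \<phi> x) = (LINT x|lborel. S x * F x))"
  proof
    fix \<phi> assume \<phi>: "\<phi> \<in> Lp_space 2"
    have "\<exists>g\<in>Lp_space 2. \<forall>f\<in>Lp_space 2. (LINT x|lborel. T f x * \<phi> x)
      = (LINT x|lborel. g x * f x)"
    proof (rule Riesz_representation[where K="nrm \<phi>"])
      show "cmod (LINT x|lborel. T f x * \<phi> x) \<le> nrm \<phi> * nrm f" if "f \<in> Lp_space 2" for f
        using L2_CS[OF L2_isometryD(1)[OF T that] \<phi>] L2_isometryD(2)[OF T that] by (simp add: mult.commute)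
    qed (rule lin[OF _ _ \<phi>])
    then show "\<exists>S. S \<in> Lp_space 2 \<and> (\<forall>F\<in>Lp_space 2. (LINT x|lborel. T F x * \<phi> x)
      = (LINT x|lborel. S x * F x))" by blast
  qed
  from bchoice[OF this] obtain S
    where SL: "\<And>\<phi>. \<phi> \<in> Lp_space 2 \<Longrightarrow> S \<phi> \<in> Lp_space 2"
    and S': "\<And>\<phi> F. \<phi> \<in> Lp_space 2 \<Longrightarrow> F \<in> Lp_space 2
      \<Longrightarrow> (LINT x|lborel. T F x * \<phi> x) = (LINT x|lborel. S \<phi> x * F x)"
    by blast
  have S: "(LINT x|lborel. T F x * \<phi> x) = (LINT x|lborel. F x * S \<phi> x)"
    if "\<phi> \<in> Lp_space 2" "F \<in> Lp_space 2" for \<phi> F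
    using S'[OF that] by (simp add: mult.commute)
  \<comment> \<open>The representing functions are picked by choice; their pairings determine them
    up to null sets. Testing the defect u with its own conjugate gives norm 0.\<close>
  have Slin: "ae_equal (S (\<lambda>x. c * \<phi> x + \<psi> x)) (\<lambda>x. c * S \<phi> x + S \<psi> x)"
    if \<phi>: "\<phi> \<in> Lp_space 2" and \<psi>: "\<psi> \<in> Lp_space 2" for \<phi> \<psi> c
  proof -
    define u where "u x = S (\<lambda>x. c * \<phi> x + \<psi> x) x - (c * S \<phi> x + S \<psi> x)" for x
    have uL: "u \<in> Lp_space 2" unfolding u_def by (intro L2_diff L2_lin SL \<phi> \<psi>)
    have "inner_L2 u u = (LINT x|lborel. cnj (u x) * S (\<lambda>x. c * \<phi> x
      + \<psi> x) x - (c * (cnj (u x) * S \<phi> x) + cnj (u x) * S \<psi> x))"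
      unfolding inner_L2_def by (simp add: u_def algebra_simps)
    also have "\<dots> = (LINT x|lborel. cnj (u x) * S (\<lambda>x. c * \<phi> x
      + \<psi> x) x) - (c * (LINT x|lborel. cnj (u x) * S \<phi> x) + (LINT x|lborel. cnj (u x) * S \<psi> x))"
      using inner_integrable[OF uL SL[OF L2_lin[OF \<phi> \<psi>]], of c] inner_integrable[OF uL SL[OF \<phi>]] inner_integrable[OF uL SL[OF \<psi>]]
      by simp
    also have "\<dots> = (LINT x|lborel. T (\<lambda>x. cnj (u x)) x * (c * \<phi> x
      + \<psi> x)) - (c * (LINT x|lborel. T (\<lambda>x. cnj (u x)) x * \<phi> x) + (LINT x|lborel. T (\<lambda>x. cnj (u x)) x * \<psi> x))"
      using S[OF L2_lin[OF \<phi> \<psi>] L2_cnj[OF uL], of c] S[OF \<phi> L2_cnj[OF uL]] S[OF \<psi> L2_cnj[OF uL]] by simp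
    also have "\<dots> = 0"
    proof -
      note Tu = L2_isometryD(1)[OF T L2_cnj[OF uL]]
      have "(LINT x|lborel. T (\<lambda>x. cnj (u x)) x * (c * \<phi> x + \<psi> x))
        = (LINT x|lborel. c * (T (\<lambda>x. cnj (u x)) x * \<phi> x) + T (\<lambda>x. cnj (u x)) x * \<psi> x)"
        by (simp add: algebra_simps)
      then show ?thesis using L2_integrable_mult[OF Tu \<phi>] L2_integrable_mult[OF Tu \<psi>] by simp
    qed
    finally have "nrm u = 0" by (simp add: inner_self)
    from nrm_eq_0_AE[OF uL this] show ?thesis by eventually_elim (simp add: u_def)
  qed
  \<comment> \<open>Dual to the L^infinity bound of T: on a ball, the conjugate sign of S \<phi> is
    a function bounded by 1 that pairs with S \<phi> to its local L^1 norm. Fatou lets the ball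
    grow.\<close>
  have S1: "(\<integral>\<^sup>+x. ennreal (cmod (S \<phi> x)) \<partial>lborel)
    \<le> ennreal (C * (LINT x|lborel. cmod (\<phi> x)))"
    if \<phi>: "\<phi> \<in> Lp_space 2" and i: "integrable lborel \<phi>" for \<phi>
  proof -
    have [measurable]: "S \<phi> \<in> borel_measurable borel" by (rule Lp_space_measurable[OF SL[OF \<phi>]])
    have le: "(\<integral>\<^sup>+x. ennreal (cmod (S \<phi> x)) * indicator (cball 0 (real n)) x \<partial>lborel)
      \<le> ennreal (C * (LINT x|lborel. cmod (\<phi> x)))" for n
    proof -
      define F where "F x = indicator (cball 0 (real n)) x * cnj (sgn (S \<phi> x))" for x
      have Fm[measurable]: "F \<in> borel_measurable borel" unfolding F_def by measurable
      have F1: "cmod (F x) \<le> 1" for x by (simp add: F_def norm_mult norm_sgn indicator_def)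
      have Ft: "F \<in> tests"
        by (rule tests_bounded_support[OF Fm F1, where R="real n"]) (auto simp: F_def indicator_def split: if_splits)
      note F2 = tests_L2[OF Ft]
      have "Lp_norm \<infinity> F \<le> ennreal 1" by (subst Lp_norm_inf_le_iff) (use F1 in auto)
      then have "Lp_norm \<infinity> (T F) \<le> ennreal C" using Lp_boundedD[OF B(1) F2, of 1] by simp
      then have TF: "AE x in lborel. cmod (T F x) \<le> C"
        using Lp_norm_inf_le_iff[of "T F" C] B Lp_space_measurable[OF L2_isometryD(1)[OF T F2]] by simp
      define R where "R x = indicator (cball 0 (real n)) x * cmod (S \<phi> x)" for x
      have e: "F x * S \<phi> x = complex_of_real (R x)" for x
      proof (cases "S \<phi> x = 0")
        case False
        have "cnj (S \<phi> x) * S \<phi> x = of_real (cmod (S \<phi> x)) * of_real (cmod (S \<phi> x))"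
          using complex_norm_square[of "S \<phi> x"] by (simp add: power2_eq_square mult.commute)
        then have "cnj (sgn (S \<phi> x)) * S \<phi> x = of_real (cmod (S \<phi> x))"
          using False by (simp add: sgn_div_norm scaleR_conv_of_real field_simps)
        then show ?thesis by (simp add: F_def R_def indicator_def)
      qed (simp add: F_def R_def)
      have Ri: "integrable lborel R"
        using integrable_Re[OF L2_integrable_mult[OF F2 SL[OF \<phi>]]] unfolding e by simp
      have "(\<integral>\<^sup>+x. ennreal (cmod (S \<phi> x)) * indicator (cball 0 (real n)) x \<partial>lborel)
        = (\<integral>\<^sup>+x. ennreal (R x) \<partial>lborel)"
        by (intro nn_integral_cong) (auto simp: R_def indicator_def)
      also have "\<dots> = ennreal (LINT x|lborel. R x)"
        by (rule nn_integral_eq_integral[OF Ri]) (simp add: R_def)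
      also have "(LINT x|lborel. R x) \<le> C * (LINT x|lborel. cmod (\<phi> x))"
      proof -
        have "complex_of_real (LINT x|lborel. R x) = (LINT x|lborel. T F x * \<phi> x)"
          unfolding S[OF \<phi> F2] e integral_complex_of_real ..
        then have "\<bar>LINT x|lborel. R x\<bar> = cmod (LINT x|lborel. T F x * \<phi> x)" by (metis norm_of_real)
        also have "\<dots> \<le> C * (LINT x|lborel. cmod (\<phi> x))"
          by (rule bounded_mult_integrable(2)[OF Lp_space_measurable[OF L2_isometryD(1)[OF T F2]] TF B(2) i])
        finally show ?thesis by linarith
      qed
      finally show ?thesis by (simp add: ennreal_leI)
    qed
    have "(\<integral>\<^sup>+x. ennreal (cmod (S \<phi> x)) \<partial>lborel)
        = (\<integral>\<^sup>+x. liminf (\<lambda>n. ennreal (cmod (S \<phi> x)) * indicator (cball 0 (real n)) x) \<partial>lborel)"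
    proof (intro nn_integral_cong)
      fix x :: "real^3"
      obtain N where N: "norm x \<le> real N" using real_arch_simple by blast
      have "(\<lambda>n. ennreal (cmod (S \<phi> x)) * indicator (cball 0 (real n)) x)
        \<longlonglongrightarrow> ennreal (cmod (S \<phi> x))"
        by (rule tendsto_eventually, unfold eventually_sequentially, rule exI[of _ N])
          (use N in \<open>auto simp: indicator_def\<close>)
      then show "ennreal (cmod (S \<phi> x))
        = liminf (\<lambda>n. ennreal (cmod (S \<phi> x)) * indicator (cball 0 (real n)) x)"
        by (simp add: lim_imp_Liminf)
    qed
    also have "\<dots> \<le> liminf (\<lambda>n. \<integral>\<^sup>+x. ennreal (cmod (S \<phi> x)) * indicator (cball 0 (real n)) x \<partial>lborel)"
      by (intro nn_integral_liminf) measurable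
    also have "\<dots> \<le> ennreal (C * (LINT x|lborel. cmod (\<phi> x)))"
      by (rule order_trans[OF Liminf_le_Limsup Limsup_bounded]) (auto simp: le)
    finally show ?thesis .
  qed
  have Si: "integrable lborel (S \<phi>)" if "\<phi> \<in> Lp_space 2" "integrable lborel \<phi>" for \<phi>
    using S1[OF that] Lp_space_measurable[OF SL[OF that(1)]] by (intro integrableI_bounded) (auto intro: le_less_trans)
  have Sb: "(LINT x|lborel. cmod (S \<phi> x)) \<le> C * (LINT x|lborel. cmod (\<phi> x))"
    if "\<phi> \<in> Lp_space 2" "integrable lborel \<phi>" for \<phi>
  proof -
    have "ennreal (LINT x|lborel. cmod (S \<phi> x)) \<le> ennreal (C * (LINT x|lborel. cmod (\<phi> x)))"
      using S1[OF that] integrable_norm[OF Si[OF that]] by (subst (asm) nn_integral_eq_integral) auto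
    then show ?thesis using B by (subst (asm) ennreal_le_iff) auto
  qed
  show thesis by (rule that[OF SL S Slin Si Sb])
qed

lemma on_Lp_exists_inf:
  assumes T: "L2_isometry T" and B: "Lp_bounded \<infinity> C T" "0 \<le> C" and f: "f \<in> Lp_space \<infinity>"
  shows "\<exists>g. g \<in> Lp_space \<infinity> \<and>
    (\<forall>F. range F \<subseteq> Lp_space \<infinity> \<inter> Lp_space 2 \<and> Lp_converges \<infinity> F f \<longrightarrow> Lp_converges \<infinity> (\<lambda>n. T (F n)) g)"
proof (rule L2_transpose[OF T B])
  fix S
  assume SL: "\<And>\<phi>. \<phi> \<in> Lp_space 2 \<Longrightarrow> S \<phi> \<in> Lp_space 2"
    and S: "\<And>\<phi> F. \<phi> \<in> Lp_space 2 \<Longrightarrow> F \<in> Lp_space 2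
      \<Longrightarrow> (LINT x|lborel. T F x * \<phi> x) = (LINT x|lborel. F x * S \<phi> x)"
    and Slin: "\<And>\<phi> \<psi> c. \<phi> \<in> Lp_space 2 \<Longrightarrow> \<psi> \<in> Lp_space 2
      \<Longrightarrow> ae_equal (S (\<lambda>x. c * \<phi> x + \<psi> x)) (\<lambda>x. c * S \<phi> x + S \<psi> x)"
    and Si: "\<And>\<phi>. \<phi> \<in> Lp_space 2 \<Longrightarrow> integrable lborel \<phi>
      \<Longrightarrow> integrable lborel (S \<phi>)"
    and Sb: "\<And>\<phi>. \<phi> \<in> Lp_space 2 \<Longrightarrow> integrable lborel \<phi>
      \<Longrightarrow> (LINT x|lborel. cmod (S \<phi> x)) \<le> C * (LINT x|lborel. cmod (\<phi> x))"
  have [measurable]: "f \<in> borel_measurable borel" using f by (rule Lp_space_measurable)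
  obtain c where c: "0 \<le> c" "Lp_norm \<infinity> f = ennreal c"
    using f unfolding Lp_space_def by (metis Lp_norm_finiteE mem_Collect_eq)
  have fc: "AE x in lborel. cmod (f x) \<le> c" using c Lp_norm_inf_le_iff[of f c] by simp
  define w where "w = gauss 1 0"
  have w: "w x = complex_of_real (exp (- (norm x)\<^sup>2))" for x by (simp add: w_def gauss_def)
  have w0: "w x \<noteq> 0" and w1: "cmod (w x) \<le> 1" for x by (simp_all add: w)
  have wL: "w \<in> Lp_space 2" unfolding w_def by (rule gauss_L2) simp
  have [measurable]: "w \<in> borel_measurable borel" unfolding w_def by measurable
  have wm: "(\<lambda>x. \<psi> x * w x) \<in> Lp_space 2" if "\<psi> \<in> Lp_space 2" for \<psi>
  proof (rule L2_bound(1)[OF that _ zero_le_one])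
    have [measurable]: "\<psi> \<in> borel_measurable borel" using that by (rule Lp_space_measurable)
    show "(\<lambda>x. \<psi> x * w x) \<in> borel_measurable borel" by measurable
    show "AE x in lborel. cmod (\<psi> x * w x) \<le> 1 * cmod (\<psi> x)"
      using w1 by (auto simp: norm_mult intro!: mult_left_le)
  qed
  have wi: "integrable lborel (\<lambda>x. \<psi> x * w x)" if "\<psi> \<in> Lp_space 2" for \<psi>
    by (rule L2_integrable_mult[OF that wL])
  define l where "l \<psi> = (LINT x|lborel. f x * S (\<lambda>x. \<psi> x * w x) x)" for \<psi>
  have fS: "integrable lborel (\<lambda>x. f x * S \<phi> x)"
      "cmod (LINT x|lborel. f x * S \<phi> x) \<le> c * (C * (LINT x|lborel. cmod (\<phi> x)))"
    if "\<phi> \<in> Lp_space 2" "integrable lborel \<phi>" for \<phi>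
    using bounded_mult_integrable[OF _ fc c(1) Si[OF that]] mult_left_mono[OF Sb[OF that] c(1)] by auto
  have "\<exists>g\<in>Lp_space 2. \<forall>\<psi>\<in>Lp_space 2. l \<psi> = (LINT x|lborel. g x * \<psi> x)"
  proof (rule Riesz_representation[where K="c * (C * nrm w)"])
    fix \<psi> \<theta> a assume \<psi>: "\<psi> \<in> Lp_space 2" and \<theta>: "\<theta> \<in> Lp_space 2"
    note [measurable] = Lp_space_measurable[OF SL[OF wm[OF \<psi>]]] Lp_space_measurable[OF SL[OF wm[OF \<theta>]]]
      Lp_space_measurable[OF SL[OF L2_lin[OF wm[OF \<psi>] wm[OF \<theta>]]]]
    have e: "(\<lambda>x. (a * \<psi> x + \<theta> x) * w x) = (\<lambda>x. a * (\<psi> x * w x) + \<theta> x * w x)"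
      by (simp add: algebra_simps)
    have "l (\<lambda>x. a * \<psi> x + \<theta> x)
      = (LINT x|lborel. a * (f x * S (\<lambda>x. \<psi> x * w x) x) + f x * S (\<lambda>x. \<theta> x * w x) x)"
      unfolding l_def e
    proof (rule integral_cong_AE)
      show "AE x in lborel. f x * S (\<lambda>x. a * (\<psi> x * w x) + \<theta> x * w x) x
        = a * (f x * S (\<lambda>x. \<psi> x * w x) x) + f x * S (\<lambda>x. \<theta> x * w x) x"
        using Slin[OF wm[OF \<psi>] wm[OF \<theta>], of a] by eventually_elim (simp add: algebra_simps)
    qed measurable
    then show "l (\<lambda>x. a * \<psi> x + \<theta> x) = a * l \<psi> + l \<theta>"
      using fS(1)[OF wm[OF \<psi>] wi[OF \<psi>]] fS(1)[OF wm[OF \<theta>] wi[OF \<theta>]] by (simp add: l_def)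
  next
    fix \<psi> assume \<psi>: "\<psi> \<in> Lp_space 2"
    have "cmod (l \<psi>) \<le> c * (C * (LINT x|lborel. cmod (\<psi> x * w x)))" unfolding l_def
      by (rule fS(2)[OF wm[OF \<psi>] wi[OF \<psi>]])
    also have "\<dots> \<le> c * (C * (nrm \<psi> * nrm w))"
      by (intro mult_left_mono L2_abs_CS \<psi> wL c B)
    finally show "cmod (l \<psi>) \<le> c * (C * nrm w) * nrm \<psi>" by (simp add: mult_ac)
  qed
  then obtain g0 where g0: "g0 \<in> Lp_space 2"
    "\<And>\<psi>. \<psi> \<in> Lp_space 2 \<Longrightarrow> l \<psi> = (LINT x|lborel. g0 x * \<psi> x)" by blast
  have [measurable]: "g0 \<in> borel_measurable borel" using g0(1) by (rule Lp_space_measurable)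
  \<comment> \<open>Undoes the Gaussian weight. So far g could be unbounded; its L^infinity bound
    follows by duality, since the functional is bounded in the L^1 norm.\<close>
  define g where "g x = g0 x / w x" for x
  have gm[measurable]: "g \<in> borel_measurable borel" unfolding g_def by measurable
  have gS: "(LINT x|lborel. g x * \<phi> x) = (LINT x|lborel. f x * S \<phi> x)" if \<phi>: "\<phi> \<in> tests" for \<phi>
  proof -
    obtain K R where K: "\<phi> \<in> borel_measurable borel" "0 \<le> K"
      "\<And>x. cmod (\<phi> x) \<le> K * indicator (cball 0 R) x"
      using \<phi> by (rule testsE) blast
    note K(1)[measurable]
    \<comment> \<open>On the bounded support of \<phi>, dividing by the Gaussian costs at most a
      factor exp(R^2).\<close>
    have "(\<lambda>x. \<phi> x / w x) \<in> tests"
    proof (rule tests_bounded_support)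
      show "cmod (\<phi> x / w x) \<le> K * exp (R\<^sup>2)" for x
      proof (cases "x \<in> cball 0 R")
        case True
        then have "(norm x)\<^sup>2 \<le> R\<^sup>2" by (intro power_mono) auto
        then have "cmod (\<phi> x) * exp ((norm x)\<^sup>2) \<le> K * exp (R\<^sup>2)"
          using K(2) K(3)[of x] True by (intro mult_mono) auto
        then show ?thesis by (simp add: norm_divide norm_mult w exp_minus field_simps)
      next
        case False
        then show ?thesis using K(2) K(3)[of x] by simp
      qed
      show "\<phi> x / w x \<noteq> 0 \<Longrightarrow> norm x \<le> R" for x
        using K(3)[of x] by (cases "x \<in> cball 0 R") auto
    qed measurable
    from g0(2)[OF tests_L2[OF this]] show ?thesis
      unfolding l_def using w0 by (simp add: g_def)
  qed
  have gb: "Lp_norm \<infinity> g \<le> ennreal (c * C)"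
  proof (rule Lp_norm_le_by_duality)
    fix u s assume u: "u \<in> tests" and d: "dual_bound \<infinity> u s"
    have "cmod (LINT x|lborel. g x * u x) \<le> c * (C * (LINT x|lborel. cmod (u x)))"
      unfolding gS[OF u] by (rule fS(2)[OF tests_L2[OF u] integrable_tests[OF u]])
    also have "\<dots> \<le> c * (C * s)" by (intro mult_left_mono dual_bound_inf_L1[OF u d] c B)
    finally show "cmod (LINT x|lborel. g x * u x) \<le> c * C * s" by (simp add: mult_ac)
  qed (use c B in auto)
  then have gp: "g \<in> Lp_space \<infinity>" by (simp add: Lp_space_def le_less_trans)
  have gc: "AE x in lborel. cmod (g x) \<le> c * C" using gb c B Lp_norm_inf_le_iff[of g "c * C"] by simp
  show ?thesis
  proof (intro exI[of _ g] conjI gp allI impI)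
    fix F assume *: "range F \<subseteq> Lp_space \<infinity> \<inter> Lp_space 2 \<and> Lp_converges \<infinity> F f"
    then have F2: "F n \<in> Lp_space 2" for n by auto
    obtain K' where K': "K' < \<infinity>" "\<And>n. Lp_norm \<infinity> (F n) \<le> K'"
      and Ff: "\<And>\<phi>. \<phi> \<in> Lp_space 1 \<Longrightarrow> (\<lambda>n. LINT x|lborel. F n x * \<phi> x)
        \<longlonglongrightarrow> (LINT x|lborel. f x * \<phi> x)"
      using * unfolding Lp_converges_def by auto
    obtain K where K: "0 \<le> K" "K' = ennreal K" using K'(1) by (cases K') auto
    have TF: "Lp_norm \<infinity> (T (F n)) \<le> ennreal (C * K)" for n
      using K'(2)[of n] K by (intro Lp_boundedD[OF B(1) F2]) auto
    note TFm = Lp_space_measurable[OF L2_isometryD(1)[OF T F2]]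
    have TFc: "AE x in lborel. cmod (T (F n) x) \<le> C * K" for n
      using TF[of n] K B TFm[of n] Lp_norm_inf_le_iff[of "T (F n)" "C * K"] by simp
    \<comment> \<open>The weak-* convergence of F n is tested with S \<phi>, which lies in L^1; by
      transposition T (F n) converges against test functions.\<close>
    have tst: "(\<lambda>n. LINT x|lborel. T (F n) x * \<phi> x) \<longlonglongrightarrow> (LINT x|lborel. g x * \<phi> x)"
      if \<phi>: "\<phi> \<in> tests" for \<phi>
    proof -
      note i = Si[OF tests_L2[OF \<phi>] integrable_tests[OF \<phi>]]
      have "S \<phi> \<in> Lp_space 1"
        using i unfolding integrable_iff_bounded by (auto simp: Lp_space_def Lp_norm_def Let_def)
      from Ff[OF this] show ?thesis unfolding gS[OF \<phi>] S[OF tests_L2[OF \<phi>] F2] .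
    qed
    show "Lp_converges \<infinity> (\<lambda>n. T (F n)) g"
      unfolding Lp_converges_def
    proof (simp only: simp_thms if_True, intro conjI exI[of _ "ennreal (C * K)"] allI ballI TF)
      show "ennreal (C * K) < \<infinity>" by simp
      fix \<phi> assume "\<phi> \<in> Lp_space 1"
      then have \<phi>: "integrable lborel \<phi>" by (rule Lp_space_1_integrable)
      have [measurable]: "\<phi> \<in> borel_measurable borel" using \<phi> by (auto dest: borel_measurable_integrable)
      \<comment> \<open>Truncations of \<phi> approximate it in L^1, while T (F n) and g are bounded
        uniformly in n, so convergence passes from test functions to all of L^1.\<close>
      define D where "D m = (LINT x|lborel. cmod (trunc m \<phi> x - \<phi> x))" for m
      have ti: "integrable lborel (trunc m \<phi>)" for m by (intro integrable_tests trunc_tests) measurable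
      have di: "integrable lborel (\<lambda>x. trunc m \<phi> x - \<phi> x)" for m using ti \<phi> by simp
      have "D \<longlonglongrightarrow> (LINT x|(lborel :: (real^3) measure). (0::real))"
        unfolding D_def
      proof (rule integral_dominated_convergence[where w="\<lambda>x. cmod (\<phi> x)"])
        show "AE x in lborel. (\<lambda>m. cmod (trunc m \<phi> x - \<phi> x)) \<longlonglongrightarrow> 0"
          by (intro AE_I2 tendsto_norm_zero LIM_zero trunc_tendsto)
        show "AE x in lborel. norm (cmod (trunc m \<phi> x - \<phi> x)) \<le> cmod (\<phi> x)" for m by (simp add: trunc_def)
      qed (use \<phi> in auto)
      then have D0: "D \<longlonglongrightarrow> 0" by simp
      show "(\<lambda>n. LINT x|lborel. T (F n) x * \<phi> x) \<longlonglongrightarrow> (LINT x|lborel. g x * \<phi> x)"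
      proof (rule LIMSEQ_I)
        fix e :: real assume e: "0 < e"
        have "(\<lambda>m. (C * K) * D m + (c * C) * D m) \<longlonglongrightarrow> (C * K) * 0 + (c * C) * 0"
          by (intro tendsto_intros D0)
        then have "\<forall>\<^sub>F m in sequentially. (C * K) * D m + (c * C) * D m < e / 2"
          using e by (intro order_tendstoD(2)) auto
        then obtain m where m: "(C * K) * D m + (c * C) * D m < e / 2" by (auto simp: eventually_sequentially)
        have tr: "trunc m \<phi> \<in> tests" by (rule trunc_tests) measurable
        obtain N where N: "\<And>n. n \<ge> N
          \<Longrightarrow> cmod ((LINT x|lborel. T (F n) x * trunc m \<phi> x) - (LINT x|lborel. g x * trunc m \<phi> x)) < e / 2"
          using LIMSEQ_D[OF tst[OF tr], of "e/2"] e by auto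
        have bd: "cmod ((LINT x|lborel. h x * trunc m \<phi> x) - (LINT x|lborel. h x * \<phi> x)) \<le> b * D m"
          if h: "h \<in> borel_measurable borel" "AE x in lborel. cmod (h x) \<le> b" "0 \<le> b" for h b
        proof -
          have "(LINT x|lborel. h x * trunc m \<phi> x) - (LINT x|lborel. h x * \<phi> x)
            = (LINT x|lborel. h x * (trunc m \<phi> x - \<phi> x))"
            using bounded_mult_integrable(1)[OF h ti] bounded_mult_integrable(1)[OF h \<phi>]
              by (simp add: right_diff_distrib)
          then show ?thesis unfolding D_def using bounded_mult_integrable(2)[OF h di] by simp
        qed
        show "\<exists>N. \<forall>n\<ge>N. norm ((LINT x|lborel. T (F n) x * \<phi> x) - (LINT x|lborel. g x * \<phi> x)) < e"
        proof (intro exI[of _ N] allI impI)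
          fix n assume n: "N \<le> n"
          let ?a = "LINT x|lborel. T (F n) x * \<phi> x" and ?b = "LINT x|lborel. T (F n) x * trunc m \<phi> x"
            and ?c = "LINT x|lborel. g x * trunc m \<phi> x" and ?d = "LINT x|lborel. g x * \<phi> x"
          have "cmod (?a - ?d) \<le> cmod (?b - ?a) + cmod (?b - ?c) + cmod (?c - ?d)"
            using dist_triangle[of ?a ?d ?b] dist_triangle[of ?b ?d ?c] norm_minus_commute[of ?a ?b]
            unfolding dist_norm by linarith
          moreover have "cmod (?b - ?a) \<le> (C * K) * D m" by (rule bd[OF TFm TFc]) (use K B in auto)
          moreover have "cmod (?c - ?d) \<le> (c * C) * D m" by (rule bd[OF gm gc]) (use c B in auto)
          ultimately show "norm (?a - ?d) < e" using m N[OF n] by linarith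
        qed
      qed
    qed
  qed
qed

text \<open>The choice in \<open>cont_extension\<close> succeeds, and the truncations of f form an
  admissible sequence for every p, so the extension can be evaluated along them.\<close>

lemma on_Lp_properties:
  assumes p: "1 \<le> p" and T: "L2_isometry T" and B: "Lp_bounded p C T" "0 \<le> C" and f: "f \<in> Lp_space p"
  shows "on_Lp p T f \<in> Lp_space p" "Lp_converges p (\<lambda>n. T (trunc n f)) (on_Lp p T f)"
proof -
  let ?P = "\<lambda>g. g \<in> Lp_space p \<and>
    (\<forall>F. range F \<subseteq> Lp_space p \<inter> Lp_space 2 \<and> Lp_converges p F f \<longrightarrow> Lp_converges p (\<lambda>n. T (F n)) g)"
  have "\<exists>g. ?P g"
    using p
  proof (cases rule: exponent_cases)
    case 1
    then show ?thesis using on_Lp_exists_inf[OF T _ B(2)] B f by simp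
  next
    case (2 q)
    then show ?thesis using on_Lp_exists_finite[OF 2(1) T _ B(2)] B f by simp
  qed
  then have P: "?P (on_Lp p T f)" unfolding cont_extension_def by (rule someI_ex[where P="?P"])
  then show "on_Lp p T f \<in> Lp_space p" by simp
  have "trunc n f \<in> tests" for n by (intro trunc_tests Lp_space_measurable[OF f])
  then have "range (\<lambda>n. trunc n f) \<subseteq> Lp_space p \<inter> Lp_space 2"
    by (auto intro: tests_L2 tests_Lp[OF p])
  then show "Lp_converges p (\<lambda>n. T (trunc n f)) (on_Lp p T f)" using P trunc_converges[OF p f] by blast
qed

section \<open>Operator norms of the extensions\<close>

lemma Lp_norm_trunc_le:
  assumes "1 \<le> p" "f \<in> borel_measurable borel" shows "Lp_norm p (trunc n f) \<le> Lp_norm p f"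
  using assms by (intro Lp_norm_mono_AE) (auto simp: cmod_trunc_le)

lemma on_Lp_integral_tendsto:
  assumes p: "1 \<le> p" and T: "L2_isometry T" and B: "Lp_bounded p C T" "0 \<le> C" and f: "f \<in> Lp_space p"
    and v: "v \<in> tests"
  shows "(\<lambda>n. LINT x|lborel. T (trunc n f) x * v x) \<longlonglongrightarrow> (LINT x|lborel. on_Lp p T f x * v x)"
proof (rule Lp_converges_tests[OF p _ on_Lp_properties(1)[OF p T B f] on_Lp_properties(2)[OF p T B f] v])
  have "trunc n f \<in> tests" for n by (intro trunc_tests Lp_space_measurable[OF f])
  then show "T (trunc n f) \<in> Lp_space p" for n
    by (intro Lp_bounded_in_Lp[OF B(1)] tests_L2 tests_Lp[OF p])
qed

text \<open>Both extensions are limits along the same truncations of f, so a bound for the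
  difference on L^2 functions survives in the pairings with test functions.\<close>

lemma on_Lp_diff_bound:
  assumes p: "1 \<le> p" and T: "L2_isometry T" and B: "Lp_bounded p C T" "0 \<le> C"
    and T': "L2_isometry T'" and B': "Lp_bounded p C' T'" "0 \<le> C'"
    and d: "0 \<le> \<delta>" "\<And>\<phi> r. \<phi> \<in> Lp_space 2 \<Longrightarrow> 0 \<le> r
      \<Longrightarrow> Lp_norm p \<phi> \<le> ennreal r \<Longrightarrow> Lp_norm p (\<lambda>x. T \<phi> x - T' \<phi> x) \<le> ennreal (\<delta> * r)"
  shows "Lp_opnorm p (\<lambda>f x. on_Lp p T f x - on_Lp p T' f x) \<le> ennreal \<delta>"
  unfolding Lp_opnorm_def
proof (rule SUP_least)
  fix f assume "f \<in> {f. Lp_norm p f \<le> 1}"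
  then have f1: "Lp_norm p f \<le> ennreal 1" by simp
  then have f: "f \<in> Lp_space p" by (simp add: Lp_space_def le_less_trans)
  note fm = Lp_space_measurable[OF f]
  note E = on_Lp_properties(1)[OF p T B f] and E' = on_Lp_properties(1)[OF p T' B' f]
  have t: "trunc n f \<in> tests" for n by (intro trunc_tests fm)
  note t2 = tests_L2[OF t] and tp = tests_Lp[OF p t]
  note Tt = Lp_bounded_in_Lp[OF B(1) tp t2] and Tt' = Lp_bounded_in_Lp[OF B'(1) tp t2]
  show "Lp_norm p (\<lambda>x. on_Lp p T f x - on_Lp p T' f x) \<le> ennreal \<delta>"
  proof (rule Lp_norm_le_by_duality[OF p _ d(1)])
    show "(\<lambda>x. on_Lp p T f x - on_Lp p T' f x) \<in> borel_measurable borel"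
      by (rule Lp_space_measurable[OF Lp_space_diff[OF p E E']])
    fix v s assume v: "v \<in> tests" and s: "0 \<le> s" and db: "dual_bound p v s"
    have e: "(LINT x|lborel. (a x - b x) * v x) = (LINT x|lborel. a x * v x) - (LINT x|lborel. b x * v x)"
      if "a \<in> Lp_space p" "b \<in> Lp_space p" for a b
      using integrable_mult_tests[OF p that(1) v] integrable_mult_tests[OF p that(2) v] by (simp add: left_diff_distrib)
    have "(\<lambda>n. LINT x|lborel. (T (trunc n f) x - T' (trunc n f) x) * v x)
      \<longlonglongrightarrow> (LINT x|lborel. (on_Lp p T f x - on_Lp p T' f x) * v x)"
      unfolding e[OF Tt Tt'] e[OF E E']
      by (intro tendsto_diff on_Lp_integral_tendsto[OF p T B f v] on_Lp_integral_tendsto[OF p T' B' f v])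
    moreover have "cmod (LINT x|lborel. (T (trunc n f) x - T' (trunc n f) x) * v x) \<le> \<delta> * s" for n
    proof -
      have "Lp_norm p (\<lambda>x. T (trunc n f) x - T' (trunc n f) x) \<le> ennreal (\<delta> * 1)"
        using order_trans[OF Lp_norm_trunc_le[OF p fm] f1] by (intro d(2) t2) auto
      moreover have "(\<lambda>x. T (trunc n f) x - T' (trunc n f) x) \<in> borel_measurable borel"
        by (rule Lp_space_measurable[OF Lp_space_diff[OF p Tt Tt']])
      ultimately show ?thesis using db d(1) unfolding dual_bound_def by auto
    qed
    ultimately show "cmod (LINT x|lborel. (on_Lp p T f x - on_Lp p T' f x) * v x) \<le> \<delta> * s"
      by (intro tendsto_upperbound[OF tendsto_norm]) auto
  qed
qed

lemma on_Lp_opnorm: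
  assumes p: "1 \<le> p" and T: "L2_isometry T" and B: "Lp_bounded p C T" "0 \<le> C"
  shows "Lp_opnorm p (on_Lp p T) \<le> ennreal C"
  unfolding Lp_opnorm_def
proof (rule SUP_least)
  fix f assume "f \<in> {f. Lp_norm p f \<le> 1}"
  then have f1: "Lp_norm p f \<le> ennreal 1" by simp
  then have f: "f \<in> Lp_space p" by (simp add: Lp_space_def le_less_trans)
  note fm = Lp_space_measurable[OF f]
  have t: "trunc n f \<in> tests" for n by (intro trunc_tests fm)
  note t2 = tests_L2[OF t]
  show "Lp_norm p (on_Lp p T f) \<le> ennreal C"
  proof (rule Lp_norm_le_by_duality[OF p _ B(2)])
    show "on_Lp p T f \<in> borel_measurable borel" by (rule Lp_space_measurable[OF on_Lp_properties(1)[OF p T B f]])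
    fix v s assume v: "v \<in> tests" and s: "0 \<le> s" and db: "dual_bound p v s"
    have "cmod (LINT x|lborel. T (trunc n f) x * v x) \<le> C * s" for n
    proof -
      have "Lp_norm p (T (trunc n f)) \<le> ennreal (C * 1)"
        using order_trans[OF Lp_norm_trunc_le[OF p fm] f1] by (intro Lp_boundedD[OF B(1) t2]) auto
      moreover have "T (trunc n f) \<in> borel_measurable borel" by (rule Lp_space_measurable[OF L2_isometryD(1)[OF T t2]])
      ultimately show ?thesis using db B(2) unfolding dual_bound_def by auto
    qed
    then show "cmod (LINT x|lborel. on_Lp p T f x * v x) \<le> C * s"
      by (intro tendsto_upperbound[OF tendsto_norm[OF on_Lp_integral_tendsto[OF p T B f v]]]) auto
  qed
qed

section \<open>Convergence in operator norm\<close>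

context flow
begin

lemma wave_approx_Lp_bounded: "1 \<le> p \<Longrightarrow> 0 \<le> t
  \<Longrightarrow> Lp_bounded p (exp total) (wave_approx U t)"
  unfolding Lp_bounded_def by (auto intro: wave_approx_Lp)

lemma wave_operator_Lp_bounded: "1 \<le> p \<Longrightarrow> Lp_bounded p (exp total) (wave_operator U)"
  unfolding Lp_bounded_def by (auto intro: wave_operator_Lp)

text \<open>The difference has operator norm at most tail t * exp total, and the tail vanishes at
  infinity because k is integrable.\<close>

lemma wave_operator_opnorm:
  assumes p: "1 \<le> p"
  shows "((\<lambda>t. Lp_opnorm p (\<lambda>u x. on_Lp p (wave_approx U t) u x - on_Lp p (wave_operator U) u x)) \<longlongrightarrow> 0) at_top"
    and "Lp_opnorm p (on_Lp p (wave_operator U)) \<le> ennreal (exp total)"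
proof -
  have "((\<lambda>t. tail t * exp total) \<longlongrightarrow> 0) at_top" using tail_tendsto
    by (rule tendsto_mult_left_zero)
  then have lim: "((\<lambda>t. ennreal (tail t * exp total)) \<longlongrightarrow> 0) at_top"
    using tendsto_ennrealI[of "\<lambda>t. tail t * exp total" 0 at_top] by simp
  show "((\<lambda>t. Lp_opnorm p (\<lambda>u x. on_Lp p (wave_approx U t) u x - on_Lp p (wave_operator U) u x)) \<longlongrightarrow> 0) at_top"
  proof (rule tendsto_sandwich[OF _ _ tendsto_const lim])
    show "\<forall>\<^sub>F t in at_top. Lp_opnorm p (\<lambda>u x. on_Lp p (wave_approx U t) u x - on_Lp p (wave_operator U) u x) \<le> ennreal (tail t * exp total)"
      using eventually_ge_at_top[of 0]
    proof eventually_elim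
      case (elim t)
      show ?case
        by (rule on_Lp_diff_bound[OF p wave_approx_isometry[OF elim] wave_approx_Lp_bounded[OF p elim] _
              wave_operator_isometry wave_operator_Lp_bounded[OF p]])
           (auto intro!: wave_operator_Lp_diff p elim mult_nonneg_nonneg tail_nonneg)
    qed
  qed simp
  show "Lp_opnorm p (on_Lp p (wave_operator U)) \<le> ennreal (exp total)"
    by (rule on_Lp_opnorm[OF p wave_operator_isometry wave_operator_Lp_bounded[OF p]]) simp
qed

end

theorem theorem1p2:
  fixes V :: "real^3 \<Rightarrow> real \<Rightarrow> real"
    and V\<^sub>1 V\<^sub>1hat :: "real^3 \<Rightarrow> real \<Rightarrow> complex"
    and g :: "real \<Rightarrow> real"
    and f :: "nat \<Rightarrow> real \<Rightarrow> complex"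
    and gs :: "nat \<Rightarrow> real \<Rightarrow> real"
    and a :: "nat \<Rightarrow> real^3"
    and h :: "real \<Rightarrow> ennreal"
    and U :: "real \<Rightarrow> real \<Rightarrow> wavefun \<Rightarrow> wavefun"
    and p :: ennreal
  assumes V1hat: "\<And>t. 0 \<le> t \<Longrightarrow> is_fourier_transform (\<lambda>x. V\<^sub>1 x t) (\<lambda>\<xi>. V\<^sub>1hat \<xi> t)"
    and h: "\<And>t. 0 \<le> t \<Longrightarrow>
          h t = (\<integral>\<^sup>+\<xi>. ennreal (cmod (V\<^sub>1hat \<xi> t)) \<partial>lborel) + (\<Sum>j. ennreal (cmod (f (Suc j) t)))"
    and h_measurable: "h \<in> borel_measurable (lebesgue_on {0..})"
    and h_integrable: "(\<integral>\<^sup>+t. h t \<partial>lebesgue_on {0..}) < \<infinity>"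
    and V1_continuous: "\<And>t. 0 \<le> t \<Longrightarrow> h t < \<infinity> \<Longrightarrow> continuous_on UNIV (\<lambda>x. V\<^sub>1 x t)"
    and V: "\<And>x t. 0 \<le> t \<Longrightarrow> h t < \<infinity> \<Longrightarrow>
          complex_of_real (V x t) = V\<^sub>1 (g t *\<^sub>R x) t
            + (2 * pi) powr (- 3 / 2) *\<^sub>R
                (\<Sum>j. f (Suc j) t * exp (\<i> * of_real (gs (Suc j) t * (x \<bullet> a (Suc j)))))"
    and U: "is_propagator V U"
    and p: "1 \<le> p"
  shows "((\<lambda>t. Lp_opnorm p (\<lambda>u x. on_Lp p (wave_approx U t) u x - on_Lp p (wave_operator U) u x))
            \<longlongrightarrow> 0) at_top
       \<and> Lp_opnorm p (on_Lp p (wave_operator U))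
          \<le> ennreal (exp (enn2real (\<integral>\<^sup>+t. h t \<partial>lebesgue_on {0..}) / (2 * pi) powr (3 / 2)))"
proof -
  let ?c = "(2 * pi) powr (- 3 / 2)"
  \<comment> \<open>Absorbs the normalisation factor into the rate. \<open>enn2real\<close> sends an
    infinite h t to 0, which concerns a null set of times outside G.\<close>
  define k where "k t = (if 0 \<le> t then ?c * enn2real (h t) else 0)" for t
  define G where "G = {t. 0 \<le> t \<and> h t < \<infinity>}"
  note h_measurable[measurable]
  have AE_fin: "AE t in lebesgue_on {0..}. h t \<noteq> \<infinity>"
    using h_integrable by (intro nn_integral_PInf_AE) auto
  have i: "integrable (lebesgue_on {0..}) (\<lambda>t. enn2real (h t))"
  proof (rule integrableI_bounded)
    have "(\<integral>\<^sup>+t. ennreal (norm (enn2real (h t))) \<partial>lebesgue_on {0..})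
      \<le> (\<integral>\<^sup>+t. h t \<partial>lebesgue_on {0..})"
      by (intro nn_integral_mono) (simp add: ennreal_enn2real_if)
    then show "(\<integral>\<^sup>+t. ennreal (norm (enn2real (h t))) \<partial>lebesgue_on {0..}) < \<infinity>"
      using h_integrable by (rule le_less_trans)
  qed measurable
  have k_ind: "indicator {0..} t *\<^sub>R k t = ?c * (indicator {0..} t *\<^sub>R enn2real (h t))" for t
    by (simp add: k_def indicator_def)
  \<comment> \<open>At times in G the distributional transform is an integrable function, so V is a
    genuine superposition of plane waves with total mass k t. The index Suc j reflects a series that
    starts at 1.\<close>
  have G_rep: "integrable lborel (\<lambda>\<xi>. V\<^sub>1hat \<xi> t)" "summable (\<lambda>j. cmod (f (Suc j) t))"
      "complex_of_real (V x t) = inv_fourier (\<lambda>\<xi>. V\<^sub>1hat \<xi> t) (g t *\<^sub>R x)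
            + ?c *\<^sub>R (\<Sum>j. f (Suc j) t * exp (\<i> * of_real (gs (Suc j) t * (x \<bullet> a (Suc j)))))"
      "k t = ?c * ((LINT \<xi>|lborel. cmod (V\<^sub>1hat \<xi> t)) + (\<Sum>j. cmod (f (Suc j) t)))"
    if "t \<in> G" for t x
  proof -
    have t: "0 \<le> t" "h t < \<infinity>" using that by (auto simp: G_def)
    have fin1: "(\<integral>\<^sup>+\<xi>. ennreal (cmod (V\<^sub>1hat \<xi> t)) \<partial>lborel) < \<infinity>"
      and fin2: "(\<Sum>j. ennreal (cmod (f (Suc j) t))) < \<infinity>"
      using t(2)[unfolded h[OF t(1)]] by (simp_all only: infinity_ennreal_def ennreal_add_less_top)
    show W: "integrable lborel (\<lambda>\<xi>. V\<^sub>1hat \<xi> t)"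
      by (rule inv_fourier_of_fourier_transform(1)[OF V1hat V1_continuous fin1]) (use t in auto)
    show sm: "summable (\<lambda>j. cmod (f (Suc j) t))"
      using fin2 by (intro summable_suminf_not_top) auto
    show "complex_of_real (V x t) = inv_fourier (\<lambda>\<xi>. V\<^sub>1hat \<xi> t) (g t *\<^sub>R x)
            + ?c *\<^sub>R (\<Sum>j. f (Suc j) t * exp (\<i> * of_real (gs (Suc j) t * (x \<bullet> a (Suc j)))))"
      unfolding V[OF t] inv_fourier_of_fourier_transform(2)[OF V1hat[OF t(1)] V1_continuous[OF t] fin1, of "g t *\<^sub>R x"] ..
    have "h t = ennreal (LINT \<xi>|lborel. cmod (V\<^sub>1hat \<xi> t)) + ennreal (\<Sum>j. cmod (f (Suc j) t))"
      unfolding h[OF t(1)] using W sm by (subst nn_integral_eq_integral) (auto simp: suminf_ennreal2)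
    also have "\<dots> = ennreal ((LINT \<xi>|lborel. cmod (V\<^sub>1hat \<xi> t)) + (\<Sum>j. cmod (f (Suc j) t)))"
      using sm by (simp add: suminf_nonneg)
    finally have ht: "h t = ennreal ((LINT \<xi>|lborel. cmod (V\<^sub>1hat \<xi> t)) + (\<Sum>j. cmod (f (Suc j) t)))" .
    have "enn2real (h t) = (LINT \<xi>|lborel. cmod (V\<^sub>1hat \<xi> t)) + (\<Sum>j. cmod (f (Suc j) t))"
      unfolding ht by (rule enn2real_ennreal) (use sm in \<open>simp add: suminf_nonneg\<close>)
    then show "k t = ?c * ((LINT \<xi>|lborel. cmod (V\<^sub>1hat \<xi> t)) + (\<Sum>j. cmod (f (Suc j) t)))"
      using t by (simp add: k_def)
  qed
  interpret flow V U G k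
  proof
    show "is_propagator V U" by (rule U)
    have "{t \<in> space (lebesgue_on {0..}). h t < \<infinity>} \<in> sets (lebesgue_on {0..})" by measurable
    moreover have "{t \<in> space (lebesgue_on {0..}). h t < \<infinity>} = G" by (auto simp: G_def)
    ultimately show "G \<in> sets lebesgue" by (simp add: sets_restrict_space_iff)
    have "AE t in lebesgue. t \<in> {0..} \<longrightarrow> h t \<noteq> \<infinity>"
      using AE_fin by (simp add: AE_restrict_space_iff)
    then show "AE t in lebesgue. 0 \<le> t \<longrightarrow> t \<in> G" by eventually_elim (auto simp: G_def less_top)
    show "0 \<le> k t" for t by (simp add: k_def)
    show "set_integrable lebesgue {0..} k"
      unfolding set_integrable_def k_ind using i by (intro integrable_mult_right) (simp add: integrable_restrict_space)
    show "(\<lambda>x. V x t) \<in> borel_measurable borel" if "t \<in> G" for t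
      by (rule superposition_bounds(1)[OF G_rep(1-3)[OF that]])
    show "\<bar>V x t\<bar> \<le> k t" if "t \<in> G" for t x 
      unfolding G_rep(4)[OF that] by (rule superposition_bounds(2)[OF G_rep(1-3)[OF that]])
    show "cmod (LINT x|lborel. F x * of_real (V x t)) \<le> k t * M"
      if "t \<in> G" "integrable lborel F"
        "\<And>b. cmod (LINT x|lborel. F x * exp (\<i> * of_real (b \<bullet> x))) \<le> M" for t F M
      unfolding G_rep(4)[OF that(1)] by (rule superposition_bounds(3)[OF G_rep(1-3)[OF that(1)] that(2,3)])
  qed
  \<comment> \<open>Identifies \<open>total\<close> with the exponent of the theorem; passing
    through \<open>enn2real\<close> preserves the integral because h is finite almost
    everywhere.\<close>
  have "total = ?c * (LINT t|lebesgue_on {0..}. enn2real (h t))"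
    unfolding total_def set_lebesgue_integral_def k_ind by (simp add: integral_restrict_space)
  also have "(LINT t|lebesgue_on {0..}. enn2real (h t))
    = enn2real (\<integral>\<^sup>+t. ennreal (enn2real (h t)) \<partial>lebesgue_on {0..})"
    by (rule integral_eq_nn_integral) auto
  also have "(\<integral>\<^sup>+t. ennreal (enn2real (h t)) \<partial>lebesgue_on {0..})
    = (\<integral>\<^sup>+t. h t \<partial>lebesgue_on {0..})"
    by (rule nn_integral_cong_AE, use AE_fin in eventually_elim) (simp add: ennreal_enn2real_if)
  finally have "total = enn2real (\<integral>\<^sup>+t. h t \<partial>lebesgue_on {0..}) / (2 * pi) powr (3 / 2)"
    by (simp add: powr_minus_divide)
  then show ?thesis using wave_operator_opnorm[OF p] by simp
qed

end
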